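(* Up to equivalence, all regular normal extensions from $(SO^*(2n+2),SO^*(2n))$ to CR structures form a one-parameter class with parameter $t\ge0$. They are non-flat for $t\ne0$.
   Context: The underlying symmetric space is $G/H$ with $G=SO^*(2n+2)$, $H=SO^*(2n)\times SO^*(2)$, $\mathfrak g=\mathfrak h+\mathfrak m$; $K$ is the semisimple part $SO^*(2n)$ of $H$ (extended by the element $h\in H$ acting as $-\mathrm{id}$ on $\mathfrak m$ and trivially on $\mathfrak h$). The space $\mathfrak m$ has real dimension $4n$ and is identified with $\mathbb H^n$, $X=X_1+iX_2+jX_3+kX_4$, $X_l\in\mathbb R^n$, on which $SO^*(2n)$ acts by its standard (quaternionic) representation $\lambda_1$, commuting with right multiplication by quaternions. CR structures here are parabolic contact geometries of type $(L,P)$ with $\mathfrak l=\mathfrak{su}(n+1,n+1)$, $L=PSU(n+1,n+1)$, graded by block sizes $(1,2n,1)$ (with respect to a hermitian form for which the first and last basis vectors are null and paired with each other and orthogonal to the remaining ones) with block $(r,s)$ of degree $s-r$; $\mathfrak p=\mathfrak l_0+\mathfrak l_1+\mathfrak l_2$. A Cartan geometry of type $(L,P)$ is a $P$-principal bundle with a $P$-equivariant $\mathfrak l$-valued 1-form $\omega$ reproducing generators of fundamental vector fields and isomorphic on each tangent space. Extension: a homomorphism $\iota:K\to P$ (here fixed: the inclusion $SO^*(2n)\subset SU(n,n)\subset L_0$, with $L_0$ the Levi subgroup of $P$) and a linear map $\alpha:\mathfrak g\to\mathfrak l$ with $\alpha\circ\mathrm{Ad}(k)=\mathrm{Ad}(\iota(k))\circ\alpha$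 ($k\in K$), $\alpha|_{\mathfrak k}=\iota'$, $\alpha:\mathfrak g/\mathfrak k\to\mathfrak l/\mathfrak p$ an isomorphism. It yields the Cartan geometry $(G\times_\iota P\to G/K,\omega_\alpha)$ of type $(L,P)$, $\omega_\alpha$ extending $\alpha\circ\omega_G$ ($\omega_G$ the Maurer–Cartan form), with curvature $\kappa(X,Y)=[\alpha(X),\alpha(Y)]-\alpha([X,Y])$ on $\mathfrak g$; flat means $\kappa=0$. Regular: $\kappa$, viewed on $\mathfrak l/\mathfrak p$, satisfies $\kappa(\mathfrak l_r,\mathfrak l_s)\subset\bigoplus_{l\ge r+s+1}\mathfrak l_l$ for $r,s<0$. Normal: $\sum_l\kappa([Z_l,X],X_l)=2\sum_l[Z_l,\kappa(X,X_l)]$ for all $X\in\mathfrak l/\mathfrak p$ ($X_l$ a basis of $\mathfrak l/\mathfrak p$, $Z_l$ the dual basis of $\mathfrak l_1+\mathfrak l_2$), the standard Kostant-codifferential condition. Two extensions are equivalent if there is a principal bundle morphism $\Phi$ of $G\times_\iota P$ with $\Phi^*\omega_{\alpha'}=\omega_\alpha$. The parameter $t$: let $(f_1,f_2)(X)=(X_1+iX_2,X_3+iX_4)$. The $\mathfrak l_{-1}$-part of any extension is $X\mapsto(f_1(Xb),f_2(Xb))\in\mathbb C^{2n}$ for a nonzero quaternion $b=b_1+ib_2+jb_3+kb_4$, and $t=b_1^2-b_2^2-b_3^2+b_4^2$; using equivalences $b$ is normalized to $b=\sqrt{\frac{1+t}{2}}+\sqrt{\frac{1-t}{2}}\,j$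 (so $b_1^2+b_2^2+b_3^2+b_4^2=1$).
   Formalization: L is enlarged from PSU(n+1,n+1) by maps reversing the sign of the hermitian form (else t and -t are inequivalent, so t≥0 fails); f is reordered to (X_1+iX_4, X_3+iX_2) so that X->f(Xb) is equivariant; n≥2 is assumed; |b|=1 gives t≤1. *)

theory Defs
  imports "HOL-Analysis.Analysis"
begin

section \<open>The groups and Lie algebras\<close>

text \<open>
  Throughout, \<open>n = CARD('n)\<close>.  The matrices of \<open>SO\<^sup>*(2n+2)\<close> and of \<open>SU(n+1,n+1)\<close> are indexed by the
  same set \<open>'n option + 'n option\<close> of \<open>2n+2\<close> elements, in which \<open>Inl None\<close> is the first and
  \<open>Inr None\<close> the last basis vector of the block decomposition \<open>(1,2n,1)\<close>.
\<close>

type_synonym 'm sqmat = "complex ^ ('m + 'm) ^ ('m + 'm)"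
type_synonym 'n mat2 = "'n option sqmat"

definition adj :: "complex ^ 'i ^ 'i \<Rightarrow> complex ^ 'i ^ 'i" where
  "adj A = (\<chi> r s. cnj (A $ s $ r))"

definition J :: "('m::finite) sqmat" where
  "J = (\<chi> r s. case (r, s) of
          (Inl a, Inr b) \<Rightarrow> (if a = b then 1 else 0)
        | (Inr a, Inl b) \<Rightarrow> (if a = b then -1 else 0)
        | _ \<Rightarrow> 0)"

definition SO_star :: "('m::finite) sqmat set" where
  "SO_star = {g. transpose g ** g = mat 1 \<and> det g = 1 \<and> adj g ** J ** g = J}"

definition so_star :: "('m::finite) sqmat set" where
  "so_star = {X. transpose X = - X \<and> adj X ** J + J ** X = 0}"

text \<open>
  The hermitian form of signature \<open>(n+1,n+1)\<close> is \<open>\<langle>v,w\<rangle> = \<i> v\<^sup>* J w\<close>: the first and last basis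
  vectors are null, paired with each other, and orthogonal to the other ones.
\<close>

definition Hm :: "('m::finite) sqmat" where
  "Hm = (\<chi> r s. \<i> * J $ r $ s)"

text \<open>
  Matrices representing the elements of \<open>L = PSU(n+1,n+1)\<close>, understood as the group of all
  projective transformations preserving the hyperquadric of null lines of the hermitian form.
  Since the signature is \<open>(n+1,n+1)\<close>, such a transformation preserves the form only up to sign.
  The sign \<open>-\<close> matters: the transformations of sign \<open>+\<close> preserve an orientation of the quotient of
  the tangent bundle by the CR distribution, which is not part of a CR structure, and with those
  alone the parameters \<open>t\<close> and \<open>-t\<close> would not be equivalent.  Elements of \<open>L\<close> are these matrices
  modulo the scalar ones; the scalars are divided out in the definition of the bundle below.
\<close>

definition L_grp :: "('m::finite) sqmat set" where
  "L_grp = {A. det A = 1 \<and> (adj A ** Hm ** A = Hm \<or> adj A ** Hm ** A = - Hm)}"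

definition su :: "('m::finite) sqmat set" where
  "su = {A. trace A = 0 \<and> adj A ** Hm + Hm ** A = 0}"

definition block :: "'n option + 'n option \<Rightarrow> int" where
  "block r = (case r of Inl None \<Rightarrow> 0 | Inr None \<Rightarrow> 2 | _ \<Rightarrow> 1)"

definition su_gr :: "int \<Rightarrow> ('n::finite) mat2 set" where
  "su_gr k = {A \<in> su. \<forall>r s. A $ r $ s \<noteq> 0 \<longrightarrow> block s - block r = k}"

definition su_filt :: "int \<Rightarrow> ('n::finite) mat2 set" where
  "su_filt k = {A \<in> su. \<forall>r s. A $ r $ s \<noteq> 0 \<longrightarrow> block s - block r \<ge> k}"

definition p_alg :: "('n::finite) mat2 set" where "p_alg = su_filt 0"

definition p_plus :: "('n::finite) mat2 set" where "p_plus = su_filt 1"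

definition l_minus :: "('n::finite) mat2 set" where
  "l_minus = {A \<in> su. \<forall>r s. A $ r $ s \<noteq> 0 \<longrightarrow> block s - block r < 0}"

definition P_grp :: "('n::finite) mat2 set" where
  "P_grp = {A \<in> L_grp. \<forall>r s. block s < block r \<longrightarrow> A $ r $ s = 0}"

text \<open>
  \<open>K = SO\<^sup>*(2n)\<close> sits in \<open>G = SO\<^sup>*(2n+2)\<close> as the block diagonal matrices \<open>diag(1,k,1)\<close>.  The element
  \<open>diag(1,-1,1)\<close> of \<open>K\<close> acts as \<open>-1\<close> on \<open>\<mm>\<close> and trivially on \<open>\<hh>\<close>.  The same matrices form the
  subgroup \<open>SO\<^sup>*(2n) \<subseteq> SU(n,n)\<close> of the Levi subgroup of \<open>P\<close>, so \<open>\<iota>\<close> and \<open>\<iota>'\<close> are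
  \<open>k \<mapsto> k\<close>.
\<close>

abbreviation G_grp :: "('n::finite) mat2 set" where "G_grp \<equiv> SO_star"

abbreviation g_alg :: "('n::finite) mat2 set" where "g_alg \<equiv> so_star"

definition K_grp :: "('n::finite) mat2 set" where
  "K_grp = {g \<in> G_grp. \<forall>r s. block r \<noteq> 1 \<or> block s \<noteq> 1 \<longrightarrow> g $ r $ s = mat 1 $ r $ s}"

definition k_alg :: "('n::finite) mat2 set" where
  "k_alg = {X \<in> g_alg. \<forall>r s. block r \<noteq> 1 \<or> block s \<noteq> 1 \<longrightarrow> X $ r $ s = 0}"

definition br :: "complex ^ 'i ^ 'i \<Rightarrow> complex ^ 'i ^ 'i \<Rightarrow> complex ^ 'i ^ ('i::finite)" where
  "br A B = A ** B - B ** A"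


section \<open>Extensions\<close>

text \<open>
  A linear map on \<open>\<gg>\<close> is represented by a real-linear map on all matrices; only its restriction to
  \<open>\<gg>\<close> is ever used.
\<close>

definition extension :: "(('n::finite) mat2 \<Rightarrow> 'n mat2) \<Rightarrow> bool" where
  "extension \<alpha> \<longleftrightarrow>
     linear \<alpha> \<and> \<alpha> ` g_alg \<subseteq> su \<and>
     (\<forall>k\<in>K_grp. \<forall>X\<in>g_alg. \<alpha> (k ** X ** matrix_inv k) = k ** \<alpha> X ** matrix_inv k) \<and>
     (\<forall>X\<in>k_alg. \<alpha> X = X) \<and>
     (\<forall>X\<in>g_alg. \<alpha> X \<in> p_alg \<longrightarrow> X \<in> k_alg) \<and>
     (\<forall>Y\<in>su. \<exists>X\<in>g_alg. \<alpha> X - Y \<in> p_alg)"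

definition curv :: "(('n::finite) mat2 \<Rightarrow> 'n mat2) \<Rightarrow> 'n mat2 \<Rightarrow> 'n mat2 \<Rightarrow> 'n mat2" where
  "curv \<alpha> X Y = br (\<alpha> X) (\<alpha> Y) - \<alpha> (br X Y)"

definition flat :: "(('n::finite) mat2 \<Rightarrow> 'n mat2) \<Rightarrow> bool" where
  "flat \<alpha> \<longleftrightarrow> (\<forall>X\<in>g_alg. \<forall>Y\<in>g_alg. curv \<alpha> X Y = 0)"

text \<open>
  The curvature on \<open>\<ll>/\<pp>\<close>, evaluated on representatives \<open>X, Y \<in> \<ll>\<close>.  The preimage in \<open>\<gg>\<close> of a class
  of \<open>\<ll>/\<pp>\<close> is unique up to \<open>\<kk>\<close>, and \<open>curv \<alpha>\<close> vanishes on \<open>\<kk>\<close> by equivariance.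
\<close>

definition lift :: "(('n::finite) mat2 \<Rightarrow> 'n mat2) \<Rightarrow> 'n mat2 \<Rightarrow> 'n mat2" where
  "lift \<alpha> Y = (SOME X. X \<in> g_alg \<and> \<alpha> X - Y \<in> p_alg)"

definition kappa :: "(('n::finite) mat2 \<Rightarrow> 'n mat2) \<Rightarrow> 'n mat2 \<Rightarrow> 'n mat2 \<Rightarrow> 'n mat2" where
  "kappa \<alpha> X Y = curv \<alpha> (lift \<alpha> X) (lift \<alpha> Y)"

definition regular :: "(('n::finite) mat2 \<Rightarrow> 'n mat2) \<Rightarrow> bool" where
  "regular \<alpha> \<longleftrightarrow>
     (\<forall>r\<in>{-2,-1}. \<forall>s\<in>{-2,-1}. \<forall>X\<in>su_gr r. \<forall>Y\<in>su_gr s. kappa \<alpha> X Y \<in> su_filt (r + s + 1))"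

text \<open>The Killing form of \<open>\<ss>\<ll>(2n+2,\<complex>)\<close>, which is real on \<open>\<ss>\<uu>(n+1,n+1)\<close>.\<close>

definition killing :: "('m::finite) sqmat \<Rightarrow> 'm sqmat \<Rightarrow> real" where
  "killing A B = 2 * real CARD('m + 'm) * Re (trace (A ** B))"

text \<open>
  A basis of \<open>\<ll>/\<pp>\<close> is given by a basis \<open>B\<close> of the complement \<open>\<ll>\<^sub>-\<^sub>2 + \<ll>\<^sub>-\<^sub>1\<close> of \<open>\<pp>\<close>, and \<open>Z X\<close> for \<open>X \<in> B\<close> is
  the element of the dual basis of \<open>\<ll>\<^sub>1 + \<ll>\<^sub>2 \<cong> (\<ll>/\<pp>)\<^sup>*\<close> belonging to \<open>X\<close>.
\<close>

definition dual_bases :: "('n::finite) mat2 set \<Rightarrow> ('n mat2 \<Rightarrow> 'n mat2) \<Rightarrow> bool" where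
  "dual_bases B Z \<longleftrightarrow>
     B \<subseteq> l_minus \<and> independent B \<and> span B = l_minus \<and> Z ` B \<subseteq> p_plus \<and>
     (\<forall>X\<in>B. \<forall>Y\<in>B. killing (Z X) Y = (if X = Y then 1 else 0))"

definition normal :: "(('n::finite) mat2 \<Rightarrow> 'n mat2) \<Rightarrow> bool" where
  "normal \<alpha> \<longleftrightarrow>
     (\<forall>B Z. dual_bases B Z \<longrightarrow>
        (\<forall>X\<in>su. (\<Sum>Y\<in>B. kappa \<alpha> (br (Z Y) X) Y) = 2 *\<^sub>R (\<Sum>Y\<in>B. br (Z Y) (kappa \<alpha> X Y))))"

definition reg_normal_ext :: "(('n::finite) mat2 \<Rightarrow> 'n mat2) \<Rightarrow> bool" where
  "reg_normal_ext \<alpha> \<longleftrightarrow> extension \<alpha> \<and> regular \<alpha> \<and> normal \<alpha>"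


section \<open>Equivalence of extensions\<close>

primrec Ck_on ::
  "nat \<Rightarrow> 'a::real_normed_vector set \<Rightarrow> ('a \<Rightarrow> 'b::real_normed_vector) \<Rightarrow> bool" where
  "Ck_on 0 S f \<longleftrightarrow> continuous_on S f"
| "Ck_on (Suc k) S f \<longleftrightarrow>
     (\<forall>x\<in>S. f differentiable (at x)) \<and> (\<forall>v. Ck_on k S (\<lambda>x. frechet_derivative f (at x) v))"

definition smooth_on ::
  "'a::real_normed_vector set \<Rightarrow> ('a \<Rightarrow> 'b::real_normed_vector) \<Rightarrow> bool" where
  "smooth_on S f \<longleftrightarrow> (\<forall>k. Ck_on k S f)"

text \<open>
  The bundle \<open>G \<times>\<^sub>\<iota> P\<close>: the quotient of \<open>G \<times> P\<close> by \<open>(g, p) \<sim> (g k, \<iota>(k)\<^sup>-\<^sup>1 p)\<close>.  Elements of \<open>P\<close> being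
  matrices modulo scalars, the second component is moreover taken up to a scalar matrix \<open>mat z\<close>.
\<close>

definition bundle_rel :: "((('n::finite) mat2 \<times> 'n mat2) \<times> ('n mat2 \<times> 'n mat2)) set" where
  "bundle_rel =
     {((g, p), (g', p')). g \<in> G_grp \<and> p \<in> P_grp \<and>
        (\<exists>k\<in>K_grp. \<exists>z. mat z \<in> (L_grp :: 'n mat2 set) \<and>
           g' = g ** k \<and> p' = mat z ** matrix_inv k ** p)}"

definition GxP :: "(('n::finite) mat2 \<times> 'n mat2) set set" where
  "GxP = (G_grp \<times> P_grp) // bundle_rel"

abbreviation cls :: "('n::finite) mat2 \<times> 'n mat2 \<Rightarrow> ('n mat2 \<times> 'n mat2) set" where
  "cls x \<equiv> bundle_rel `` {x}"

definition ract ::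
  "(('n::finite) mat2 \<times> 'n mat2) set \<Rightarrow> 'n mat2 \<Rightarrow> ('n mat2 \<times> 'n mat2) set" where
  "ract c q = (\<lambda>(g, p). (g, p ** q)) ` c"

text \<open>
  The Cartan connection \<open>\<omega>\<^sub>\<alpha>\<close>, pulled back along the projection \<open>G \<times> P \<rightarrow> G \<times>\<^sub>\<iota> P\<close>, at the
  point \<open>(g, p)\<close> on the tangent vector \<open>(V, W)\<close>.
\<close>

definition omega ::
  "(('n::finite) mat2 \<Rightarrow> 'n mat2) \<Rightarrow> 'n mat2 \<times> 'n mat2 \<Rightarrow> 'n mat2 \<times> 'n mat2 \<Rightarrow> 'n mat2" where
  "omega \<alpha> = (\<lambda>(g, p) (V, W).
     matrix_inv p ** \<alpha> (matrix_inv g ** V) ** p + matrix_inv p ** W)"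

text \<open>
  Smooth maps of \<open>G \<times>\<^sub>\<iota> P\<close> are described through local lifts to \<open>G \<times> P\<close>.  These exist because
  the projection is a principal bundle, and a map into or out of the embedded submanifold
  \<open>G \<times> P\<close> is smooth iff it extends locally to a smooth map of the ambient vector space.
\<close>

definition local_lift ::
  "((('n::finite) mat2 \<times> 'n mat2) set \<Rightarrow> ('n mat2 \<times> 'n mat2) set) \<Rightarrow>
   ('n mat2 \<times> 'n mat2) set \<Rightarrow> ('n mat2 \<times> 'n mat2 \<Rightarrow> 'n mat2 \<times> 'n mat2) \<Rightarrow> bool" where
  "local_lift \<Phi> U \<Psi> \<longleftrightarrow>
     open U \<and> smooth_on U \<Psi> \<and>
     (\<forall>x \<in> U \<inter> (G_grp \<times> P_grp). \<Psi> x \<in> G_grp \<times> P_grp \<and> \<Phi> (cls x) = cls (\<Psi> x))"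

definition bundle_morphism ::
  "((('n::finite) mat2 \<times> 'n mat2) set \<Rightarrow> ('n mat2 \<times> 'n mat2) set) \<Rightarrow> bool" where
  "bundle_morphism \<Phi> \<longleftrightarrow>
     (\<forall>c\<in>GxP. \<Phi> c \<in> GxP) \<and>
     (\<forall>c\<in>GxP. \<forall>q\<in>P_grp. \<Phi> (ract c q) = ract (\<Phi> c) q) \<and>
     (\<forall>x \<in> G_grp \<times> P_grp. \<exists>U \<Psi>. x \<in> U \<and> local_lift \<Phi> U \<Psi>)"

text \<open>\<open>\<Phi>\<^sup>* \<omega>\<^sub>\<beta> = \<omega>\<^sub>\<alpha>\<close>; the tangent space of \<open>G \<times> P\<close> at \<open>(g, p)\<close> consists of all \<open>(g X, p A)\<close>.\<close>

definition pulls_back ::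
  "((('n::finite) mat2 \<times> 'n mat2) set \<Rightarrow> ('n mat2 \<times> 'n mat2) set) \<Rightarrow>
   ('n mat2 \<Rightarrow> 'n mat2) \<Rightarrow> ('n mat2 \<Rightarrow> 'n mat2) \<Rightarrow> bool" where
  "pulls_back \<Phi> \<beta> \<alpha> \<longleftrightarrow>
     (\<forall>U \<Psi>. local_lift \<Phi> U \<Psi> \<longrightarrow>
        (\<forall>g\<in>G_grp. \<forall>p\<in>P_grp. (g, p) \<in> U \<longrightarrow>
           (\<forall>X\<in>g_alg. \<forall>A\<in>p_alg.
              omega \<beta> (\<Psi> (g, p)) (frechet_derivative \<Psi> (at (g, p)) (g ** X, p ** A)) =
              omega \<alpha> (g, p) (g ** X, p ** A))))"

definition equivalent ::
  "(('n::finite) mat2 \<Rightarrow> 'n mat2) \<Rightarrow> ('n mat2 \<Rightarrow> 'n mat2) \<Rightarrow> bool" where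
  "equivalent \<alpha> \<beta> \<longleftrightarrow> (\<exists>\<Phi>. bundle_morphism \<Phi> \<and> pulls_back \<Phi> \<beta> \<alpha>)"


section \<open>The parameter\<close>

text \<open>
  A quaternion is \<open>b = b\<^sub>1 + i b\<^sub>2 + j b\<^sub>3 + k b\<^sub>4\<close>; an element of \<open>\<bbbH>\<^sup>n\<close> is \<open>X = X\<^sub>1 + i X\<^sub>2 + j X\<^sub>3 + k X\<^sub>4\<close> with
  \<open>X\<^sub>l \<in> \<real>\<^sup>n\<close>.
\<close>

type_synonym quat = "real ^ 4"
type_synonym 'n qvec = "(real ^ 'n) ^ 4"

definition qrmult :: "('n::finite) qvec \<Rightarrow> quat \<Rightarrow> 'n qvec" where
  "qrmult X b = vector
     [b$1 *\<^sub>R X$1 - b$2 *\<^sub>R X$2 - b$3 *\<^sub>R X$3 - b$4 *\<^sub>R X$4,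
      b$2 *\<^sub>R X$1 + b$1 *\<^sub>R X$2 + b$4 *\<^sub>R X$3 - b$3 *\<^sub>R X$4,
      b$3 *\<^sub>R X$1 - b$4 *\<^sub>R X$2 + b$1 *\<^sub>R X$3 + b$2 *\<^sub>R X$4,
      b$4 *\<^sub>R X$1 + b$3 *\<^sub>R X$2 - b$2 *\<^sub>R X$3 + b$1 *\<^sub>R X$4]"

text \<open>
  The identification \<open>\<bbbH>\<^sup>n \<cong> \<complex>\<^sup>2\<^sup>n\<close>.  The matrices of \<open>SO\<^sup>*(2n)\<close> commute with multiplication by \<open>\<i>\<close> and
  with \<open>(u,v) \<mapsto> (-cnj v, cnj u)\<close>.  The coordinates are ordered so that these are right
  multiplications by quaternions, namely by \<open>k\<close> and by \<open>j\<close>: this makes \<open>X \<mapsto> f(X b)\<close> equivariant for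
  every \<open>b\<close>, and makes \<open>b\<^sub>1\<^sup>2 - b\<^sub>2\<^sup>2 - b\<^sub>3\<^sup>2 + b\<^sub>4\<^sup>2\<close>, which is invariant under multiplication of \<open>b\<close> by unit
  elements of \<open>\<real> + \<real>k\<close> from either side, the appropriate parameter.
\<close>

definition qf :: "('n::finite) qvec \<Rightarrow> complex ^ ('n + 'n)" where
  "qf X = (\<chi> r. case r of Inl a \<Rightarrow> Complex (X$1$a) (X$4$a) | Inr a \<Rightarrow> Complex (X$3$a) (X$2$a))"

definition mid :: "'n + 'n \<Rightarrow> 'n option + 'n option" where
  "mid = map_sum Some Some"

definition quat_struct :: "complex ^ ('n + 'n) \<Rightarrow> complex ^ (('n::finite) + 'n)" where
  "quat_struct x = (\<chi> r. case r of Inl a \<Rightarrow> - cnj (x $ Inr a) | Inr a \<Rightarrow> cnj (x $ Inl a))"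

text \<open>The element of \<open>\<mm>\<close> with first column \<open>x\<close>; its last column is determined by \<open>x\<close>.\<close>

definition m_of_col :: "complex ^ (('n::finite) + 'n) \<Rightarrow> 'n mat2" where
  "m_of_col x = (\<chi> r s.
     if \<exists>a. r = mid a \<and> s = Inl None then x $ (THE a. r = mid a)
     else if \<exists>a. r = mid a \<and> s = Inr None then quat_struct x $ (THE a. r = mid a)
     else if \<exists>a. s = mid a \<and> r = Inl None then - x $ (THE a. s = mid a)
     else if \<exists>a. s = mid a \<and> r = Inr None then - quat_struct x $ (THE a. s = mid a)
     else 0)"

text \<open>
  The identification \<open>\<bbbH>\<^sup>n \<cong> \<mm>\<close>.  On first columns of elements of \<open>\<mm>\<close>, the subgroup \<open>SO\<^sup>*(2)\<close> acts by
  \<open>quat_struct\<close>, i.e. by right multiplication by \<open>j\<close>.  The constant \<open>q = (1 + i)/\<surd>2\<close> satisfies \<open>k q = q j\<close>,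
  so that on \<open>X \<in> \<bbbH>\<^sup>n\<close> the subgroup \<open>SO\<^sup>*(2)\<close> acts by right multiplication by elements of \<open>\<real> + \<real>k\<close>.
\<close>

definition m_emb :: "('n::finite) qvec \<Rightarrow> 'n mat2" where
  "m_emb X = m_of_col (qf (qrmult X (vector [1 / sqrt 2, 1 / sqrt 2, 0, 0])))"

text \<open>
  The \<open>\<ll>\<^sub>-\<^sub>1\<close>-part of \<open>\<alpha>\<close> is \<open>X \<mapsto> f(X b)\<close>, where \<open>\<ll>\<^sub>-\<^sub>1 \<cong> \<complex>\<^sup>2\<^sup>n\<close> by taking the first column.
\<close>

definition has_quat :: "(('n::finite) mat2 \<Rightarrow> 'n mat2) \<Rightarrow> quat \<Rightarrow> bool" where
  "has_quat \<alpha> b \<longleftrightarrow> (\<forall>X a. \<alpha> (m_emb X) $ mid a $ Inl None = qf (qrmult X b) $ a)"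

definition tpar :: "quat \<Rightarrow> real" where
  "tpar b = (b$1)\<^sup>2 - (b$2)\<^sup>2 - (b$3)\<^sup>2 + (b$4)\<^sup>2"

text \<open>The normalized quaternion of norm \<open>1\<close> with parameter \<open>t \<in> [-1,1]\<close>.\<close>

definition bnorm :: "real \<Rightarrow> quat" where
  "bnorm t = vector [sqrt ((1 + t) / 2), 0, sqrt ((1 - t) / 2), 0]"

lemma vec4_nth [simp]:
  fixes x y z w :: "'a::zero"
  shows "(vector [x, y, z, w] :: 'a ^ 4) $ 1 = x" "(vector [x, y, z, w] :: 'a ^ 4) $ 2 = y"
    "(vector [x, y, z, w] :: 'a ^ 4) $ 3 = z" "(vector [x, y, z, w] :: 'a ^ 4) $ 4 = w"
  by (simp_all add: vector_def)

lemma tpar_bnorm: "-1 \<le> t \<Longrightarrow> t \<le> 1 \<Longrightarrow> tpar (bnorm t) = t"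
  by (simp add: tpar_def bnorm_def field_simps)

end

theory Submission
  imports Defs
begin

text \<open>
  As a representation of \<open>K\<close>, \<open>\<gg>/\<kk> = \<complex>\<^sup>2\<^sup>n \<oplus> \<real>\<close>, where \<open>\<complex>\<^sup>2\<^sup>n\<close> carries the standard representation of \<open>K\<close> and \<open>\<real>\<close> is spanned by the
  generator \<open>ee\<close> of \<open>\<ss>\<oo>\<^sup>*(2)\<close>.  The maps of \<open>\<complex>\<^sup>2\<^sup>n\<close> commuting with \<open>K\<close> are the right multiplications by
  quaternions, \<open>qop \<beta> \<gamma> x = \<beta> x + \<gamma> x j\<close>.  Equivariance therefore leaves finitely many real parameters
  (\<open>ext_shape\<close>): a quaternion \<open>(\<beta>, \<gamma>)\<close> in degree \<open>-1\<close>, a quaternion in degree \<open>1\<close>, and four real numbers.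
  Regularity fixes the component of degree \<open>-2\<close>, and the traces of the curvature that make up the
  normality condition fix all the rest except one real number \<open>s\<close> and the quaternion itself
  (\<open>normal_forces\<close>, \<open>reg_normal_shape\<close>).  The resulting extension is \<open>nrm_ext \<beta> \<gamma> s\<close>.

  The curvature of \<open>nrm_ext \<beta> \<gamma> s\<close> depends on the quaternion only through two numbers:  right multiplication by
  \<open>j\<close>, conjugated by \<open>qop \<beta> \<gamma>\<close>, is \<open>qop (-\<i> \<tau>) \<rho>\<close> with \<open>\<tau>\<^sup>2 + \<bar>\<rho>\<bar>\<^sup>2 = 1\<close>.  The part of the curvature on
  two vectors of degree \<open>-1\<close> is a nonzero multiple of \<open>\<tau>\<close>, and the part on degrees \<open>-2\<close> and \<open>-1\<close> is a multiple of
  \<open>\<tau> \<rho>\<close> (\<open>nrm_ext_curv\<close>).  For a normalized quaternion \<open>\<tau> = -t\<close>, so that \<open>t \<noteq> 0\<close> excludes flatness.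

  Four families of bundle isomorphisms reduce the quaternion to its normal form: unipotent elements of
  degree \<open>2\<close> in \<open>P\<close> move \<open>s\<close> (\<open>move_s\<close>), diagonal elements of \<open>P\<close> multiply \<open>(\<beta>, \<gamma>)\<close> by a complex number
  (\<open>move_scale\<close>), right translations by \<open>SO\<^sup>*(2)\<close>, which commutes with \<open>K\<close>, rotate \<open>(\<beta>, \<gamma>)\<close> (\<open>move_rot\<close>), and an
  element of \<open>P\<close> that reverses the sign of the hermitian form maps \<open>\<tau>\<close> to \<open>-\<tau>\<close> (\<open>move_flip\<close>).  In the coordinates
  \<open>\<beta> + \<i> \<gamma>\<close> and \<open>\<beta> - \<i> \<gamma>\<close> the second and third move are diagonal, and the two absolute values, up to a
  common factor and their order, are all that remains.

  Conversely, an equivalence is a map of the bundles that preserves the Cartan connections.  Differentiating this along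
  curves through one point, and using the symmetry of second derivatives, shows that the two curvatures at that
  point correspond under some linear map \<open>L\<close> of \<open>\<gg>\<close> and an element of \<open>P\<close> (\<open>transport\<close>).  This is the
  Maurer--Cartan computation at a point, carried out in terms of local lifts.  Comparing the two parts of the curvature gives
  \<open>\<bar>\<tau>\<bar> = \<bar>\<tau>'\<bar>\<close> (\<open>abs_tau_invariant\<close>): the absolute values of \<open>\<tau>\<close> and \<open>\<rho>\<close> change by the same factor if \<open>\<tau> \<noteq> 0\<close>, which is \<open>1\<close> because of
  \<open>\<tau>\<^sup>2 + \<bar>\<rho>\<bar>\<^sup>2 = 1\<close>.
\<close>

section \<open>Quaternionic linear algebra and block matrices\<close>

type_synonym 'n cv = "complex ^ ('n + 'n)"

abbreviation sg :: "'n::finite cv \<Rightarrow> 'n cv" where "sg \<equiv> quat_struct"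

lemma sg_nth [simp]:
  "sg x $ Inl a = - cnj (x $ Inr a)" "sg x $ Inr a = cnj (x $ Inl a)"
  by (simp_all add: quat_struct_def)

lemma cv_eq_iff: "(x :: 'n::finite cv) = y \<longleftrightarrow> (\<forall>a. x $ Inl a = y $ Inl a) \<and> (\<forall>a. x $ Inr a = y $ Inr a)"
  by (simp add: vec_eq_iff split_sum_all)

lemma sg_simps [simp]:
  "sg (x + y) = sg x + sg y" "sg (x - y) = sg x - sg y" "sg (- x) = - sg x" "sg 0 = 0"
  "sg (c *s x) = cnj c *s sg x" "sg (r *\<^sub>R x) = r *\<^sub>R sg x" "sg (sg x) = - x"
  by (simp_all add: cv_eq_iff)

lemma sg_sum: "sg (\<Sum>i\<in>A. f i) = (\<Sum>i\<in>A. sg (f i))"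
  by (induction A rule: infinite_finite_induct) auto

definition dt :: "complex ^ 'i \<Rightarrow> complex ^ 'i \<Rightarrow> complex" where
  "dt x y = (\<Sum>i\<in>UNIV. x $ i * y $ i)"

lemma dt_commute: "dt x y = dt y x"
  by (simp add: dt_def mult.commute)

lemma dt_simps [simp]:
  "dt (x + x') y = dt x y + dt x' y" "dt (x - x') y = dt x y - dt x' y" "dt (- x) y = - dt x y"
  "dt (c *s x) y = c * dt x y" "dt (r *\<^sub>R x) y = r *\<^sub>R dt x y" "dt 0 y = 0"
  "dt x (y + y') = dt x y + dt x y'" "dt x (y - y') = dt x y - dt x y'" "dt x (- y) = - dt x y"
  "dt x (c *s y) = c * dt x y" "dt x (r *\<^sub>R y) = r *\<^sub>R dt x y" "dt x 0 = 0"
  by (simp_all add: dt_def algebra_simps sum.distrib sum_subtractf sum_negf sum_distrib_left scaleR_sum_right)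

lemma sum_UNIV_Plus: "(\<Sum>r\<in>UNIV. f r) = (\<Sum>a\<in>UNIV. f (Inl a)) + (\<Sum>a\<in>UNIV. f (Inr a))"
  for f :: "'a::finite + 'b::finite \<Rightarrow> 'c::comm_monoid_add"
  by (subst UNIV_Plus_UNIV[symmetric], subst sum.Plus) auto

lemma dt_sg_sg [simp]: "dt (sg x) (sg y) = cnj (dt x y)"
  by (simp add: dt_def sum_UNIV_Plus add.commute)

lemma dt_sg_swap: "dt (sg y) x = - cnj (dt (sg x) y)"
  using dt_sg_sg[of "sg x" y] unfolding sg_simps(7) dt_simps(3) dt_commute[of x "sg y"] by (metis minus_minus)

lemma dt_axis [simp]: "dt (axis i c) y = c * y $ i" "dt y (axis i c) = c * y $ i"
proof -
  show "dt (axis i c) y = c * y $ i"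
    unfolding dt_def axis_def by (simp add: if_distrib[where f="\<lambda>u. u * _"] cong: if_cong)
  then show "dt y (axis i c) = c * y $ i" by (metis dt_commute)
qed

lemma dt_nondegenerate: "(\<And>y. dt x y = 0) \<Longrightarrow> x = 0"
  by (metis dt_axis(2) mult_1 vec_eq_iff zero_index)

definition outer :: "complex ^ 'i \<Rightarrow> complex ^ 'j \<Rightarrow> complex ^ 'j ^ 'i" where
  "outer x y = (\<chi> i j. x $ i * y $ j)"

lemma outer_nth [simp]: "outer x y $ i $ j = x $ i * y $ j"
  by (simp add: outer_def)

lemma outer_mv [simp]: "outer x y *v w = dt y w *s x"
  by (simp add: vec_eq_iff matrix_vector_mult_def dt_def sum_distrib_left algebra_simps)

lemma vm_outer [simp]: "w v* outer x y = dt w x *s y"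
  by (simp add: vec_eq_iff vector_matrix_mult_def dt_def sum_distrib_left sum_distrib_right algebra_simps)

lemma dt_mv: "dt x (M *v y) = dt (x v* M) y"
  by (simp add: dt_def matrix_vector_mult_def vector_matrix_mult_def sum_distrib_left sum_distrib_right)
    (subst sum.swap, simp add: algebra_simps)

lemma mat_mv [simp]: "mat c *v x = c *s (x :: 'a::comm_semiring_1 ^ 'i)"
  by (simp add: vec_eq_iff matrix_vector_mult_def mat_def if_distrib[where f="\<lambda>u. u * _"] cong: if_cong)

lemma vm_mat [simp]: "x v* mat c = c *s (x :: 'a::comm_semiring_1 ^ 'i)"
  by (simp add: vec_eq_iff vector_matrix_mult_def mat_def if_distrib[where f="\<lambda>u. _ * u"] mult.commute cong: if_cong)

lemma mat_mult_nth [simp]: "(mat c ** M) $ i $ j = c * M $ i $ j" "(M ** mat c) $ i $ j = M $ i $ j * (c :: 'a::comm_semiring_1)"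
  by (simp_all add: matrix_matrix_mult_def mat_def if_distrib[where f="\<lambda>u. u * _"] if_distrib[where f="\<lambda>u. _ * u"] cong: if_cong)

lemma mm_add_rdistrib: "(A + B) ** C = A ** C + B ** (C :: 'a::semiring_1^_^_)"
  by (simp add: vec_eq_iff matrix_matrix_mult_def sum.distrib algebra_simps)

lemma mm_diff: "(A - B) ** C = A ** C - B ** C" "C ** (A - B) = C ** A - C ** (B :: 'a::ring_1^_^_)"
  by (simp_all add: vec_eq_iff matrix_matrix_mult_def sum_subtractf algebra_simps)

lemma mm_minus [simp]: "(- A) ** C = - (A ** C)" "C ** (- A) = - (C ** (A :: 'a::ring_1^_^_))"
  by (simp_all add: vec_eq_iff matrix_matrix_mult_def sum_negf)

lemma mm_scaleR [simp]: "(r *\<^sub>R A) ** B = r *\<^sub>R (A ** B)" "A ** (r *\<^sub>R B) = r *\<^sub>R (A ** (B :: 'a::real_algebra_1^_^_))"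
  by (simp_all add: vec_eq_iff matrix_matrix_mult_def scaleR_sum_right)

lemma mv_simps [simp]:
  "(- A) *v x = - (A *v x)" "A *v (- x) = - (A *v (x :: 'a::ring_1^_))"
  by (simp_all add: vec_eq_iff matrix_vector_mult_def sum_negf)

lemma mv_smult [simp]: "M *v (c *s x) = c *s (M *v (x :: 'a::comm_semiring_1^_))"
  by (simp add: vec_eq_iff matrix_vector_mult_def sum_distrib_left algebra_simps)

lemma vm_simps [simp]:
  "(- x) v* A = - (x v* A)" "x v* (- A) = - ((x :: 'a::ring_1^_) v* A)"
  by (simp_all add: vec_eq_iff vector_matrix_mult_def sum_negf)

lemma vm_smult [simp]: "(c *s x) v* M = c *s ((x :: 'a::comm_semiring_1^_) v* M)"
  by (simp add: vec_eq_iff vector_matrix_mult_def sum_distrib_left algebra_simps)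

lemma scaleR_mv [simp]: "(r *\<^sub>R A) *v x = r *\<^sub>R (A *v (x::'a::real_algebra_1^_))"
  by (simp add: vec_eq_iff matrix_vector_mult_def scaleR_sum_right)

lemma outer_mm [simp]: "M ** outer x y = outer (M *v x) y" "outer x y ** M = outer x (y v* M)"
  by (simp_all add: vec_eq_iff matrix_matrix_mult_def matrix_vector_mult_def vector_matrix_mult_def
      sum_distrib_left sum_distrib_right algebra_simps)

lemma matrix_eq_mv: "(\<And>x. A *v x = B *v x) \<Longrightarrow> A = (B :: complex^'j^'i)"
  by (simp add: matrix_eq)

subsection \<open>Block matrices\<close>

fun unmid :: "'n option + 'n option \<Rightarrow> ('n + 'n) + bool" where
  "unmid (Inl None) = Inr False" | "unmid (Inr None) = Inr True"
| "unmid (Inl (Some a)) = Inl (Inl a)" | "unmid (Inr (Some a)) = Inl (Inr a)"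

lemma mid_simps: "mid (Inl a) = Inl (Some a)" "mid (Inr a) = Inr (Some a)"
  by (simp_all add: mid_def)

lemma unmid_mid [simp]: "unmid (mid a) = Inl a"
  by (cases a) (simp_all add: mid_simps)

lemma mid_neq [simp]: "mid a \<noteq> Inl None" "mid a \<noteq> Inr None" "Inl None \<noteq> mid a" "Inr None \<noteq> mid a"
  by (cases a; simp add: mid_simps)+

lemma mid_inject [simp]: "mid a = mid b \<longleftrightarrow> a = b"
  by (cases a; cases b; simp add: mid_simps)

lemma block_simps [simp]: "block (Inl None) = 0" "block (Inr None) = 2" "block (mid a) = 1"
  by (cases a; simp add: block_def mid_simps)+

lemma all_idx: "(\<forall>r. P r) \<longleftrightarrow> P (Inl None) \<and> P (Inr None) \<and> (\<forall>a. P (mid a))"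
proof -
  have "P r" if *: "P (Inl None)" "P (Inr None)" "\<forall>a. P (mid a)" for r
  proof (cases r rule: unmid.cases)
    case (3 a) then show ?thesis using *(3)[rule_format, of "Inl a"] by (simp add: mid_simps)
  next
    case (4 a) then show ?thesis using *(3)[rule_format, of "Inr a"] by (simp add: mid_simps)
  qed (use * in auto)
  then show ?thesis by blast
qed

lemma sum_idx: "(\<Sum>r\<in>UNIV. f r) = f (Inl None) + f (Inr None) + (\<Sum>a\<in>UNIV. f (mid a))"
  for f :: "'n::finite option + 'n option \<Rightarrow> 'c::comm_monoid_add"
proof -
  have "(UNIV :: ('n option + 'n option) set) = {Inl None, Inr None} \<union> range mid"
    using all_idx[of "\<lambda>r. r \<in> {Inl None, Inr None} \<union> range mid"] by auto
  then have "(\<Sum>r\<in>UNIV. f r) = (\<Sum>r\<in>{Inl None, Inr None} \<union> range mid. f r)" by simp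
  also have "\<dots> = (\<Sum>r\<in>{Inl None, Inr None}. f r) + (\<Sum>r\<in>range mid. f r)"
    by (rule sum.union_disjoint) auto
  also have "(\<Sum>r\<in>range mid. f r) = (\<Sum>a\<in>UNIV. f (mid a))"
    by (subst sum.reindex) (auto simp: inj_on_def)
  finally show ?thesis by simp
qed

text \<open>
  The block rows are \<open>(a, y, c)\<close>, \<open>(x, M, z)\<close> and \<open>(d, w, f)\<close>; rows and columns come in the order first basis vector,
  middle part, last basis vector.
\<close>

definition bm :: "complex \<Rightarrow> 'n::finite cv \<Rightarrow> complex \<Rightarrow> 'n cv \<Rightarrow> complex ^ ('n + 'n) ^ ('n + 'n) \<Rightarrow> 'n cv \<Rightarrow>
    complex \<Rightarrow> 'n cv \<Rightarrow> complex \<Rightarrow> 'n mat2" where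
  "bm a y c x M z d w f = (\<chi> r s. case unmid r of
       Inr False \<Rightarrow> (case unmid s of Inr False \<Rightarrow> a | Inr True \<Rightarrow> c | Inl j \<Rightarrow> y $ j)
     | Inl i \<Rightarrow> (case unmid s of Inr False \<Rightarrow> x $ i | Inr True \<Rightarrow> z $ i | Inl j \<Rightarrow> M $ i $ j)
     | Inr True \<Rightarrow> (case unmid s of Inr False \<Rightarrow> d | Inr True \<Rightarrow> f | Inl j \<Rightarrow> w $ j))"

lemma bm_nth [simp]:
  "bm a y c x M z d w f $ Inl None $ Inl None = a"
  "bm a y c x M z d w f $ Inl None $ mid j = y $ j"
  "bm a y c x M z d w f $ Inl None $ Inr None = c"
  "bm a y c x M z d w f $ mid i $ Inl None = x $ i"
  "bm a y c x M z d w f $ mid i $ mid j = M $ i $ j"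
  "bm a y c x M z d w f $ mid i $ Inr None = z $ i"
  "bm a y c x M z d w f $ Inr None $ Inl None = d"
  "bm a y c x M z d w f $ Inr None $ mid j = w $ j"
  "bm a y c x M z d w f $ Inr None $ Inr None = f"
  by (simp_all add: bm_def)

lemma mat2_eq_iff: "(A :: 'n::finite mat2) = B \<longleftrightarrow>
   A $ Inl None $ Inl None = B $ Inl None $ Inl None \<and> A $ Inl None $ Inr None = B $ Inl None $ Inr None \<and>
   A $ Inr None $ Inl None = B $ Inr None $ Inl None \<and> A $ Inr None $ Inr None = B $ Inr None $ Inr None \<and>
   (\<forall>j. A $ Inl None $ mid j = B $ Inl None $ mid j) \<and> (\<forall>j. A $ Inr None $ mid j = B $ Inr None $ mid j) \<and>
   (\<forall>i. A $ mid i $ Inl None = B $ mid i $ Inl None) \<and> (\<forall>i. A $ mid i $ Inr None = B $ mid i $ Inr None) \<and>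
   (\<forall>i j. A $ mid i $ mid j = B $ mid i $ mid j)"
  unfolding vec_eq_iff all_idx by blast

lemma bm_eq_iff [simp]:
  "bm a y c x M z d w f = bm a' y' c' x' M' z' d' w' f' \<longleftrightarrow>
   a = a' \<and> y = y' \<and> c = c' \<and> x = x' \<and> M = M' \<and> z = z' \<and> d = d' \<and> w = w' \<and> f = f'"
  by (auto simp: mat2_eq_iff vec_eq_iff)

lemma bm_exists: obtains a y c x M z d w f where "A = bm a y c x M z d w f"
proof
  show "A = bm (A $ Inl None $ Inl None) (\<chi> j. A $ Inl None $ mid j) (A $ Inl None $ Inr None)
     (\<chi> i. A $ mid i $ Inl None) (\<chi> i j. A $ mid i $ mid j) (\<chi> i. A $ mid i $ Inr None)
     (A $ Inr None $ Inl None) (\<chi> j. A $ Inr None $ mid j) (A $ Inr None $ Inr None)"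
    by (simp add: mat2_eq_iff)
qed

lemma bm_simps [simp]:
  "bm a y c x M z d w f + bm a' y' c' x' M' z' d' w' f' =
     bm (a + a') (y + y') (c + c') (x + x') (M + M') (z + z') (d + d') (w + w') (f + f')"
  "bm a y c x M z d w f - bm a' y' c' x' M' z' d' w' f' =
     bm (a - a') (y - y') (c - c') (x - x') (M - M') (z - z') (d - d') (w - w') (f - f')"
  "- bm a y c x M z d w f = bm (- a) (- y) (- c) (- x) (- M) (- z) (- d) (- w) (- f)"
  "r *\<^sub>R bm a y c x M z d w f = bm (r *\<^sub>R a) (r *\<^sub>R y) (r *\<^sub>R c) (r *\<^sub>R x) (r *\<^sub>R M) (r *\<^sub>R z) (r *\<^sub>R d) (r *\<^sub>R w) (r *\<^sub>R f)"
  by (simp_all add: mat2_eq_iff)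

lemma bm_0: "bm 0 0 0 0 0 0 0 0 0 = 0" by (simp add: mat2_eq_iff)

lemma bm_1: "bm 1 0 0 0 (mat 1) 0 0 0 1 = mat 1" by (simp add: mat2_eq_iff mat_def)

lemma bm_mat: "mat c = bm c 0 0 0 (mat c) 0 0 0 c" by (simp add: mat2_eq_iff mat_def)

lemma bm_eq_0 [simp]: "bm a y c x M z d w f = 0 \<longleftrightarrow> a = 0 \<and> y = 0 \<and> c = 0 \<and> x = 0 \<and> M = 0 \<and> z = 0 \<and> d = 0 \<and> w = 0 \<and> f = 0"
  unfolding bm_0[symmetric] by simp

lemma bm_mult [simp]:
  "bm a y c x M z d w f ** bm a' y' c' x' M' z' d' w' f' =
   bm (a * a' + dt y x' + c * d') (a *s y' + y v* M' + c *s w') (a * c' + dt y z' + c * f')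
      (a' *s x + M *v x' + d' *s z) (outer x y' + M ** M' + outer z w') (c' *s x + M *v z' + f' *s z)
      (d * a' + dt w x' + f * d') (d *s y' + w v* M' + f *s w') (d * c' + dt w z' + f * f')"
  by (simp add: mat2_eq_iff matrix_matrix_mult_def matrix_vector_mult_def vector_matrix_mult_def sum_idx dt_def algebra_simps)

lemma bm_transpose [simp]: "transpose (bm a y c x M z d w f) = bm a x d y (transpose M) w c z f"
  by (simp add: mat2_eq_iff transpose_def)

definition cj :: "complex ^ 'i \<Rightarrow> complex ^ 'i" where "cj x = (\<chi> i. cnj (x $ i))"

lemma cj_nth [simp]: "cj x $ i = cnj (x $ i)" by (simp add: cj_def)

lemma cj_simps [simp]: "cj (x + y) = cj x + cj y" "cj (x - y) = cj x - cj y" "cj (- x) = - cj x"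
   "cj (c *s x) = cnj c *s cj x" "cj (cj x) = x" "cj 0 = 0" "cj x = cj y \<longleftrightarrow> x = y" "dt (cj x) (cj y) = cnj (dt x y)"
  by (auto simp: vec_eq_iff dt_def)

lemma adj_bm [simp]: "adj (bm a y c x M z d w f) = bm (cnj a) (cj x) (cnj d) (cj y) (adj M) (cj w) (cnj c) (cj z) (cnj f)"
  by (simp add: mat2_eq_iff adj_def)

lemma trace_bm [simp]: "trace (bm a y c x M z d w f) = a + trace M + f"
  by (simp add: trace_def sum_idx)

lemma J_bm: "(J :: 'n::finite mat2) = bm 0 0 1 0 J 0 (-1) 0 0"
proof -
  have "(J :: 'n::finite mat2) $ mid i $ mid j = J $ i $ j" for i j :: "'n + 'n"
    by (cases i; cases j; simp add: mid_simps J_def)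
  moreover have "(J :: 'n::finite mat2) $ mid i $ Inl None = 0" "(J :: 'n::finite mat2) $ mid i $ Inr None = 0"
     "(J :: 'n::finite mat2) $ Inl None $ mid i = 0" "(J :: 'n::finite mat2) $ Inr None $ mid i = 0" for i :: "'n + 'n"
    by (cases i; simp add: mid_simps J_def)+
  ultimately show ?thesis by (simp add: mat2_eq_iff) (simp add: J_def)
qed

lemma J_mv: "J *v x = - cj (sg x)" "x v* J = cj (sg (x :: 'n::finite cv))"
  by (simp_all add: cv_eq_iff matrix_vector_mult_def vector_matrix_mult_def sum_UNIV_Plus J_def
     if_distrib[where f="\<lambda>u. u * _"] if_distrib[where f="\<lambda>u. _ * u"] cong: if_cong)

lemma sg_cj: "sg (cj x) = cj (sg x)" by (simp add: cv_eq_iff)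

lemma J_J: "J ** J = - mat 1"
  by (simp add: matrix_eq matrix_vector_mul_assoc[symmetric] J_mv sg_cj mv_simps)

lemma Hm_eq: "Hm = mat \<i> ** J" by (simp add: vec_eq_iff Hm_def)

section \<open>The groups and Lie algebras in block form\<close>

abbreviation kb :: "complex ^ ('n + 'n) ^ ('n + 'n) \<Rightarrow> 'n::finite mat2" where
  "kb M \<equiv> bm 0 0 0 0 M 0 0 0 0"
abbreviation kg :: "complex ^ ('n + 'n) ^ ('n + 'n) \<Rightarrow> 'n::finite mat2" where
  "kg k \<equiv> bm 1 0 0 0 k 0 0 0 1"

lemma mm_smult_ac: "A ** (mat c ** B) = mat c ** (A ** (B :: complex^'j^'i))" "(mat c ** A) ** B = mat c ** (A ** B)"
  by (rule matrix_eq_mv, simp add: matrix_vector_mul_assoc[symmetric])+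

lemma outer_simps [simp]: "outer 0 y = 0" "outer x 0 = 0" "outer (- x) y = - outer x y" "outer x (- y) = - outer x y"
  by (simp_all add: vec_eq_iff)

declare sg_cj [simp]

lemma dt_J: "dt (cj u) (J *v v) = dt (sg u) v"
proof -
  have "dt (cj u) (J *v v) = dt (cj u v* J) v" by (rule dt_mv)
  then show ?thesis unfolding J_mv by (simp del: cj_simps(8))
qed

lemma dt_eqI: "(\<And>y. dt x y = dt x' y) \<Longrightarrow> x = x'"
  using dt_nondegenerate[of "x - x'"] by simp

lemma mat_mm_cancel: "mat \<i> ** A = mat \<i> ** B \<longleftrightarrow> A = (B :: complex^'i^'i)"
  by (simp add: vec_eq_iff)

lemma mat_mm_simps: "mat c ** A + mat c ** B = mat c ** (A + B)" "- (mat c ** A) = mat c ** (- A)"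
  "(mat \<i> ** A = 0) = (A = 0)"
  for A B :: "complex^'i^'i"
  by (simp_all add: vec_eq_iff algebra_simps)

text \<open>
  The Lie algebra \<open>\<uu>(n,n)\<close> of the hermitian form, without the trace condition.
\<close>

definition uu :: "('m::finite) sqmat \<Rightarrow> bool" where
  "uu M \<longleftrightarrow> adj M ** J + J ** M = 0"

lemma su_iff: "A \<in> su \<longleftrightarrow> trace A = 0 \<and> uu A"
  by (simp add: su_def Hm_eq uu_def mm_smult_ac mat_mm_simps del: mm_minus)

lemma L_grp_iff: "A \<in> L_grp \<longleftrightarrow> det A = 1 \<and> (adj A ** J ** A = J \<or> adj A ** J ** A = - J)"
  by (simp add: L_grp_def Hm_eq mm_smult_ac mat_mm_simps mat_mm_cancel del: mm_minus)

lemma adj_mv: "cj x v* A = cj (adj A *v x)" "adj A *v x = cj (cj x v* A)" "x v* adj A = cj (A *v cj x)"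
  by (simp_all add: vec_eq_iff adj_def matrix_vector_mult_def vector_matrix_mult_def mult.commute)

lemma uu_bm [simp]: "uu (bm a y c x M z d w f) \<longleftrightarrow>
   cnj c = c \<and> cnj d = d \<and> y = sg z \<and> w = - sg x \<and> f = - cnj a \<and> uu M"
proof -
  have 1: "- sg y = z \<longleftrightarrow> y = sg z" for y z :: "'n::finite cv" by (metis sg_simps(3) sg_simps(7) minus_minus)
  have "uu (bm a y c x M z d w f) \<longleftrightarrow> bm (- cnj d + d) (cj (sg (cj x)) + w) (cnj a + f) (- cj w - cj (sg x))
     (adj M ** J + J ** M) (cj y - cj (sg z)) (- cnj f - a) (cj (sg (cj z)) - y) (cnj c - c) = 0"
    unfolding uu_def J_bm by (simp add: J_mv)
  also have "\<dots> \<longleftrightarrow> cnj c = c \<and> cnj d = d \<and> y = sg z \<and> w = - sg x \<and> f = - cnj a \<and> uu M"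
    by (auto simp: uu_def add_eq_0_iff)
  finally show ?thesis .
qed

lemma su_bm: "bm a y c x M z d w f \<in> su \<longleftrightarrow>
   cnj c = c \<and> cnj d = d \<and> y = sg z \<and> w = - sg x \<and> f = - cnj a \<and> uu M \<and> a + trace M + f = 0"
  by (auto simp: su_iff)

text \<open>
  In terms of \<open>sg\<close> the hermitian form is \<open>dt (sg x) y\<close> up to a factor; in this form membership is checked on vectors.
\<close>

lemma uu_h: "uu M \<longleftrightarrow> (\<forall>x y. dt (sg (M *v x)) y = - dt (sg x) (M *v y))"
proof -
  have *: "dt (cj u) ((adj M ** J + J ** M) *v v) = dt (sg (M *v u)) v + dt (sg u) (M *v v)" for u v
  proof -
    have "dt (cj u) (adj M *v (J *v v)) = dt (sg (M *v u)) v"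
      by (simp add: dt_mv[of _ "adj M"] adj_mv(3) dt_J)
    moreover have "dt (cj u) (J *v (M *v v)) = dt (sg u) (M *v v)"
      by (rule dt_J)
    ultimately show ?thesis by (simp add: matrix_vector_mult_add_rdistrib matrix_vector_mul_assoc)
  qed
  show ?thesis
  proof
    assume "uu M"
    then show "\<forall>x y. dt (sg (M *v x)) y = - dt (sg x) (M *v y)"
      using * by (auto simp: uu_def eq_neg_iff_add_eq_0)
  next
    assume "\<forall>x y. dt (sg (M *v x)) y = - dt (sg x) (M *v y)"
    then have "dt (cj u) ((adj M ** J + J ** M) *v v) = 0" for u v by (simp add: *)
    then have "(adj M ** J + J ** M) *v v = 0" for v
      using dt_nondegenerate by (metis cj_simps(5) dt_commute)
    then show "uu M" unfolding uu_def by (intro matrix_eq_mv) simp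
  qed
qed

lemma so_iff: "M \<in> so_star \<longleftrightarrow> transpose M = - M \<and> uu M"
  by (simp add: so_star_def uu_def)

lemma transpose_dt: "transpose M = N \<longleftrightarrow> (\<forall>x y. dt (M *v x) y = dt x (N *v y))" for M N :: "complex^'i^'i"
proof
  assume "transpose M = N" then show "\<forall>x y. dt (M *v x) y = dt x (N *v y)"
    by (metis dt_commute dt_mv transpose_matrix_vector)
next
  assume *: "\<forall>x y. dt (M *v x) y = dt x (N *v y)"
  have "dt x (transpose M *v y) = dt x (N *v y)" for x y
    using *[rule_format, of x y] by (simp add: dt_mv[symmetric] dt_commute[of x "y v* M"] dt_commute[of "M *v x"])
  then have "transpose M *v y = N *v y" for y
    using dt_nondegenerate[of "transpose M *v y - N *v y"] by (simp add: dt_commute)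
  then show "transpose M = N" by (intro matrix_eq_mv)
qed

text \<open>
  The elements of \<open>\<ss>\<oo>\<^sup>*\<close> are the skew matrices that commute with right multiplication by \<open>j\<close>.
\<close>

lemma so_h: "M \<in> so_star \<longleftrightarrow> (\<forall>x y. dt (M *v x) y = - dt x (M *v y)) \<and> (\<forall>x. M *v sg x = sg (M *v x))"
proof -
  have "uu M \<longleftrightarrow> (\<forall>x. M *v sg x = sg (M *v x))" if *: "\<And>x y. dt (M *v x) y = - dt x (M *v y)"
    unfolding uu_h
  proof safe
    fix x assume "\<forall>x y. dt (sg (M *v x)) y = - dt (sg x) (M *v y)"
    then have "dt (M *v sg x) y = dt (sg (M *v x)) y" for y by (simp add: *)
    then show "M *v sg x = sg (M *v x)" by (rule dt_eqI)
  qed (metis *)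
  then show ?thesis unfolding so_iff transpose_dt by (auto)
qed

lemma self_neg [simp]: "a = - a \<longleftrightarrow> (a :: complex) = 0"
  by (simp add: eq_neg_iff_add_eq_0)

lemma g_bm: "bm a y c x M z d w f \<in> so_star \<longleftrightarrow>
   a = 0 \<and> y = - x \<and> c = - d \<and> cnj d = d \<and> z = sg x \<and> w = - sg x \<and> f = 0 \<and> M \<in> so_star"
  unfolding so_iff bm_transpose bm_simps bm_eq_iff uu_bm self_neg by (safe; simp)

lemma vec0: "(\<forall>i. x $ i = 0) \<longleftrightarrow> x = 0" by (simp add: vec_eq_iff)
lemma mat0: "(\<forall>i j. M $ i $ j = 0) \<longleftrightarrow> M = 0" by (simp add: vec_eq_iff)
lemma uu_0 [simp]: "uu 0" by (simp add: uu_def adj_def vec_eq_iff matrix_matrix_mult_def)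
lemma trace_0' [simp]: "trace 0 = 0" by (simp add: trace_def)

lemma p_bm: "bm a y c x M z d w f \<in> p_alg \<longleftrightarrow> bm a y c x M z d w f \<in> su \<and> x = 0 \<and> d = 0 \<and> w = 0"
  unfolding p_alg_def su_filt_def all_idx by (auto simp: all_conj_distrib vec0 mat0)

lemma p_plus_bm: "bm a y c x M z d w f \<in> p_plus \<longleftrightarrow>
    cnj c = c \<and> y = sg z \<and> a = 0 \<and> x = 0 \<and> M = 0 \<and> d = 0 \<and> w = 0 \<and> f = 0"
  unfolding p_plus_def su_filt_def all_idx by (auto simp: all_conj_distrib vec0 mat0 su_bm)

lemma l_minus_bm: "bm a y c x M z d w f \<in> l_minus \<longleftrightarrow>
    cnj d = d \<and> w = - sg x \<and> a = 0 \<and> y = 0 \<and> c = 0 \<and> M = 0 \<and> z = 0 \<and> f = 0"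
  unfolding l_minus_def all_idx by (auto simp: all_conj_distrib vec0 mat0 su_bm)

lemma su_gr_m1_bm: "bm a y c x M z d w f \<in> su_gr (-1) \<longleftrightarrow>
    w = - sg x \<and> a = 0 \<and> y = 0 \<and> c = 0 \<and> M = 0 \<and> z = 0 \<and> f = 0 \<and> d = 0"
  unfolding su_gr_def all_idx by (auto simp: all_conj_distrib vec0 mat0 su_bm)

lemma su_filt_m1_bm: "bm a y c x M z d w f \<in> su_filt (-1) \<longleftrightarrow> bm a y c x M z d w f \<in> su \<and> d = 0"
  unfolding su_filt_def all_idx by (auto simp: all_conj_distrib vec0 mat0)

lemma su_filt_low: "k \<le> -2 \<Longrightarrow> su_filt k = su"
  unfolding su_filt_def all_idx by auto

lemma k_bm: "bm a y c x M z d w f \<in> k_alg \<longleftrightarrow> bm a y c x M z d w f = kb M \<and> M \<in> so_star"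
  unfolding k_alg_def all_idx by (auto simp: all_conj_distrib vec0 mat0 g_bm)

lemma K_bm: "bm a y c x M z d w f \<in> K_grp \<longleftrightarrow> bm a y c x M z d w f = kg M \<and> kg M \<in> SO_star"
  unfolding K_grp_def all_idx by (auto simp: all_conj_distrib vec0 mat0 mat_def)

lemma P_bm: "bm a y c x M z d w f \<in> P_grp \<longleftrightarrow> bm a y c x M z d w f \<in> L_grp \<and> x = 0 \<and> d = 0 \<and> w = 0"
  unfolding P_grp_def all_idx by (auto simp: all_conj_distrib vec0 mat0)

lemma trace_so: "M \<in> so_star \<Longrightarrow> trace M = 0"
proof -
  assume "M \<in> so_star"
  then have "transpose M $ i $ i = - M $ i $ i" for i by (simp add: so_iff)
  then have "M $ i $ i = 0" for i by (simp add: transpose_def)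
  then show ?thesis by (simp add: trace_def)
qed

lemma su_cases: assumes "A \<in> su" obtains a z c x M d where
    "A = bm a (sg z) c x M z d (- sg x) (- cnj a)" "cnj c = c" "cnj d = d" "uu M" "a + trace M - cnj a = 0"
  using assms by (rule_tac A=A in bm_exists) (simp add: su_bm)

lemma g_cases: assumes "A \<in> so_star" obtains r x M where
    "A = bm 0 (- x) (- complex_of_real r) x M (sg x) (complex_of_real r) (- sg x) 0" "M \<in> so_star"
proof -
  obtain a y c x M z d w f where A: "A = bm a y c x M z d w f" by (rule bm_exists)
  then have *: "a = 0" "y = - x" "c = - d" "cnj d = d" "z = sg x" "w = - sg x" "f = 0" "M \<in> so_star"
    using assms by (auto simp: g_bm)
  then have "d = complex_of_real (Re d)" by (simp add: complex_eq_iff)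
  with * A that[of x "Re d" M] show ?thesis by metis
qed

lemma dt_adj_J: "dt (cj u) ((adj A ** J ** A) *v v) = dt (sg (A *v u)) (A *v v)"
proof -
  have "dt (cj u) (adj A *v w) = dt (cj (A *v u)) w" for w by (simp add: dt_mv adj_mv(3))
  then show ?thesis by (simp add: matrix_vector_mul_assoc[symmetric] dt_J)
qed

lemma matrix_eq_dt: "A = B \<longleftrightarrow> (\<forall>u v. dt (cj u) (A *v v) = dt (cj u) (B *v v))"
proof
  assume *: "\<forall>u v. dt (cj u) (A *v v) = dt (cj u) (B *v v)"
  have "dt (A *v v - B *v v) u = 0" for u v using *[rule_format, of "cj u" v] by (simp add: dt_commute)
  then have "A *v v = B *v v" for v using dt_nondegenerate[of "A *v v - B *v v"] by simp
  then show "A = B" by (rule matrix_eq_mv)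
qed simp

lemma adj_J_iff: "adj A ** J ** A = mat e ** J \<longleftrightarrow> (\<forall>u v. dt (sg (A *v u)) (A *v v) = e * dt (sg u) v)"
proof -
  have "dt (cj u) ((mat e ** J) *v v) = e * dt (sg u) v" for u v
    by (simp add: dt_J flip: matrix_vector_mul_assoc)
  then show ?thesis unfolding matrix_eq_dt[of "adj A ** J ** A"] dt_adj_J by metis
qed

lemma orth_iff: "transpose A ** A = mat 1 \<longleftrightarrow> (\<forall>u v. dt (A *v u) (A *v v) = dt u v)" for A :: "complex^'i^'i"
proof -
  have "dt (cj u) ((transpose A ** A) *v v) = dt (A *v cj u) (A *v v)" for u v
    by (metis matrix_vector_mul_assoc transpose_dt transpose_transpose)
  then have "transpose A ** A = mat 1 \<longleftrightarrow> (\<forall>u v. dt (A *v cj u) (A *v v) = dt (cj u) v)"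
    by (subst matrix_eq_dt) (simp)
  then show ?thesis by (metis cj_simps(5))
qed

lemma matrix_inv: assumes "invertible A" shows "A ** matrix_inv A = mat 1" "matrix_inv A ** A = mat 1"
  using assms unfolding invertible_def matrix_inv_def by (metis (mono_tags, lifting) someI_ex)+

lemma matrix_inv_unique: "B ** A = mat 1 \<Longrightarrow> matrix_inv A = B" for A B :: "complex^'i^'i"
  by (metis invertible_def matrix_inv matrix_left_right_inverse matrix_mul_assoc matrix_mul_lid matrix_mul_rid)

lemma inv_mult: "det A \<noteq> 0 \<Longrightarrow> matrix_inv A ** A = mat 1" "det A \<noteq> 0 \<Longrightarrow> A ** matrix_inv A = mat 1" for A :: "complex^'i^'i"
  by (simp_all add: invertible_det_nz matrix_inv)

lemma SO_inv: "g \<in> SO_star \<Longrightarrow> matrix_inv g = transpose g" "g \<in> SO_star \<Longrightarrow> transpose g ** g = mat 1" "g \<in> SO_star \<Longrightarrow> g ** transpose g = mat 1"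
  by (auto simp: SO_star_def matrix_inv_unique matrix_left_right_inverse)

lemma SO_iff: "g \<in> SO_star \<longleftrightarrow> transpose g ** g = mat 1 \<and> det g = 1 \<and> (\<forall>x. g *v sg x = sg (g *v x))"
proof -
  have "adj g ** J ** g = mat 1 ** J \<longleftrightarrow> (\<forall>x. g *v sg x = sg (g *v x))" if "transpose g ** g = mat 1"
  proof -
    have o: "dt (g *v u) (g *v v) = dt u v" for u v using that orth_iff by blast
    have gg: "g *v (transpose g *v y) = y" for y
      using that by (metis matrix_left_right_inverse matrix_vector_mul_assoc matrix_vector_mul_lid)
    show ?thesis unfolding adj_J_iff
    proof safe
      fix x assume *: "\<forall>u v. dt (sg (g *v u)) (g *v v) = 1 * dt (sg u) v"
      have "dt (g *v sg x) y = dt (sg (g *v x)) y" for y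
        using *[rule_format, of x "transpose g *v y"] o[of "sg x" "transpose g *v y"] unfolding gg by simp
      then show "g *v sg x = sg (g *v x)" by (rule dt_eqI)
    qed (metis o mult_1)
  qed
  then show ?thesis by (auto simp: SO_star_def)
qed

lemma SO_mult: "g \<in> SO_star \<Longrightarrow> h \<in> SO_star \<Longrightarrow> g ** h \<in> SO_star"
  unfolding SO_iff by (auto simp: matrix_transpose_mul det_mul matrix_vector_mul_assoc[symmetric])
    (metis matrix_mul_assoc matrix_mul_lid)

lemma SO_transpose: "g \<in> SO_star \<Longrightarrow> transpose g \<in> SO_star"
  unfolding SO_iff
proof safe
  assume *: "transpose g ** g = mat 1" "\<forall>x. g *v sg x = sg (g *v x)"
  then show **: "transpose (transpose g) ** transpose g = mat 1" by (simp add: matrix_left_right_inverse)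
  fix x
  have "g *v (transpose g *v sg x) = g *v sg (transpose g *v x)"
    using * ** by (simp add: matrix_vector_mul_assoc del: transpose_matrix_vector)
  then show "transpose g *v sg x = sg (transpose g *v x)"
    using *(1) by (metis matrix_vector_mul_assoc matrix_vector_mul_lid)
qed simp

lemma SO_1: "mat 1 \<in> SO_star" by (simp add: SO_iff)

lemma K_cases: assumes "g \<in> K_grp" obtains k where "g = kg k" "transpose k ** k = mat 1" "\<And>x. k *v sg x = sg (k *v x)" "kg k \<in> SO_star" "det (kg k) = 1"
proof -
  obtain k where k: "g = kg k" "kg k \<in> SO_star"
    using assms by (rule_tac A=g in bm_exists) (auto simp: K_bm)
  have "transpose k ** k = mat 1" using SO_inv(2)[OF k(2)] unfolding bm_1[symmetric] by simp
  moreover have "k *v sg x = sg (k *v x)" for x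
  proof -
    have "adj (kg k) ** J ** kg k = J" using k(2) unfolding SO_star_def by simp
    then have "adj k ** J ** k = mat 1 ** J" by (simp add: J_bm)
    then have "dt (sg (k *v u)) (k *v v) = dt (sg u) v" for u v by (simp add: adj_J_iff del: matrix_mul_lid)
    moreover have "dt (k *v sg u) (k *v v) = dt (sg u) v" for u v
      using \<open>transpose k ** k = mat 1\<close> orth_iff by blast
    ultimately have "dt (k *v sg x) (k *v (transpose k *v v)) = dt (sg (k *v x)) (k *v (transpose k *v v))" for v by metis
    then have "dt (k *v sg x) v = dt (sg (k *v x)) v" for v
      using \<open>transpose k ** k = mat 1\<close> by (metis matrix_left_right_inverse matrix_vector_mul_assoc matrix_vector_mul_lid)
    then show ?thesis by (rule dt_eqI)
  qed
  ultimately show ?thesis using that k unfolding SO_star_def by auto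
qed

lemma K_SO: "g \<in> K_grp \<Longrightarrow> g \<in> SO_star" by (simp add: K_grp_def)

lemma K_transpose: "g \<in> K_grp \<Longrightarrow> transpose g \<in> K_grp"
  using SO_transpose K_SO by (elim K_cases) (force simp: K_bm)

section \<open>Curves through the identity\<close>

lemma bounded_bilinear_mm: "bounded_bilinear ((**) :: complex^'m^'m \<Rightarrow> complex^'m^'m \<Rightarrow> complex^'m^'m)"
  unfolding bilinear_conv_bounded_bilinear[symmetric] bilinear_def
  by (auto intro!: linearI simp: matrix_add_ldistrib mm_add_rdistrib)

lemma continuous_det: "continuous_on S f \<Longrightarrow> continuous_on S (\<lambda>x. det (f x :: complex^'m^'m))"
  unfolding det_def by (intro continuous_intros)

lemma mat_nth: "mat c $ i $ j = (if i = j then c else 0)" by (simp add: mat_def)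

lemma DERIV_det_1:
  fixes A :: "complex^'m^'m"
  shows "((\<lambda>z. det (mat 1 + mat z ** A)) has_field_derivative trace A) (at 0)"
proof -
  let ?F = "\<lambda>p i z. (if i = p i then 1 else 0) + z * A $ i $ p i"
  have 1: "((\<lambda>z. \<Prod>i\<in>UNIV. ?F p i z) has_field_derivative (\<Sum>i\<in>UNIV. A $ i $ p i * (\<Prod>j\<in>UNIV - {i}. ?F p j 0))) (at 0)" for p
    by (rule has_field_derivative_prod) (auto intro!: derivative_eq_intros)
  have 2: "(\<Sum>i\<in>UNIV. A $ i $ p i * (\<Prod>j\<in>UNIV - {i}. ?F p j 0)) = (if p = id then trace A else 0)" if "p permutes UNIV" for p
  proof (cases "p = id")
    case False
    have "(\<Prod>j\<in>UNIV - {i}. ?F p j 0) = 0" for i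
    proof -
      have "\<exists>j. j \<noteq> i \<and> p j \<noteq> j"
      proof (rule ccontr)
        assume "\<not> ?thesis"
        then have *: "p j = j" if "j \<noteq> i" for j using that by auto
        have "p i = i" using permutes_inj[OF \<open>p permutes UNIV\<close>] * by (metis injD)
        then have "p = id" using * by (metis eq_id_iff)
        with False show False by simp
      qed
      then show ?thesis by (force intro!: prod_zero)
    qed
    then have "(\<Sum>i\<in>UNIV. A $ i $ p i * (\<Prod>j\<in>UNIV - {i}. ?F p j 0)) = 0"
      by (simp only: mult_zero_right sum.neutral_const)
    then show ?thesis using False by (simp only: if_False)
  qed (simp add: trace_def)
  have 3: "((\<lambda>z. of_int (sign p) * (\<Prod>i\<in>UNIV. ?F p i z)) has_field_derivative
     of_int (sign p) * (if p = id then trace A else 0)) (at 0)" if "p permutes UNIV" for p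
    unfolding 2[OF that, symmetric] by (rule DERIV_cmult[OF 1])
  have "((\<lambda>z. \<Sum>p\<in>{p. p permutes (UNIV :: 'm set)}. of_int (sign p) * (\<Prod>i\<in>UNIV. ?F p i z)) has_field_derivative
     (\<Sum>p\<in>{p. p permutes (UNIV :: 'm set)}. of_int (sign p) * (if p = id then trace A else 0))) (at 0)"
    by (rule DERIV_sum) (use 3 in blast)
  moreover have "(\<Sum>p\<in>{p. p permutes (UNIV :: 'm set)}. of_int (sign p) * (if p = id then trace A else 0)) = trace A"
    by (subst sum.mono_neutral_right[of _ "{id}"]) (auto simp: permutes_id finite_permutations)
  ultimately show ?thesis by (simp add: det_def mat_nth)
qed

lemma mat_of_real: "mat (of_real s) ** A = s *\<^sub>R (A :: complex^'m^'m)"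
  by (simp add: vec_eq_iff) (simp add: scaleR_conv_of_real)

text \<open>
  The Cayley transform.  It stays inside any group given by a bilinear or sesquilinear form, and so replaces the exponential map
  without requiring power series.  The value \<open>mat 1\<close> at singular parameters keeps the curve in the group for all \<open>s\<close>.
\<close>

definition cay :: "complex^'m^'m \<Rightarrow> real \<Rightarrow> complex^'m^'m" where
  "cay X s = (if det (mat 1 - (s/2) *\<^sub>R X) = 0 then mat 1
              else matrix_inv (mat 1 - (s/2) *\<^sub>R X) ** (mat 1 + (s/2) *\<^sub>R X))"

lemma cay_0 [simp]: "cay X 0 = mat 1"
  by (simp add: cay_def) (metis matrix_inv_unique matrix_mul_lid)

lemma cay_cases [case_names trivial cayley]:
  fixes X :: "complex^'a^'a"
  assumes "det (mat 1 - (s/2) *\<^sub>R X) = 0 \<Longrightarrow> cay X s = mat 1 \<Longrightarrow> thesis"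
    "det (mat 1 - (s/2) *\<^sub>R X) \<noteq> 0 \<Longrightarrow> cay X s ** (mat 1 - (s/2) *\<^sub>R X) = mat 1 + (s/2) *\<^sub>R X \<Longrightarrow>
       (mat 1 - (s/2) *\<^sub>R X) ** cay X s = mat 1 + (s/2) *\<^sub>R X \<Longrightarrow> thesis"
  shows thesis
proof (cases "det (mat 1 - (s/2) *\<^sub>R X) = 0")
  case True with assms(1) show ?thesis by (simp add: cay_def)
next
  case False
  let ?B = "mat 1 - (s/2) *\<^sub>R X" and ?A = "mat 1 + (s/2) *\<^sub>R X"
  have c: "cay X s = matrix_inv ?B ** ?A" using False by (simp add: cay_def)
  have "(mat 1 + Y) ** (mat 1 - Y) = (mat 1 - Y) ** (mat 1 + Y)" for Y :: "complex^'a^'a"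
    by (simp add: mm_diff mm_add_rdistrib matrix_add_ldistrib)
  then have "?A ** ?B = ?B ** ?A" .
  then have "cay X s ** ?B = ?A" unfolding c
    by (metis False inv_mult(1) matrix_mul_assoc matrix_mul_lid)
  moreover have "?B ** cay X s = ?A" unfolding c
    by (metis False inv_mult(2) matrix_mul_assoc matrix_mul_lid)
  ultimately show ?thesis using assms(2) False by blast
qed

lemma cay_eventually: "\<forall>\<^sub>F s in at 0. det (mat 1 - (s/2) *\<^sub>R X) \<noteq> 0" for X :: "complex^'m^'m"
proof -
  have "continuous_on UNIV (\<lambda>s. det (mat 1 - (s/2) *\<^sub>R X))"
    by (intro continuous_det continuous_intros) auto
  then have "isCont (\<lambda>s. det (mat 1 - (s/2) *\<^sub>R X)) 0" by (simp add: continuous_on_eq_continuous_at)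
  then have "((\<lambda>s. det (mat 1 - (s/2) *\<^sub>R X)) \<longlongrightarrow> 1) (at 0)" by (simp add: isCont_def)
  then show ?thesis by (rule tendsto_imp_eventually_ne) simp
qed

lemma cay_deriv: "(cay X has_vector_derivative X) (at 0)" for X :: "complex^'a^'a"
proof -
  interpret mm: bounded_bilinear "(**) :: complex^'a^'a \<Rightarrow> complex^'a^'a \<Rightarrow> complex^'a^'a" by (rule bounded_bilinear_mm)
  obtain K where K: "K > 0" "\<And>(A :: complex^'a^'a) (B :: complex^'a^'a). norm (A ** B) \<le> norm A * norm B * K"
    using bounded_bilinear.pos_bounded[OF bounded_bilinear_mm[where 'm='a]] by metis
  let ?B = "\<lambda>s. matrix_inv (mat 1 - (s/2) *\<^sub>R X)"
  let ?n1 = "norm (mat 1 :: complex^'a^'a)"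
  have dev: "?B s - mat 1 = (s/2) *\<^sub>R (?B s ** X)" if "det (mat 1 - (s/2) *\<^sub>R X) \<noteq> 0" for s
  proof -
    have "?B s - (s/2) *\<^sub>R (?B s ** X) = mat 1" using inv_mult(1)[OF that] by (simp add: mm_diff)
    then show ?thesis by (metis add_diff_cancel_left' diff_add_cancel)
  qed
  have bd: "norm (?B s) \<le> 2 * ?n1" if "det (mat 1 - (s/2) *\<^sub>R X) \<noteq> 0" "\<bar>s\<bar> * (norm X * K) \<le> 1" for s
  proof -
    have "norm (?B s) \<le> ?n1 + norm (?B s - mat 1)" by (metis add.commute diff_add_cancel norm_triangle_ineq)
    also have "norm (?B s - mat 1) \<le> \<bar>s\<bar>/2 * (norm (?B s) * norm X * K)"
      unfolding dev[OF that(1)] using K(2)[of "?B s" X] by (simp add: mult_left_mono)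
    also have "\<dots> = (\<bar>s\<bar> * (norm X * K)) * (norm (?B s) / 2)" by simp
    also have "\<dots> \<le> 1 * (norm (?B s) / 2)" by (intro mult_right_mono that) simp
    finally show ?thesis by simp
  qed
  have small: "\<forall>\<^sub>F s in at 0. \<bar>s\<bar> * (norm X * K) \<le> 1"
  proof -
    have "((\<lambda>s::real. \<bar>s\<bar> * (norm X * K)) \<longlongrightarrow> \<bar>0\<bar> * (norm X * K)) (at 0)" by (intro tendsto_intros)
    then have "\<forall>\<^sub>F s in at 0. \<bar>s\<bar> * (norm X * K) < 1" by (rule order_tendstoD) simp
    then show ?thesis by eventually_elim simp
  qed
  have lim: "((\<lambda>s. ?B s - mat 1) \<longlongrightarrow> 0) (at 0)"
  proof (rule Lim_null_comparison)
    show "\<forall>\<^sub>F s in at 0. norm (?B s - mat 1) \<le> \<bar>s\<bar> * (?n1 * norm X * K)"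
      using cay_eventually[of X] small
    proof eventually_elim
      case (elim s)
      have "norm (?B s - mat 1) \<le> \<bar>s\<bar>/2 * (norm (?B s) * norm X * K)"
        unfolding dev[OF elim(1)] using K(2)[of "?B s" X] by (simp add: mult_left_mono)
      also have "\<dots> \<le> \<bar>s\<bar>/2 * ((2 * ?n1) * norm X * K)"
        using bd[OF elim] K(1) by (intro mult_left_mono mult_right_mono) auto
      finally show ?case by simp
    qed
    have "((\<lambda>s::real. \<bar>s\<bar> * (?n1 * norm X * K)) \<longlongrightarrow> \<bar>0\<bar> * (?n1 * norm X * K)) (at 0)" by (intro tendsto_intros)
    then show "((\<lambda>s::real. \<bar>s\<bar> * (?n1 * norm X * K)) \<longlongrightarrow> 0) (at 0)" by simp
  qed
  have "((\<lambda>s. (?B s - mat 1) ** X + X) \<longlongrightarrow> 0 ** X + X) (at 0)"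
    by (intro tendsto_add mm.tendsto lim tendsto_const)
  then have "((\<lambda>s. (?B s - mat 1) ** X + X) \<longlongrightarrow> X) (at 0)" by simp
  moreover have "\<forall>\<^sub>F s in at 0. (cay X s - cay X 0) /\<^sub>R (s - 0) = (?B s - mat 1) ** X + X"
    using cay_eventually[of X] eventually_neq_at_within[of 0]
  proof eventually_elim
    case (elim s)
    have "s *\<^sub>R X = (s/2) *\<^sub>R X + (s/2) *\<^sub>R X" by (simp flip: scaleR_left_distrib)
    then have "mat 1 + (s/2) *\<^sub>R X = (mat 1 - (s/2) *\<^sub>R X) + s *\<^sub>R X" by simp
    then have "cay X s - mat 1 = ?B s ** ((mat 1 - (s/2) *\<^sub>R X) + s *\<^sub>R X) - mat 1"
      using elim(1) by (simp only: cay_def if_False)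
    also have "\<dots> = s *\<^sub>R (?B s ** X)" using inv_mult(1)[OF elim(1)] by (simp only: matrix_add_ldistrib) simp
    finally show ?case using elim by (simp add: mm_diff)
  qed
  then have "\<forall>\<^sub>F s in at 0. (?B s - mat 1) ** X + X = (cay X s - cay X 0) /\<^sub>R (s - 0)"
    by eventually_elim (rule sym)
  ultimately have lim2: "((\<lambda>s. (cay X s - cay X 0) /\<^sub>R (s - 0)) \<longlongrightarrow> X) (at 0)"
    by (rule Lim_transform_eventually)
  show ?thesis
    unfolding has_vector_derivative_def has_derivative_within
  proof
    show "bounded_linear (\<lambda>x. x *\<^sub>R X)" by (rule bounded_linear_scaleR_left)
    have "((\<lambda>s. (cay X s - cay X 0) /\<^sub>R (s - 0) - X) \<longlongrightarrow> 0) (at 0)" using lim2 by (simp add: LIM_zero)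
    then have "((\<lambda>s. norm ((cay X s - cay X 0) /\<^sub>R (s - 0) - X)) \<longlongrightarrow> 0) (at 0)" by (rule tendsto_norm_zero)
    moreover have "\<forall>\<^sub>F s in at 0. norm ((cay X s - cay X 0) /\<^sub>R (s - 0) - X) =
        norm ((1 / norm (s - 0)) *\<^sub>R (cay X s - (cay X 0 + (s - 0) *\<^sub>R X)))"
      using eventually_neq_at_within[of 0]
    proof eventually_elim
      case (elim s)
      have "(cay X s - cay X 0) /\<^sub>R s - X = (1/s) *\<^sub>R (cay X s - (cay X 0 + s *\<^sub>R X))"
        using elim by (simp add: scaleR_diff_right scaleR_add_right inverse_eq_divide)
      then show ?case by simp
    qed
    ultimately have "((\<lambda>s. norm ((1 / norm (s - 0)) *\<^sub>R (cay X s - (cay X 0 + (s - 0) *\<^sub>R X)))) \<longlongrightarrow> 0) (at 0)"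
      by (rule Lim_transform_eventually)
    then show "((\<lambda>s. (1 / norm (s - 0)) *\<^sub>R (cay X s - (cay X 0 + (s - 0) *\<^sub>R X))) \<longlongrightarrow> 0) (at 0)"
      by (rule tendsto_norm_zero_cancel)
  qed
qed

text \<open>
  A skew matrix and its negative are transposes of each other; hence the Cayley transform has determinant \<open>1\<close>.
\<close>

lemma det_1_pm: "X \<in> so_star \<Longrightarrow> det (mat 1 + s *\<^sub>R X) = det (mat 1 - s *\<^sub>R X)"
proof -
  assume "X \<in> so_star"
  then have "transpose X $ i $ j = (- X) $ i $ j" for i j by (simp only: so_iff)
  then have x: "X $ j $ i = - X $ i $ j" for i j
    unfolding transpose_def vec_lambda_beta vector_uminus_component .
  have "transpose (mat 1 - s *\<^sub>R X) $ i $ j = (mat 1 + s *\<^sub>R X) $ i $ j" for i j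
    by (simp add: transpose_def mat_nth x[of i j])
  then have "transpose (mat 1 - s *\<^sub>R X) = mat 1 + s *\<^sub>R X" unfolding vec_eq_iff by blast
  then show ?thesis by (metis det_transpose)
qed

lemma cay_vec:
  assumes "det (mat 1 - (s/2) *\<^sub>R X) \<noteq> 0" "cay X s ** (mat 1 - (s/2) *\<^sub>R X) = mat 1 + (s/2) *\<^sub>R X"
  obtains v where "x = v - (s/2) *\<^sub>R (X *v v)" "cay X s *v x = v + (s/2) *\<^sub>R (X *v v)"
proof
  let ?B = "mat 1 - (s/2) *\<^sub>R X"
  let ?v = "matrix_inv ?B *v x"
  have x: "?B *v ?v = x" by (simp only: matrix_vector_mul_assoc inv_mult[OF assms(1)] matrix_vector_mul_lid)
  then show "x = ?v - (s/2) *\<^sub>R (X *v ?v)" by (simp add: matrix_vector_mult_diff_rdistrib)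
  have "cay X s *v x = cay X s *v (?B *v ?v)" by (simp only: x)
  also have "\<dots> = (mat 1 + (s/2) *\<^sub>R X) *v ?v" by (metis matrix_vector_mul_assoc assms(2))
  finally show "cay X s *v x = ?v + (s/2) *\<^sub>R (X *v ?v)" by (simp add: matrix_vector_mult_add_rdistrib)
qed

lemma cay_SO:
  assumes "X \<in> so_star" shows "cay X s \<in> SO_star"
proof (cases X s rule: cay_cases)
  case cayley
  have X: "\<And>x y. dt (X *v x) y = - dt x (X *v y)" "\<And>x. X *v sg x = sg (X *v x)" using assms by (auto simp: so_h)
  show ?thesis unfolding SO_iff orth_iff
  proof safe
    fix x y
    obtain v where v: "x = v - (s/2) *\<^sub>R (X *v v)" "cay X s *v x = v + (s/2) *\<^sub>R (X *v v)" by (rule cay_vec[OF cayley(1,2)])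
    obtain w where w: "y = w - (s/2) *\<^sub>R (X *v w)" "cay X s *v y = w + (s/2) *\<^sub>R (X *v w)" by (rule cay_vec[OF cayley(1,2)])
    show "dt (cay X s *v x) (cay X s *v y) = dt x y"
      unfolding v(2) w(2) unfolding v(1) w(1) by (simp add: X(1)) (simp add: scaleR_conv_of_real algebra_simps)
  next
    have "det (cay X s) * det (mat 1 - (s/2) *\<^sub>R X) = det (mat 1 + (s/2) *\<^sub>R X)" by (metis cayley(2) det_mul)
    then show "det (cay X s) = 1" using cayley(1) by (simp add: det_1_pm[OF assms])
  next
    fix x
    obtain v where v: "x = v - (s/2) *\<^sub>R (X *v v)" "cay X s *v x = v + (s/2) *\<^sub>R (X *v v)" by (rule cay_vec[OF cayley(1,2)])
    have "sg x = sg v - (s/2) *\<^sub>R (X *v sg v)" by (simp add: v(1) X(2))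
    then have "sg x = (mat 1 - (s/2) *\<^sub>R X) *v sg v" by (simp add: matrix_vector_mult_diff_rdistrib)
    then have "cay X s *v sg x = (mat 1 + (s/2) *\<^sub>R X) *v sg v" by (simp only: matrix_vector_mul_assoc cayley(2))
    then show "cay X s *v sg x = sg (cay X s *v x)" by (simp add: v(2) X(2) matrix_vector_mult_add_rdistrib)
  qed
qed (simp add: SO_1)

lemma cay_J:
  assumes "uu X" shows "adj (cay X s) ** J ** cay X s = J"
proof (cases X s rule: cay_cases)
  case cayley
  have X: "\<And>x y. dt (sg (X *v x)) y = - dt (sg x) (X *v y)" using assms by (auto simp: uu_h)
  have "adj (cay X s) ** J ** cay X s = mat 1 ** J" unfolding adj_J_iff
  proof safe
    fix x y
    obtain v where v: "x = v - (s/2) *\<^sub>R (X *v v)" "cay X s *v x = v + (s/2) *\<^sub>R (X *v v)" by (rule cay_vec[OF cayley(1,2)])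
    obtain w where w: "y = w - (s/2) *\<^sub>R (X *v w)" "cay X s *v y = w + (s/2) *\<^sub>R (X *v w)" by (rule cay_vec[OF cayley(1,2)])
    show "dt (sg (cay X s *v x)) (cay X s *v y) = 1 * dt (sg x) y"
      unfolding v(2) w(2) unfolding v(1) w(1) by (simp add: X(1)) (simp add: scaleR_conv_of_real algebra_simps)
  qed
  then show ?thesis by simp
next
  case trivial
  have "adj (mat 1) = (mat 1 :: 'a sqmat)" by (simp add: adj_def mat_def vec_eq_iff)
  with trivial show ?thesis by simp
qed

lemma cay_K:
  assumes "X \<in> k_alg" shows "cay X s \<in> K_grp"
proof (cases X s rule: cay_cases)
  case cayley
  have g: "X \<in> so_star" using assms by (simp add: k_alg_def)
  obtain M where X: "X = kb M" using assms by (rule_tac A=X in bm_exists) (auto simp: k_bm)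
  obtain a y c x N z d w f where C: "cay X s = bm a y c x N z d w f" by (rule bm_exists)
  have Y: "mat 1 - (s/2) *\<^sub>R X = kg (mat 1 - (s/2) *\<^sub>R M)" "mat 1 + (s/2) *\<^sub>R X = kg (mat 1 + (s/2) *\<^sub>R M)"
    unfolding X bm_1[symmetric] by simp_all
  have "bm 0 y 0 0 0 0 0 w 0 ** (mat 1 - (s/2) *\<^sub>R X) = 0"
    using cayley(2) unfolding C Y by simp
  moreover have "bm 0 y 0 0 0 0 0 w 0 = (bm 0 y 0 0 0 0 0 w 0 ** (mat 1 - (s/2) *\<^sub>R X)) ** matrix_inv (mat 1 - (s/2) *\<^sub>R X)"
    by (simp only: matrix_mul_assoc[symmetric] inv_mult(2)[OF cayley(1)] matrix_mul_rid)
  ultimately have "y = 0" "w = 0" by (simp_all only: times0_left bm_eq_0)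
  with cayley(2) have "cay X s = kg N" unfolding C Y bm_mult bm_eq_iff by (simp only: dt_simps) simp
  then show ?thesis using cay_SO[OF g, of s] by (simp add: K_bm)
next
  case trivial then show ?thesis using SO_1 by (simp add: K_grp_def)
qed

lemma det_cnj: "det (\<chi> i j. cnj (A $ i $ j)) = cnj (det A)"
  by (simp add: det_def)

lemma det_adj: "det (adj A) = cnj (det A)"
proof -
  have "adj A = transpose (\<chi> i j. cnj (A $ i $ j))" by (simp add: adj_def transpose_def)
  then show ?thesis by (simp add: det_cnj)
qed

lemma det_J: "det (J :: 'm::finite sqmat) \<noteq> 0"
proof -
  have "(J ** J) ** (J ** J) = (mat 1 :: 'm sqmat)" by (simp add: J_J)
  then have "det (J :: 'm sqmat) * det (J :: 'm sqmat) * (det (J :: 'm sqmat) * det (J :: 'm sqmat)) = 1"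
    by (metis det_I det_mul)
  then show ?thesis by auto
qed

lemma norm_det: fixes A :: "'m::finite sqmat" assumes "adj A ** J ** A = J" shows "cmod (det A) = 1"
proof -
  have "det (adj A ** J ** A) = det (J :: 'm sqmat)" by (simp only: assms)
  then have "cnj (det A) * det (J :: 'm sqmat) * det A = det (J :: 'm sqmat)" by (simp only: det_mul det_adj)
  then have "det (J :: 'm sqmat) * (det A * cnj (det A) - 1) = 0" by (simp add: algebra_simps)
  then have "det A * cnj (det A) = 1" using det_J[where 'm='m] by (simp only: mult_eq_0_iff) simp
  then have "complex_of_real ((cmod (det A))\<^sup>2) = 1" by (simp only: complex_norm_square)
  then have "(cmod (det A))\<^sup>2 = 1\<^sup>2" by (simp only: of_real_eq_1_iff power_one)
  then show ?thesis by (rule power2_eq_imp_eq) simp_all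
qed

lemma mat_mat: "mat a ** mat b = (mat (a * b) :: complex^'m^'m)"
  by (simp add: vec_eq_iff mat_nth)

lemma mat_sandwich: "(mat a ** A) ** B ** (mat b ** C) = mat (a * b) ** (A ** B ** (C :: complex^'m^'m))"
  by (rule matrix_eq_mv) (simp add: matrix_vector_mul_assoc[symmetric] vector_smult_assoc)

lemma det_mat: "det (mat c :: complex^'m^'m) = c ^ CARD('m)"
  by (subst det_diagonal) (auto simp: mat_def)

text \<open>
  The scalar matrices in \<open>L\<close> form a finite group.  This makes the scalar factor in the fibres of the bundle locally constant.
\<close>

lemma mat_L: "mat z \<in> (L_grp :: 'm::finite sqmat set) \<Longrightarrow> z ^ CARD('m + 'm) = 1"
  by (simp add: L_grp_def det_mat del: card_UNIV_sum)

text \<open>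
  The Cayley curve preserves the hermitian form, but its determinant is only of absolute value one.  It is corrected by a scalar
  factor, which does not change the derivative at \<open>0\<close> because \<open>A\<close> has trace \<open>0\<close>.
\<close>

lemma cay_P:
  assumes "A \<in> p_alg"
  shows "\<exists>q. q 0 = mat 1 \<and> (\<forall>s. q s \<in> (P_grp :: 'n::finite mat2 set)) \<and> (q has_vector_derivative A) (at 0)"
proof -
  define N where "N = CARD('n option + 'n option)"
  have N: "N > 0" by (simp add: N_def del: card_UNIV_sum)
  have A: "trace A = 0" "uu A" using assms unfolding p_alg_def su_filt_def su_iff by auto
  let ?r = "\<lambda>s. exp (- Ln (det (cay A s)) / of_nat N)"
  let ?q = "\<lambda>s. mat (?r s) ** cay A s"
  have J: "adj (cay A s) ** J ** cay A s = J" for s by (rule cay_J[OF A(2)])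
  have nd: "cmod (det (cay A s)) = 1" for s by (rule norm_det[OF J])
  have L: "?q s \<in> L_grp" for s
  proof -
    have "det (cay A s) \<noteq> 0" using nd[of s] by auto
    then have "cmod (?r s) = 1" using nd[of s] N by (simp add: Re_Ln)
    then have "?r s * cnj (?r s) = 1" by (simp only: complex_norm_square[symmetric] power_one of_real_1)
    then have rr: "cnj (?r s) * ?r s = 1" by (simp only: mult.commute)
    have "adj (?q s) = mat (cnj (?r s)) ** adj (cay A s)" by (simp add: vec_eq_iff adj_def)
    have "adj (?q s) ** J ** ?q s = mat (cnj (?r s) * ?r s) ** (adj (cay A s) ** J ** cay A s)"
      unfolding \<open>adj (?q s) = _\<close> by (rule mat_sandwich)
    also have "\<dots> = mat 1 ** J" unfolding J rr ..
    finally have "adj (?q s) ** J ** ?q s = J" by simp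
    moreover have "det (?q s) = 1"
    proof -
      have "det (?q s) = ?r s ^ N * det (cay A s)" by (simp add: det_mul det_mat N_def del: card_UNIV_sum)
      also have "?r s ^ N = exp (- Ln (det (cay A s)))" using N by (simp flip: exp_of_nat_mult)
      also have "\<dots> * det (cay A s) = 1"
      proof -
        have "det (cay A s) \<noteq> 0" using nd[of s] by auto
        then show ?thesis by (simp add: exp_minus exp_Ln)
      qed
      finally show ?thesis .
    qed
    ultimately show ?thesis by (simp add: L_grp_iff)
  qed
  have P: "?q s \<in> P_grp" for s
  proof -
    obtain a y c x M z d w f where C: "cay A s = bm a y c x M z d w f" by (rule bm_exists)
    have "x = 0 \<and> d = 0"
    proof (cases A s rule: cay_cases)
      case trivial then show ?thesis using C unfolding bm_1[symmetric] by simp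
    next
      case cayley
      obtain a1 y1 c1 M1 z1 f1 where A1: "A = bm a1 y1 c1 0 M1 z1 0 0 f1"
        using assms by (rule_tac A=A in bm_exists) (auto simp: p_bm)
      have Y: "mat 1 - (s/2) *\<^sub>R A = bm (1 - (s/2) *\<^sub>R a1) (- ((s/2) *\<^sub>R y1)) (- ((s/2) *\<^sub>R c1)) 0 (mat 1 - (s/2) *\<^sub>R M1) (- ((s/2) *\<^sub>R z1)) 0 0 (1 - (s/2) *\<^sub>R f1)"
        unfolding A1 bm_1[symmetric] by simp
      have Z: "mat 1 + (s/2) *\<^sub>R A = bm (1 + (s/2) *\<^sub>R a1) ( ((s/2) *\<^sub>R y1)) ( ((s/2) *\<^sub>R c1)) 0 (mat 1 + (s/2) *\<^sub>R M1) ( ((s/2) *\<^sub>R z1)) 0 0 (1 + (s/2) *\<^sub>R f1)"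
        unfolding A1 bm_1[symmetric] by simp
      have "1 - (s/2) *\<^sub>R a1 \<noteq> 0"
      proof
        assume "1 - (s/2) *\<^sub>R a1 = 0"
        then have "column (Inl None) (mat 1 - (s/2) *\<^sub>R A) = 0"
          unfolding Y by (simp add: column_def vec_eq_iff all_idx)
        then show False using cayley(1) det_zero_column(1) by blast
      qed
      moreover have x: "x = ((s/2) *\<^sub>R a1) *s x" "d * (1 - (s/2) *\<^sub>R a1) = 0"
        using cayley(2) unfolding C Y Z by auto
      moreover have "(1 - (s/2) *\<^sub>R a1) *s x = 0"
        using x(1) by (metis vector_sub_rdistrib vector_smult_lid right_minus_eq)
      ultimately show ?thesis by (simp only: vector_mul_eq_0 mult_eq_0_iff) blast
    qed
    moreover have "w = 0"
    proof -
      have "a \<noteq> 0"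
      proof
        assume "a = 0"
        with calculation have "column (Inl None) (cay A s) = 0" unfolding C by (simp add: column_def vec_eq_iff all_idx)
        then have "det (cay A s) = 0" by (rule det_zero_column(1))
        then show False using nd[of s] by simp
      qed
      moreover have "cnj a *s w = 0" using J[of s] \<open>x = 0 \<and> d = 0\<close> unfolding C J_bm by simp
      ultimately show ?thesis by simp
    qed
    ultimately have "?q s = bm (?r s * a) (?r s *s y) (?r s * c) 0 (mat (?r s) ** M) (?r s *s z) 0 0 (?r s * f)"
      unfolding C bm_mat by simp
    with L[of s] show ?thesis by (simp add: P_bm)
  qed
  have "(?q has_vector_derivative A) (at 0)"
  proof -
    let ?A = "(1/2) *\<^sub>R A"
    let ?D = "\<lambda>z. exp (- Ln (det (mat 1 + mat z ** ?A) / det (mat 1 + mat z ** (- ?A))) / of_nat N)"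
    have tr: "trace ?A = 0" "trace (- ?A) = 0" using A(1) by (simp_all add: trace_def sum_negf flip: scaleR_sum_right)
    have "(?D has_field_derivative 0) (at (of_real 0))"
      using DERIV_det_1[of ?A] DERIV_det_1[of "- ?A"] unfolding tr
      using N by (auto intro!: derivative_eq_intros)
    then have "((\<lambda>s. ?D (of_real s)) has_vector_derivative 0) (at 0)"
      by (rule has_vector_derivative_real_field)
    moreover have "bounded_linear (mat :: complex \<Rightarrow> 'n mat2)"
      unfolding linear_conv_bounded_linear[symmetric] by (auto intro!: linearI simp: vec_eq_iff mat_nth)
    ultimately have "((\<lambda>s. mat (?D (of_real s)) :: 'n mat2) has_vector_derivative mat 0) (at 0)"
      by (rule bounded_linear.has_vector_derivative[rotated])
    then have "((\<lambda>s. mat (?D (of_real s)) ** cay A s) has_vector_derivative mat (?D (of_real 0)) ** A + mat 0 ** cay A 0) (at 0)"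
      by (rule bounded_bilinear.has_vector_derivative[OF bounded_bilinear_mm _ cay_deriv])
    then have D: "((\<lambda>s. mat (?D (of_real s)) ** cay A s) has_vector_derivative A) (at 0)"
      by simp
    have ev: "\<forall>\<^sub>F s in at 0. mat (?D (of_real s)) ** cay A s = ?q s"
      using cay_eventually[of A]
    proof eventually_elim
      case (elim s)
      have e: "mat 1 + mat (of_real s) ** ?A = mat 1 + (s/2) *\<^sub>R A" "mat 1 + mat (of_real s) ** (- ?A) = mat 1 - (s/2) *\<^sub>R A"
        by (simp_all add: mat_of_real)
      have "det (cay A s) = det (mat 1 + (s/2) *\<^sub>R A) / det (mat 1 - (s/2) *\<^sub>R A)"
      proof (cases A s rule: cay_cases)
        case trivial with elim show ?thesis by simp
      next
        case cayley then show ?thesis by (metis det_mul nonzero_mult_div_cancel_right)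
      qed
      then show ?case unfolding e by simp
    qed
    show ?thesis
      using D ev unfolding has_vector_derivative_def
      by (rule has_derivative_transform_eventually) (use N in simp_all)
  qed
  moreover have "?q 0 = mat 1" by simp
  ultimately show ?thesis using P by (intro exI[of _ ?q]) blast
qed

section \<open>Maps commuting with the infinitesimal rotations\<close>

lemma numeral_scaleR [simp]: "numeral k *\<^sub>R (z :: complex) = numeral k * z" "(- numeral k) *\<^sub>R (z :: complex) = - (numeral k * z)"
  by (simp_all add: scaleR_conv_of_real)

lemma scaleR_complex: "r *\<^sub>R (z :: complex) = complex_of_real r * z"
  by (rule scaleR_conv_of_real)

text \<open>
  Right multiplication by a quaternion, \<open>sg\<close> being right multiplication by \<open>j\<close>.
\<close>

definition qop :: "complex \<Rightarrow> complex \<Rightarrow> 'n::finite cv \<Rightarrow> 'n cv" where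
  "qop \<beta> \<gamma> x = \<beta> *s x + \<gamma> *s sg x"

lemma qop_simps [simp]:
  "qop \<beta> \<gamma> (x + y) = qop \<beta> \<gamma> x + qop \<beta> \<gamma> y" "qop \<beta> \<gamma> (x - y) = qop \<beta> \<gamma> x - qop \<beta> \<gamma> y"
  "qop \<beta> \<gamma> (- x) = - qop \<beta> \<gamma> x" "qop \<beta> \<gamma> 0 = 0" "qop \<beta> \<gamma> (r *\<^sub>R x) = r *\<^sub>R qop \<beta> \<gamma> x"
  by (simp_all add: qop_def vec_eq_iff algebra_simps)

lemma qop_qop: "qop \<beta> \<gamma> (qop p q x) = qop (\<beta> * p - \<gamma> * cnj q) (\<beta> * q + \<gamma> * cnj p) x"
  by (simp add: qop_def vec_eq_iff algebra_simps)

lemma qop_sg: "qop \<beta> \<gamma> (sg x) = qop (- \<gamma>) \<beta> x"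
  by (simp add: qop_def vec_eq_iff algebra_simps)

lemma sg_axis: "sg (axis (Inl a) c) = axis (Inr a) (cnj c)" "sg (axis (Inr a) c) = axis (Inl a) (- cnj c)"
  by (simp_all add: cv_eq_iff axis_def)

lemma qop_inj: "(\<forall>x :: 'n::finite cv. qop \<beta> \<gamma> x = qop p q x) \<longleftrightarrow> \<beta> = p \<and> \<gamma> = q"
proof
  assume *: "\<forall>x :: 'n cv. qop \<beta> \<gamma> x = qop p q x"
  fix a :: 'n
  obtain a :: 'n where True by auto
  have "qop \<beta> \<gamma> (axis (Inl a) 1) $ i = qop p q (axis (Inl a) 1) $ i" for i using * by simp
  from this[of "Inl a"] this[of "Inr a"] show "\<beta> = p \<and> \<gamma> = q"
    by (simp add: qop_def sg_axis) (simp add: axis_def)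
qed simp

lemma qop_eq_0: "qop \<beta> \<gamma> x = 0 \<longleftrightarrow> \<beta> = 0 \<and> \<gamma> = 0 \<or> x = 0"
proof -
  have e: "qop (cnj \<beta>) (- \<gamma>) (qop \<beta> \<gamma> x) = (\<beta> * cnj \<beta> + \<gamma> * cnj \<gamma>) *s x"
    unfolding qop_qop by (simp add: qop_def mult.commute)
  have n: "\<beta> * cnj \<beta> + \<gamma> * cnj \<gamma> = of_real ((cmod \<beta>)\<^sup>2 + (cmod \<gamma>)\<^sup>2)"
    by (simp only: complex_norm_square of_real_add)
  show ?thesis
  proof
    assume "qop \<beta> \<gamma> x = 0"
    then have "of_real ((cmod \<beta>)\<^sup>2 + (cmod \<gamma>)\<^sup>2) *s x = 0" using e unfolding n[symmetric] by simp
    then have "(cmod \<beta>)\<^sup>2 + (cmod \<gamma>)\<^sup>2 = 0 \<or> x = 0" by (simp only: vector_mul_eq_0 of_real_eq_0_iff)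
    then show "\<beta> = 0 \<and> \<gamma> = 0 \<or> x = 0" by (simp add: sum_power2_eq_zero_iff)
  qed (auto simp: qop_def)
qed

text \<open>
  Rank-two elements of \<open>\<ss>\<oo>\<^sup>*(2n)\<close>: the middle block of the bracket of two elements of \<open>\<mm>\<close>.
\<close>

definition kk :: "'n::finite cv \<Rightarrow> 'n cv \<Rightarrow> complex ^ ('n + 'n) ^ ('n + 'n)" where
  "kk x y = outer y x + outer (sg y) (sg x) - outer x y - outer (sg x) (sg y)"

lemma kk_mv: "kk x y *v w = dt x w *s y + dt (sg x) w *s sg y - dt y w *s x - dt (sg y) w *s sg x"
  by (simp add: kk_def matrix_vector_mult_add_rdistrib matrix_vector_mult_diff_rdistrib)

lemma kk_so: "kk x y \<in> so_star"
proof -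
  have "dt (sg x) (sg w) = cnj (dt x w)" "dt x (sg w) = - cnj (dt (sg x) w)" for x w :: "'a cv"
    by (simp_all add: dt_sg_swap[of w x] dt_commute[of x "sg w"])
  then show ?thesis unfolding so_h kk_mv
    by (auto simp: dt_commute[of _ x] dt_commute[of _ y] dt_commute[of _ "sg x"] dt_commute[of _ "sg y"] algebra_simps)
qed

lemma axis_Re_Im: "axis r c = Re c *\<^sub>R axis r 1 + Im c *\<^sub>R axis r \<i>"
  by (simp add: vec_eq_iff axis_def complex_eq_iff)

text \<open>
  Schur's lemma for the standard representation of \<open>\<ss>\<oo>\<^sup>*(2n)\<close>, which is of quaternionic type.  For \<open>n = 1\<close> the Lie algebra
  is abelian and its commutant is larger.
\<close>

lemma commutant:
  fixes E :: "'n::finite cv \<Rightarrow> 'n cv"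
  assumes lin: "linear E" and comm: "\<And>X x. X \<in> so_star \<Longrightarrow> E (X *v x) = X *v E x" and n: "CARD('n) \<ge> 2"
  shows "\<exists>\<beta> \<gamma>. \<forall>x. E x = qop \<beta> \<gamma> x"
proof -
  obtain a :: 'n where True by auto
  let ?e = "\<lambda>a :: 'n. axis (Inl a) (1::complex) :: 'n cv" and ?f = "\<lambda>a :: 'n. axis (Inr a) (1::complex) :: 'n cv"
  have sgi: "sg (\<i> *s x) = - (\<i> *s sg x)" for x :: "'n cv" by simp
  have ki: "kk (?e a) (?e b) *v ?e a = ?e b" if "a \<noteq> b" for a b
    using that by (simp add: kk_mv sg_axis) (simp add: cv_eq_iff axis_def)
  have ki2: "kk (?e a) (\<i> *s ?e b) *v ?e a = \<i> *s ?e b" if "a \<noteq> b" for a b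
    using that by (simp add: kk_mv sg_axis) (simp add: cv_eq_iff axis_def)
  have ki3: "kk (?e a) (?f a) *v w = (2 * w $ Inl a) *s ?f a - (2 * w $ Inr a) *s ?e a" for a w
    by (simp add: kk_mv sg_axis vec_eq_iff) (simp add: axis_def)
  define \<beta> \<gamma> where "\<beta> = E (?e a) $ Inl a" and "\<gamma> = E (?e a) $ Inr a"
  have Ea: "E (?e a) = qop \<beta> \<gamma> (?e a)"
  proof -
    have "kk (?e a) (?f a) *v (kk (?e a) (?f a) *v ?e a) = (-4) *\<^sub>R ?e a"
      unfolding ki3 by (simp add: vec_eq_iff axis_def)
    then have "(-4) *\<^sub>R E (?e a) = E (kk (?e a) (?f a) *v (kk (?e a) (?f a) *v ?e a))"
      using linear_cmul[OF lin, of "-4" "?e a"] by simp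
    also have "\<dots> = kk (?e a) (?f a) *v (kk (?e a) (?f a) *v E (?e a))" by (simp only: comm kk_so)
    also have "\<dots> = (-4) *\<^sub>R qop \<beta> \<gamma> (?e a)"
      unfolding ki3 \<beta>_def \<gamma>_def by (simp add: qop_def sg_axis) (simp add: vec_eq_iff axis_def)
    finally show ?thesis by simp
  qed
  define D where "D x = E x - qop \<beta> \<gamma> x" for x
  have linD: "linear D" unfolding D_def by (intro linear_compose_sub lin) (simp add: linear_iff)
  have qc: "qop \<beta> \<gamma> (X *v x) = X *v qop \<beta> \<gamma> x" if "X \<in> so_star" for X x
    using that by (simp add: so_h qop_def matrix_vector_right_distrib)
  have D: "D (X *v x) = 0" if "X \<in> so_star" "D x = 0" for X x
    using that by (simp add: D_def comm qc flip: matrix_vector_mult_diff_distrib)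
  have a0: "D (?e a) = 0" by (simp add: D_def Ea)
  have b0: "D (?e b) = 0" for b using D[OF kk_so a0] ki a0 by (cases "b = a") metis+
  have b1: "D (\<i> *s ?e b) = 0" for b
  proof -
    have "\<exists>c. c \<noteq> b"
    proof (rule ccontr)
      assume "\<not> ?thesis" then have "UNIV = {b}" by auto
      then have "CARD('n) = 1" by (metis card_1_singleton_iff One_nat_def)
      with n show False by simp
    qed
    then obtain c where "c \<noteq> b" by blast
    then show ?thesis using D[OF kk_so b0] ki2 by metis
  qed
  have h0: "D w = 0" if "D (2 *\<^sub>R w) = 0" for w using that by (simp add: linear_cmul[OF linD])
  have b2: "D (?f b) = 0" for b
  proof (rule h0)
    have "2 *\<^sub>R ?f b = kk (?e b) (?f b) *v ?e b" unfolding ki3 by (simp add: vec_eq_iff axis_def)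
    then show "D (2 *\<^sub>R ?f b) = 0" using D[OF kk_so b0] by metis
  qed
  have b3: "D (\<i> *s ?f b) = 0" for b
  proof (rule h0)
    have "2 *\<^sub>R (\<i> *s ?f b) = kk (?e b) (?f b) *v (\<i> *s ?e b)" unfolding ki3 by (simp add: vec_eq_iff axis_def)
    then show "D (2 *\<^sub>R (\<i> *s ?f b)) = 0" using D[OF kk_so b1] by metis
  qed
  have ax: "\<i> *s axis r 1 = (axis r \<i> :: 'n cv)" for r by (simp add: vec_eq_iff axis_def)
  have "D (axis r c) = 0" for r c
  proof -
    have "D (axis r 1) = 0 \<and> D (axis r \<i>) = 0" using b0 b1 b2 b3 unfolding ax by (cases r) auto
    then show ?thesis by (subst axis_Re_Im) (simp add: linear_add[OF linD] linear_cmul[OF linD])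
  qed
  moreover have "x = (\<Sum>r\<in>UNIV. axis r (x $ r))" for x :: "'n cv"
    by (simp add: vec_eq_iff axis_def)
  ultimately have "D x = 0" for x by (metis (no_types, lifting) linear_sum[OF linD] sum.neutral)
  then show ?thesis unfolding D_def by (metis eq_iff_diff_eq_0)
qed

section \<open>Shape of the extensions\<close>

abbreviation mc :: "'n::finite cv \<Rightarrow> 'n mat2" where "mc x \<equiv> bm 0 (- x) 0 x 0 (sg x) 0 (- sg x) 0"
abbreviation ee :: "'n::finite mat2" where "ee \<equiv> bm 0 0 (-1) 0 0 0 1 0 0"

lemma m_of_col_bm: "m_of_col x = mc x"
  by (simp add: mat2_eq_iff m_of_col_def)

lemma so_0 [simp]: "0 \<in> so_star" by (simp add: so_iff transpose_def vec_eq_iff)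

lemma mc_g: "mc x \<in> so_star" and ee_g: "ee \<in> so_star" and kb_k: "M \<in> so_star \<Longrightarrow> kb M \<in> k_alg" and kb_g: "M \<in> so_star \<Longrightarrow> kb M \<in> so_star"
proof -
  show "mc x \<in> so_star" "ee \<in> so_star" "M \<in> so_star \<Longrightarrow> kb M \<in> k_alg" "M \<in> so_star \<Longrightarrow> kb M \<in> so_star"
    by (simp_all add: g_bm k_bm)
qed

lemma linear_transpose: "linear (transpose :: complex^'m^'m \<Rightarrow> complex^'m^'m)"
  by (auto intro!: linearI simp: transpose_def vec_eq_iff)

text \<open>
  The derivative of \<open>K\<close>-equivariance along a Cayley curve.
\<close>

lemma inf_equivariant:
  assumes "extension \<alpha>" "X \<in> k_alg" "W \<in> g_alg"
  shows "\<alpha> (br X W) = br X (\<alpha> W)"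
proof -
  have lin: "linear \<alpha>" using assms by (simp add: extension_def)
  have X: "transpose X = - X" using assms by (auto simp: k_alg_def so_iff)
  have c: "((\<lambda>s. cay X s ** W ** transpose (cay X s)) has_vector_derivative (br X W)) (at 0)" for W
  proof -
    have t: "((\<lambda>s. transpose (cay X s)) has_vector_derivative (- X)) (at 0)"
      unfolding X[symmetric] using linear_transpose cay_deriv linear_conv_bounded_linear
      by (metis bounded_linear.has_vector_derivative)
    have "((\<lambda>s. cay X s ** W) has_vector_derivative (cay X 0 ** 0 + X ** W)) (at 0)"
      by (rule bounded_bilinear.has_vector_derivative[OF bounded_bilinear_mm cay_deriv has_vector_derivative_const])
    from bounded_bilinear.has_vector_derivative[OF bounded_bilinear_mm this t]
    show ?thesis by (simp add: br_def)
  qed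
  have "\<alpha> (cay X s ** W ** transpose (cay X s)) = cay X s ** \<alpha> W ** transpose (cay X s)" for s
  proof -
    have K: "cay X s \<in> K_grp" by (rule cay_K[OF assms(2)])
    have "\<alpha> (cay X s ** W ** matrix_inv (cay X s)) = cay X s ** \<alpha> W ** matrix_inv (cay X s)"
      using assms(1,3) K unfolding extension_def by blast
    then show ?thesis unfolding SO_inv(1)[OF K_SO[OF K]] .
  qed
  then have "((\<lambda>s. \<alpha> (cay X s ** W ** transpose (cay X s))) has_vector_derivative (br X (\<alpha> W))) (at 0)"
    using c[of "\<alpha> W"] by simp
  moreover have "((\<lambda>s. \<alpha> (cay X s ** W ** transpose (cay X s))) has_vector_derivative \<alpha> (br X W)) (at 0)"
    by (rule bounded_linear.has_vector_derivative[OF lin[unfolded linear_conv_bounded_linear] c])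
  ultimately show ?thesis using vector_derivative_unique_at by blast
qed

definition col0 :: "'n::finite mat2 \<Rightarrow> 'n cv" where "col0 X = (\<chi> i. X $ mid i $ Inl None)"
definition midm :: "'n::finite mat2 \<Rightarrow> complex ^ ('n + 'n) ^ ('n + 'n)" where "midm X = (\<chi> i j. X $ mid i $ mid j)"

lemma col0_simps [simp]: "col0 (bm a y c x M z d w f) = x" "col0 (A + B) = col0 A + col0 B" "col0 (A - B) = col0 A - col0 B"
  "col0 (r *\<^sub>R A) = r *\<^sub>R col0 A" "col0 (- A) = - col0 A" "col0 0 = 0"
  by (simp_all add: col0_def vec_eq_iff)

lemma midm_simps [simp]: "midm (bm a y c x M z d w f) = M" "midm (A + B) = midm A + midm B" "midm (r *\<^sub>R A) = r *\<^sub>R midm A"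
  by (simp_all add: midm_def vec_eq_iff)

text \<open>
  The general \<open>K\<close>-equivariant linear map \<open>\<gg> \<rightarrow> \<ll>\<close> restricting to the identity on \<open>\<kk>\<close>.  On \<open>\<complex>\<^sup>2\<^sup>n\<close> its component of degree \<open>-1\<close> is given
  by \<open>(\<beta>, \<gamma>)\<close>, and \<open>(f, g)\<close> turns this into the component of degree \<open>1\<close>; the components of degrees \<open>-2\<close>, \<open>0\<close> and \<open>2\<close> of the image
  of \<open>ee\<close> are given by \<open>d\<close>, \<open>(s, \<nu>)\<close> and \<open>c\<close>.  The trace condition is built in.
\<close>

definition ext :: "complex \<Rightarrow> complex \<Rightarrow> complex \<Rightarrow> complex \<Rightarrow> real \<Rightarrow> real \<Rightarrow> real \<Rightarrow> real \<Rightarrow> 'n::finite mat2 \<Rightarrow> 'n mat2" where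
  "ext \<beta> \<gamma> f g s \<nu> c d X =
    (let u = qop \<beta> \<gamma> (col0 X); r = complex_of_real (Re (X $ Inr None $ Inl None));
         a = Complex s (- real CARD('n) * \<nu>)
     in bm (r * a) (sg (qop f g u)) (r * c) u (midm X + mat (r * \<i> * \<nu>)) (qop f g u)
           (r * d) (- sg u) (- cnj (r * a)))"

lemma ext_bm: "ext \<beta> \<gamma> f g s \<nu> c d (bm 0 (- x) (- complex_of_real r) x (M :: complex^('n + 'n)^('n + 'n)) (sg x) (complex_of_real r) (- sg x) 0 :: 'n::finite mat2) =
   bm (r * Complex s (- real CARD('n) * \<nu>)) (sg (qop f g (qop \<beta> \<gamma> x))) (r * c) (qop \<beta> \<gamma> x) (M + mat (r * \<i> * \<nu>)) (qop f g (qop \<beta> \<gamma> x))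
      (r * d) (- sg (qop \<beta> \<gamma> x)) (- cnj (r * Complex s (- real CARD('n) * \<nu>)))"
  by (simp add: ext_def Let_def)

lemma trace_mat: "trace (mat c :: complex^'m^'m) = of_nat CARD('m) * c"
  by (simp add: trace_def mat_nth)

lemma J_so: "(J :: 'n::finite sqmat) \<in> so_star"
  unfolding so_h J_mv
  by (simp add: dt_def cv_eq_iff sum_UNIV_Plus sum_negf)

text \<open>
  The element \<open>diag(1,-1,1)\<close> of \<open>K\<close> separates the components of odd degree from those of even degree.  The former are given
  by Schur's lemma; the latter only occur on \<open>ee\<close>, whose image is invariant under \<open>\<kk>\<close>.
\<close>

lemma ext_shape:
  fixes \<alpha> :: "'n::finite mat2 \<Rightarrow> 'n mat2"
  assumes e: "extension \<alpha>" and n: "CARD('n) \<ge> 2"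
  obtains \<beta> \<gamma> f g s \<nu> c d where "\<And>X. X \<in> g_alg \<Longrightarrow> \<alpha> X = ext \<beta> \<gamma> f g s \<nu> c d X" "\<beta> \<noteq> 0 \<or> \<gamma> \<noteq> 0" "d \<noteq> 0"
proof -
  have lin: "linear \<alpha>" and su: "\<And>X. X \<in> g_alg \<Longrightarrow> \<alpha> X \<in> su" and k: "\<And>X. X \<in> k_alg \<Longrightarrow> \<alpha> X = X"
    and p: "\<And>X. X \<in> g_alg \<Longrightarrow> \<alpha> X \<in> p_alg \<Longrightarrow> X \<in> k_alg"
    using e by (auto simp: extension_def)
  have eq: "\<alpha> (br (kb M) W) = br (kb M) (\<alpha> W)" if "M \<in> so_star" "W \<in> so_star" for M W
    using inf_equivariant[OF e kb_k] that by blast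
  have bb: "br (kb M) (bm a y c x N z d w f') = bm 0 (- (y v* M)) 0 (M *v x) (M ** N - N ** M) (M *v z) 0 (- (w v* M)) 0"
    for M N :: "complex^('n + 'n)^('n + 'n)" and a y c x z d w f' by (simp add: br_def)
  have bmc: "br (kb M) (mc x) = mc (M *v x)" if "M \<in> so_star" for M :: "complex^('n + 'n)^('n + 'n)" and x
  proof -
    have "y v* M = - (M *v y)" for y :: "'n cv"
      using that by (metis mv_simps(1) minus_minus so_iff transpose_matrix_vector)
    moreover have "M *v sg x = sg (M *v x)" using that so_h by blast
    ultimately show ?thesis unfolding bb by simp
  qed
  define E1 where "E1 x = (\<chi> i. \<alpha> (mc x) $ mid i $ Inl None)" for x
  define E2 where "E2 x = (\<chi> i. \<alpha> (mc x) $ mid i $ Inr None)" for x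
  have mcl: "mc (x + y) = mc x + mc y" "mc (r *\<^sub>R x) = r *\<^sub>R mc x" for x y :: "'n cv" and r by simp_all
  have lin1: "linear E1" "linear E2"
    unfolding E1_def E2_def
    by (rule linearI; simp only: mcl linear_add[OF lin] linear_cmul[OF lin]; simp add: vec_eq_iff)+
  have odd: "\<alpha> (mc x) = bm 0 (sg (E2 x)) 0 (E1 x) 0 (E2 x) 0 (- sg (E1 x)) 0" for x
  proof -
    obtain a z c u N d where A: "\<alpha> (mc x) = bm a (sg z) c u N z d (- sg u) (- cnj a)"
      using su_cases[OF su[OF mc_g]] by metis
    have JJ: "J *v (J *v x) = - x" for x :: "'n cv" by (simp add: matrix_vector_mul_assoc J_J)
    have "br (kb J) (br (kb J) (mc x)) = - mc x" unfolding bmc[OF J_so] JJ by simp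
    then have "br (kb J) (br (kb J) (\<alpha> (mc x))) = - \<alpha> (mc x)"
      using eq[OF J_so] J_so mc_g bmc by (metis linear_neg[OF lin])
    then have *: "a = 0" "c = 0" "d = 0" "J ** (J ** N - N ** J) - (J ** N - N ** J) ** J = - N" unfolding A bb by simp_all
    have "N = 0"
    proof -
      have "J ** (J ** N) = - N" "(N ** J) ** J = - N" by (simp_all add: J_J matrix_mul_assoc) (simp add: J_J flip: matrix_mul_assoc)
      then have "N $ i $ j = - 2 * (J ** N ** J) $ i $ j" for i j
        using arg_cong[OF *(4), of "\<lambda>M. M $ i $ j"] by (simp add: mm_diff matrix_mul_assoc)
      then have N: "N = (-2) *\<^sub>R (J ** N ** J)" by (simp add: vec_eq_iff scaleR_complex)
      have "J ** N ** J = (-2) *\<^sub>R (J ** (J ** N ** J) ** J)" by (subst N) simp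
      also have "J ** (J ** N ** J) ** J = N"
        by (simp add: matrix_mul_assoc J_J) (simp add: J_J flip: matrix_mul_assoc)
      finally have "N = 4 *\<^sub>R N" using N by simp
      then show "N = 0" by (metis scaleR_cancel_right scaleR_one numeral_eq_one_iff semiring_norm(83))
    qed
    moreover have "E1 x = u" "E2 x = z" unfolding E1_def E2_def A by (simp_all add: vec_eq_iff)
    ultimately show ?thesis unfolding A * by simp
  qed
  have comm: "E1 (M *v x) = M *v E1 x" "E2 (M *v x) = M *v E2 x" if "M \<in> so_star" for M x
  proof -
    have "\<alpha> (mc (M *v x)) = br (kb M) (\<alpha> (mc x))" using eq[OF that mc_g, of x] by (simp only: bmc[OF that])
    then show "E1 (M *v x) = M *v E1 x" "E2 (M *v x) = M *v E2 x" unfolding odd bb bm_eq_iff by blast+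
  qed
  obtain \<beta> \<gamma> where E1: "\<And>x. E1 x = qop \<beta> \<gamma> x" using commutant[OF lin1(1) comm(1) n] by metis
  obtain p q where E2: "\<And>x. E2 x = qop p q x" using commutant[OF lin1(2) comm(2) n] by metis
  have nz: "\<beta> \<noteq> 0 \<or> \<gamma> \<noteq> 0"
  proof (rule ccontr)
    assume "\<not> ?thesis"
    then have E0: "E1 x = 0" for x by (simp add: E1 qop_def)
    let ?x = "axis (Inl undefined) 1 :: 'n cv"
    have "\<alpha> (mc ?x) \<in> p_alg" using su[OF mc_g, of ?x] unfolding odd p_bm E0 by simp
    then have "mc ?x \<in> k_alg" by (rule p[OF mc_g])
    then have "?x = 0" unfolding k_bm bm_eq_iff by blast
    then show False by simp
  qed
  let ?N = "\<beta> * cnj \<beta> + \<gamma> * cnj \<gamma>"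
  have N0: "?N \<noteq> 0"
  proof -
    have "?N = of_real ((cmod \<beta>)\<^sup>2 + (cmod \<gamma>)\<^sup>2)" by (simp only: complex_norm_square of_real_add)
    then show ?thesis using nz by (metis of_real_eq_0_iff sum_power2_eq_zero_iff norm_eq_zero)
  qed
  define f where "f = (p * cnj \<beta> + q * cnj \<gamma>) / ?N"
  define g where "g = (q * \<beta> - p * \<gamma>) / ?N"
  have E2': "E2 x = qop f g (qop \<beta> \<gamma> x)" for x
  proof -
    have "f * \<beta> - g * cnj \<gamma> = p" "f * \<gamma> + g * cnj \<beta> = q"
    proof -
      have "f * \<beta> - g * cnj \<gamma> = (p * ?N) / ?N" "f * \<gamma> + g * cnj \<beta> = (q * ?N) / ?N"
        unfolding f_def g_def times_divide_eq_left diff_divide_distrib[symmetric] add_divide_distrib[symmetric]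
        by (rule arg_cong[where f="\<lambda>w. w / ?N"], simp add: algebra_simps)+
      then show "f * \<beta> - g * cnj \<gamma> = p" "f * \<gamma> + g * cnj \<beta> = q" using N0 by simp_all
    qed
    then show ?thesis unfolding E2 qop_qop by simp
  qed
  obtain a z c u N d where A: "\<alpha> ee = bm a (sg z) c u N z d (- sg u) (- cnj a)"
    and A': "cnj c = c" "cnj d = d" "uu N" "a + trace N - cnj a = 0"
    using su_cases[OF su[OF ee_g]] by metis
  have k0: "br (kb M) (\<alpha> ee) = 0" if "M \<in> so_star" for M
    using eq[OF that ee_g] linear_0[OF lin] by (simp add: bb bm_0)
  have "J *v u = 0" "J *v z = 0" using k0[OF J_so] unfolding A bb by simp_all
  then have uz: "u = 0" "z = 0" by (metis J_J matrix_vector_mul_assoc matrix_vector_mult_0_right matrix_vector_mul_lid mv_simps(1) neg_equal_0_iff_equal)+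
  have NN: "M ** N = N ** M" if "M \<in> so_star" for M using k0[OF that] unfolding A bb by simp
  have "\<exists>m m'. \<forall>x. N *v x = qop m m' x"
    by (rule commutant[OF _ _ n]) (simp_all add: NN matrix_vector_mul_assoc)
  then obtain m m' where m: "\<And>x. N *v x = qop m m' x" by metis
  have m0: "m' *s sg x = 0" for x :: "'n cv"
  proof -
    have "N *v (\<i> *s x) = \<i> *s (N *v x)" by simp
    then have "\<i> *s (m' *s sg x) + \<i> *s (m' *s sg x) = 0" unfolding m by (simp add: qop_def vec_eq_iff algebra_simps)
    then show ?thesis by (simp add: vec_eq_iff)
  qed
  then have N: "N = mat m" by (intro matrix_eq_mv) (simp add: m qop_def m0)
  have "cnj m = - m"
  proof -
    have "dt (sg (N *v axis i 1)) (sg (axis i 1)) = - dt (sg (axis i 1)) (N *v (sg (axis i 1)))" for i using A'(3) unfolding uu_h by blast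
    then show ?thesis unfolding N by (simp del: sg_simps(7) add: sg_simps(5))
  qed
  then obtain \<nu> where nu: "m = \<i> * complex_of_real \<nu>" by (intro that[of "Im m"]) (simp add: complex_eq_iff)
  obtain c' d' where cd: "c = complex_of_real c'" "d = complex_of_real d'" using A'(1,2) by (metis Reals_cases Reals_cnj_iff)
  have a: "a = Complex (Re a) (- real CARD('n) * \<nu>)"
    using A'(4) unfolding N nu trace_mat by (simp add: complex_eq_iff)
  show ?thesis
  proof (rule that[of \<beta> \<gamma> f g "Re a" \<nu> c' d'])
    fix X :: "'n mat2" assume "X \<in> g_alg"
    then obtain r x M where X: "X = bm 0 (- x) (- complex_of_real r) x M (sg x) (complex_of_real r) (- sg x) 0" and M: "M \<in> so_star"
      by (rule g_cases)
    have "X = kb M + mc x + r *\<^sub>R ee" unfolding X by (simp add: scaleR_complex)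
    then have "\<alpha> X = kb M + \<alpha> (mc x) + r *\<^sub>R \<alpha> ee"
      by (simp only: linear_add[OF lin] linear_cmul[OF lin] k[OF kb_k[OF M]])
    also have "\<dots> = ext \<beta> \<gamma> f g (Re a) \<nu> c' d' X"
      unfolding X ext_bm A odd uz N nu cd a[symmetric] E2' unfolding E1
      by (simp add: scaleR_complex) (simp add: vec_eq_iff mat_nth scaleR_complex)
    finally show "\<alpha> X = ext \<beta> \<gamma> f g (Re a) \<nu> c' d' X" .
  next
    show "d' \<noteq> 0"
    proof
      assume "d' = 0"
      then have "\<alpha> ee \<in> p_alg" using su[OF ee_g] unfolding A uz cd p_bm by simp
      then have "ee \<in> (k_alg :: 'n mat2 set)" using p ee_g by blast
      then show False by (simp add: k_bm)
    qed
  qed (rule nz)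
qed

section \<open>Curvature on generators\<close>

definition wf :: "'n::finite cv \<Rightarrow> 'n cv \<Rightarrow> complex" where
  "wf u v = dt (sg u) v - dt (sg v) u"

lemma wf_real: "cnj (wf u v) = wf u v"
  unfolding wf_def using dt_sg_swap[of u v] dt_sg_swap[of v u] by simp

lemma wf_simps [simp]:
  "wf (u + u') v = wf u v + wf u' v" "wf u (v + v') = wf u v + wf u v'"
  "wf (r *\<^sub>R u) v = r *\<^sub>R wf u v" "wf u (r *\<^sub>R v) = r *\<^sub>R wf u v" "wf (- u) v = - wf u v" "wf u (- v) = - wf u v"
  "wf 0 v = 0" "wf u 0 = 0"
  by (simp_all add: wf_def scaleR_diff_right)

text \<open>
  The curvature on two elements of \<open>\<complex>\<^sup>2\<^sup>n\<close> with components \<open>u, v\<close> of degree \<open>-1\<close>, where \<open>F\<close> maps these to the components of degree \<open>1\<close> and \<open>U\<close>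
  is the conjugated multiplication by \<open>j\<close>.
\<close>

definition KK :: "real \<Rightarrow> ('n::finite cv \<Rightarrow> 'n cv) \<Rightarrow> ('n cv \<Rightarrow> 'n cv) \<Rightarrow> complex \<Rightarrow> complex \<Rightarrow> real \<Rightarrow> real \<Rightarrow> 'n cv \<Rightarrow> 'n cv \<Rightarrow> 'n mat2" where
  "KK D F U a \<mu> c d u v = (let k0 = dt (sg (F u)) v - dt (sg (F v)) u + wf u v / D * a in
     bm k0 0 (wf (F u) (F v) + wf u v / D * c) 0
       (outer u (sg (F v)) - outer (F u) (sg v) - outer v (sg (F u)) + outer (F v) (sg u) + mat (wf u v / D * \<mu>)
        - (1/D) *\<^sub>R (outer (sg (U u)) v - outer (U u) (sg v) - outer (sg (U v)) u + outer (U v) (sg u)))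
       0 (wf u v / D * d - wf u v) 0 (- cnj k0))"

text \<open>
  The curvature on \<open>ee\<close> and an element of \<open>\<complex>\<^sup>2\<^sup>n\<close> with component \<open>u\<close> of degree \<open>-1\<close>.
\<close>

definition TT :: "('n::finite cv \<Rightarrow> 'n cv) \<Rightarrow> ('n cv \<Rightarrow> 'n cv) \<Rightarrow> complex \<Rightarrow> complex \<Rightarrow> real \<Rightarrow> real \<Rightarrow> 'n cv \<Rightarrow> 'n mat2" where
  "TT F U a \<mu> c d u = (let w = (\<mu> - a) *s u - d *\<^sub>R F u + U u; z = (\<mu> + cnj a) *s F u - c *\<^sub>R u + F (U u) in
     bm 0 (sg z) 0 w 0 z 0 (- sg w) 0)"

definition nrm2 :: "complex \<Rightarrow> complex \<Rightarrow> real" where "nrm2 \<beta> \<gamma> = (cmod \<beta>)\<^sup>2 + (cmod \<gamma>)\<^sup>2"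

lemma nrm2: "complex_of_real (nrm2 \<beta> \<gamma>) = \<beta> * cnj \<beta> + \<gamma> * cnj \<gamma>"
  by (simp only: nrm2_def complex_norm_square of_real_add)

lemma nrm2_pos: "\<beta> \<noteq> 0 \<or> \<gamma> \<noteq> 0 \<Longrightarrow> nrm2 \<beta> \<gamma> > 0"
  unfolding nrm2_def by (metis sum_power2_gt_zero_iff norm_eq_zero)

text \<open>
  The numbers \<open>\<tau>\<close> and \<open>\<rho>\<close> describe right multiplication by \<open>j\<close> on \<open>\<complex>\<^sup>2\<^sup>n\<close> after conjugation with \<open>qop \<beta> \<gamma>\<close>.
\<close>

definition tau :: "complex \<Rightarrow> complex \<Rightarrow> real" where "tau \<beta> \<gamma> = 2 * Im (cnj \<beta> * \<gamma>) / nrm2 \<beta> \<gamma>"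
definition rho :: "complex \<Rightarrow> complex \<Rightarrow> complex" where "rho \<beta> \<gamma> = (\<beta>\<^sup>2 + \<gamma>\<^sup>2) / nrm2 \<beta> \<gamma>"
text \<open>
  Right multiplication by \<open>j\<close> seen through \<open>qop \<beta> \<gamma>\<close>.
\<close>

definition Uq :: "complex \<Rightarrow> complex \<Rightarrow> 'n::finite cv \<Rightarrow> 'n cv" where "Uq \<beta> \<gamma> = qop (- \<i> * tau \<beta> \<gamma>) (rho \<beta> \<gamma>)"

lemma tau_eq: assumes "\<beta> \<noteq> 0 \<or> \<gamma> \<noteq> 0"
  shows "\<i> * complex_of_real (tau \<beta> \<gamma>) * nrm2 \<beta> \<gamma> = cnj \<beta> * \<gamma> - \<beta> * cnj \<gamma>"
proof -
  have "cnj \<beta> * \<gamma> - \<beta> * cnj \<gamma> = \<i> * complex_of_real (2 * Im (cnj \<beta> * \<gamma>))"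
    by (simp add: complex_eq_iff)
  then show ?thesis using nrm2_pos[OF assms] by (simp add: tau_def)
qed

lemma rho_eq: "\<beta> \<noteq> 0 \<or> \<gamma> \<noteq> 0 \<Longrightarrow> rho \<beta> \<gamma> * nrm2 \<beta> \<gamma> = \<beta>\<^sup>2 + \<gamma>\<^sup>2"
  using nrm2_pos[of \<beta> \<gamma>] by (simp add: rho_def)

text \<open>
  The conjugated right multiplication by \<open>j\<close> still has square \<open>-1\<close>.
\<close>

lemma tau_rho: assumes "\<beta> \<noteq> 0 \<or> \<gamma> \<noteq> 0" shows "(tau \<beta> \<gamma>)\<^sup>2 + (cmod (rho \<beta> \<gamma>))\<^sup>2 = 1"
proof -
  let ?N = "complex_of_real (nrm2 \<beta> \<gamma>)" and ?t = "\<i> * complex_of_real (tau \<beta> \<gamma>)"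
  have N: "?N \<noteq> 0" using nrm2_pos[OF assms] by simp
  have c: "cnj (rho \<beta> \<gamma>) * ?N = (cnj \<beta>)\<^sup>2 + (cnj \<gamma>)\<^sup>2" using arg_cong[OF rho_eq[OF assms], of cnj] by simp
  have "(- (?t * ?t) + rho \<beta> \<gamma> * cnj (rho \<beta> \<gamma>)) * (?N * ?N) = - ((?t * ?N) * (?t * ?N)) + (rho \<beta> \<gamma> * ?N) * (cnj (rho \<beta> \<gamma>) * ?N)"
    by (simp add: algebra_simps)
  also have "\<dots> = ?N * ?N" unfolding tau_eq[OF assms] c rho_eq[OF assms] unfolding nrm2 by (simp add: power2_eq_square algebra_simps)
  finally have "- (?t * ?t) + rho \<beta> \<gamma> * cnj (rho \<beta> \<gamma>) = 1" using N by simp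
  then have "complex_of_real ((tau \<beta> \<gamma>)\<^sup>2 + (cmod (rho \<beta> \<gamma>))\<^sup>2) = 1"
    by (simp only: of_real_add complex_norm_square) (simp add: power2_eq_square algebra_simps)
  then show ?thesis by (simp only: of_real_eq_1_iff)
qed

lemma Uq_qop: assumes "\<beta> \<noteq> 0 \<or> \<gamma> \<noteq> 0" shows "Uq \<beta> \<gamma> (qop \<beta> \<gamma> x) = qop \<beta> \<gamma> (sg x)"
proof -
  let ?N = "complex_of_real (nrm2 \<beta> \<gamma>)" and ?t = "\<i> * complex_of_real (tau \<beta> \<gamma>)"
  have N: "?N \<noteq> 0" using nrm2_pos[OF assms] by simp
  have "(- ?t * \<beta> - rho \<beta> \<gamma> * cnj \<gamma>) * ?N = - (?t * ?N) * \<beta> - (rho \<beta> \<gamma> * ?N) * cnj \<gamma>" by (simp add: algebra_simps)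
  also have "\<dots> = - \<gamma> * ?N" unfolding tau_eq[OF assms] rho_eq[OF assms] unfolding nrm2 by (simp add: power2_eq_square algebra_simps)
  finally have 1: "- ?t * \<beta> - rho \<beta> \<gamma> * cnj \<gamma> = - \<gamma>" by (simp only: mult_right_cancel[OF N])
  have "(- ?t * \<gamma> + rho \<beta> \<gamma> * cnj \<beta>) * ?N = - (?t * ?N) * \<gamma> + (rho \<beta> \<gamma> * ?N) * cnj \<beta>" by (simp add: algebra_simps)
  also have "\<dots> = \<beta> * ?N" unfolding tau_eq[OF assms] rho_eq[OF assms] unfolding nrm2 by (simp add: power2_eq_square algebra_simps)
  finally have 2: "- ?t * \<gamma> + rho \<beta> \<gamma> * cnj \<beta> = \<beta>" by (simp only: mult_right_cancel[OF N])
  show ?thesis unfolding Uq_def qop_qop qop_sg using 1 2 by (simp add: mult.assoc)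
qed

lemma qop_surj: assumes "\<beta> \<noteq> 0 \<or> \<gamma> \<noteq> 0" obtains x where "u = qop \<beta> \<gamma> x"
proof
  have "nrm2 \<beta> \<gamma> \<noteq> 0" using nrm2_pos[OF assms] by simp
  then show "u = qop \<beta> \<gamma> ((1 / nrm2 \<beta> \<gamma>) *\<^sub>R qop (cnj \<beta>) (- \<gamma>) u)"
    by (simp add: qop_qop nrm2[symmetric] mult.commute) (simp add: qop_def vec_eq_iff scaleR_complex)
qed

lemma wf_qop: "wf (qop \<beta> \<gamma> x) (qop \<beta> \<gamma> y) = nrm2 \<beta> \<gamma> * wf x y"
  unfolding nrm2 wf_def qop_def using dt_sg_swap[of x y] dt_sg_swap[of y x]
  by (simp add: algebra_simps dt_commute[of y x] dt_commute[of "sg x" y] dt_commute[of "sg y" x])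

lemma kk_qop: assumes "\<beta> \<noteq> 0 \<or> \<gamma> \<noteq> 0"
  shows "nrm2 \<beta> \<gamma> *\<^sub>R kk x y = outer (sg (qop \<beta> \<gamma> (sg x))) (qop \<beta> \<gamma> y) - outer (qop \<beta> \<gamma> (sg x)) (sg (qop \<beta> \<gamma> y))
     - outer (sg (qop \<beta> \<gamma> (sg y))) (qop \<beta> \<gamma> x) + outer (qop \<beta> \<gamma> (sg y)) (sg (qop \<beta> \<gamma> x))"
  by (simp add: vec_eq_iff kk_def scaleR_complex nrm2 qop_def algebra_simps)

lemma ext_mc: "ext \<beta> \<gamma> f g s \<nu> c d (mc x) = bm 0 (sg (qop f g (qop \<beta> \<gamma> x))) 0 (qop \<beta> \<gamma> x) 0 (qop f g (qop \<beta> \<gamma> x)) 0 (- sg (qop \<beta> \<gamma> x)) 0"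
  using ext_bm[where r=0 and M=0 and x=x] by (simp add: bm_0)
lemma ext_ee: "ext \<beta> \<gamma> f g s \<nu> c d (ee :: 'n::finite mat2) = bm (Complex s (- real CARD('n) * \<nu>)) 0 c 0 (mat (\<i> * \<nu>)) 0 d 0 (- cnj (Complex s (- real CARD('n) * \<nu>)))"
  using ext_bm[where r=1 and M=0 and x=0] by simp
lemma ext_kb: "ext \<beta> \<gamma> f g s \<nu> c d (kb M) = kb M"
  using ext_bm[where r=0 and M=M and x=0] by simp

lemma br_mc: "br (mc x) (mc y) = kb (kk x y) + (- Re (wf x y)) *\<^sub>R ee"
proof -
  have "wf x y = of_real (Re (wf x y))" using wf_real[of x y] by (simp add: complex_eq_iff)
  then have *: "complex_of_real (Re (wf x y)) = dt (sg x) y - dt (sg y) x" by (simp add: wf_def)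
  show ?thesis unfolding br_def bm_mult bm_simps bm_eq_iff
    by (auto simp: * scaleR_complex kk_def dt_commute[of y x] dt_commute[of "sg y" "sg x"] dt_commute[of y "sg x"] dt_commute[of x "sg y"])
qed

lemma br_ee_mc: "br ee (mc x) = mc (- sg x)"
  unfolding br_def by simp

lemma linear_ext: "linear (ext \<beta> \<gamma> f g s \<nu> c d)"
  by (rule linearI; simp add: ext_def Let_def; simp add: vec_eq_iff mat_nth scaleR_complex algebra_simps)

lemma curv_mc:
  assumes nz: "\<beta> \<noteq> 0 \<or> \<gamma> \<noteq> 0"
  shows "curv (ext \<beta> \<gamma> f g s \<nu> c d) (mc x) (mc y :: 'n::finite mat2) =
    KK (nrm2 \<beta> \<gamma>) (qop f g) (Uq \<beta> \<gamma>) (Complex s (- real CARD('n) * \<nu>)) (\<i> * \<nu>) c d (qop \<beta> \<gamma> x) (qop \<beta> \<gamma> y)"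
proof -
  let ?N = "nrm2 \<beta> \<gamma>" and ?a = "Complex s (- real CARD('n) * \<nu>)" and ?u = "qop \<beta> \<gamma> x" and ?v = "qop \<beta> \<gamma> y"
  have N: "?N \<noteq> 0" using nrm2_pos[OF nz] by simp
  have w: "complex_of_real (Re (wf x y)) = wf ?u ?v / ?N" using wf_real[of x y] N by (simp add: wf_qop complex_eq_iff)
  have k: "kk x y = (1/?N) *\<^sub>R (outer (sg (Uq \<beta> \<gamma> ?u)) ?v - outer (Uq \<beta> \<gamma> ?u) (sg ?v) - outer (sg (Uq \<beta> \<gamma> ?v)) ?u + outer (Uq \<beta> \<gamma> ?v) (sg ?u))"
    unfolding Uq_qop[OF nz] kk_qop[OF nz, symmetric] using N by simp
  define W where "W = wf ?u ?v / ?N"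
  have e: "ext \<beta> \<gamma> f g s \<nu> c d (br (mc x) (mc y)) =
      bm (- (W * ?a)) 0 (- (W * c)) 0 (kk x y - mat (W * (\<i> * \<nu>))) 0 (- (W * d)) 0 (W * cnj ?a)"
    unfolding br_mc linear_add[OF linear_ext] linear_cmul[OF linear_ext] ext_kb ext_ee
    by (simp add: scaleR_complex w W_def[symmetric]) (simp add: vec_eq_iff mat_nth scaleR_complex w W_def[symmetric])
  have W: "cnj W = W" unfolding w[symmetric, folded W_def] by simp
  show ?thesis
    unfolding curv_def e unfolding ext_mc KK_def Let_def br_def bm_mult bm_simps bm_eq_iff k W_def[symmetric]
    using dt_sg_swap[of ?v "qop f g ?u"] dt_sg_swap[of ?u "qop f g ?v"]
    by (auto simp: wf_def W mat_nth vec_eq_iff dt_commute[of _ "sg _"] algebra_simps)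
qed

lemma curv_ee:
  assumes nz: "\<beta> \<noteq> 0 \<or> \<gamma> \<noteq> 0"
  shows "curv (ext \<beta> \<gamma> f g s \<nu> c d) ee (mc x :: 'n::finite mat2) =
    TT (qop f g) (Uq \<beta> \<gamma>) (Complex s (- real CARD('n) * \<nu>)) (\<i> * \<nu>) c d (qop \<beta> \<gamma> x)"
proof -
  have e: "ext \<beta> \<gamma> f g s \<nu> c d (br ee (mc x)) = bm 0 (sg (qop f g (qop \<beta> \<gamma> (- sg x)))) 0 (qop \<beta> \<gamma> (- sg x)) 0 (qop f g (qop \<beta> \<gamma> (- sg x))) 0 (- sg (qop \<beta> \<gamma> (- sg x))) 0"
    unfolding br_ee_mc by (rule ext_mc)
  show ?thesis
    unfolding curv_def e unfolding ext_mc ext_ee TT_def Let_def br_def bm_mult bm_simps bm_eq_iff Uq_qop[OF nz]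
    by (simp add: scaleR_complex) (simp add: scaleR_complex vec_eq_iff algebra_simps)
qed

section \<open>The curvature on the tangent space\<close>

lemma uu_lin: "uu A \<Longrightarrow> uu B \<Longrightarrow> uu (A + B)" "uu A \<Longrightarrow> uu B \<Longrightarrow> uu (A - B)" "uu A \<Longrightarrow> uu (r *\<^sub>R A)"
  by (simp_all add: uu_h matrix_vector_mult_add_rdistrib matrix_vector_mult_diff_rdistrib algebra_simps)

lemma uu_br: "uu A \<Longrightarrow> uu B \<Longrightarrow> uu (br A B)"
  by (simp add: uu_h br_def matrix_vector_mult_diff_rdistrib matrix_vector_mul_assoc[symmetric])

lemma trace_lin: "trace (r *\<^sub>R A) = r *\<^sub>R trace (A :: complex^'m^'m)"
  by (simp add: trace_def scaleR_sum_right)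

lemma su_lin: "A \<in> su \<Longrightarrow> B \<in> su \<Longrightarrow> A + B \<in> su" "A \<in> su \<Longrightarrow> B \<in> su \<Longrightarrow> A - B \<in> su" "A \<in> su \<Longrightarrow> r *\<^sub>R A \<in> su"
  by (simp_all add: su_iff uu_lin trace_add trace_sub trace_lin)

lemma su_br: "A \<in> su \<Longrightarrow> B \<in> su \<Longrightarrow> br A B \<in> su"
  unfolding su_iff using uu_br[of A B] by (simp add: br_def trace_sub trace_mul_sym[of A B])

lemma so_br: "A \<in> so_star \<Longrightarrow> B \<in> so_star \<Longrightarrow> br A B \<in> so_star"
  by (simp add: so_h br_def matrix_vector_mult_diff_rdistrib matrix_vector_mul_assoc[symmetric])

lemma so_diff: "A \<in> so_star \<Longrightarrow> B \<in> so_star \<Longrightarrow> A - B \<in> so_star"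
  by (simp add: so_h matrix_vector_mult_diff_rdistrib)

lemma uu_imat: "uu (mat (\<i> * complex_of_real r))"
  by (simp add: uu_h)

lemma g_split: assumes "X \<in> so_star" obtains M x r where "X = kb M + mc x + r *\<^sub>R ee" "M \<in> so_star"
  using assms by (rule g_cases) (rule that, auto simp: scaleR_complex)

lemma br_lin: "br (A + B) C = br A C + br B C" "br C (A + B) = br C A + br C B" "br (r *\<^sub>R A) C = r *\<^sub>R br A C" "br C (r *\<^sub>R A) = r *\<^sub>R br C A"
  "br (A - B) C = br A C - br B C"  "br C (A - B) = br C A - br C B"
  by (simp_all add: br_def matrix_add_ldistrib mm_add_rdistrib mm_diff scaleR_diff_right)

lemma br_swap: "br A B = - br B A" by (simp add: br_def)

lemma curv_lin:
  assumes "linear \<alpha>"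
  shows "curv \<alpha> (A + B) C = curv \<alpha> A C + curv \<alpha> B C" "curv \<alpha> C (A + B) = curv \<alpha> C A + curv \<alpha> C B"
    "curv \<alpha> (r *\<^sub>R A) C = r *\<^sub>R curv \<alpha> A C" "curv \<alpha> C (r *\<^sub>R A) = r *\<^sub>R curv \<alpha> C A" "curv \<alpha> A C = - curv \<alpha> C A"
proof -
  show "curv \<alpha> A C = - curv \<alpha> C A"
    unfolding curv_def br_swap[of A C] br_swap[of "\<alpha> A" "\<alpha> C"] linear_neg[OF assms] by simp
qed (simp_all add: curv_def br_lin linear_add[OF assms] linear_cmul[OF assms] scaleR_diff_right)

lemma ext_kmr: "ext \<beta> \<gamma> f g s \<nu> c d (kb M + mc x + r *\<^sub>R ee :: 'n::finite mat2) =
   bm (r * Complex s (- real CARD('n) * \<nu>)) (sg (qop f g (qop \<beta> \<gamma> x))) (r * c) (qop \<beta> \<gamma> x) (M + mat (r * \<i> * \<nu>)) (qop f g (qop \<beta> \<gamma> x))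
      (r * d) (- sg (qop \<beta> \<gamma> x)) (- cnj (r * Complex s (- real CARD('n) * \<nu>)))"
proof -
  have "kb M + mc x + r *\<^sub>R ee = bm 0 (- x) (- complex_of_real r) x M (sg x) (complex_of_real r) (- sg x) 0"
    by (simp add: scaleR_complex)
  then show ?thesis by (simp only: ext_bm)
qed

lemma ext_su: assumes "X \<in> g_alg" shows "ext \<beta> \<gamma> f g s \<nu> c d X \<in> (su :: 'n::finite mat2 set)"
proof -
  obtain M x r where X: "X = kb M + mc x + r *\<^sub>R ee" and M: "M \<in> so_star" using assms by (rule g_split)
  have "uu (mat (\<i> * complex_of_real (r * \<nu>)) :: 'n sqmat)" by (rule uu_imat)
  then have "uu (mat (complex_of_real r * \<i> * complex_of_real \<nu>) :: 'n sqmat)" by (simp add: mult.commute mult.left_commute)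
  then have "uu (M + mat (complex_of_real r * \<i> * complex_of_real \<nu>))" using M by (simp add: uu_lin so_iff)
  then show ?thesis unfolding X ext_kmr su_bm using trace_so[OF M]
    by (simp add: trace_add trace_mat complex_eq_iff)
qed

lemma ext_extension:
  assumes nz: "\<beta> \<noteq> 0 \<or> \<gamma> \<noteq> 0" and d: "d \<noteq> 0"
  shows "extension (ext \<beta> \<gamma> f g s \<nu> c d :: 'n::finite mat2 \<Rightarrow> 'n mat2)"
  unfolding extension_def
proof (intro conjI ballI impI)
  let ?e = "ext \<beta> \<gamma> f g s \<nu> c d :: 'n mat2 \<Rightarrow> 'n mat2"
  show "linear ?e" by (rule linear_ext)
  show "?e ` g_alg \<subseteq> su" using ext_su by blast
  show "?e (k ** X ** matrix_inv k) = k ** ?e X ** matrix_inv k" if k: "k \<in> K_grp" and X: "X \<in> g_alg" for k X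
  proof -
    obtain M x r where X: "X = bm 0 (- x) (- complex_of_real r) x M (sg x) (complex_of_real r) (- sg x) 0" and M: "M \<in> so_star"
      using X by (rule g_cases)
    obtain l where l: "k = kg l" "transpose l ** l = mat 1" and lsg: "\<And>x. l *v sg x = sg (l *v x)" using k by (rule K_cases) metis
    have inv: "matrix_inv (kg l) = kg (transpose l)" using SO_inv(1)[OF K_SO[OF k]] by (simp add: l(1))
    have lq: "l *v qop p q x = qop p q (l *v x)" for p q x by (simp add: qop_def matrix_vector_right_distrib lsg)
    have ll: "l ** transpose l = mat 1" using l(2) by (simp add: matrix_left_right_inverse)
    have lm: "l ** mat z ** transpose l = mat z" for z
    proof -
      have "l ** mat z = mat z ** l" by (rule matrix_eq_mv) (simp add: matrix_vector_mul_assoc[symmetric])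
      then show ?thesis by (simp add: ll flip: matrix_mul_assoc)
    qed
    have 1: "k ** X ** matrix_inv k = bm 0 (- (l *v x)) (- complex_of_real r) (l *v x) (l ** M ** transpose l) (sg (l *v x)) (complex_of_real r) (- sg (l *v x)) 0"
      unfolding l(1) inv X by (simp add: lsg)
    show ?thesis unfolding 1 unfolding X ext_bm l(1) inv
      by (simp add: lsg lq matrix_add_ldistrib mm_add_rdistrib lm)
  qed
  show "?e X = X" if "X \<in> k_alg" for X using that by (rule_tac A=X in bm_exists) (auto simp: k_bm ext_kb)
  show "X \<in> k_alg" if Xg: "X \<in> g_alg" and Xp: "?e X \<in> p_alg" for X
  proof -
    obtain M x r where X: "X = kb M + mc x + r *\<^sub>R ee" and M: "M \<in> so_star" using Xg by (rule g_split)
    have "qop \<beta> \<gamma> x = 0" "r * d = 0" using Xp unfolding X ext_kmr p_bm by (simp_all flip: of_real_mult)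
    then have "x = 0" "r = 0" using nz d by (auto simp: qop_eq_0)
    then show ?thesis using kb_k[OF M] unfolding X by (simp add: bm_0)
  qed
  show "\<exists>X\<in>g_alg. ?e X - Y \<in> p_alg" if Y: "Y \<in> su" for Y
  proof -
    obtain a z c' u N \<delta> where A: "Y = bm a (sg z) c' u N z \<delta> (- sg u) (- cnj a)" and A': "cnj \<delta> = \<delta>"
      using su_cases[OF Y] by metis
    obtain x where x: "u = qop \<beta> \<gamma> x" using qop_surj[OF nz] by metis
    define r where "r = Re \<delta> / d"
    have r: "complex_of_real r * d = \<delta>" using A' d by (simp add: r_def complex_eq_iff)
    let ?X = "kb 0 + mc x + r *\<^sub>R ee"
    have g: "?X \<in> g_alg" by (simp add: g_bm scaleR_complex)
    have "?e ?X - Y \<in> su" using g ext_su Y su_lin by blast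
    then have "?e ?X - Y \<in> p_alg" unfolding ext_kmr A by (simp add: p_bm r x)
    then show ?thesis using g by blast
  qed
qed

lemma curv_k: assumes "extension \<alpha>" "M \<in> so_star" "W \<in> g_alg" shows "curv \<alpha> (kb M) W = 0"
  using inf_equivariant[OF assms(1) kb_k[OF assms(2)] assms(3)] assms(1) kb_k[OF assms(2)]
  by (simp add: curv_def extension_def)

text \<open>
  The curvature vanishes on \<open>\<kk>\<close>, so its values on generators of \<open>\<mm>\<close> determine it.
\<close>

lemma curv_split:
  fixes \<alpha> :: "'n::finite mat2 \<Rightarrow> 'n mat2"
  assumes e: "extension \<alpha>" and M: "M \<in> so_star" "M' \<in> so_star"
  shows "curv \<alpha> (kb M + mc x + r *\<^sub>R ee) (kb M' + mc y + r' *\<^sub>R ee) =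
     curv \<alpha> (mc x) (mc y) + r *\<^sub>R curv \<alpha> ee (mc y) - r' *\<^sub>R curv \<alpha> ee (mc x)"
proof -
  have lin: "linear \<alpha>" using e by (simp add: extension_def)
  have k: "curv \<alpha> (kb M) W = 0" "curv \<alpha> W (kb M') = 0" if "W \<in> g_alg" for W
    using curv_k[OF e M(1) that] curv_k[OF e M(2) that] curv_lin(5)[OF lin, of W "kb M'"] by simp_all
  have g: "mc x \<in> g_alg" "mc y \<in> g_alg" "ee \<in> g_alg" "kb M \<in> g_alg" "kb M' \<in> g_alg" using mc_g ee_g kb_g M by blast+
  have 0: "curv \<alpha> ee ee = 0" by (simp add: curv_def br_def linear_0[OF lin])
  have "curv \<alpha> (mc x) ee = - curv \<alpha> ee (mc x)" by (rule curv_lin(5)[OF lin])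
  then show ?thesis
    by (simp only: curv_lin(1-4)[OF lin] k[OF g(1)] k[OF g(2)] k[OF g(3)] k[OF g(4)] k[OF g(5)] 0) simp
qed

text \<open>
  The bilinear extension of the values on degrees \<open>(-1,-1)\<close> and \<open>(-2,-1)\<close> to \<open>\<ll>/\<pp>\<close>.
\<close>

definition Kf :: "('n::finite cv \<Rightarrow> 'n cv \<Rightarrow> 'n mat2) \<Rightarrow> ('n cv \<Rightarrow> 'n mat2) \<Rightarrow> real \<Rightarrow> 'n mat2 \<Rightarrow> 'n mat2 \<Rightarrow> 'n mat2" where
  "Kf K T d A B = K (col0 A) (col0 B) + (Re (A $ Inr None $ Inl None) / d) *\<^sub>R T (col0 B)
     - (Re (B $ Inr None $ Inl None) / d) *\<^sub>R T (col0 A)"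

lemma curv_agree:
  assumes "\<And>X. X \<in> g_alg \<Longrightarrow> \<alpha> X = \<alpha>' X" "X \<in> g_alg" "Y \<in> g_alg"
  shows "curv \<alpha> X Y = curv \<alpha>' X Y"
  using assms so_br[OF assms(2,3)] by (simp add: curv_def)

lemma kappa_formula:
  fixes \<alpha> :: "'n::finite mat2 \<Rightarrow> 'n mat2"
  assumes e: "extension \<alpha>" and a: "\<And>X. X \<in> g_alg \<Longrightarrow> \<alpha> X = ext \<beta> \<gamma> f g s \<nu> c d X"
    and nz: "\<beta> \<noteq> 0 \<or> \<gamma> \<noteq> 0" and d: "d \<noteq> 0" and AB: "A \<in> su" "B \<in> su"
  shows "kappa \<alpha> A B = Kf (KK (nrm2 \<beta> \<gamma>) (qop f g) (Uq \<beta> \<gamma>) (Complex s (- real CARD('n) * \<nu>)) (\<i> * \<nu>) c d)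
       (TT (qop f g) (Uq \<beta> \<gamma>) (Complex s (- real CARD('n) * \<nu>)) (\<i> * \<nu>) c d) d A B"
proof -
  have l: "\<exists>M x r. lift \<alpha> A = kb M + mc x + r *\<^sub>R ee \<and> M \<in> so_star \<and> qop \<beta> \<gamma> x = col0 A \<and> r = Re (A $ Inr None $ Inl None) / d"
    if A: "A \<in> su" for A
  proof -
    have "\<exists>X. X \<in> g_alg \<and> \<alpha> X - A \<in> p_alg" using e A by (auto simp: extension_def)
    then have L: "lift \<alpha> A \<in> g_alg" "\<alpha> (lift \<alpha> A) - A \<in> p_alg" unfolding lift_def by (rule someI2_ex, simp)+
    obtain M x r where X: "lift \<alpha> A = kb M + mc x + r *\<^sub>R ee" and M: "M \<in> so_star" using L(1) by (rule g_split)
    obtain a' z c' u N \<delta> where A: "A = bm a' (sg z) c' u N z \<delta> (- sg u) (- cnj a')" and A': "cnj \<delta> = \<delta>"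
      using su_cases[OF A] by metis
    have "ext \<beta> \<gamma> f g s \<nu> c d (kb M + mc x + r *\<^sub>R ee) - A \<in> p_alg" using L(2) unfolding a[OF L(1)] unfolding X .
    then have "qop \<beta> \<gamma> x = u" "complex_of_real r * d = \<delta>" unfolding ext_kmr A by (simp_all add: p_bm)
    then have "qop \<beta> \<gamma> x = col0 A" "r = Re (A $ Inr None $ Inl None) / d" using d A by auto
    with X M show ?thesis by blast
  qed
  obtain M x r where X: "lift \<alpha> A = kb M + mc x + r *\<^sub>R ee" "M \<in> so_star" "qop \<beta> \<gamma> x = col0 A" "r = Re (A $ Inr None $ Inl None) / d"
    using l[OF AB(1)] by blast
  obtain M' y r' where Y: "lift \<alpha> B = kb M' + mc y + r' *\<^sub>R ee" "M' \<in> so_star" "qop \<beta> \<gamma> y = col0 B" "r' = Re (B $ Inr None $ Inl None) / d"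
    using l[OF AB(2)] by blast
  have c: "curv \<alpha> (mc x) (mc y) = curv (ext \<beta> \<gamma> f g s \<nu> c d) (mc x) (mc y)" "curv \<alpha> ee (mc x) = curv (ext \<beta> \<gamma> f g s \<nu> c d) ee (mc x)" for x y :: "'n cv"
    by (rule curv_agree[OF a mc_g mc_g] curv_agree[OF a ee_g mc_g], assumption)+
  show ?thesis
    unfolding kappa_def X(1) Y(1) curv_split[OF e X(2) Y(2)] c curv_mc[OF nz] curv_ee[OF nz] Kf_def X(3) Y(3) X(4) Y(4) ..
qed

section \<open>Contractions\<close>

abbreviation Zp :: "'n::finite cv \<Rightarrow> 'n mat2" where "Zp z \<equiv> bm 0 (sg z) 0 0 0 z 0 0 0"
abbreviation Np :: "'n::finite cv \<Rightarrow> 'n mat2" where "Np y \<equiv> bm 0 0 0 y 0 0 0 (- sg y) 0"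
abbreviation Ep :: "'n::finite mat2" where "Ep \<equiv> bm 0 0 1 0 0 0 0 0 0"
abbreviation Em :: "'n::finite mat2" where "Em \<equiv> bm 0 0 0 0 0 0 1 0 0"
abbreviation e1 :: "'n + 'n \<Rightarrow> 'n::finite cv" where "e1 r \<equiv> axis r 1"

text \<open>
  Contraction with dual real bases of the components of degrees \<open>1\<close> and \<open>-1\<close>; the two summands belong to the real and the
  imaginary multiple of a unit vector.
\<close>

definition ct :: "('n::finite cv \<Rightarrow> 'n cv \<Rightarrow> 'b::comm_monoid_add) \<Rightarrow> 'b" where
  "ct f = (\<Sum>r\<in>UNIV. f (- sg (e1 r)) (e1 r) + f (- (\<i> *s sg (e1 r))) (\<i> *s e1 r))"

lemma ct_lin: "ct (\<lambda>z y. f z y + g z y) = ct f + ct g"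
  unfolding ct_def sum.distrib[symmetric] by (rule sum.cong) (simp_all add: algebra_simps)

lemma ct_linear: assumes "linear L" shows "ct (\<lambda>z y. L (f z y)) = L (ct f)"
  unfolding ct_def by (simp add: linear_sum[OF assms] linear_add[OF assms])

lemma sum_e1: "(\<Sum>r\<in>UNIV. u $ r *s e1 r) = u" by (rule basis_expansion)

lemma sum_sg_e1: "(\<Sum>r\<in>UNIV. dt u (sg (e1 r)) *s sg (e1 r)) = u"
proof -
  have "dt u (sg (e1 r)) = - cnj (sg u $ r)" for r using dt_sg_swap[of "e1 r" u] by (simp add: dt_commute)
  then have "(\<Sum>r\<in>UNIV. dt u (sg (e1 r)) *s sg (e1 r)) = - sg (\<Sum>r\<in>UNIV. sg u $ r *s e1 r)"
    by (simp add: sg_sum sum_negf vector_smult_lneg)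
  then show ?thesis unfolding sum_e1 by simp
qed

lemma e1_sg [simp]: "sg (e1 r) $ r = 0" "axis r 1 $ r = (1::complex)"
  by (cases r; simp add: sg_axis; simp add: axis_def)+

lemma smult_sum: "(\<Sum>r\<in>I. c *s f r) = c *s (\<Sum>r\<in>I. f r)" for f :: "_ \<Rightarrow> complex^'i"
  by (simp add: vec_eq_iff sum_distrib_left)

lemma sum_const_smult: "(\<Sum>r\<in>(UNIV :: ('n + 'n) set). c *s x) = (2 * of_nat CARD('n::finite) * c) *s (x :: complex^'i)"
  unfolding vec_eq_iff sum_component vector_smult_component by simp

lemma ct_dt: "ct (\<lambda>z (y :: 'n::finite cv). dt (sg z) (qop p q y)) = 4 * of_nat CARD('n) * p"
proof -
  have "ct (\<lambda>z (y :: 'n cv). dt (sg z) (qop p q y)) = (\<Sum>r\<in>(UNIV :: ('n + 'n) set). 2 * p)"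
    unfolding ct_def by (rule sum.cong) (simp_all add: qop_def algebra_simps)
  then show ?thesis by simp
qed

lemma ct_wf: "ct (\<lambda>z (y :: 'n::finite cv). wf z (qop p q y)) = of_real (8 * of_nat CARD('n) * Re p)"
proof -
  have "wf z v = dt (sg z) v + cnj (dt (sg z) v)" for z v :: "'n cv" unfolding wf_def using dt_sg_swap[of v z] by simp
  then have "ct (\<lambda>z (y :: 'n cv). wf z (qop p q y)) = ct (\<lambda>z (y :: 'n cv). dt (sg z) (qop p q y)) + cnj (ct (\<lambda>z (y :: 'n cv). dt (sg z) (qop p q y)))"
    by (simp only: ct_lin ct_linear[OF bounded_linear.linear[OF bounded_linear_cnj]])
  then show ?thesis unfolding ct_dt by (simp add: complex_eq_iff)
qed

lemma ct_wf_z: "ct (\<lambda>z y. wf x y *s z) = 2 *s (x :: 'n::finite cv)"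
proof -
  have w: "wf x y = sg x $ r + cnj (sg x $ r)" if "y = e1 r" for y r unfolding wf_def that using dt_sg_swap[of "e1 r" x] by simp
  have w2: "wf x (\<i> *s e1 r) = \<i> * sg x $ r - \<i> * cnj (sg x $ r)" for r unfolding wf_def using dt_sg_swap[of "e1 r" x] by simp
  have "ct (\<lambda>z y. wf x y *s z) = (\<Sum>r\<in>UNIV. - (2 *s sg (sg x $ r *s e1 r)))"
    unfolding ct_def w2 w[OF refl] by (rule sum.cong) (simp_all add: vec_eq_iff algebra_simps)
  also have "\<dots> = - (2 *s sg (\<Sum>r\<in>UNIV. sg x $ r *s e1 r))" by (simp only: sum_negf smult_sum sg_sum)
  finally show ?thesis unfolding sum_e1 by (simp add: vec_eq_iff)
qed

definition Q1 :: "'n::finite cv \<Rightarrow> 'n cv \<Rightarrow> complex^('n+'n)^('n+'n)" where "Q1 u v = outer u (sg v) - outer v (sg u)"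
definition Q2 :: "'n::finite cv \<Rightarrow> 'n cv \<Rightarrow> complex^('n+'n)^('n+'n)" where "Q2 u v = outer (sg u) v - outer (sg v) u"
definition Q3 :: "'n::finite cv \<Rightarrow> 'n cv \<Rightarrow> complex^('n+'n)^('n+'n)" where "Q3 u v = outer u v - outer v u"
definition Q4 :: "'n::finite cv \<Rightarrow> 'n cv \<Rightarrow> complex^('n+'n)^('n+'n)" where "Q4 u v = outer (sg u) (sg v) - outer (sg v) (sg u)"

lemmas mv_lin = matrix_vector_mult_add_rdistrib matrix_vector_mult_diff_rdistrib

lemma ct_Q1: "ct (\<lambda>z y. Q1 x y *v z) = (- 4 * of_nat CARD('n)) *s (x :: 'n::finite cv)"
proof -
  have "ct (\<lambda>z y. Q1 x y *v z) = (\<Sum>r\<in>(UNIV::('n+'n) set). (-2) *s x)"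
    unfolding ct_def Q1_def by (rule sum.cong) (simp_all add: mv_lin, simp add: vec_eq_iff algebra_simps)
  then show ?thesis unfolding sum_const_smult by simp
qed

lemma ct_Q2: "ct (\<lambda>z y. Q2 x y *v z) = 2 *s (x :: 'n::finite cv)"
proof -
  have "ct (\<lambda>z y. Q2 x y *v z) = (\<Sum>r\<in>UNIV. 2 *s (dt x (sg (e1 r)) *s sg (e1 r)))"
    unfolding ct_def Q2_def by (rule sum.cong) (simp_all add: mv_lin, simp add: vec_eq_iff algebra_simps)
  then show ?thesis unfolding smult_sum sum_sg_e1 .
qed

lemma ct_Q3: "ct (\<lambda>z y. Q3 x y *v z) = (0 :: 'n::finite cv)"
  unfolding ct_def Q3_def by (rule sum.neutral) (simp add: mv_lin vec_eq_iff algebra_simps)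

lemma ct_Q4: "ct (\<lambda>z y. Q4 x y *v z) = (2 - 4 * of_nat CARD('n)) *s sg (x :: 'n::finite cv)"
proof -
  have "ct (\<lambda>z y. Q4 x y *v z) = (\<Sum>r\<in>(UNIV::('n+'n) set). (-2) *s sg x) + (\<Sum>r\<in>UNIV. 2 *s (dt (sg x) (sg (e1 r)) *s sg (e1 r)))"
    unfolding ct_def Q4_def sum.distrib[symmetric] by (rule sum.cong) (simp_all add: mv_lin del: dt_sg_sg, simp add: vec_eq_iff algebra_simps)
  then show ?thesis unfolding sum_const_smult unfolding smult_sum sum_sg_e1 by (simp add: vec_eq_iff algebra_simps)
qed

lemma ct_Q1': "ct (\<lambda>z y. Q1 z y) = mat (-4)"
proof (rule matrix_eq_mv)
  fix w :: "'n::finite cv"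
  have "ct (\<lambda>z y. Q1 z y) *v w = ct (\<lambda>z y. Q1 z y *v w)" unfolding ct_def
    by (simp add: matrix_vector_mult_def vec_eq_iff sum_distrib_right) (subst sum.swap, simp add: sum.distrib algebra_simps)
  also have "\<dots> = (\<Sum>r\<in>UNIV. (-2) *s (w $ r *s e1 r)) + (\<Sum>r\<in>UNIV. (-2) *s (dt w (sg (e1 r)) *s sg (e1 r)))"
    unfolding ct_def Q1_def sum.distrib[symmetric] by (rule sum.cong) (simp_all add: mv_lin, simp add: vec_eq_iff dt_commute[of _ w] algebra_simps)
  finally show "ct (\<lambda>z y. Q1 z y) *v w = mat (-4) *v w" unfolding smult_sum sum_sg_e1 sum_e1 by (simp add: vec_eq_iff)
qed

lemma ct_Q2': "ct (\<lambda>z y. Q2 z y) = mat 4"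
proof (rule matrix_eq_mv)
  fix w :: "'n::finite cv"
  have "ct (\<lambda>z y. Q2 z y) *v w = ct (\<lambda>z y. Q2 z y *v w)" unfolding ct_def
    by (simp add: matrix_vector_mult_def vec_eq_iff sum_distrib_right) (subst sum.swap, simp add: sum.distrib algebra_simps)
  also have "\<dots> = (\<Sum>r\<in>UNIV. 2 *s (w $ r *s e1 r)) + (\<Sum>r\<in>UNIV. 2 *s (dt w (sg (e1 r)) *s sg (e1 r)))"
    unfolding ct_def Q2_def sum.distrib[symmetric] by (rule sum.cong) (simp_all add: mv_lin, simp add: vec_eq_iff dt_commute[of _ w] algebra_simps)
  finally show "ct (\<lambda>z y. Q2 z y) *v w = mat 4 *v w" unfolding smult_sum sum_sg_e1 sum_e1 by (simp add: vec_eq_iff)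
qed

subsection \<open>Dual bases\<close>

lemma killing_lin: "linear (killing A)" "linear (\<lambda>A. killing A B)"
  unfolding killing_def
  by (rule linearI; simp add: matrix_add_ldistrib mm_add_rdistrib trace_add trace_lin algebra_simps)+

lemma killing_Zp: "killing (bm 0 (sg z) c 0 0 z 0 0 0) (bm 0 0 0 y 0 0 d (- sg y) 0 :: 'n::finite mat2) =
   4 * real CARD('n option + 'n option) * Re (dt (sg z) y) + 2 * real CARD('n option + 'n option) * Re (c * d)"
proof -
  have "trace (outer z (- sg y)) = - dt z (sg y)" by (simp add: trace_def dt_def sum_negf)
  moreover have "dt z (sg y) = - cnj (dt (sg z) y)" using dt_sg_swap[of y z] by (simp add: dt_commute)
  ultimately show ?thesis unfolding killing_def by (simp add: trace_def[of 0] algebra_simps)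
qed

lemma p_plus_cases: assumes "Z \<in> p_plus" obtains z r where "Z = Zp z + r *\<^sub>R Ep"
proof -
  obtain a y c x M z d w f where Z: "Z = bm a y c x M z d w f" by (rule bm_exists)
  then have *: "Z = bm 0 (sg z) c 0 0 z 0 0 0" "cnj c = c" using assms by (simp_all add: p_plus_bm)
  then have "c = of_real (Re c)" by (simp add: complex_eq_iff)
  with * that[of z "Re c"] show ?thesis by (simp add: scaleR_complex)
qed

lemma l_minus_cases: assumes "Y \<in> l_minus" obtains y r where "Y = Np y + r *\<^sub>R Em"
proof -
  obtain a y c x M z d w f where Z: "Y = bm a y c x M z d w f" by (rule bm_exists)
  then have *: "Y = bm 0 0 0 x 0 0 d (- sg x) 0" "cnj d = d" using assms by (simp_all add: l_minus_bm)
  then have "d = of_real (Re d)" by (simp add: complex_eq_iff)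
  with * that[of x "Re d"] show ?thesis by (simp add: scaleR_complex)
qed

abbreviation (input) CC :: "'n::finite itself \<Rightarrow> real" where "CC _ \<equiv> 4 * real CARD('n option + 'n option)"

lemma p_plus_expand:
  fixes Z :: "'n::finite mat2"
  assumes "Z \<in> p_plus"
  shows "CC TYPE('n) *\<^sub>R Z = (\<Sum>r\<in>UNIV. killing Z (Np (e1 r)) *\<^sub>R Zp (- sg (e1 r)) + killing Z (Np (\<i> *s e1 r)) *\<^sub>R Zp (- (\<i> *s sg (e1 r)))) + (2 * killing Z Em) *\<^sub>R Ep"
proof -
  obtain z t where Z: "Z = Zp z + t *\<^sub>R Ep" using p_plus_cases[OF assms] by metis
  have Z': "Z = bm 0 (sg z) t 0 0 z 0 0 0" unfolding Z by (simp add: scaleR_complex)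
  have k: "killing Z (Np y) = CC TYPE('n) * Re (dt (sg z) y)" for y unfolding Z' using killing_Zp[of z t y 0] by simp
  have k': "2 * killing Z Em = CC TYPE('n) * t" unfolding Z' using killing_Zp[of z t 0 1] by simp
  have zs: "(\<Sum>r\<in>UNIV. Re (dt (sg z) (e1 r)) *\<^sub>R (- sg (e1 r)) + Re (dt (sg z) (\<i> *s e1 r)) *\<^sub>R (- (\<i> *s sg (e1 r)))) = z"
  proof -
    have "Re (dt (sg z) (e1 r)) *\<^sub>R (- sg (e1 r)) + Re (dt (sg z) (\<i> *s e1 r)) *\<^sub>R (- (\<i> *s sg (e1 r))) = - sg (sg z $ r *s e1 r)" for r
    proof -
      have "of_real (Im t) * (\<i> * b) - of_real (Re t) * b = - (cnj t * b)" for t b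
        by (simp add: complex_eq_iff)
      then show ?thesis by (simp add: vec_eq_iff scaleR_complex)
    qed
    then have "(\<Sum>r\<in>UNIV. Re (dt (sg z) (e1 r)) *\<^sub>R (- sg (e1 r)) + Re (dt (sg z) (\<i> *s e1 r)) *\<^sub>R (- (\<i> *s sg (e1 r)))) = - sg (\<Sum>r\<in>UNIV. sg z $ r *s e1 r)"
      by (simp only: sg_sum sum_negf)
    then show ?thesis unfolding sum_e1 by simp
  qed
  have ZpL: "linear (Zp :: 'n cv \<Rightarrow> 'n mat2)" by (rule linearI) simp_all
  have "(\<Sum>r\<in>UNIV. killing Z (Np (e1 r)) *\<^sub>R Zp (- sg (e1 r)) + killing Z (Np (\<i> *s e1 r)) *\<^sub>R Zp (- (\<i> *s sg (e1 r))))
     = CC TYPE('n) *\<^sub>R Zp (\<Sum>r\<in>UNIV. Re (dt (sg z) (e1 r)) *\<^sub>R (- sg (e1 r)) + Re (dt (sg z) (\<i> *s e1 r)) *\<^sub>R (- (\<i> *s sg (e1 r))))"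
    unfolding k linear_sum[OF ZpL] linear_add[OF ZpL] linear_cmul[OF ZpL] scaleR_sum_right scaleR_add_right scaleR_scaleR ..
  also have "\<dots> = CC TYPE('n) *\<^sub>R Zp z" unfolding zs ..
  finally show ?thesis unfolding k' unfolding Z by (simp only: scaleR_add_right scaleR_scaleR)
qed

lemma dual_expand:
  assumes d: "dual_bases B Z" and W: "W \<in> l_minus"
  shows "W = (\<Sum>Y\<in>B. killing (Z Y) W *\<^sub>R Y)" "finite B"
proof -
  show fin: "finite B" using d by (auto simp: dual_bases_def intro: independent_imp_finite)
  have "W \<in> span B" using d W by (simp add: dual_bases_def)
  then obtain u where u: "W = (\<Sum>Y\<in>B. u Y *\<^sub>R Y)" using span_finite[OF fin] by auto
  have "killing (Z Y) W = u Y" if "Y \<in> B" for Y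
  proof -
    have "killing (Z Y) W = (\<Sum>Y'\<in>B. u Y' * killing (Z Y) Y')"
      unfolding u by (simp add: linear_sum[OF killing_lin(1)] linear_cmul[OF killing_lin(1)])
    also have "\<dots> = (\<Sum>Y'\<in>B. if Y' = Y then u Y' else 0)"
      using d that by (intro sum.cong) (auto simp: dual_bases_def)
    finally show ?thesis using fin that by simp
  qed
  then show "W = (\<Sum>Y\<in>B. killing (Z Y) W *\<^sub>R Y)" using u by (metis (mono_tags, lifting) sum.cong)
qed

text \<open>
  A sum over dual bases does not depend on the bases, so it may be computed with unit vectors.  The constant is the
  normalization of the Killing form on them.
\<close>

lemma dual_contract:
  fixes T :: "'n::finite mat2 \<Rightarrow> 'n mat2 \<Rightarrow> 'n mat2"
  assumes d: "dual_bases B Z" and T1: "\<And>Y. linear (\<lambda>Z. T Z Y)" and T2: "\<And>Z. linear (T Z)"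
  shows "CC TYPE('n) *\<^sub>R (\<Sum>Y\<in>B. T (Z Y) Y) = ct (\<lambda>z y. T (Zp z) (Np y)) + 2 *\<^sub>R T Ep Em"
proof -
  have fin: "finite B" using dual_expand(2)[OF d, of 0] l_minus_bm[of 0 0 0 0 0 0 0 0 0] by (simp add: bm_0)
  have Np: "Np y \<in> l_minus" "Em \<in> l_minus" for y :: "'n cv" by (simp_all add: l_minus_bm)
  have x: "(\<Sum>Y\<in>B. killing (Z Y) W *\<^sub>R T V Y) = T V W" if "W \<in> l_minus" for V W
  proof -
    have "T V W = T V (\<Sum>Y\<in>B. killing (Z Y) W *\<^sub>R Y)" using dual_expand(1)[OF d that] by simp
    then show ?thesis by (simp add: linear_sum[OF T2] linear_cmul[OF T2])
  qed
  have "CC TYPE('n) *\<^sub>R (\<Sum>Y\<in>B. T (Z Y) Y) = (\<Sum>Y\<in>B. T (CC TYPE('n) *\<^sub>R Z Y) Y)"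
    by (simp only: scaleR_sum_right linear_cmul[OF T1])
  also have "\<dots> = (\<Sum>Y\<in>B. (\<Sum>r\<in>UNIV. killing (Z Y) (Np (e1 r)) *\<^sub>R T (Zp (- sg (e1 r))) Y + killing (Z Y) (Np (\<i> *s e1 r)) *\<^sub>R T (Zp (- (\<i> *s sg (e1 r)))) Y) + (2 * killing (Z Y) Em) *\<^sub>R T Ep Y)"
  proof (rule sum.cong[OF refl])
    fix Y assume "Y \<in> B"
    then have "Z Y \<in> p_plus" using d by (auto simp: dual_bases_def)
    then show "T (CC TYPE('n) *\<^sub>R Z Y) Y = (\<Sum>r\<in>UNIV. killing (Z Y) (Np (e1 r)) *\<^sub>R T (Zp (- sg (e1 r))) Y + killing (Z Y) (Np (\<i> *s e1 r)) *\<^sub>R T (Zp (- (\<i> *s sg (e1 r)))) Y) + (2 * killing (Z Y) Em) *\<^sub>R T Ep Y"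
      by (subst p_plus_expand) (simp_all only: linear_sum[OF T1] linear_add[OF T1] linear_cmul[OF T1])
  qed
  also have "\<dots> = (\<Sum>r\<in>UNIV. (\<Sum>Y\<in>B. killing (Z Y) (Np (e1 r)) *\<^sub>R T (Zp (- sg (e1 r))) Y) + (\<Sum>Y\<in>B. killing (Z Y) (Np (\<i> *s e1 r)) *\<^sub>R T (Zp (- (\<i> *s sg (e1 r)))) Y))
      + 2 *\<^sub>R (\<Sum>Y\<in>B. killing (Z Y) Em *\<^sub>R T Ep Y)"
    by (subst sum.distrib, subst sum.swap) (simp only: sum.distrib scaleR_sum_right scaleR_scaleR)
  finally show ?thesis unfolding x[OF Np(1)] x[OF Np(2)] ct_def .
qed

lemma dual_exists: "\<exists>B Z. dual_bases B (Z :: 'n::finite mat2 \<Rightarrow> 'n mat2)"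
proof -
  define bf :: "(('n + 'n) \<times> bool) option \<Rightarrow> 'n mat2" where
    "bf i = (case i of None \<Rightarrow> Em | Some (r, b) \<Rightarrow> Np (if b then \<i> *s e1 r else e1 r))" for i
  define zf :: "(('n + 'n) \<times> bool) option \<Rightarrow> 'n mat2" where
    "zf i = (case i of None \<Rightarrow> (2 / CC TYPE('n)) *\<^sub>R Ep | Some (r, b) \<Rightarrow> (1 / CC TYPE('n)) *\<^sub>R Zp (if b then - (\<i> *s sg (e1 r)) else - sg (e1 r)))" for i
  have k: "killing (zf i) (bf j) = (if i = j then 1 else 0)" for i j
  proof -
    have sc: "killing (t *\<^sub>R A) B = t * killing A B" for t A and B :: "'n mat2" using linear_cmul[OF killing_lin(2)] by simp
    have kz: "killing (Zp z) (Np y) = CC TYPE('n) * Re (dt (sg z) y)" for z y :: "'n cv" using killing_Zp[of z 0 y 0] by simp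
    have k1: "killing (Zp z) (Em :: 'n mat2) = 0" for z :: "'n cv" using killing_Zp[of z 0 0 1] by simp
    have k2: "killing Ep (Np y) = 0" for y :: "'n cv" using killing_Zp[of 0 1 y 0] by simp
    have k3: "2 * killing Ep (Em :: 'n mat2) = CC TYPE('n)" using killing_Zp[where z="0 :: 'n cv" and c=1 and y=0 and d=1] by simp
    have cc: "(1 / CC TYPE('n)) * (CC TYPE('n) * t) = t" for t by simp
    have a: "killing (zf (Some (r, b))) (bf (Some (r', b'))) =
      Re (dt (sg (if b then - (\<i> *s sg (e1 r)) else - sg (e1 r))) (if b' then \<i> *s e1 r' else e1 r'))" for r r' b b'
      by (simp only: zf_def bf_def option.case prod.case sc kz cc)
    have a': "Re (dt (sg (if b then - (\<i> *s sg (e1 r)) else - sg (e1 r))) (if b' then \<i> *s e1 r' else e1 r')) = (if r = r' \<and> b = b' then 1 else 0)"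
      for r r' :: "'n + 'n" and b b' by (cases b; cases b'; simp; simp add: axis_def)
    have b: "killing (zf (Some (r, b))) (bf None) = 0" "killing (zf None) (bf (Some (r, b))) = 0" for r b
      by (simp_all only: zf_def bf_def option.case prod.case sc k1 k2 mult_zero_right)
    have b0: "killing (zf None) (bf None) = 1"
      unfolding zf_def bf_def option.case sc using k3 by simp
    show ?thesis
    proof (cases i)
      case None then show ?thesis using b(2) b0 by (cases j) auto
    next
      case (Some p)
      obtain r c where "p = (r, c)" by (cases p)
      with Some show ?thesis using b(1)[of r c] a[unfolded a', of r c] by (cases j) (auto split: if_splits)
    qed
  qed
  have inj: "inj bf"
  proof (rule injI)
    fix i j assume "bf i = bf j"
    then show "i = j" using k[of i i] k[of i j] by (auto split: if_splits)
  qed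
  let ?B = "range bf" and ?Z = "zf \<circ> inv bf"
  have Z: "?Z (bf i) = zf i" for i using inj by simp
  have "dual_bases ?B ?Z" unfolding dual_bases_def
  proof (intro conjI)
    show sub: "?B \<subseteq> l_minus" by (auto simp: bf_def l_minus_bm split: option.split)
    show "?Z ` ?B \<subseteq> p_plus" using Z by (auto simp: zf_def p_plus_bm split: option.split)
    show "\<forall>X\<in>?B. \<forall>Y\<in>?B. killing (?Z X) Y = (if X = Y then 1 else 0)" using Z k inj by (auto simp: inj_def)
    show "independent ?B"
    proof
      assume "dependent ?B"
      then obtain u v where u: "v \<in> ?B" "u v \<noteq> 0" "(\<Sum>v\<in>?B. u v *\<^sub>R v) = 0" using dependent_finite[of ?B] by auto
      obtain i where v: "v = bf i" using u(1) by auto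
      have "0 = killing (zf i) (\<Sum>v\<in>?B. u v *\<^sub>R v)" unfolding u(3) by (simp add: linear_0[OF killing_lin(1)])
      also have "\<dots> = (\<Sum>v\<in>?B. u v * killing (zf i) v)" by (simp add: linear_sum[OF killing_lin(1)] linear_cmul[OF killing_lin(1)])
      also have "\<dots> = (\<Sum>j\<in>UNIV. u (bf j) * killing (zf i) (bf j))" using inj by (simp add: sum.reindex)
      also have "\<dots> = (\<Sum>j\<in>UNIV. if i = j then u (bf j) else 0)" unfolding k by (rule sum.cong) auto
      also have "\<dots> = u v" by (simp add: v)
      finally show False using u(2) by simp
    qed
    show "span ?B = l_minus"
    proof
      have "subspace (l_minus :: 'n mat2 set)"
      proof (rule subspaceI)
        show "(0 :: 'n mat2) \<in> l_minus" using l_minus_bm[of 0 "0 :: 'n cv" 0 0 0 0 0 0 0] by (simp add: bm_0)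
      next
        fix A B :: "'n mat2" assume "A \<in> l_minus" "B \<in> l_minus"
        then show "A + B \<in> l_minus" by (elim l_minus_cases) (simp add: l_minus_bm scaleR_complex)
      next
        fix A :: "'n mat2" and c assume "A \<in> l_minus"
        then show "c *\<^sub>R A \<in> l_minus" by (elim l_minus_cases) (simp add: l_minus_bm scaleR_complex)
      qed
      then show "span ?B \<subseteq> l_minus" by (rule span_minimal[OF sub])
      show "l_minus \<subseteq> span ?B"
      proof
        fix W :: "'n mat2" assume "W \<in> l_minus"
        then obtain y t where W: "W = Np y + t *\<^sub>R Em" by (rule l_minus_cases)
        have NpL: "linear (Np :: 'n cv \<Rightarrow> 'n mat2)" by (rule linearI) simp_all
        have "y = (\<Sum>r\<in>UNIV. Re (y $ r) *\<^sub>R e1 r + Im (y $ r) *\<^sub>R (\<i> *s e1 r))"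
        proof -
          have "Re t *\<^sub>R e1 r + Im t *\<^sub>R (\<i> *s e1 r) = t *s (e1 r :: 'n cv)" for t r
            by (simp add: vec_eq_iff axis_def complex_eq_iff)
          then show ?thesis by (simp add: sum_e1)
        qed
        then have "Np y = (\<Sum>r\<in>UNIV. Re (y $ r) *\<^sub>R Np (e1 r) + Im (y $ r) *\<^sub>R Np (\<i> *s e1 r))"
          by (metis (mono_tags, lifting) linear_sum[OF NpL] linear_add[OF NpL] linear_cmul[OF NpL] sum.cong)
        also have "\<dots> = (\<Sum>r\<in>UNIV. Re (y $ r) *\<^sub>R bf (Some (r, False)) + Im (y $ r) *\<^sub>R bf (Some (r, True)))"
          by (simp add: bf_def)
        also have "\<dots> \<in> span ?B" by (intro span_sum span_add span_scale span_base) auto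
        finally have "Np y \<in> span ?B" .
        moreover have "t *\<^sub>R Em \<in> span ?B"
        proof -
          have "Em = bf None" by (simp add: bf_def)
          then show ?thesis by (metis rangeI span_base span_scale)
        qed
        ultimately show "W \<in> span ?B" unfolding W by (rule span_add)
      qed
    qed
  qed
  then show ?thesis by blast
qed

section \<open>Normality\<close>

text \<open>
  The codifferential condition for \<open>X\<close> of degrees \<open>-1\<close> and \<open>-2\<close>, written as contractions of the curvature.
\<close>

lemma normal_iff:
  fixes \<alpha> :: "'n::finite mat2 \<Rightarrow> 'n mat2"
  assumes k: "\<And>A B. A \<in> su \<Longrightarrow> B \<in> su \<Longrightarrow> kappa \<alpha> A B = Kf K T d A B"
    and K1: "\<And>v. linear (\<lambda>u. K u v)" and K2: "\<And>u. linear (K u)" and T: "linear T" and d: "d \<noteq> 0"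
  shows "normal \<alpha> \<longleftrightarrow> (\<forall>x. ct (\<lambda>z y. br (Zp z) (K x y)) = (2 / d) *\<^sub>R br Ep (T x)) \<and>
     ct K = (2 / d) *\<^sub>R ct (\<lambda>z y. br (Zp z) (T y))"
proof -
  let ?K = "Kf K T d"
  have L1: "linear (\<lambda>A. ?K A B)" for B
    by (rule linearI) (simp_all add: Kf_def linear_add[OF K1] linear_cmul[OF K1] linear_add[OF T] linear_cmul[OF T] scaleR_diff_right scaleR_add_right scaleR_add_left add_divide_distrib)
  have L2: "linear (?K A)" for A
    by (rule linearI) (simp_all add: Kf_def linear_add[OF K2] linear_cmul[OF K2] linear_add[OF T] linear_cmul[OF T] scaleR_diff_right scaleR_add_right scaleR_add_left add_divide_distrib)
  have LT1: "linear (\<lambda>Z. ?K (br Z X) Y)" for X Y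
    by (rule linearI) (simp_all add: br_lin linear_add[OF L1] linear_cmul[OF L1])
  have LT2: "linear (\<lambda>Y. ?K (br Z X) Y)" for X Z by (rule L2)
  have LS1: "linear (\<lambda>Z. br Z (?K X Y))" for X Y by (rule linearI) (simp_all add: br_lin)
  have LS2: "linear (\<lambda>Y. br Z (?K X Y))" for X Z by (rule linearI) (simp_all add: br_lin linear_add[OF L2] linear_cmul[OF L2])
  let ?P = "\<lambda>X. ct (\<lambda>z y. ?K (br (Zp z) X) (Np y)) + 2 *\<^sub>R ?K (br Ep X) Em = 2 *\<^sub>R (ct (\<lambda>z y. br (Zp z) (?K X (Np y))) + 2 *\<^sub>R br Ep (?K X Em))"
  have sums: "((\<Sum>Y\<in>B. kappa \<alpha> (br (Z Y) X) Y) = 2 *\<^sub>R (\<Sum>Y\<in>B. br (Z Y) (kappa \<alpha> X Y))) \<longleftrightarrow> ?P X"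
    if dB: "dual_bases B Z" and X: "X \<in> su" for B Z X
  proof -
    have Bs: "Y \<in> su" "Z Y \<in> su" if "Y \<in> B" for Y
      using dB that by (auto simp: dual_bases_def l_minus_def p_plus_def su_filt_def)
    have 1: "(\<Sum>Y\<in>B. kappa \<alpha> (br (Z Y) X) Y) = (\<Sum>Y\<in>B. ?K (br (Z Y) X) Y)"
      by (rule sum.cong[OF refl]) (simp add: k Bs su_br X)
    have 2: "(\<Sum>Y\<in>B. br (Z Y) (kappa \<alpha> X Y)) = (\<Sum>Y\<in>B. br (Z Y) (?K X Y))"
      by (rule sum.cong[OF refl]) (simp add: k Bs X)
    have c: "a = b \<longleftrightarrow> CC TYPE('n) *\<^sub>R a = CC TYPE('n) *\<^sub>R b" for a b :: "'n mat2" by simp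
    have "(\<Sum>Y\<in>B. kappa \<alpha> (br (Z Y) X) Y) = 2 *\<^sub>R (\<Sum>Y\<in>B. br (Z Y) (kappa \<alpha> X Y)) \<longleftrightarrow>
       CC TYPE('n) *\<^sub>R (\<Sum>Y\<in>B. ?K (br (Z Y) X) Y) = 2 *\<^sub>R (CC TYPE('n) *\<^sub>R (\<Sum>Y\<in>B. br (Z Y) (?K X Y)))"
      unfolding 1 2 by (subst c) (simp only: scaleR_left_commute)
    also have "\<dots> \<longleftrightarrow> ?P X"
      unfolding dual_contract[OF dB LT1 LT2] dual_contract[OF dB LS1 LS2] ..
    finally show ?thesis .
  qed
  have n: "normal \<alpha> \<longleftrightarrow> (\<forall>X\<in>su. ?P X)"
    unfolding normal_def using sums dual_exists[where 'n='n] by meson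
  have T0: "T 0 = 0" and K0: "K 0 v = 0" "K u 0 = 0" for u v
    using linear_0[OF T] linear_0[OF K1] linear_0[OF K2] by auto
  have P: "?P X \<longleftrightarrow> t *\<^sub>R ct K = 2 *\<^sub>R (ct (\<lambda>z y. br (Zp z) (K x y)) + (t / d) *\<^sub>R ct (\<lambda>z y. br (Zp z) (T y)) - (2 / d) *\<^sub>R br Ep (T x))"
    if X: "X = bm a (sg z0) c0 x N z0 (complex_of_real t) (- sg x) f0" for X a z0 c0 x N t f0
  proof -
    have c: "col0 (br (Zp z) X) = t *\<^sub>R z" "br (Zp z) X $ Inr None $ Inl None = 0" for z
      unfolding X br_def by (simp_all add: vec_eq_iff scaleR_complex)
    have c': "col0 (br Ep X) = 0" "br Ep X $ Inr None $ Inl None = 0" unfolding X br_def by simp_all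
    have 1: "?K (br (Zp z) X) (Np y) = t *\<^sub>R K z y" for z y unfolding Kf_def c by (simp add: linear_cmul[OF K1] T0)
    have 2: "?K (br Ep X) Em = 0" unfolding Kf_def c' by (simp add: K0 T0)
    have 3: "?K X (Np y) = K x y + (t / d) *\<^sub>R T y" for y unfolding Kf_def X by (simp add: T0)
    have 4: "?K X Em = - (1 / d) *\<^sub>R T x" unfolding Kf_def X by (simp add: K0 T0)
    have l: "linear (\<lambda>A :: 'n mat2. t *\<^sub>R A)" "linear (\<lambda>A :: 'n mat2. (t/d) *\<^sub>R A)" by (simp_all add: linear_iff scaleR_add_right)
    have 5: "2 *\<^sub>R (- (1 / d) *\<^sub>R br Ep (T x)) = - ((2 / d) *\<^sub>R br Ep (T x))" by simp
    have a: "ct (\<lambda>z y. t *\<^sub>R K z y) = t *\<^sub>R ct K" "ct (\<lambda>z y. (t / d) *\<^sub>R br (Zp z) (T y)) = (t / d) *\<^sub>R ct (\<lambda>z y. br (Zp z) (T y))"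
      by (rule ct_linear[OF l(1)], rule ct_linear[OF l(2)])
    show ?thesis unfolding 1 2 3 4 br_lin ct_lin 5 a by simp
  qed
  show ?thesis
  proof (intro iffI conjI allI)
    assume nn: "normal \<alpha>"
    fix x :: "'n cv"
    have "Np x \<in> su" by (simp add: su_bm trace_def)
    then have "?P (Np x)" using nn n by blast
    then show "ct (\<lambda>z y. br (Zp z) (K x y)) = (2 / d) *\<^sub>R br Ep (T x)"
      using P[of "Np x" 0 0 0 x 0 0 0] by simp
  next
    assume nn: "normal \<alpha>"
    have "(Em :: 'n mat2) \<in> su" by (simp add: su_bm trace_def)
    then have "?P Em" using nn n by blast
    then have "ct K = 2 *\<^sub>R (ct (\<lambda>z y. br (Zp z) (K 0 y)) + (1 / d) *\<^sub>R ct (\<lambda>z y. br (Zp z) (T y)) - (2 / d) *\<^sub>R br Ep (T 0))"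
      using P[of Em 0 0 0 0 0 1 0] by simp
    then show "ct K = (2 / d) *\<^sub>R ct (\<lambda>z y. br (Zp z) (T y))"
      by (simp add: K0 T0 br_def ct_def)
  next
    assume *: "(\<forall>x. ct (\<lambda>z y. br (Zp z) (K x y)) = (2 / d) *\<^sub>R br Ep (T x)) \<and> ct K = (2 / d) *\<^sub>R ct (\<lambda>z y. br (Zp z) (T y))"
    show "normal \<alpha>" unfolding n
    proof
      fix X :: "'n mat2" assume "X \<in> su"
      then obtain a z c x M \<delta> where X: "X = bm a (sg z) c x M z \<delta> (- sg x) (- cnj a)" and "cnj \<delta> = \<delta>"
        by (rule su_cases) blast
      then have "X = bm a (sg z) c x M z (complex_of_real (Re \<delta>)) (- sg x) (- cnj a)" by (simp add: complex_eq_iff)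
      note p = P[OF this]
      from * have NA: "\<And>x. ct (\<lambda>z y. br (Zp z) (K x y)) = (2 / d) *\<^sub>R br Ep (T x)"
        and NB: "ct K = (2 / d) *\<^sub>R ct (\<lambda>z y. br (Zp z) (T y))" by blast+
      show "?P X" unfolding p NA NB by simp
    qed
  qed
qed

text \<open>
  The middle block of the curvature is always of this form, a combination of four rank-two terms and a scalar matrix; all
  contractions are linear in the coefficients.
\<close>

definition combo :: "complex \<Rightarrow> complex \<Rightarrow> complex \<Rightarrow> complex \<Rightarrow> complex \<Rightarrow> 'n::finite cv \<Rightarrow> 'n cv \<Rightarrow> complex^('n+'n)^('n+'n)" where
  "combo p1 p2 p3 p4 \<mu> u v = mat p1 ** Q1 u v + mat p2 ** Q2 u v + mat p3 ** Q3 u v + mat p4 ** Q4 u v + mat (wf u v * \<mu>)"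

lemma KK_eq:
  assumes D: "D \<noteq> 0" and U: "\<And>x. U x = qop U1 U2 x"
  shows "KK D (qop f g) U a \<mu> c D u v = (1/D) *\<^sub>R bm (wf u v * (D * cnj f + a)) 0 (wf u v * (D * nrm2 f g + c)) 0
    (combo (D * cnj f - D * f + U1) (- cnj U1) (cnj U2 - D * cnj g) (U2 - D * g) \<mu> u v) 0 0 0 (- cnj (wf u v * (D * cnj f + a)))"
proof -
  have D': "complex_of_real D \<noteq> 0" using D by simp
  have 1: "dt (sg (qop f g u)) v - dt (sg (qop f g v)) u = wf u v * cnj f"
    by (simp add: qop_def wf_def dt_commute[of v u] algebra_simps)
  have r: "cnj (wf u v) = wf u v" by (rule wf_real)
  show ?thesis unfolding KK_def Let_def 1 wf_qop bm_simps bm_eq_iff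
  proof (intro conjI)
    show "outer u (sg (qop f g v)) - outer (qop f g u) (sg v) - outer v (sg (qop f g u)) + outer (qop f g v) (sg u) + mat (wf u v / D * \<mu>)
        - (1/D) *\<^sub>R (outer (sg (U u)) v - outer (U u) (sg v) - outer (sg (U v)) u + outer (U v) (sg u)) =
      (1/D) *\<^sub>R combo (D * cnj f - D * f + U1) (- cnj U1) (cnj U2 - D * cnj g) (U2 - D * g) \<mu> u v"
      unfolding combo_def Q1_def Q2_def Q3_def Q4_def U
      using D' by (simp add: vec_eq_iff qop_def mat_nth scaleR_complex field_simps)
  qed (use D' r in \<open>simp_all add: scaleR_complex field_simps\<close>)
qed

lemma TT_eq:
  assumes U: "\<And>x. U x = qop U1 U2 x"
  shows "TT (qop f g) U a \<mu> c d u = (let w = qop (\<mu> - a + U1 - d * f) (U2 - d * g) u;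
      z = qop ((\<mu> + cnj a) * f - c + (f * U1 - g * cnj U2)) ((\<mu> + cnj a) * g + (f * U2 + g * cnj U1)) u in bm 0 (sg z) 0 w 0 z 0 (- sg w) 0)"
  unfolding TT_def Let_def U qop_qop bm_eq_iff
  by (auto simp: qop_def vec_eq_iff scaleR_complex algebra_simps)

lemma ct_smult: "ct (\<lambda>z y. p *s f z y) = p *s (ct f :: complex^'i)"
  by (rule ct_linear) (simp add: linear_iff vec_eq_iff algebra_simps)

lemma ct_combo: "ct (\<lambda>z y. combo p1 p2 p3 p4 \<mu> x y *v z) =
    qop (- 4 * of_nat CARD('n) * p1 + 2 * p2 + 2 * \<mu>) (p4 * (2 - 4 * of_nat CARD('n))) (x :: 'n::finite cv)"
proof -
  have m: "(mat p ** M) *v z = p *s (M *v z)" for p and M :: "complex^('n+'n)^('n+'n)" and z by (simp flip: matrix_vector_mul_assoc)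
  have w: "mat (wf x y * \<mu>) *v z = \<mu> *s (wf x y *s z)" for y z :: "'n cv" by (simp add: vector_smult_assoc mult.commute)
  show ?thesis unfolding combo_def mv_lin m w ct_lin ct_smult ct_Q1 ct_Q2 ct_Q3 ct_Q4 ct_wf_z
    by (simp add: qop_def vec_eq_iff algebra_simps)
qed

text \<open>
  The combination that is free of traces; the curvature of a normal extension on vectors of degree \<open>-1\<close> reduces to it.
\<close>

definition Sc :: "real \<Rightarrow> 'n::finite cv \<Rightarrow> 'n cv \<Rightarrow> complex^('n+'n)^('n+'n)" where
  "Sc \<nu> = combo (- \<i> * \<nu>) (- \<i> * (2 * real CARD('n) + 1) * \<nu>) 0 0 (\<i> * \<nu>)"

text \<open>
  For these values of the parameters only trace-free parts of the curvature are left.  The middle block does not involve \<open>c\<close>, so the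
  last fact is available before \<open>c\<close> is known.
\<close>

lemma curvature_normal_form:
  fixes \<beta> \<gamma> f g :: complex and s \<nu> c :: real
  defines "D \<equiv> nrm2 \<beta> \<gamma>" and "a \<equiv> Complex s (- real CARD('n::finite) * \<nu>)" and "\<mu> \<equiv> \<i> * complex_of_real \<nu>"
  assumes nz: "\<beta> \<noteq> 0 \<or> \<gamma> \<noteq> 0" and f: "D * f = Complex (- s) (- real CARD('n) * \<nu>)" and g: "D * g = rho \<beta> \<gamma>"
    and \<tau>: "tau \<beta> \<gamma> = (2 * real CARD('n) + 1) * \<nu>"
  shows "D * c = (real CARD('n) + 1) * (3 * real CARD('n) + 1) * \<nu>\<^sup>2 - 1 - s\<^sup>2 \<Longrightarrow>
       KK D (qop f g) (Uq \<beta> \<gamma>) a \<mu> c D u v = (1/D) *\<^sub>R kb (Sc \<nu> u (v :: 'n cv))"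
    and "D * c = (real CARD('n) + 1) * (3 * real CARD('n) + 1) * \<nu>\<^sup>2 - 1 - s\<^sup>2 \<Longrightarrow>
       TT (qop f g) (Uq \<beta> \<gamma>) a \<mu> c D u = (1/D) *\<^sub>R Zp (qop 0 (2 * (real CARD('n) + 1) * \<i> * \<nu> * rho \<beta> \<gamma>) (u :: 'n cv))"
    and "KK D (qop f g) (Uq \<beta> \<gamma>) a \<mu> c D u v $ mid i $ mid j = (1/D) *\<^sub>R Sc \<nu> u (v :: 'n cv) $ i $ j"
proof -
  let ?n = "real CARD('n)" and ?t = "tau \<beta> \<gamma>" and ?r = "rho \<beta> \<gamma>"
  have D: "D > 0" unfolding D_def by (rule nrm2_pos[OF nz])
  then have D': "complex_of_real D \<noteq> 0" "D \<noteq> 0" by auto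
  have U: "Uq \<beta> \<gamma> x = qop (- \<i> * ?t) ?r x" for x :: "'n cv" by (simp add: Uq_def)
  have cf: "D * cnj f = Complex (- s) (?n * \<nu>)" using arg_cong[OF f, of cnj] by (simp add: complex_eq_iff)
  have tr: "?t\<^sup>2 + (cmod ?r)\<^sup>2 = 1" by (rule tau_rho[OF nz])
  have A: "D * cnj f + a = 0" unfolding cf a_def by (simp add: complex_eq_iff)
  have p1: "D * cnj f - D * f + (- \<i> * ?t) = - \<i> * \<nu>" unfolding cf f \<tau> by (simp add: complex_eq_iff algebra_simps)
  have p2: "- cnj (- \<i> * complex_of_real ?t) = - \<i> * (2 * ?n + 1) * \<nu>" unfolding \<tau> by (simp add: complex_eq_iff algebra_simps)
  have p3: "cnj ?r - D * cnj g = 0" using arg_cong[OF g, of cnj] by simp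
  have p4: "?r - D * g = 0" using g by simp
  have nf: "D\<^sup>2 * nrm2 f g = s\<^sup>2 + (?n * \<nu>)\<^sup>2 + (cmod ?r)\<^sup>2"
  proof -
    have "D\<^sup>2 * nrm2 f g = (cmod (D * f))\<^sup>2 + (cmod (D * g))\<^sup>2" using D by (simp add: nrm2_def norm_mult power_mult_distrib algebra_simps)
    then show ?thesis unfolding f g by (simp add: cmod_power2)
  qed
  have KQ: "KK D (qop f g) (Uq \<beta> \<gamma>) a \<mu> c D u v = (1/D) *\<^sub>R bm 0 0 (wf u v * (D * nrm2 f g + c)) 0 (Sc \<nu> u v) 0 0 0 0"
    unfolding KK_eq[OF D'(2) U] A p1 p2 p3 p4 Sc_def \<mu>_def by simp
  then show "KK D (qop f g) (Uq \<beta> \<gamma>) a \<mu> c D u v $ mid i $ mid j = (1/D) *\<^sub>R Sc \<nu> u v $ i $ j" by simp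
  assume c: "D * c = (?n + 1) * (3 * ?n + 1) * \<nu>\<^sup>2 - 1 - s\<^sup>2"
  have "D * (D * nrm2 f g + c) = 0"
    using nf c tr unfolding \<tau> by (simp add: power2_eq_square algebra_simps)
  then have k2: "D * nrm2 f g + c = 0" using D' by simp
  show "KK D (qop f g) (Uq \<beta> \<gamma>) a \<mu> c D u v = (1/D) *\<^sub>R kb (Sc \<nu> u v)"
    unfolding KQ using k2 by (simp flip: of_real_mult of_real_add)
  have w: "\<mu> - a + (- \<i> * ?t) - D * f = 0" unfolding \<mu>_def a_def f \<tau> by (simp add: complex_eq_iff algebra_simps)
  have "D * ((\<mu> + cnj a) * f - c + (f * (- \<i> * ?t) - g * cnj ?r)) = (\<mu> + cnj a) * (D * f) - D * c + ((D * f) * (- \<i> * ?t) - (D * g) * cnj ?r)"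
    by (simp add: algebra_simps)
  also have "\<dots> = 0"
  proof -
    have "?r * cnj ?r = complex_of_real ((cmod ?r)\<^sup>2)" by (simp only: complex_norm_square)
    also have "(cmod ?r)\<^sup>2 = 1 - ?t\<^sup>2" using tr by simp
    finally have rr: "?r * cnj ?r = complex_of_real (1 - ?t\<^sup>2)" .
    have cc: "complex_of_real D * complex_of_real c = complex_of_real ((?n + 1) * (3 * ?n + 1) * \<nu>\<^sup>2 - 1 - s\<^sup>2)"
      unfolding of_real_mult[symmetric] c ..
    show ?thesis unfolding f g rr cc \<mu>_def a_def \<tau> using c by (simp add: complex_eq_iff power2_eq_square algebra_simps)
  qed
  finally have m1: "(\<mu> + cnj a) * f - c + (f * (- \<i> * ?t) - g * cnj ?r) = 0" using D' by simp
  have "D * ((\<mu> + cnj a) * g + (f * ?r + g * cnj (- \<i> * ?t))) = (\<mu> + cnj a) * (D * g) + ((D * f) * ?r + (D * g) * cnj (- \<i> * ?t))"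
    by (simp add: algebra_simps)
  also have "\<dots> = 2 * (?n + 1) * \<i> * \<nu> * ?r" unfolding f g \<mu>_def a_def \<tau>
    by (simp add: complex_eq_iff algebra_simps)
  finally have m2: "(\<mu> + cnj a) * g + (f * ?r + g * cnj (- \<i> * ?t)) = (1 / D) * (2 * (?n + 1) * \<i> * \<nu> * ?r)"
    using D' by (simp add: field_simps)
  show "TT (qop f g) (Uq \<beta> \<gamma>) a \<mu> c D u = (1/D) *\<^sub>R Zp (qop 0 (2 * (?n + 1) * \<i> * \<nu> * ?r) u)"
    unfolding TT_eq[OF U] w p4 m1 m2 Let_def
    by (simp add: qop_def) (simp add: vec_eq_iff scaleR_complex)
qed

definition colI :: "'n::finite mat2 \<Rightarrow> 'n cv" where "colI X = (\<chi> i. X $ mid i $ Inr None)"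

lemma colI_lin: "linear colI" "colI (bm a y c x M z d w f) = z"
  by (auto intro!: linearI simp: colI_def vec_eq_iff)

lemma entry_lin: "linear (\<lambda>X :: 'n::finite mat2. X $ r $ t)"
  by (rule linearI) simp_all

lemma ct_scale: "ct (\<lambda>z y. r *\<^sub>R (A * h z y)) = r *\<^sub>R (A * ct h)" for A :: complex
  by (rule ct_linear) (simp add: linear_iff scaleR_add_right algebra_simps)

text \<open>
  The vanishing of the traces is a triangular system in the parameters of degrees \<open>0\<close>, \<open>1\<close> and \<open>2\<close>, which it determines up
  to \<open>s\<close>.
\<close>

lemma normal_forces:
  fixes \<beta> \<gamma> f g :: complex and s \<nu> c :: real
  defines "D \<equiv> nrm2 \<beta> \<gamma>" and "a \<equiv> Complex s (- real CARD('n::finite) * \<nu>)" and "\<mu> \<equiv> \<i> * complex_of_real \<nu>"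
  defines "K \<equiv> KK D (qop f g) (Uq \<beta> \<gamma>) a \<mu> c D" and "T \<equiv> TT (qop f g) (Uq \<beta> \<gamma>) a \<mu> c D :: 'n cv \<Rightarrow> _"
  assumes nz: "\<beta> \<noteq> 0 \<or> \<gamma> \<noteq> 0"
    and NA: "\<And>x. ct (\<lambda>z y. br (Zp z) (K x y)) = (2 / D) *\<^sub>R br Ep (T x)"
    and NB: "ct K = (2 / D) *\<^sub>R ct (\<lambda>z y. br (Zp z) (T y))"
  shows "D * f = Complex (- s) (- real CARD('n) * \<nu>)" "D * g = rho \<beta> \<gamma>" "tau \<beta> \<gamma> = (2 * real CARD('n) + 1) * \<nu>"
    "D * c = (real CARD('n) + 1) * (3 * real CARD('n) + 1) * \<nu>\<^sup>2 - 1 - s\<^sup>2"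
proof -
  let ?n = "real CARD('n)" and ?t = "tau \<beta> \<gamma>" and ?r = "rho \<beta> \<gamma>"
  let ?U1 = "- \<i> * complex_of_real ?t"
  let ?A = "D * cnj f + a" and ?p1 = "D * cnj f - D * f + ?U1" and ?p2 = "- cnj ?U1" and ?p3 = "cnj ?r - D * cnj g" and ?p4 = "?r - D * g"
  let ?W = "\<mu> - a + ?U1 - D * f" and ?m1 = "(\<mu> + cnj a) * f - c + (f * ?U1 - g * cnj ?r)" and ?m2 = "(\<mu> + cnj a) * g + (f * ?r + g * cnj ?U1)"
  have n0: "?n > 0" by simp
  have D: "D > 0" unfolding D_def by (rule nrm2_pos[OF nz])
  then have D': "complex_of_real D \<noteq> 0" "D \<noteq> 0" by auto
  have U: "Uq \<beta> \<gamma> x = qop ?U1 ?r x" for x :: "'n cv" by (simp add: Uq_def)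
  have tr: "?t\<^sup>2 + (cmod ?r)\<^sup>2 = 1" by (rule tau_rho[OF nz])
  have K: "K u v = (1/D) *\<^sub>R bm (wf u v * ?A) 0 (wf u v * (D * nrm2 f g + c)) 0 (combo ?p1 ?p2 ?p3 ?p4 \<mu> u v) 0 0 0 (- cnj (wf u v * ?A))" for u v
    unfolding K_def by (rule KK_eq[OF D'(2) U])
  have T: "T u = bm 0 (sg (qop ?m1 ?m2 u)) 0 (qop ?W ?p4 u) 0 (qop ?m1 ?m2 u) 0 (- sg (qop ?W ?p4 u)) 0" for u
    unfolding T_def TT_eq[OF U] Let_def ..
  have cA: "cnj (wf u v * ?A) = (D * f + cnj a) * wf u v" for u v :: "'n cv" using wf_real[of u v] by simp
  have ca: "colI (br (Zp z) (K x y)) = (- 1/D) *\<^sub>R ((D * f + cnj a) *s (wf x y *s z) + combo ?p1 ?p2 ?p3 ?p4 \<mu> x y *v z)" for x y z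
    unfolding K cA br_lin br_def[of "Zp z" "bm _ _ _ _ _ _ _ _ _"] bm_mult
    by (simp add: linear_cmul[OF colI_lin(1)] colI_lin(2) vec_eq_iff scaleR_complex algebra_simps)
  have h: "(- 1/D) *\<^sub>R ((D * f + cnj a) *s (2 *s x) + qop (- 4 * of_nat CARD('n) * ?p1 + 2 * ?p2 + 2 * \<mu>) (?p4 * (2 - 4 * of_nat CARD('n))) x)
       = (2/D) *\<^sub>R (- qop ?W ?p4 x)" for x :: "'n cv"
  proof -
    have "ct (\<lambda>z y. colI (br (Zp z) (K x y))) = colI ((2 / D) *\<^sub>R br Ep (T x))"
      unfolding ct_linear[OF colI_lin(1)] NA ..
    also have "\<dots> = (2/D) *\<^sub>R (- qop ?W ?p4 x)"
      unfolding T br_def bm_mult linear_cmul[OF colI_lin(1)] by (simp add: colI_lin(2))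
    also have "ct (\<lambda>z y. colI (br (Zp z) (K x y))) = (- 1/D) *\<^sub>R ((D * f + cnj a) *s ct (\<lambda>z y. wf x y *s z) + ct (\<lambda>z y. combo ?p1 ?p2 ?p3 ?p4 \<mu> x y *v z))"
      unfolding ca ct_lin[symmetric] ct_smult[symmetric] by (rule ct_linear) (simp add: linear_iff scaleR_add_right scaleR_diff_right)
    finally show ?thesis unfolding ct_wf_z ct_combo .
  qed
  have "(D * f + cnj a) *s (2 *s x) + qop (- 4 * of_nat CARD('n) * ?p1 + 2 * ?p2 + 2 * \<mu>) (?p4 * (2 - 4 * of_nat CARD('n))) x = 2 *\<^sub>R qop ?W ?p4 x" for x :: "'n cv"
  proof -
    have "(- D) *\<^sub>R ((- 1/D) *\<^sub>R v) = v" "(- D) *\<^sub>R ((2/D) *\<^sub>R (- v)) = 2 *\<^sub>R v" for v :: "'n cv" using D'(2) by simp_all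
    then show ?thesis using arg_cong[OF h[of x], of "\<lambda>v. (- D) *\<^sub>R v"] by (simp only:)
  qed
  then have "\<forall>x :: 'n cv. qop (2 * (D * f + cnj a) - 4 * of_nat CARD('n) * ?p1 + 2 * ?p2 + 2 * \<mu>) (?p4 * (2 - 4 * of_nat CARD('n))) x = qop (2 * ?W) (2 * ?p4) x"
    by (simp add: qop_def vec_eq_iff scaleR_complex algebra_simps)
  then have e1: "2 * (D * f + cnj a) - 4 * of_nat CARD('n) * ?p1 + 2 * ?p2 + 2 * \<mu> = 2 * ?W" and e2: "?p4 * (2 - 4 * of_nat CARD('n)) = 2 * ?p4"
    unfolding qop_inj by blast+
  have "?p4 * of_nat CARD('n) = 0" using e2 by (simp add: algebra_simps)
  then have p4: "?p4 = 0" by simp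
  then show g: "D * g = ?r" by simp
  have b00: "br (Zp z) (T y) $ Inl None $ Inl None = dt (sg z) (qop ?W ?p4 y)" "br (Zp z) (T y) $ Inl None $ Inr None = wf z (qop ?m1 ?m2 y)" for z y
    unfolding T br_def by (simp_all add: wf_def dt_commute)
  have "ct (\<lambda>z y. K z y $ Inl None $ Inl None) = (2/D) *\<^sub>R ct (\<lambda>z y. br (Zp z) (T y) $ Inl None $ Inl None)"
    unfolding ct_linear[OF entry_lin] NB by simp
  then have "(1/D) *\<^sub>R (8 * of_nat CARD('n) * ?A) = (2/D) *\<^sub>R (4 * of_nat CARD('n) * ?W)"
  proof -
    have "K z y $ Inl None $ Inl None = (1/D) *\<^sub>R (?A * wf z (qop 1 0 y))" for z y unfolding K by (simp add: qop_def)
    then have "ct (\<lambda>z y. K z y $ Inl None $ Inl None) = (1/D) *\<^sub>R (?A * ct (\<lambda>z (y :: 'n cv). wf z (qop 1 0 y)))"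
      by (simp only: ct_scale)
    then show "ct (\<lambda>z y. K z y $ Inl None $ Inl None) = (2/D) *\<^sub>R ct (\<lambda>z y. br (Zp z) (T y) $ Inl None $ Inl None) \<Longrightarrow> ?thesis"
      unfolding b00 ct_dt ct_wf by (simp add: mult.commute)
  qed
  moreover have "(1/D) *\<^sub>R (8 * of_nat CARD('n) * A) = (8 * of_nat CARD('n) / D) * A" "(2/D) *\<^sub>R (4 * of_nat CARD('n) * A) = (8 * of_nat CARD('n) / D) * A" for A :: complex
    by (simp_all add: scaleR_complex)
  ultimately have "(8 * of_nat CARD('n) / D) * ?A = (8 * of_nat CARD('n) / D) * ?W" by (simp only:)
  moreover have "complex_of_real (8 * real CARD('n) / D) \<noteq> 0" using D' by simp
  ultimately have e3: "?A = ?W" using mult_left_cancel by blast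
  have "ct (\<lambda>z y. K z y $ Inl None $ Inr None) = (2/D) *\<^sub>R ct (\<lambda>z y. br (Zp z) (T y) $ Inl None $ Inr None)"
    unfolding ct_linear[OF entry_lin] NB by simp
  moreover have "ct (\<lambda>z y. K z y $ Inl None $ Inr None) = (1/D) *\<^sub>R ((D * nrm2 f g + c) * complex_of_real (8 * real CARD('n) * Re 1))"
  proof -
    have "K z y $ Inl None $ Inr None = (1/D) *\<^sub>R ((D * nrm2 f g + c) * wf z (qop 1 0 y))" for z y unfolding K by (simp add: qop_def)
    then show ?thesis by (simp only: ct_scale ct_wf)
  qed
  moreover have "ct (\<lambda>z y. br (Zp z) (T y) $ Inl None $ Inr None) = complex_of_real (8 * real CARD('n) * Re ?m1)"
    unfolding b00 ct_wf ..
  ultimately have "(1/D) *\<^sub>R ((D * nrm2 f g + c) * complex_of_real (8 * real CARD('n) * Re 1)) = (2/D) *\<^sub>R complex_of_real (8 * real CARD('n) * Re ?m1)"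
    by (simp only:)
  then have "complex_of_real ((8 * real CARD('n) / D) * (D * nrm2 f g + c)) = complex_of_real ((8 * real CARD('n) / D) * (2 * Re ?m1))"
    unfolding scaleR_complex of_real_mult[symmetric] of_real_add[symmetric] of_real_eq_iff by (simp only: one_complex.sel mult_1_right times_divide_eq_left times_divide_eq_right mult.commute mult.left_commute mult_1)
  then have "(8 * real CARD('n) / D) * (D * nrm2 f g + c) = (8 * real CARD('n) / D) * (2 * Re ?m1)" by (simp only: of_real_eq_iff)
  moreover have "8 * real CARD('n) / D \<noteq> 0" using D' by simp
  ultimately have "D * nrm2 f g + c = 2 * Re ?m1" using mult_left_cancel by blast
  then have e4: "D * nrm2 f g + c = 2 * Re ?m1" .
  define F1 where "F1 = D * f"
  have cF1: "D * cnj f = cnj F1" by (simp add: F1_def)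
  have re: "Re F1 = - s" and t: "?t = (2 * ?n + 1) * \<nu>"
    using e3 unfolding cF1 F1_def[symmetric] a_def \<mu>_def by (simp_all add: complex_eq_iff algebra_simps)
  show "tau \<beta> \<gamma> = (2 * ?n + 1) * \<nu>" by (rule t)
  have "Im F1 * (2 * ?n + 1) = - ?n * ?t"
    using e1 unfolding cF1 F1_def[symmetric] a_def \<mu>_def by (simp add: complex_eq_iff algebra_simps)
  then have "Im F1 * (2 * ?n + 1) = (- ?n * \<nu>) * (2 * ?n + 1)" unfolding t by (simp add: algebra_simps)
  moreover have "2 * ?n + 1 \<noteq> 0" using n0 by linarith
  ultimately have im: "Im F1 = - ?n * \<nu>" using mult_right_cancel by blast
  have F1: "F1 = Complex (- s) (- ?n * \<nu>)" using re im by (simp add: complex_eq_iff)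
  then show f: "D * f = Complex (- s) (- ?n * \<nu>)" by (simp add: F1_def)
  have nf: "D * (D * nrm2 f g) = s\<^sup>2 + (?n * \<nu>)\<^sup>2 + (cmod ?r)\<^sup>2"
  proof -
    have "D * (D * nrm2 f g) = (cmod (D * f))\<^sup>2 + (cmod (D * g))\<^sup>2" using D by (simp add: nrm2_def norm_mult power_mult_distrib power2_eq_square algebra_simps)
    then show ?thesis unfolding f g by (simp add: cmod_power2)
  qed
  have "D * ?m1 = (\<mu> + cnj a) * (D * f) - D * c + ((D * f) * ?U1 - (D * g) * cnj ?r)" by (simp add: algebra_simps)
  also have "\<dots> = (\<mu> + cnj a) * Complex (- s) (- ?n * \<nu>) - D * c + (Complex (- s) (- ?n * \<nu>) * ?U1 - complex_of_real ((cmod ?r)\<^sup>2))"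
    unfolding f g by (simp only: complex_norm_square)
  finally have "Re (D * ?m1) = Re ((\<mu> + cnj a) * Complex (- s) (- ?n * \<nu>) - D * c + (Complex (- s) (- ?n * \<nu>) * ?U1 - complex_of_real ((cmod ?r)\<^sup>2)))" by simp
  then have m: "D * Re ?m1 = - s\<^sup>2 + ?n * (?n + 1) * \<nu>\<^sup>2 - D * c - ?n * \<nu> * ?t - (cmod ?r)\<^sup>2"
    unfolding a_def \<mu>_def by (simp add: power2_eq_square algebra_simps)
  have "D * (D * nrm2 f g) + D * c = 2 * (D * Re ?m1)" using e4 by (metis distrib_left mult.left_commute)
  then show "D * c = (?n + 1) * (3 * ?n + 1) * \<nu>\<^sup>2 - 1 - s\<^sup>2"
    unfolding nf m using tr unfolding t by (simp add: power2_eq_square algebra_simps)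
qed

section \<open>The regular normal extensions\<close>

lemma combo_lin:
  "combo p1 p2 p3 p4 \<mu> (u + u') v = combo p1 p2 p3 p4 \<mu> u v + combo p1 p2 p3 p4 \<mu> u' v"
  "combo p1 p2 p3 p4 \<mu> (r *\<^sub>R u) v = r *\<^sub>R combo p1 p2 p3 p4 \<mu> u v"
  "combo p1 p2 p3 p4 \<mu> v (u + u') = combo p1 p2 p3 p4 \<mu> v u + combo p1 p2 p3 p4 \<mu> v u'"
  "combo p1 p2 p3 p4 \<mu> v (r *\<^sub>R u) = r *\<^sub>R combo p1 p2 p3 p4 \<mu> v u"
  by (simp_all add: combo_def Q1_def Q2_def Q3_def Q4_def vec_eq_iff mat_nth scaleR_complex algebra_simps)

lemma KK_linear:
  assumes D: "D \<noteq> 0" and U: "\<And>x. U x = qop U1 U2 x"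
  shows "linear (\<lambda>u. KK D (qop f g) U a \<mu> c D u v)" "linear (KK D (qop f g) U a \<mu> c D v)"
  unfolding KK_eq[OF D U]
  by (rule linearI; simp add: combo_lin scaleR_complex; simp add: algebra_simps scaleR_add_right add_divide_distrib scaleR_complex)+

lemma TT_linear:
  assumes U: "\<And>x. U x = qop U1 U2 x"
  shows "linear (TT (qop f g) U a \<mu> c d)"
  unfolding TT_eq[OF U] Let_def by (rule linearI) simp_all

lemma wf_ex: "wf (- sg (e1 r)) (e1 r) = 2"
  by (simp add: wf_def)

lemma curv_su: assumes "extension \<alpha>" "X \<in> g_alg" "Y \<in> g_alg" shows "curv \<alpha> X Y \<in> su"
proof -
  have "\<alpha> X \<in> su" "\<alpha> Y \<in> su" "\<alpha> (br X Y) \<in> su" using assms so_br[OF assms(2,3)] by (auto simp: extension_def)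
  then show ?thesis unfolding curv_def by (intro su_lin su_br)
qed

lemma lift_g: assumes "extension \<alpha>" "A \<in> su" shows "lift \<alpha> A \<in> g_alg"
proof -
  have "\<exists>X. X \<in> g_alg \<and> \<alpha> X - A \<in> p_alg" using assms by (auto simp: extension_def)
  then show ?thesis unfolding lift_def by (rule someI2_ex) simp
qed

lemma kappa_su: "extension \<alpha> \<Longrightarrow> A \<in> su \<Longrightarrow> B \<in> su \<Longrightarrow> kappa \<alpha> A B \<in> su"
  unfolding kappa_def by (intro curv_su lift_g)

lemma kappa_formula':
  fixes \<alpha> :: "'n::finite mat2 \<Rightarrow> 'n mat2"
  assumes e: "extension \<alpha>" and a: "\<forall>X\<in>g_alg. \<alpha> X = ext \<beta> \<gamma> f g s \<nu> c d X"
    and nz: "\<beta> \<noteq> 0 \<or> \<gamma> \<noteq> 0" and d: "d \<noteq> 0" and AB: "A \<in> su" "B \<in> su"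
  shows "kappa \<alpha> A B = Kf (KK (nrm2 \<beta> \<gamma>) (qop f g) (Uq \<beta> \<gamma>) (Complex s (- real CARD('n) * \<nu>)) (\<i> * \<nu>) c d)
       (TT (qop f g) (Uq \<beta> \<gamma>) (Complex s (- real CARD('n) * \<nu>)) (\<i> * \<nu>) c d) d A B"
  by (rule kappa_formula[OF e _ nz d AB]) (use a in blast)

lemma normal_iff':
  fixes \<alpha> :: "'n::finite mat2 \<Rightarrow> 'n mat2"
  assumes k: "\<forall>A\<in>su. \<forall>B\<in>su. kappa \<alpha> A B = Kf K T d A B"
    and K1: "\<forall>v. linear (\<lambda>u. K u v)" and K2: "\<forall>u. linear (K u)" and T: "linear T" and d: "d \<noteq> 0"
  shows "normal \<alpha> \<longleftrightarrow> (\<forall>x. ct (\<lambda>z y. br (Zp z) (K x y)) = (2 / d) *\<^sub>R br Ep (T x)) \<and>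
     ct K = (2 / d) *\<^sub>R ct (\<lambda>z y. br (Zp z) (T y))"
  by (rule normal_iff[OF _ _ _ T d]) (use k K1 K2 in blast)+

lemma su_gr_m1_low: assumes "X \<in> su_gr (-1)" shows "X $ Inr None $ Inl None = 0"
proof (rule ccontr)
  assume "X $ Inr None $ Inl None \<noteq> 0"
  then have "block (Inl None :: 'a option + 'a option) - block (Inr None :: 'a option + 'a option) = -1" using assms unfolding su_gr_def by blast
  then show False by simp
qed

text \<open>
  Regularity only concerns the component of the curvature from degrees \<open>(-1,-1)\<close> to degree \<open>-2\<close>, and this compares \<open>d\<close> with the
  scale of the hermitian form pulled back by \<open>qop \<beta> \<gamma>\<close>.
\<close>

lemma regular_iff:
  fixes \<alpha> :: "'n::finite mat2 \<Rightarrow> 'n mat2"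
  assumes e: "extension \<alpha>" and a: "\<forall>X\<in>g_alg. \<alpha> X = ext \<beta> \<gamma> f g s \<nu> c d X"
    and nz: "\<beta> \<noteq> 0 \<or> \<gamma> \<noteq> 0" and d: "d \<noteq> 0"
  shows "regular \<alpha> \<longleftrightarrow> d = nrm2 \<beta> \<gamma>"
proof
  let ?D = "nrm2 \<beta> \<gamma>"
  have D: "?D > 0" by (rule nrm2_pos[OF nz])
  have Np: "Np y \<in> su_gr (-1)" "Np y \<in> su" for y :: "'n cv" by (simp_all add: su_gr_m1_bm su_bm trace_def)
  have low: "kappa \<alpha> A B $ Inr None $ Inl None = wf (col0 A) (col0 B) / ?D * d - wf (col0 A) (col0 B)"
    if "A \<in> su" "B \<in> su" "A $ Inr None $ Inl None = 0" "B $ Inr None $ Inl None = 0" for A B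
    unfolding kappa_formula'[OF e a nz d that(1,2)] Kf_def that(3,4) by (simp add: KK_def Let_def)
  {
    assume r: "regular \<alpha>"
    obtain r :: "'n + 'n" where True by auto
    let ?X = "Np (- sg (e1 r))" and ?Y = "Np (e1 r)"
    have "kappa \<alpha> ?X ?Y \<in> su_filt (-1)" using r Np(1)[of "- sg (e1 r)"] Np(1)[of "e1 r"] unfolding regular_def by fastforce
    then have "kappa \<alpha> ?X ?Y $ Inr None $ Inl None = 0" by (rule_tac A="kappa \<alpha> ?X ?Y" in bm_exists) (auto simp: su_filt_m1_bm)
    then have "complex_of_real (2 / ?D * d - 2) = 0" unfolding low[OF Np(2) Np(2) bm_nth(7) bm_nth(7)] col0_simps wf_ex by simp
    then have "2 / ?D * d - 2 = 0" by (simp only: of_real_eq_0_iff)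
    then show "d = ?D" using D by (simp add: field_simps)
  next
    assume dD: "d = ?D"
    show "regular \<alpha>" unfolding regular_def
    proof (intro ballI)
      fix r t :: int and X Y :: "'n mat2"
      assume *: "r \<in> {-2,-1}" "t \<in> {-2,-1}" "X \<in> su_gr r" "Y \<in> su_gr t"
      then have su: "X \<in> su" "Y \<in> su" by (auto simp: su_gr_def)
      show "kappa \<alpha> X Y \<in> su_filt (r + t + 1)"
      proof (cases "r = -1 \<and> t = -1")
        case False
        then have "r + t + 1 \<le> -2" using * by auto
        then show ?thesis using kappa_su[OF e su] by (simp add: su_filt_low)
      next
        case True
        then have "r = -1" "t = -1" by simp_all
        then have XY: "X $ Inr None $ Inl None = 0" "Y $ Inr None $ Inl None = 0"
          using su_gr_m1_low *(3,4) by (simp_all only:)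
        have "kappa \<alpha> X Y $ Inr None $ Inl None = 0" unfolding low[OF su XY] using dD D by simp
        then have "kappa \<alpha> X Y \<in> su_filt (-1)" using kappa_su[OF e su] by (rule_tac A="kappa \<alpha> X Y" in bm_exists) (simp add: su_filt_m1_bm)
        then show ?thesis using True by simp
      qed
    qed
  }
qed

text \<open>
  The remaining freedom in \<open>s\<close> comes from the unipotent elements of degree \<open>2\<close> in \<open>P\<close>, see \<open>move_s\<close> below.
\<close>

definition nrm_ext :: "complex \<Rightarrow> complex \<Rightarrow> real \<Rightarrow> 'n::finite mat2 \<Rightarrow> 'n mat2" where
  "nrm_ext \<beta> \<gamma> s = (let D = nrm2 \<beta> \<gamma>; n = real CARD('n); \<nu> = tau \<beta> \<gamma> / (2 * n + 1) in
     ext \<beta> \<gamma> (Complex (- s) (- n * \<nu>) / D) (rho \<beta> \<gamma> / D) s \<nu> (((n + 1) * (3 * n + 1) * \<nu>\<^sup>2 - 1 - s\<^sup>2) / D) D)"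

lemma reg_normal_shape:
  fixes \<alpha> :: "'n::finite mat2 \<Rightarrow> 'n mat2"
  assumes r: "reg_normal_ext \<alpha>" and n: "CARD('n) \<ge> 2"
  obtains \<beta> \<gamma> s where "\<beta> \<noteq> 0 \<or> \<gamma> \<noteq> 0" "\<And>X. X \<in> g_alg \<Longrightarrow> \<alpha> X = nrm_ext \<beta> \<gamma> s X"
proof -
  have e: "extension \<alpha>" and reg: "regular \<alpha>" and nor: "normal \<alpha>" using r by (auto simp: reg_normal_ext_def)
  obtain \<beta> \<gamma> f g s \<nu> c d where a: "\<forall>X\<in>g_alg. \<alpha> X = ext \<beta> \<gamma> f g s \<nu> c d X" and nz: "\<beta> \<noteq> 0 \<or> \<gamma> \<noteq> 0" and d: "d \<noteq> 0"
    using ext_shape[OF e n] by metis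
  have D: "nrm2 \<beta> \<gamma> > 0" by (rule nrm2_pos[OF nz])
  have dD: "d = nrm2 \<beta> \<gamma>" using regular_iff[OF e a nz d] reg by simp
  have U: "Uq \<beta> \<gamma> x = qop (- \<i> * complex_of_real (tau \<beta> \<gamma>)) (rho \<beta> \<gamma>) x" for x :: "'n cv" by (simp add: Uq_def)
  have D0: "nrm2 \<beta> \<gamma> \<noteq> 0" using D by simp
  have kf: "\<forall>A\<in>su. \<forall>B\<in>su. kappa \<alpha> A B = Kf (KK (nrm2 \<beta> \<gamma>) (qop f g) (Uq \<beta> \<gamma>) (Complex s (- real CARD('n) * \<nu>)) (\<i> * \<nu>) c (nrm2 \<beta> \<gamma>))
       (TT (qop f g) (Uq \<beta> \<gamma>) (Complex s (- real CARD('n) * \<nu>)) (\<i> * \<nu>) c (nrm2 \<beta> \<gamma>)) (nrm2 \<beta> \<gamma>) A B"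
    using kappa_formula'[OF e a nz d, unfolded dD] by blast
  note ni = normal_iff'[OF kf KK_linear(1)[OF D0 U, THEN allI] KK_linear(2)[OF D0 U, THEN allI] TT_linear[OF U] D0]
  note N = ni[THEN iffD1, OF nor]
  note nf = normal_forces[OF nz N[THEN conjunct1, rule_format] N[THEN conjunct2]]
  have n1: "2 * real CARD('n) + 1 \<noteq> 0" by linarith
  have \<nu>: "\<nu> = tau \<beta> \<gamma> / (2 * real CARD('n) + 1)" using nf(3) n1 by (simp add: field_simps)
  have f: "f = Complex (- s) (- real CARD('n) * \<nu>) / nrm2 \<beta> \<gamma>" using nf(1) D by (simp add: nonzero_eq_divide_eq mult.commute)
  have g: "g = rho \<beta> \<gamma> / nrm2 \<beta> \<gamma>" using nf(2) D by (simp add: nonzero_eq_divide_eq mult.commute)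
  have c: "c = ((real CARD('n) + 1) * (3 * real CARD('n) + 1) * \<nu>\<^sup>2 - 1 - s\<^sup>2) / nrm2 \<beta> \<gamma>" using nf(4) D by (simp add: nonzero_eq_divide_eq mult.commute)
  have "\<alpha> X = nrm_ext \<beta> \<gamma> s X" if "X \<in> g_alg" for X
    unfolding a[rule_format, OF that] nrm_ext_def Let_def \<nu>[symmetric] f[symmetric] g[symmetric] c[symmetric] dD ..
  then show ?thesis using that nz by blast
qed

lemma nrm_ext_params:
  fixes \<beta> \<gamma> :: complex and s :: real
  assumes nz: "\<beta> \<noteq> 0 \<or> \<gamma> \<noteq> 0"
  obtains f g :: complex and \<nu> c :: real where "nrm_ext \<beta> \<gamma> s = (ext \<beta> \<gamma> f g s \<nu> c (nrm2 \<beta> \<gamma>) :: 'n::finite mat2 \<Rightarrow> 'n mat2)"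
    "nrm2 \<beta> \<gamma> * f = Complex (- s) (- real CARD('n) * \<nu>)" "nrm2 \<beta> \<gamma> * g = rho \<beta> \<gamma>"
    "tau \<beta> \<gamma> = (2 * real CARD('n) + 1) * \<nu>" "nrm2 \<beta> \<gamma> * c = (real CARD('n) + 1) * (3 * real CARD('n) + 1) * \<nu>\<^sup>2 - 1 - s\<^sup>2"
proof -
  have D: "nrm2 \<beta> \<gamma> \<noteq> 0" using nrm2_pos[OF nz] by simp
  have n1: "2 * real CARD('n) + 1 \<noteq> 0" by linarith
  show ?thesis by (rule that[OF nrm_ext_def[unfolded Let_def]]) (use D n1 in simp_all)
qed

text \<open>
  The quaternion enters the curvature on generators only through \<open>\<tau>\<close>, \<open>\<rho>\<close>, a scale and the identification \<open>qop \<beta> \<gamma>\<close> itself.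
\<close>

lemma nrm_ext_curv:
  fixes \<beta> \<gamma> :: complex and s :: real
  assumes nz: "\<beta> \<noteq> 0 \<or> \<gamma> \<noteq> 0"
  defines "\<nu> \<equiv> tau \<beta> \<gamma> / (2 * real CARD('n::finite) + 1)"
  shows "curv (nrm_ext \<beta> \<gamma> s) (mc x) (mc y :: 'n mat2) = (1 / nrm2 \<beta> \<gamma>) *\<^sub>R kb (Sc \<nu> (qop \<beta> \<gamma> x) (qop \<beta> \<gamma> y))"
    "curv (nrm_ext \<beta> \<gamma> s) ee (mc x :: 'n mat2) = (1 / nrm2 \<beta> \<gamma>) *\<^sub>R Zp (qop 0 (2 * (real CARD('n) + 1) * \<i> * \<nu> * rho \<beta> \<gamma>) (qop \<beta> \<gamma> x))"
proof -
  obtain f g :: complex and \<nu>' c :: real where p: "nrm_ext \<beta> \<gamma> s = (ext \<beta> \<gamma> f g s \<nu>' c (nrm2 \<beta> \<gamma>) :: 'n mat2 \<Rightarrow> 'n mat2)"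
    "nrm2 \<beta> \<gamma> * f = Complex (- s) (- real CARD('n) * \<nu>')" "nrm2 \<beta> \<gamma> * g = rho \<beta> \<gamma>"
    "tau \<beta> \<gamma> = (2 * real CARD('n) + 1) * \<nu>'" "nrm2 \<beta> \<gamma> * c = (real CARD('n) + 1) * (3 * real CARD('n) + 1) * \<nu>'\<^sup>2 - 1 - s\<^sup>2"
    by (rule nrm_ext_params[OF nz])
  have "2 * real CARD('n) + 1 \<noteq> 0" by linarith
  then have \<nu>: "\<nu>' = \<nu>" unfolding \<nu>_def p(4) by simp
  show "curv (nrm_ext \<beta> \<gamma> s) (mc x) (mc y :: 'n mat2) = (1 / nrm2 \<beta> \<gamma>) *\<^sub>R kb (Sc \<nu> (qop \<beta> \<gamma> x) (qop \<beta> \<gamma> y))"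
    unfolding p(1) curv_mc[OF nz] \<nu>[symmetric] by (rule curvature_normal_form(1)[OF nz p(2-5)])
  show "curv (nrm_ext \<beta> \<gamma> s) ee (mc x :: 'n mat2) = (1 / nrm2 \<beta> \<gamma>) *\<^sub>R Zp (qop 0 (2 * (real CARD('n) + 1) * \<i> * \<nu> * rho \<beta> \<gamma>) (qop \<beta> \<gamma> x))"
    unfolding p(1) curv_ee[OF nz] \<nu>[symmetric] by (rule curvature_normal_form(2)[OF nz p(2-5)])
qed

lemma ct_mat: "ct (\<lambda>z y. mat (h z y * \<mu>)) = (mat (ct h * \<mu>) :: complex^'m^'m)"
  by (rule ct_linear) (simp add: linear_iff vec_eq_iff mat_nth scaleR_complex algebra_simps)

lemma nrm_ext_reg_normal:
  fixes \<beta> \<gamma> :: complex and s :: real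
  assumes nz: "\<beta> \<noteq> 0 \<or> \<gamma> \<noteq> 0"
  shows "reg_normal_ext (nrm_ext \<beta> \<gamma> s :: 'n::finite mat2 \<Rightarrow> 'n mat2)"
proof -
  obtain f g :: complex and \<nu> c :: real where p: "nrm_ext \<beta> \<gamma> s = (ext \<beta> \<gamma> f g s \<nu> c (nrm2 \<beta> \<gamma>) :: 'n mat2 \<Rightarrow> 'n mat2)"
    "nrm2 \<beta> \<gamma> * f = Complex (- s) (- real CARD('n) * \<nu>)" "nrm2 \<beta> \<gamma> * g = rho \<beta> \<gamma>"
    "tau \<beta> \<gamma> = (2 * real CARD('n) + 1) * \<nu>" "nrm2 \<beta> \<gamma> * c = (real CARD('n) + 1) * (3 * real CARD('n) + 1) * \<nu>\<^sup>2 - 1 - s\<^sup>2"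
    by (rule nrm_ext_params[OF nz])
  let ?\<alpha> = "ext \<beta> \<gamma> f g s \<nu> c (nrm2 \<beta> \<gamma>) :: 'n mat2 \<Rightarrow> 'n mat2" and ?D = "nrm2 \<beta> \<gamma>"
  let ?K = "KK ?D (qop f g) (Uq \<beta> \<gamma>) (Complex s (- real CARD('n) * \<nu>)) (\<i> * \<nu>) c ?D :: 'n cv \<Rightarrow> 'n cv \<Rightarrow> 'n mat2"
    and ?T = "TT (qop f g) (Uq \<beta> \<gamma>) (Complex s (- real CARD('n) * \<nu>)) (\<i> * \<nu>) c ?D :: 'n cv \<Rightarrow> 'n mat2"
  have D: "?D > 0" by (rule nrm2_pos[OF nz])
  then have D0: "?D \<noteq> 0" by simp
  have e: "extension ?\<alpha>" by (rule ext_extension[OF nz D0])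
  have aa: "\<forall>X\<in>g_alg. ?\<alpha> X = ?\<alpha> X" by simp
  have reg: "regular ?\<alpha>" using regular_iff[OF e aa nz D0] by simp
  have U: "Uq \<beta> \<gamma> x = qop (- \<i> * complex_of_real (tau \<beta> \<gamma>)) (rho \<beta> \<gamma>) x" for x :: "'n cv" by (simp add: Uq_def)
  have K: "?K u v = (1/?D) *\<^sub>R kb (Sc \<nu> u v)" for u v by (rule curvature_normal_form(1)[OF nz p(2-5)])
  have T: "?T u = (1/?D) *\<^sub>R Zp (qop 0 (2 * (real CARD('n) + 1) * \<i> * \<nu> * rho \<beta> \<gamma>) u)" for u by (rule curvature_normal_form(2)[OF nz p(2-5)])
  have uS: "uu (Sc \<nu> u v)" for u v :: "'n cv"
  proof -
    obtain x y where "u = qop \<beta> \<gamma> x" "v = qop \<beta> \<gamma> y" using qop_surj[OF nz] by metis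
    then have "?K u v \<in> su" using curv_su[OF e mc_g mc_g] curv_mc[OF nz] by metis
    then have "uu ((1/?D) *\<^sub>R Sc \<nu> u v)" unfolding K by (simp add: su_bm)
    from uu_lin(3)[OF this, of ?D] show ?thesis using D0 by simp
  qed
  have sM: "sg z v* M = - sg (M *v z)" if "uu M" for z and M :: "complex^('n+'n)^('n+'n)"
    by (rule dt_eqI) (use that in \<open>simp add: uu_h dt_mv[symmetric]\<close>)
  have S0: "ct (\<lambda>z y. Sc \<nu> x y *v z) = (0 :: 'n cv)" for x
    unfolding Sc_def ct_combo by (simp add: qop_def algebra_simps)
  have NA: "ct (\<lambda>z y. br (Zp z) (?K x y)) = (2 / ?D) *\<^sub>R br Ep (?T x)" for x
  proof -
    have "br (Zp z) (?K x y) = (1/?D) *\<^sub>R Zp (- (Sc \<nu> x y *v z))" for z y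
      unfolding K br_lin by (simp add: br_def sM[OF uS])
    moreover have "linear (\<lambda>v :: 'n cv. (1/?D) *\<^sub>R Zp (- v))" by (rule linearI) (simp_all add: scaleR_add_right scaleR_diff_right)
    ultimately have "ct (\<lambda>z y. br (Zp z) (?K x y)) = (1/?D) *\<^sub>R Zp (- ct (\<lambda>z y. Sc \<nu> x y *v z))"
      using ct_linear[of "\<lambda>v :: 'n cv. (1/?D) *\<^sub>R Zp (- v)" "\<lambda>z y. Sc \<nu> x y *v z"] by simp
    also have "\<dots> = 0" unfolding S0 by (simp add: bm_0)
    finally show ?thesis unfolding T br_lin by (simp add: br_def bm_0)
  qed
  have NB: "ct ?K = (2 / ?D) *\<^sub>R ct (\<lambda>z y. br (Zp z) (?T y))"
  proof -
    have "ct (\<lambda>z y. Sc \<nu> z y :: complex^('n+'n)^('n+'n)) = 0"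
    proof -
      have l: "linear (\<lambda>M :: complex^('n+'n)^('n+'n). mat p ** M)" for p by (simp add: linear_iff matrix_add_ldistrib)
      have w: "ct (\<lambda>z y :: 'n cv. wf z y) = of_real (8 * real CARD('n))"
        using ct_wf[of 1 0, where 'n='n] by (simp add: qop_def)
      show ?thesis unfolding Sc_def combo_def ct_lin ct_linear[OF l] ct_Q1' ct_Q2' ct_mat w
        by (simp add: vec_eq_iff mat_nth algebra_simps)
    qed
    moreover have "linear (\<lambda>M :: complex^('n+'n)^('n+'n). (1/?D) *\<^sub>R kb M)" by (rule linearI) (simp_all add: scaleR_add_right)
    ultimately have "ct (\<lambda>z y. ?K z y) = (1/?D) *\<^sub>R kb 0"
      unfolding K using ct_linear[of "\<lambda>M :: complex^('n+'n)^('n+'n). (1/?D) *\<^sub>R kb M" "Sc \<nu>"] by simp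
    then have 1: "ct ?K = 0" by (simp add: bm_0)
    let ?m = "2 * (real CARD('n) + 1) * \<i> * \<nu> * rho \<beta> \<gamma>"
    have "br (Zp z) (?T y) = (1/?D) *\<^sub>R bm 0 0 (wf z (qop 0 ?m y)) 0 0 0 0 0 0" for z y
      unfolding T br_lin by (simp add: br_def wf_def)
    moreover have "linear (\<lambda>t. (1/?D) *\<^sub>R (bm 0 0 t 0 0 0 0 0 0 :: 'n mat2))" by (rule linearI) (simp_all add: scaleR_add_right)
    ultimately have "ct (\<lambda>z y. br (Zp z) (?T y)) = (1/?D) *\<^sub>R bm 0 0 (ct (\<lambda>z (y :: 'n cv). wf z (qop 0 ?m y))) 0 0 0 0 0 0"
      using ct_linear[of "\<lambda>t. (1/?D) *\<^sub>R (bm 0 0 t 0 0 0 0 0 0 :: 'n mat2)" "\<lambda>z (y :: 'n cv). wf z (qop 0 ?m y)"] by simp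
    then have "ct (\<lambda>z y. br (Zp z) (?T y)) = 0" unfolding ct_wf by (simp add: bm_0)
    with 1 show ?thesis by simp
  qed
  have kf: "\<forall>A\<in>su. \<forall>B\<in>su. kappa ?\<alpha> A B = Kf ?K ?T ?D A B" using kappa_formula'[OF e aa nz D0] by blast
  have "normal ?\<alpha>"
    using normal_iff'[OF kf KK_linear(1)[OF D0 U, THEN allI] KK_linear(2)[OF D0 U, THEN allI] TT_linear[OF U] D0] NA NB by blast
  then show ?thesis using e reg unfolding p(1) reg_normal_ext_def by blast
qed

lemma Sc_apply:
  "Sc \<nu> x (\<i> *s x) *v w = (- 2 * \<nu> * dt (sg x) w) *s x - (2 * \<nu> * dt (sg x) x) *s w
     + (2 * (2 * real CARD('n) + 1) * \<nu> * dt x w) *s sg (x :: 'n::finite cv)"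
proof -
  have m: "(mat p ** M) *v z = p *s (M *v z)" for p and M :: "complex^('n+'n)^('n+'n)" and z by (simp flip: matrix_vector_mul_assoc)
  show ?thesis unfolding Sc_def combo_def Q1_def Q2_def Q3_def Q4_def mv_lin m
    by (simp add: mv_lin wf_def) (simp add: vec_eq_iff algebra_simps)
qed

text \<open>
  A vector that is isotropic for the symmetric form but not for the hermitian one; on such vectors the curvature has a
  simple eigenvalue equation.
\<close>

lemma special_vector: fixes a :: "'n::finite" and r :: complex
  assumes "r = \<i> \<or> r = - \<i>"
  defines "x \<equiv> axis (Inl a) 1 + r *s axis (Inr a) 1 :: 'n::finite cv"
  shows "dt x x = 0" "dt (sg x) x = 2 * r"
proof -
  have [simp]: "axis (Inl a) c $ Inr a = 0" "axis (Inr a) c $ Inl a = 0" for c :: complex by (simp_all add: axis_def)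
  show "dt x x = 0" "dt (sg x) x = 2 * r" using assms(1) unfolding x_def by (auto simp: sg_axis)
qed

text \<open>
  On a vector that is isotropic for the symmetric form but not for the hermitian one the curvature is a nonzero
  multiple of \<open>\<tau>\<close>.
\<close>

lemma flat_tau:
  fixes \<alpha> :: "'n::finite mat2 \<Rightarrow> 'n mat2"
  assumes a: "\<And>X. X \<in> g_alg \<Longrightarrow> \<alpha> X = nrm_ext \<beta> \<gamma> s X" and nz: "\<beta> \<noteq> 0 \<or> \<gamma> \<noteq> 0" and fl: "flat \<alpha>"
  shows "tau \<beta> \<gamma> = 0"
proof -
  let ?\<nu> = "tau \<beta> \<gamma> / (2 * real CARD('n) + 1)"
  obtain i :: 'n where True by auto
  define u where "u = axis (Inl i) 1 + \<i> *s axis (Inr i) 1"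
  have u: "dt u u = 0" "dt (sg u) u = 2 * \<i>" unfolding u_def by (rule special_vector; simp)+
  obtain x where x: "u = qop \<beta> \<gamma> x" using qop_surj[OF nz] by metis
  obtain y where y: "\<i> *s u = qop \<beta> \<gamma> y" using qop_surj[OF nz] by metis
  have "curv (nrm_ext \<beta> \<gamma> s) (mc x) (mc y) = 0"
    using fl curv_agree[of \<alpha>, OF a mc_g[of x] mc_g[of y]] mc_g unfolding flat_def by metis
  then have "Sc ?\<nu> u (\<i> *s u) = 0" unfolding nrm_ext_curv[OF nz] x[symmetric] y[symmetric] using nrm2_pos[OF nz] by simp
  then have "Sc ?\<nu> u (\<i> *s u) *v u = 0" by simp
  then have "(complex_of_real ?\<nu> * \<i>) *s u = 0" unfolding Sc_apply u by (simp add: vec_eq_iff algebra_simps)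
  moreover have "u \<noteq> 0" using u(2) by auto
  ultimately have "?\<nu> = 0" by (simp only: vector_mul_eq_0 mult_eq_0_iff complex_i_not_zero of_real_eq_0_iff) blast
  moreover have "2 * real CARD('n) + 1 \<noteq> 0" by linarith
  ultimately show ?thesis by simp
qed

section \<open>The quaternion of an extension\<close>

lemma qf_qrmult: "qf (qrmult X b) = qop (Complex (b$1) (b$4)) (Complex (b$3) (b$2)) (qf X)"
  by (simp add: cv_eq_iff qf_def qrmult_def qop_def complex_eq_iff)

lemma qf_surj: obtains X where "qf X = u"
proof
  show "qf (vector [(\<chi> a. Re (u $ Inl a)), (\<chi> a. Im (u $ Inr a)), (\<chi> a. Re (u $ Inr a)), (\<chi> a. Im (u $ Inl a))]) = u"
    by (simp add: cv_eq_iff qf_def)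
qed

text \<open>
  The coordinates \<open>\<beta> + \<i> \<gamma>\<close> and \<open>\<beta> - \<i> \<gamma>\<close> are adapted to \<open>SO\<^sup>*(2)\<close>; the constant \<open>q\<close> in \<open>m_emb\<close> multiplies them by phases, so that
  they correspond to the parts \<open>b\<^sub>1 + k b\<^sub>4\<close> and \<open>b\<^sub>3 j + b\<^sub>2 i\<close> of \<open>b\<close>.
\<close>

lemma has_quat_iff:
  fixes \<alpha> :: "'n::finite mat2 \<Rightarrow> 'n mat2"
  assumes a: "\<And>X. X \<in> g_alg \<Longrightarrow> \<alpha> X = nrm_ext \<beta> \<gamma> s X"
  shows "has_quat \<alpha> b \<longleftrightarrow> \<beta> + \<i> * \<gamma> = sqrt 2 * Complex (b$1) (b$4) \<and> \<beta> - \<i> * \<gamma> = - \<i> * sqrt 2 * Complex (b$3) (b$2)"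
proof -
  let ?q = "vector [1 / sqrt 2, 1 / sqrt 2, 0, 0] :: real^4"
  let ?r = "complex_of_real (1 / sqrt 2)"
  have m: "\<alpha> (m_emb X) $ mid i $ Inl None = qop \<beta> \<gamma> (qf (qrmult X ?q)) $ i" for X and i :: "'n + 'n"
    unfolding m_emb_def m_of_col_bm a[OF mc_g] nrm_ext_def Let_def ext_mc by simp
  have q: "qop \<beta> \<gamma> (qf (qrmult X ?q)) = qop (?r * (\<beta> + \<i> * \<gamma>)) (?r * (\<i> * (\<beta> - \<i> * \<gamma>))) (qf X)" for X :: "'n qvec"
  proof -
    have 1: "Complex (1 / sqrt 2) 0 = ?r" "Complex 0 (1 / sqrt 2) = \<i> * ?r" by (simp_all add: complex_eq_iff)
    show ?thesis unfolding qf_qrmult qop_qop vec4_nth 1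
      by (rule arg_cong2[where f="\<lambda>p q. qop p q (qf X)"]) (simp_all add: algebra_simps add_divide_distrib)
  qed
  have "has_quat \<alpha> b \<longleftrightarrow> (\<forall>X :: 'n qvec. qop (?r * (\<beta> + \<i> * \<gamma>)) (?r * (\<i> * (\<beta> - \<i> * \<gamma>))) (qf X) = qop (Complex (b$1) (b$4)) (Complex (b$3) (b$2)) (qf X))"
    unfolding has_quat_def m q by (simp add: vec_eq_iff[of "qop _ _ _"] qf_qrmult)
  also have "\<dots> \<longleftrightarrow> (\<forall>u :: 'n cv. qop (?r * (\<beta> + \<i> * \<gamma>)) (?r * (\<i> * (\<beta> - \<i> * \<gamma>))) u = qop (Complex (b$1) (b$4)) (Complex (b$3) (b$2)) u)"
    by (metis qf_surj)
  also have "\<dots> \<longleftrightarrow> ?r * (\<beta> + \<i> * \<gamma>) = Complex (b$1) (b$4) \<and> ?r * (\<i> * (\<beta> - \<i> * \<gamma>)) = Complex (b$3) (b$2)"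
    by (rule qop_inj)
  also have "\<dots> \<longleftrightarrow> \<beta> + \<i> * \<gamma> = sqrt 2 * Complex (b$1) (b$4) \<and> \<beta> - \<i> * \<gamma> = - \<i> * sqrt 2 * Complex (b$3) (b$2)"
  proof -
    have s: "complex_of_real (sqrt 2) * ?r = 1" by (simp flip: of_real_mult)
    let ?c = "complex_of_real (sqrt 2)"
    have m1: "?c * (?r * A) = A" "?r * (?c * A) = A" for A :: complex
    proof -
      have "?c * (?r * A) = (?c * ?r) * A" "?r * (?c * A) = (?c * ?r) * A" by (simp_all only: mult.assoc mult.left_commute)
      then show "?c * (?r * A) = A" "?r * (?c * A) = A" unfolding s by simp_all
    qed
    have 1: "?r * A = B \<longleftrightarrow> A = sqrt 2 * B" for A B :: complex
    proof
      assume "?r * A = B" then show "A = sqrt 2 * B" using m1(1)[of A] by (simp only:)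
    next
      assume "A = sqrt 2 * B" then show "?r * A = B" using m1(2)[of B] by (simp only:)
    qed
    have "\<i> * A = sqrt 2 * B \<longleftrightarrow> A = - \<i> * sqrt 2 * B" for A B :: complex by (auto simp: complex_eq_iff)
    then show ?thesis by (simp only: 1)
  qed
  finally show ?thesis .
qed

text \<open>
  The parameter \<open>\<tau>\<close> in terms of the coordinates adapted to \<open>SO\<^sup>*(2)\<close>.
\<close>

lemma pq_norms: fixes \<beta> \<gamma> :: complex
  shows "(cmod (\<beta> + \<i> * \<gamma>))\<^sup>2 + (cmod (\<beta> - \<i> * \<gamma>))\<^sup>2 = 2 * nrm2 \<beta> \<gamma>"
    "\<beta> \<noteq> 0 \<or> \<gamma> \<noteq> 0 \<Longrightarrow> (cmod (\<beta> + \<i> * \<gamma>))\<^sup>2 - (cmod (\<beta> - \<i> * \<gamma>))\<^sup>2 = - 2 * nrm2 \<beta> \<gamma> * tau \<beta> \<gamma>"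
proof -
  show "(cmod (\<beta> + \<i> * \<gamma>))\<^sup>2 + (cmod (\<beta> - \<i> * \<gamma>))\<^sup>2 = 2 * nrm2 \<beta> \<gamma>"
    unfolding nrm2_def cmod_power2 by (simp add: power2_eq_square algebra_simps)
  assume "\<beta> \<noteq> 0 \<or> \<gamma> \<noteq> 0"
  then have "nrm2 \<beta> \<gamma> * tau \<beta> \<gamma> = 2 * Im (cnj \<beta> * \<gamma>)" using nrm2_pos[of \<beta> \<gamma>] by (simp add: tau_def)
  then have t: "- 2 * nrm2 \<beta> \<gamma> * tau \<beta> \<gamma> = - 4 * Im (cnj \<beta> * \<gamma>)" by simp
  show "(cmod (\<beta> + \<i> * \<gamma>))\<^sup>2 - (cmod (\<beta> - \<i> * \<gamma>))\<^sup>2 = - 2 * nrm2 \<beta> \<gamma> * tau \<beta> \<gamma>"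
    unfolding t cmod_power2 by (simp add: power2_eq_square algebra_simps)
qed

section \<open>Isomorphisms between extensions\<close>

text \<open>
  The data of the bundle isomorphism \<open>(g, h) \<mapsto> (A g B, p h)\<close>: an automorphism of \<open>G\<close> preserving \<open>K\<close>, written as conjugation by a
  matrix \<open>A\<close> with inverse \<open>B\<close>, together with an element \<open>p\<close> of \<open>P\<close> that intertwines its restriction to \<open>K\<close>.
\<close>

definition eqv :: "('n::finite mat2 \<Rightarrow> 'n mat2) \<Rightarrow> ('n mat2 \<Rightarrow> 'n mat2) \<Rightarrow> bool" where
  "eqv \<alpha> \<beta> \<longleftrightarrow> (\<exists>A B p. A ** B = mat 1 \<and> B ** A = mat 1 \<and> p \<in> P_grp \<and>
     (\<forall>g\<in>SO_star. A ** g ** B \<in> SO_star) \<and> (\<forall>X\<in>so_star. A ** X ** B \<in> so_star) \<and>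
     (\<forall>k\<in>K_grp. A ** k ** B \<in> K_grp \<and> B ** k ** A \<in> K_grp \<and> p ** k = A ** k ** B ** p) \<and>
     (\<forall>X\<in>g_alg. \<beta> (A ** X ** B) ** p = p ** \<alpha> X))"

lemma L_mult: assumes "A \<in> L_grp" "B \<in> L_grp" shows "A ** B \<in> L_grp"
proof -
  have *: "\<exists>e. (e = 1 \<or> e = -1) \<and> (\<forall>u v. dt (sg (A *v u)) (A *v v) = e * dt (sg u) v)" if "A \<in> L_grp" for A :: "'a sqmat"
  proof -
    have "- (J :: 'a sqmat) = mat (-1) ** J" by (simp add: vec_eq_iff)
    then have "adj A ** J ** A = mat 1 ** J \<or> adj A ** J ** A = mat (-1) ** J" using that unfolding L_grp_iff by simp
    then show ?thesis unfolding adj_J_iff by blast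
  qed
  obtain e where e: "e = 1 \<or> e = -1" "\<forall>u v. dt (sg (A *v u)) (A *v v) = e * dt (sg u) v" using *[OF assms(1)] by blast
  obtain e' where e': "e' = 1 \<or> e' = -1" "\<forall>u v. dt (sg (B *v u)) (B *v v) = e' * dt (sg u) v" using *[OF assms(2)] by blast
  have "dt (sg ((A ** B) *v u)) ((A ** B) *v v) = (e * e') * dt (sg u) v" for u v
    by (simp only: matrix_vector_mul_assoc[symmetric] e(2)[rule_format] e'(2)[rule_format] mult.assoc)
  then have "adj (A ** B) ** J ** (A ** B) = mat (e * e') ** J" unfolding adj_J_iff by blast
  moreover have "mat (-1) ** J = - (J :: 'a sqmat)" by (simp add: vec_eq_iff)
  moreover have "det (A ** B) = 1" using assms by (simp add: L_grp_iff det_mul)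
  ultimately show ?thesis using e(1) e'(1) unfolding L_grp_iff by auto
qed

lemma P_mult: assumes "A \<in> P_grp" "B \<in> P_grp" shows "A ** B \<in> P_grp"
proof -
  obtain a y c x M z d w f where A: "A = bm a y c x M z d w f" by (rule bm_exists)
  obtain a' y' c' x' M' z' d' w' f' where B: "B = bm a' y' c' x' M' z' d' w' f'" by (rule bm_exists)
  have "A ** B \<in> L_grp" using assms by (intro L_mult) (auto simp: P_grp_def)
  then show ?thesis using assms unfolding A B by (simp add: P_bm)
qed

lemma eqv_trans: assumes "eqv \<alpha> \<beta>" "eqv \<beta> \<gamma>" shows "eqv \<alpha> (\<gamma> :: 'n::finite mat2 \<Rightarrow> 'n mat2)"
proof -
  from assms(1) obtain A B p where 1: "A ** B = mat 1" "B ** A = mat 1" "p \<in> P_grp"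
     "\<forall>g\<in>SO_star. A ** g ** B \<in> SO_star" "\<forall>X\<in>so_star. A ** X ** B \<in> so_star"
     "\<forall>k\<in>K_grp. A ** k ** B \<in> K_grp \<and> B ** k ** A \<in> K_grp \<and> p ** k = A ** k ** B ** p"
     "\<forall>X\<in>g_alg. \<beta> (A ** X ** B) ** p = p ** \<alpha> X" unfolding eqv_def by metis
  from assms(2) obtain A' B' p' where 2: "A' ** B' = mat 1" "B' ** A' = mat 1" "p' \<in> P_grp"
     "\<forall>g\<in>SO_star. A' ** g ** B' \<in> SO_star" "\<forall>X\<in>so_star. A' ** X ** B' \<in> so_star"
     "\<forall>k\<in>K_grp. A' ** k ** B' \<in> K_grp \<and> B' ** k ** A' \<in> K_grp \<and> p' ** k = A' ** k ** B' ** p'"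
     "\<forall>X\<in>g_alg. \<gamma> (A' ** X ** B') ** p' = p' ** \<beta> X" unfolding eqv_def by metis
  have s: "(A' ** A) ** X ** (B ** B') = A' ** (A ** X ** B) ** B'" "(B ** B') ** X ** (A' ** A) = B ** (B' ** X ** A') ** A" for X
    by (simp_all only: matrix_mul_assoc)
  have i1: "(A' ** A) ** (B ** B') = mat 1" using s(1)[of "mat 1"] 1(1) 2(1) by (simp only: matrix_mul_rid)
  have i2: "(B ** B') ** (A' ** A) = mat 1" using s(2)[of "mat 1"] 1(2) 2(2) by (simp only: matrix_mul_rid)
  have k: "p' ** p ** k = A' ** (A ** k ** B) ** B' ** (p' ** p)" if "k \<in> K_grp" for k
  proof -
    have "p' ** p ** k = p' ** (p ** k)" by (simp only: matrix_mul_assoc)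
    also have "\<dots> = p' ** (A ** k ** B) ** p" using 1(6) that by (simp only: matrix_mul_assoc)
    also have "p' ** (A ** k ** B) = A' ** (A ** k ** B) ** B' ** p'" using 1(6) 2(6) that by blast
    finally show ?thesis by (simp only: matrix_mul_assoc)
  qed
  have g: "\<gamma> (A' ** (A ** X ** B) ** B') ** (p' ** p) = p' ** p ** \<alpha> X" if "X \<in> g_alg" for X
  proof -
    have a: "\<gamma> (A' ** (A ** X ** B) ** B') ** p' = p' ** \<beta> (A ** X ** B)" using 1(5) 2(7) that by blast
    have b: "\<beta> (A ** X ** B) ** p = p ** \<alpha> X" using 1(7) that by blast
    have "\<gamma> (A' ** (A ** X ** B) ** B') ** (p' ** p) = (\<gamma> (A' ** (A ** X ** B) ** B') ** p') ** p" by (rule matrix_mul_assoc)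
    also have "\<dots> = p' ** (\<beta> (A ** X ** B) ** p)" unfolding a by (rule matrix_mul_assoc[symmetric])
    also have "\<dots> = p' ** p ** \<alpha> X" unfolding b by (rule matrix_mul_assoc)
    finally show ?thesis .
  qed
  show ?thesis unfolding eqv_def
    apply (rule exI[of _ "A' ** A"], rule exI[of _ "B ** B'"], rule exI[of _ "p' ** p"])
    unfolding s using i1 i2 P_mult[OF 2(3) 1(3)] k g 1(4-6) 2(4-6) by blast
qed

lemma adj_1 [simp]: "adj (mat 1) = mat 1" by (simp add: adj_def mat_nth vec_eq_iff)

lemma adj_mat [simp]: "adj (mat c) = mat (cnj c)" by (simp add: adj_def mat_nth vec_eq_iff)

lemma gen_check:
  fixes \<alpha> \<beta> :: "'n::finite mat2 \<Rightarrow> 'n mat2"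
  assumes la: "linear \<alpha>" and lb: "linear \<beta>"
    and kb: "\<And>M. M \<in> so_star \<Longrightarrow> \<beta> (A ** kb M ** B) ** p = p ** \<alpha> (kb M)"
    and mc: "\<And>x. \<beta> (A ** mc x ** B) ** p = p ** \<alpha> (mc x)" and ee: "\<beta> (A ** ee ** B) ** p = p ** \<alpha> ee"
    and X: "X \<in> g_alg"
  shows "\<beta> (A ** X ** B) ** p = p ** \<alpha> X"
proof -
  obtain M x r where X: "X = kb M + mc x + r *\<^sub>R ee" and M: "M \<in> so_star" using X by (rule g_split)
  show ?thesis unfolding X
    by (simp only: matrix_add_ldistrib mm_add_rdistrib mm_scaleR linear_add[OF la] linear_add[OF lb] linear_cmul[OF la] linear_cmul[OF lb] kb[OF M] mc ee)
qed

lemma linear_nrm_ext: "linear (nrm_ext \<beta> \<gamma> s)"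
  unfolding nrm_ext_def Let_def by (rule linear_ext)

lemma eqv_P:
  assumes p: "p \<in> P_grp" and k: "\<And>k. k \<in> K_grp \<Longrightarrow> p ** k = k ** p" and g: "\<And>X. X \<in> g_alg \<Longrightarrow> \<beta> X ** p = p ** \<alpha> X"
  shows "eqv \<alpha> \<beta>"
  unfolding eqv_def by (rule exI[of _ "mat 1"], rule exI[of _ "mat 1"], rule exI[of _ p]) (use assms in simp)

lemma nrm_ext_vals:
  fixes \<beta> \<gamma> :: complex and s :: real
  defines "D \<equiv> nrm2 \<beta> \<gamma>" and "\<nu> \<equiv> tau \<beta> \<gamma> / (2 * real CARD('n::finite) + 1)"
  shows "nrm_ext \<beta> \<gamma> s (kb M) = (kb M :: 'n mat2)"
    "nrm_ext \<beta> \<gamma> s (mc x) = (let u = qop \<beta> \<gamma> x; v = qop (Complex (- s) (- real CARD('n) * \<nu>) / D) (rho \<beta> \<gamma> / D) u in bm 0 (sg v) 0 u 0 v 0 (- sg u) 0 :: 'n mat2)"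
    "nrm_ext \<beta> \<gamma> s ee = (bm (Complex s (- real CARD('n) * \<nu>)) 0 (complex_of_real (((real CARD('n) + 1) * (3 * real CARD('n) + 1) * \<nu>\<^sup>2 - 1 - s\<^sup>2) / D)) 0 (mat (\<i> * \<nu>)) 0 D 0 (- cnj (Complex s (- real CARD('n) * \<nu>))) :: 'n mat2)"
  unfolding nrm_ext_def Let_def ext_kb ext_mc ext_ee D_def \<nu>_def by (rule refl)+

text \<open>
  The exponential of the component of degree \<open>2\<close>.
\<close>

definition Nu :: "real \<Rightarrow> 'n::finite mat2" where "Nu u = bm 1 0 u 0 (mat 1) 0 0 0 1"

text \<open>
  The determinant is \<open>1\<close> since \<open>Nu u\<close> is conjugate to its square.
\<close>

lemma Nu_P: "Nu u \<in> (P_grp :: 'n::finite mat2 set)"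
proof -
  let ?D = "bm 2 0 0 0 (mat 1) 0 0 0 1 :: 'n mat2" and ?E = "bm (1/2) 0 0 0 (mat 1) 0 0 0 1 :: 'n mat2"
  have "?D ** ?E = mat 1" by (simp add: bm_1)
  then have D: "det ?D \<noteq> 0" by (metis det_I det_mul mult_eq_0_iff zero_neq_one)
  have "?D ** Nu u = Nu u ** Nu u ** ?D" by (simp add: Nu_def)
  then have "det ?D * det (Nu u :: 'n mat2) = det (Nu u :: 'n mat2) * det (Nu u :: 'n mat2) * det ?D" using arg_cong[of _ _ det] by (simp only: det_mul[symmetric])
  moreover have "Nu u ** Nu (- u) = (mat 1 :: 'n mat2)" by (simp add: Nu_def bm_1)
  then have "det (Nu u :: 'n mat2) \<noteq> 0" by (metis det_I det_mul mult_eq_0_iff zero_neq_one)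
  ultimately have "det (Nu u :: 'n mat2) = 1" using D by simp
  moreover have "adj (Nu u) ** J ** Nu u = (J :: 'n mat2)" unfolding Nu_def J_bm by simp
  ultimately show ?thesis unfolding Nu_def by (simp add: P_bm L_grp_iff)
qed

text \<open>
  The unipotent element \<open>Nu t\<close> commutes with \<open>K\<close> and adds a multiple of the component of degree \<open>-2\<close> to the one of degree \<open>0\<close>.
\<close>

lemma move_s: assumes nz: "\<beta> \<noteq> 0 \<or> \<gamma> \<noteq> 0" shows "eqv (nrm_ext \<beta> \<gamma> s) (nrm_ext \<beta> \<gamma> s' :: 'n::finite mat2 \<Rightarrow> 'n mat2)"
proof -
  let ?D = "nrm2 \<beta> \<gamma>" and ?n = "real CARD('n)"
  let ?\<nu> = "tau \<beta> \<gamma> / (2 * ?n + 1)"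
  define t where "t = (s' - s) / ?D"
  have D: "?D > 0" by (rule nrm2_pos[OF nz])
  have t: "s' = s + t * ?D" using D by (simp add: t_def)
  have f: "Complex (- s') y / ?D = Complex (- s) y / ?D - t" for y
  proof -
    have "Complex (- s') y = Complex (- s) y - t * ?D" by (simp add: t complex_eq_iff)
    then show ?thesis using D by (simp add: diff_divide_distrib)
  qed
  have c: "((A - s'\<^sup>2) / ?D) = (A - s\<^sup>2) / ?D - 2 * t * s - t * t * ?D" for A
    unfolding t using D by (simp add: power2_eq_square field_simps)
  show ?thesis
  proof (rule eqv_P[OF Nu_P[of t]])
    fix k :: "'n mat2" assume "k \<in> K_grp"
    then obtain l where "k = kg l" by (rule K_cases) blast
    then show "Nu t ** k = k ** Nu t" by (simp add: Nu_def)
  next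
    fix X :: "'n mat2" assume X: "X \<in> g_alg"
    have "nrm_ext \<beta> \<gamma> s' (mat 1 ** X ** mat 1) ** Nu t = Nu t ** nrm_ext \<beta> \<gamma> s X"
    proof (rule gen_check[OF linear_nrm_ext linear_nrm_ext _ _ _ X])
      show "nrm_ext \<beta> \<gamma> s' (mat 1 ** kb M ** mat 1) ** Nu t = Nu t ** nrm_ext \<beta> \<gamma> s (kb M)" for M :: "complex^('n+'n)^('n+'n)"
        unfolding matrix_mul_lid matrix_mul_rid nrm_ext_vals Nu_def by simp
      show "nrm_ext \<beta> \<gamma> s' (mat 1 ** mc x ** mat 1) ** Nu t = Nu t ** nrm_ext \<beta> \<gamma> s (mc x)" for x :: "'n cv"
        unfolding matrix_mul_lid matrix_mul_rid nrm_ext_vals Let_def Nu_def f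
        by simp (simp add: qop_def vec_eq_iff algebra_simps)
      show "nrm_ext \<beta> \<gamma> s' (mat 1 ** ee ** mat 1) ** Nu t = Nu t ** nrm_ext \<beta> \<gamma> s ee"
        unfolding matrix_mul_lid matrix_mul_rid nrm_ext_vals Nu_def c
        by (simp add: t complex_eq_iff) (simp add: algebra_simps)
    qed
    then show "nrm_ext \<beta> \<gamma> s' X ** Nu t = Nu t ** nrm_ext \<beta> \<gamma> s X" by simp
  qed
qed

lemma det_dg: "det (bm p 0 0 0 (mat m) 0 0 0 q :: 'n::finite mat2) = p * m ^ (2 * CARD('n)) * q"
proof -
  let ?A = "bm p 0 0 0 (mat m) 0 0 0 q :: 'n mat2"
  have d: "?A $ i $ j = 0" if "i \<noteq> j" for i j
  proof -
    have "\<forall>i j. i \<noteq> j \<longrightarrow> ?A $ i $ j = 0" unfolding all_idx by (simp add: mat_nth)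
    then show ?thesis using that by blast
  qed
  have "det ?A = (\<Prod>i\<in>UNIV. ?A $ i $ i)" using d by (rule det_diagonal)
  also have "(UNIV :: ('n option + 'n option) set) = {Inl None, Inr None} \<union> range mid"
    using all_idx[of "\<lambda>r. r \<in> {Inl None, Inr None} \<union> range mid"] by auto
  also have "(\<Prod>i\<in>{Inl None, Inr None} \<union> range mid. ?A $ i $ i) = (\<Prod>i\<in>{Inl None, Inr None}. ?A $ i $ i) * (\<Prod>i\<in>range mid. ?A $ i $ i)"
    by (rule prod.union_disjoint) auto
  also have "(\<Prod>i\<in>range mid. ?A $ i $ i) = m ^ (2 * CARD('n))"
    by (subst prod.reindex) (auto simp: inj_on_def mat_nth mult_2)
  finally show ?thesis by (simp add: mult.commute mult.left_commute)
qed

lemma nrm2_scale: "nrm2 (l * \<beta>) (l * \<gamma>) = (cmod l)\<^sup>2 * nrm2 \<beta> \<gamma>"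
  by (simp add: nrm2_def norm_mult power_mult_distrib algebra_simps)

lemma Im_complex_of_real_mult: "Im (complex_of_real r * z) = r * Im z" by simp

text \<open>
  A diagonal matrix \<open>diag(p, m, q)\<close> in \<open>P\<close> multiplies the component of degree \<open>-1\<close> by \<open>m / p\<close>.  The phases of \<open>p\<close>, \<open>q\<close> and \<open>m\<close> are chosen to give
  determinant \<open>1\<close>.
\<close>

lemma move_scale: assumes nz: "\<beta> \<noteq> 0 \<or> \<gamma> \<noteq> 0" and l: "l \<noteq> 0"
  shows "eqv (nrm_ext \<beta> \<gamma> 0) (nrm_ext (l * \<beta>) (l * \<gamma>) 0 :: 'n::finite mat2 \<Rightarrow> 'n mat2)"
proof -
  let ?D = "nrm2 \<beta> \<gamma>" and ?D' = "nrm2 (l * \<beta>) (l * \<gamma>)" and ?n = "real CARD('n)"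
  have D: "?D > 0" by (rule nrm2_pos[OF nz])
  have L: "cmod l > 0" using l by simp
  define \<psi> where "\<psi> = Arg l / (?n + 1)"
  define m where "m = cis \<psi>"
  define p where "p = complex_of_real (1 / cmod l) * cis (- ?n * \<psi>)"
  define q where "q = complex_of_real (cmod l) * cis (- ?n * \<psi>)"
  have l1: "l = complex_of_real (cmod l) * cis (Arg l)" using rcis_cmod_Arg[of l] by (simp add: rcis_def)
  have n1: "?n + 1 \<noteq> 0" by linarith
  have lp: "l * p = m"
  proof -
    have "l * p = (complex_of_real (cmod l) * complex_of_real (1 / cmod l)) * (cis (Arg l) * cis (- ?n * \<psi>))"
      unfolding p_def by (subst l1) (simp only: mult.assoc mult.left_commute)
    also have "\<dots> = cis (Arg l - ?n * \<psi>)" using L by (simp add: cis_mult flip: of_real_mult)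
    also have "Arg l - ?n * \<psi> = \<psi>" using n1 by (simp add: \<psi>_def field_simps)
    finally show ?thesis by (simp add: m_def)
  qed
  have pq: "cnj p * q = 1" unfolding p_def q_def using L by (simp add: cis_cnj cis_mult mult.assoc mult.left_commute flip: of_real_mult)
  have mm: "cnj m * m = 1" "m * cnj m = 1" unfolding m_def by (simp_all add: cis_cnj cis_mult)
  have nz0: "p \<noteq> 0" "q \<noteq> 0" "m \<noteq> 0" using pq mm by auto
  have lq: "cnj l * m = q"
  proof -
    have "cnj l * cnj p = cnj m" using arg_cong[OF lp, of cnj] by simp
    then have "cnj l * m = cnj l * (cnj p * q) * m" by (simp add: pq)
    also have "\<dots> = (cnj l * cnj p) * m * q" by (simp only: mult.assoc mult.commute mult.left_commute)
    also have "\<dots> = q" using mm \<open>cnj l * cnj p = cnj m\<close> by simp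
    finally show ?thesis .
  qed
  have ll: "complex_of_real ((cmod l)\<^sup>2) = l * cnj l" by (rule complex_norm_square)
  have det1: "p * m ^ (2 * CARD('n)) * q = 1"
  proof -
    have "p * q = cis (- 2 * ?n * \<psi>)" unfolding p_def q_def using L by (simp add: cis_mult mult.assoc mult.left_commute flip: of_real_mult) (simp add: algebra_simps)
    moreover have "m ^ (2 * CARD('n)) = cis (2 * ?n * \<psi>)"
    proof -
      have "m ^ (2 * CARD('n)) = cis (real (2 * CARD('n)) * \<psi>)" unfolding m_def by (rule Complex.DeMoivre)
      then show ?thesis by simp
    qed
    ultimately have "(p * q) * m ^ (2 * CARD('n)) = 1" by (simp add: cis_mult)
    then show ?thesis by (simp only: mult.assoc mult.commute mult.left_commute)
  qed
  have P: "bm p 0 0 0 (mat m) 0 0 0 q \<in> (P_grp :: 'n mat2 set)"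
  proof -
    have "cnj q * p = 1" using arg_cong[OF pq, of cnj] by (simp add: mult.commute)
    moreover have "mat (cnj m) ** J ** mat m = (J :: 'n sqmat)" by (simp add: vec_eq_iff) (use mm in \<open>metis mult.assoc mult.commute mult_1\<close>)
    ultimately show ?thesis unfolding P_bm L_grp_iff det_dg J_bm using det1 pq by simp
  qed
  have tau: "tau (l * \<beta>) (l * \<gamma>) = tau \<beta> \<gamma>"
  proof -
    have "cnj (l * \<beta>) * (l * \<gamma>) = complex_of_real ((cmod l)\<^sup>2) * (cnj \<beta> * \<gamma>)" unfolding ll by (simp add: mult.assoc mult.commute mult.left_commute)
    then have "Im (cnj (l * \<beta>) * (l * \<gamma>)) = (cmod l)\<^sup>2 * Im (cnj \<beta> * \<gamma>)" by (simp only: Im_complex_of_real_mult)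
    then show ?thesis unfolding tau_def nrm2_scale using L by (simp del: complex_cnj_mult times_complex.sel)
  qed
  have rho: "rho (l * \<beta>) (l * \<gamma>) * (l * cnj l) = l * l * rho \<beta> \<gamma>"
    unfolding rho_def nrm2_scale of_real_mult ll using l D by (simp add: power2_eq_square field_simps)
  have g1: "(rho (l * \<beta>) (l * \<gamma>) / ?D') * cnj l * q = m * (rho \<beta> \<gamma> / ?D)"
  proof -
    have "rho (l * \<beta>) (l * \<gamma>) = l * rho \<beta> \<gamma> / cnj l" using rho l by (simp add: field_simps)
    then have "(rho (l * \<beta>) (l * \<gamma>) / ?D') * cnj l * q = (rho \<beta> \<gamma> / ?D) * (q / cnj l)"
      unfolding nrm2_scale of_real_mult ll using l D by (simp add: field_simps)
    also have "q / cnj l = m" using l by (simp flip: lq)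
    finally show ?thesis by (simp add: mult.commute)
  qed
  have f1: "(F / ?D') * l * q = m * (F / ?D)" for F :: complex
  proof -
    have "(F / ?D') * l * q = (F / ?D) * (q / cnj l)" unfolding nrm2_scale of_real_mult ll using l D ll by (simp add: field_simps)
    also have "q / cnj l = m" using l by (simp flip: lq)
    finally show ?thesis by (simp add: mult.commute)
  qed
  \<comment> \<open>transfers an identity from the last to the first diagonal entry, using \<open>cnj q * p = 1\<close>\<close>
  have aux: "W * m = p * R" if "W * (cnj q * m) = R" for W R
  proof -
    have "cnj q * p = 1" using arg_cong[OF pq, of cnj] by (simp add: mult.commute)
    then have "W * m = W * m * (cnj q * p)" by simp
    also have "\<dots> = p * (W * (cnj q * m))" by (simp only: mult.assoc mult.commute mult.left_commute)
    finally show ?thesis unfolding that .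
  qed
  have g2: "cnj (rho (l * \<beta>) (l * \<gamma>) / ?D') * l * m = p * cnj (rho \<beta> \<gamma> / ?D)"
  proof -
    have "cnj (rho (l * \<beta>) (l * \<gamma>) / ?D') * l * (cnj q * m) = cnj ((rho (l * \<beta>) (l * \<gamma>) / ?D') * cnj l * q) * m" by (simp add: mult.assoc)
    also have "\<dots> = cnj (rho \<beta> \<gamma> / ?D)" unfolding g1 using mm by (simp add: mult.assoc mult.left_commute)
    finally show ?thesis by (rule aux)
  qed
  have f2: "cnj (F / ?D') * cnj l * m = p * cnj (F / ?D)" for F :: complex
  proof -
    have "cnj (F / ?D') * cnj l * (cnj q * m) = cnj ((F / ?D') * l * q) * m" by (simp add: mult.assoc)
    also have "\<dots> = cnj (F / ?D)" unfolding f1 using mm by (simp add: mult.assoc mult.left_commute)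
    finally show ?thesis by (rule aux)
  qed
  have qs: "qop (l * \<beta>) (l * \<gamma>) x = l *s qop \<beta> \<gamma> x" for x :: "'n cv" by (simp add: qop_def vec_eq_iff algebra_simps)
  have d1: "complex_of_real ?D' * p = q * complex_of_real ?D"
  proof -
    have "complex_of_real ?D' * p = ?D * (cnj l * (l * p))" unfolding nrm2_scale of_real_mult ll by (simp only: mult.assoc mult.commute mult.left_commute)
    then show ?thesis unfolding lp lq by (simp add: mult.commute)
  qed
  have c1: "complex_of_real (A / ?D') * q = p * complex_of_real (A / ?D)" for A
  proof -
    have "complex_of_real (A / ?D') * q = complex_of_real A * q / (complex_of_real ?D')" by simp
    also have "\<dots> = complex_of_real A * (p / complex_of_real ?D)"
    proof -
      have "q / complex_of_real ?D' = p / complex_of_real ?D"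
        using d1 D L nrm2_scale[of l \<beta> \<gamma>] by (simp add: frac_eq_eq mult.commute)
      then show ?thesis by (metis times_divide_eq_right)
    qed
    finally show ?thesis by (simp add: mult.commute)
  qed
  show ?thesis
  proof (rule eqv_P[OF P])
    fix k :: "'n mat2" assume "k \<in> K_grp"
    then obtain k' where "k = kg k'" by (rule K_cases) blast
    then show "bm p 0 0 0 (mat m) 0 0 0 q ** k = k ** bm p 0 0 0 (mat m) 0 0 0 q" by simp (simp add: vec_eq_iff mult.commute)
  next
    fix X :: "'n mat2" assume X: "X \<in> g_alg"
    let ?p = "bm p 0 0 0 (mat m) 0 0 0 q :: 'n mat2"
    have "nrm_ext (l * \<beta>) (l * \<gamma>) 0 (mat 1 ** X ** mat 1) ** ?p = ?p ** nrm_ext \<beta> \<gamma> 0 X"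
    proof (rule gen_check[OF linear_nrm_ext linear_nrm_ext _ _ _ X])
      show "nrm_ext (l * \<beta>) (l * \<gamma>) 0 (mat 1 ** kb M ** mat 1) ** ?p = ?p ** nrm_ext \<beta> \<gamma> 0 (kb M)" for M :: "complex^('n+'n)^('n+'n)"
        unfolding matrix_mul_lid matrix_mul_rid nrm_ext_vals by simp (simp add: vec_eq_iff mult.commute)
      show "nrm_ext (l * \<beta>) (l * \<gamma>) 0 (mat 1 ** mc x ** mat 1) ** ?p = ?p ** nrm_ext \<beta> \<gamma> 0 (mc x)" for x :: "'n cv"
      proof -
        define u where "u = qop \<beta> \<gamma> x"
        define F where "F = Complex (- 0) (- ?n * (tau \<beta> \<gamma> / (2 * ?n + 1)))"
        have 1: "q *s qop (F / ?D') (rho (l * \<beta>) (l * \<gamma>) / ?D') (l *s u) = m *s qop (F / ?D) (rho \<beta> \<gamma> / ?D) u"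
        proof -
          have "q *s qop (F / ?D') (rho (l * \<beta>) (l * \<gamma>) / ?D') (l *s u) = ((F / ?D') * l * q) *s u + ((rho (l * \<beta>) (l * \<gamma>) / ?D') * cnj l * q) *s sg u"
            unfolding qop_def by (simp add: vec_eq_iff algebra_simps)
          then show ?thesis unfolding f1 g1 by (simp add: qop_def vec_eq_iff algebra_simps)
        qed
        have 2: "m *s sg (qop (F / ?D') (rho (l * \<beta>) (l * \<gamma>) / ?D') (l *s u)) = p *s sg (qop (F / ?D) (rho \<beta> \<gamma> / ?D) u)"
        proof -
          have "m *s sg (qop (F / ?D') (rho (l * \<beta>) (l * \<gamma>) / ?D') (l *s u)) = (cnj (F / ?D') * cnj l * m) *s sg u - (cnj (rho (l * \<beta>) (l * \<gamma>) / ?D') * l * m) *s u"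
            unfolding qop_def by (simp add: vec_eq_iff algebra_simps)
          then show ?thesis unfolding f2 g2 by (simp add: qop_def vec_eq_iff algebra_simps)
        qed
        have 3: "p * l = m" "m * cnj l = q" using lp lq by (simp_all add: mult.commute)
        show ?thesis
          unfolding matrix_mul_lid matrix_mul_rid nrm_ext_vals Let_def tau qs u_def[symmetric] F_def[symmetric]
          by (simp add: 1 2 3)
      qed
      show "nrm_ext (l * \<beta>) (l * \<gamma>) 0 (mat 1 ** ee ** mat 1) ** ?p = ?p ** nrm_ext \<beta> \<gamma> 0 ee"
        unfolding matrix_mul_lid matrix_mul_rid nrm_ext_vals tau bm_mult bm_eq_iff
        using c1 d1 by (simp add: mat_mat mult.commute del: of_real_divide)
    qed
    then show "nrm_ext (l * \<beta>) (l * \<gamma>) 0 X ** ?p = ?p ** nrm_ext \<beta> \<gamma> 0 X" by simp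
  qed
qed

lemma SO_conj_so: assumes A: "A \<in> SO_star" and X: "X \<in> so_star" shows "A ** X ** transpose A \<in> so_star"
proof -
  have At: "dt (A *v u) v = dt u (transpose A *v v)" "dt (transpose A *v u) v = dt u (A *v v)" for u v
    using transpose_dt[of A "transpose A"] transpose_dt[of "transpose A" A] by auto
  have s: "A *v sg x = sg (A *v x)" "transpose A *v sg x = sg (transpose A *v x)" for x
    using A SO_transpose[OF A] by (auto simp: SO_iff simp del: transpose_matrix_vector)
  show ?thesis unfolding so_h
    using X by (auto simp: matrix_vector_mul_assoc[symmetric] At s so_h simp del: transpose_matrix_vector)
qed

text \<open>
  The subgroup \<open>SO\<^sup>*(2)\<close> of \<open>H\<close>, which is compact and centralizes \<open>K\<close>.
\<close>

definition Rt :: "real \<Rightarrow> 'n::finite mat2" where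
  "Rt \<theta> = bm (cos \<theta>) 0 (- sin \<theta>) 0 (mat 1) 0 (sin \<theta>) 0 (cos \<theta>)"

lemma Rt_mult: "Rt a ** Rt b = Rt (a + b)"
  unfolding Rt_def by (simp add: cos_add sin_add algebra_simps flip: of_real_mult of_real_add of_real_diff)

lemma Rt_0: "Rt 0 = mat 1" by (simp add: Rt_def bm_1)

lemma Rt_transpose: "transpose (Rt \<theta>) = Rt (- \<theta>)" by (simp add: Rt_def)

text \<open>
  The determinant is the square of that of a rotation by half the angle, which is \<open>1\<close> or \<open>-1\<close> by orthogonality.
\<close>

lemma Rt_SO: "Rt \<theta> \<in> SO_star"
proof -
  have o: "transpose (Rt \<theta>) ** Rt \<theta> = (mat 1 :: 'a mat2)" for \<theta> unfolding Rt_transpose Rt_mult by (simp add: Rt_0)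
  have "det (Rt (\<theta> / 2) :: 'a mat2) * det (Rt (\<theta> / 2) :: 'a mat2) = 1"
    using arg_cong[OF o[of "\<theta>/2"], of det] by (simp add: det_mul)
  moreover have "Rt \<theta> = (Rt (\<theta> / 2) ** Rt (\<theta> / 2) :: 'a mat2)" unfolding Rt_mult by simp
  ultimately have "det (Rt \<theta> :: 'a mat2) = 1" by (metis det_mul)
  moreover have "complex_of_real (cos \<theta>) * cos \<theta> + complex_of_real (sin \<theta>) * sin \<theta> = 1"
    using sin_cos_squared_add3[of \<theta>] by (simp flip: of_real_mult of_real_add)
  then have "adj (Rt \<theta>) ** J ** Rt \<theta> = (J :: 'a mat2)" unfolding Rt_def J_bm by (simp add: algebra_simps)
  ultimately show ?thesis using o by (simp add: SO_star_def)
qed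

text \<open>
  Right translation by an element of the centralizer of \<open>K\<close> in \<open>G\<close> descends to \<open>G/K\<close> and turns \<open>x\<close> into \<open>x (cos \<theta> - j sin \<theta>)\<close>.
\<close>

lemma move_rot:
  fixes \<theta> :: real and \<beta> \<gamma> :: complex
  assumes nz: "\<beta> \<noteq> 0 \<or> \<gamma> \<noteq> 0"
  defines "b \<equiv> \<beta> * complex_of_real (cos \<theta>) - \<gamma> * complex_of_real (sin \<theta>)"
    and "g \<equiv> \<beta> * complex_of_real (sin \<theta>) + \<gamma> * complex_of_real (cos \<theta>)"
  shows "eqv (nrm_ext \<beta> \<gamma> 0) (nrm_ext b g 0 :: 'n::finite mat2 \<Rightarrow> 'n mat2)"
proof -
  let ?c = "complex_of_real (cos \<theta>)" and ?s = "complex_of_real (sin \<theta>)"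
  let ?b = "\<beta> * complex_of_real (cos \<theta>) - \<gamma> * complex_of_real (sin \<theta>)" and ?g = "\<beta> * complex_of_real (sin \<theta>) + \<gamma> * complex_of_real (cos \<theta>)"
  have cs: "?c * ?c + ?s * ?s = 1" using sin_cos_squared_add3[of \<theta>] by (simp flip: of_real_mult of_real_add)
  have cs': "cos \<theta> * cos \<theta> + sin \<theta> * sin \<theta> = 1" by (rule sin_cos_squared_add3)
  have cs2: "?c * (?c * A) + ?s * (?s * A) = A" for A using cs by (metis distrib_right mult.assoc mult_1)
  have n2: "nrm2 ?b ?g = nrm2 \<beta> \<gamma>"
  proof -
    have "complex_of_real (nrm2 ?b ?g) = (?c * ?c + ?s * ?s) * (\<beta> * cnj \<beta> + \<gamma> * cnj \<gamma>)" unfolding nrm2 by (simp add: algebra_simps)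
    then have "complex_of_real (nrm2 ?b ?g) = complex_of_real (nrm2 \<beta> \<gamma>)" unfolding cs nrm2 by simp
    then show ?thesis by (simp only: of_real_eq_iff)
  qed
  have t2: "tau ?b ?g = tau \<beta> \<gamma>"
  proof -
    have "Im (cnj (\<beta> * complex_of_real c - \<gamma> * complex_of_real d) * (\<beta> * complex_of_real d + \<gamma> * complex_of_real c))
      = (c * c + d * d) * Im (cnj \<beta> * \<gamma>)" for c d by (simp add: algebra_simps)
    then show ?thesis unfolding tau_def n2 by (simp only: cs' mult_1)
  qed
  have r2: "rho ?b ?g = rho \<beta> \<gamma>"
  proof -
    have "?b\<^sup>2 + ?g\<^sup>2 = (?c * ?c + ?s * ?s) * (\<beta>\<^sup>2 + \<gamma>\<^sup>2)" by (simp add: power2_eq_square algebra_simps)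
    then show ?thesis unfolding rho_def n2 cs by simp
  qed
  have inv: "Rt \<theta> ** Rt (- \<theta>) = (mat 1 :: 'n mat2)" "Rt (- \<theta>) ** Rt \<theta> = (mat 1 :: 'n mat2)" unfolding Rt_mult by (simp_all add: Rt_0)
  have tr: "Rt (- \<theta>) = (transpose (Rt \<theta>) :: 'n mat2)" by (simp add: Rt_transpose)
  have kR: "Rt t ** kg k = kg k ** Rt t" for t and k :: "complex^('n+'n)^('n+'n)" by (simp add: Rt_def)
  have kk: "Rt \<theta> ** k ** Rt (- \<theta>) = k" "Rt (- \<theta>) ** k ** Rt \<theta> = k" if kK: "k \<in> K_grp" for k :: "'n mat2"
  proof -
    obtain l where l: "k = kg l" using kK by (rule K_cases) blast
    show "Rt \<theta> ** k ** Rt (- \<theta>) = k" "Rt (- \<theta>) ** k ** Rt \<theta> = k"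
      unfolding l kR matrix_mul_assoc[symmetric] inv by simp_all
  qed
  have one: "mat 1 \<in> (P_grp :: 'n mat2 set)" using Nu_P[of 0, where 'n='n] by (simp add: Nu_def bm_1)
  have RS: "Rt \<theta> ** g ** Rt (- \<theta>) \<in> SO_star" if "g \<in> SO_star" for g :: "'n mat2"
    using that by (intro SO_mult Rt_SO)
  have RX: "Rt \<theta> ** X ** Rt (- \<theta>) \<in> so_star" if "X \<in> so_star" for X :: "'n mat2"
    unfolding tr by (rule SO_conj_so[OF Rt_SO that])
  show ?thesis unfolding eqv_def b_def g_def
  proof (rule exI[of _ "Rt \<theta>"], rule exI[of _ "Rt (- \<theta>)"], rule exI[of _ "mat 1"], intro conjI ballI)
    fix X :: "'n mat2" assume X: "X \<in> g_alg"
    show "nrm_ext ?b ?g 0 (Rt \<theta> ** X ** Rt (- \<theta>)) ** mat 1 = mat 1 ** nrm_ext \<beta> \<gamma> 0 X"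
    proof (rule gen_check[OF linear_nrm_ext linear_nrm_ext _ _ _ X])
      show "nrm_ext ?b ?g 0 (Rt \<theta> ** kb M ** Rt (- \<theta>)) ** mat 1 = mat 1 ** nrm_ext \<beta> \<gamma> 0 (kb M)" for M :: "complex^('n+'n)^('n+'n)"
      proof -
        have "Rt \<theta> ** kb M ** Rt (- \<theta>) = kb M" by (simp add: Rt_def)
        then show ?thesis by (simp add: nrm_ext_vals)
      qed
      show "nrm_ext ?b ?g 0 (Rt \<theta> ** mc x ** Rt (- \<theta>)) ** mat 1 = mat 1 ** nrm_ext \<beta> \<gamma> 0 (mc x)" for x :: "'n cv"
      proof -
        have "Rt \<theta> ** mc x ** Rt (- \<theta>) = mc (?c *s x - ?s *s sg x)"
          unfolding Rt_def by simp
        moreover have "qop ?b ?g (?c *s x - ?s *s sg x) = qop \<beta> \<gamma> x"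
        proof -
          have "qop ?b ?g (?c *s x - ?s *s sg x) = (?c * ?c + ?s * ?s) *s qop \<beta> \<gamma> x" by (simp add: qop_def vec_eq_iff algebra_simps)
          then show ?thesis unfolding cs by simp
        qed
        ultimately show ?thesis by (simp only: nrm_ext_vals n2 t2 r2 Let_def matrix_mul_lid matrix_mul_rid)
      qed
      show "nrm_ext ?b ?g 0 (Rt \<theta> ** (ee :: 'n mat2) ** Rt (- \<theta>)) ** mat 1 = mat 1 ** nrm_ext \<beta> \<gamma> 0 ee"
      proof -
        have "Rt \<theta> ** ee ** Rt (- \<theta>) = (ee :: 'n mat2)" using cs unfolding Rt_def by (simp add: algebra_simps)
        then show ?thesis by (simp only: nrm_ext_vals n2 t2 r2 matrix_mul_lid matrix_mul_rid)
      qed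
    qed
  qed (use one inv kk RS RX in auto)
qed

text \<open>
  Left multiplication by \<open>\<i>\<close> on the first and by \<open>-\<i>\<close> on the second half of the coordinates.  It commutes with \<open>sg\<close> and changes the sign of
  the symmetric form, hence also that of the hermitian form.
\<close>

definition Fl :: "('m::finite) sqmat" where
  "Fl = (\<chi> r s. if r = s then (case r of Inl _ \<Rightarrow> \<i> | Inr _ \<Rightarrow> - \<i>) else 0)"

lemma Fl_mv: "(Fl *v x) $ Inl a = \<i> * x $ Inl a" "(Fl *v x) $ Inr a = - \<i> * x $ Inr a"
  by (simp_all add: Fl_def matrix_vector_mult_def if_distrib[where f="\<lambda>u. u * _"] cong: if_cong)

lemma Fl_facts: "Fl *v (Fl *v x) = - x" "dt (Fl *v x) (Fl *v y) = - dt x y" "Fl *v sg x = sg (Fl *v x)"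
proof -
  show "Fl *v (Fl *v x) = - x" "Fl *v sg x = sg (Fl *v x)" by (simp_all add: cv_eq_iff Fl_mv)
  show "dt (Fl *v x) (Fl *v y) = - dt x y" unfolding dt_def sum_UNIV_Plus Fl_mv by (simp add: sum_negf algebra_simps)
qed

lemma Fl_Fl: "Fl ** Fl = - mat 1"
  by (rule matrix_eq_mv) (simp add: matrix_vector_mul_assoc[symmetric] Fl_facts)

lemma det_Fl: "det (Fl :: 'm::finite sqmat) = 1"
proof -
  have "det (Fl :: 'm sqmat) = (\<Prod>i\<in>UNIV. (Fl :: 'm sqmat) $ i $ i)" by (rule det_diagonal) (simp add: Fl_def)
  also have "\<dots> = (\<Prod>a\<in>(UNIV :: 'm set). \<i>) * (\<Prod>a\<in>(UNIV :: 'm set). - \<i>)"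
    by (subst UNIV_Plus_UNIV[symmetric], subst prod.Plus) (simp_all add: Fl_def)
  also have "\<dots> = (\<i> * (- \<i>)) ^ CARD('m)" by (simp only: prod_constant power_mult_distrib)
  finally show ?thesis by simp
qed

lemma Fl_bm: "(Fl :: 'n::finite mat2) = bm \<i> 0 0 0 Fl 0 0 0 (- \<i>)"
proof -
  have "(Fl :: 'n mat2) $ mid i $ mid j = Fl $ i $ j" for i j by (cases i; cases j; simp add: mid_simps Fl_def)
  moreover have "(Fl :: 'n mat2) $ mid i $ Inl None = 0" "(Fl :: 'n mat2) $ mid i $ Inr None = 0"
     "(Fl :: 'n mat2) $ Inl None $ mid i = 0" "(Fl :: 'n mat2) $ Inr None $ mid i = 0" for i by (simp_all add: Fl_def)
  ultimately show ?thesis by (simp add: mat2_eq_iff) (simp add: Fl_def)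
qed

lemma Fl_SO: fixes g :: "'m::finite sqmat" assumes "g \<in> SO_star" shows "Fl ** g ** (- Fl) \<in> SO_star"
proof -
  have g: "\<And>u v. dt (g *v u) (g *v v) = dt u v" "\<And>x. g *v sg x = sg (g *v x)" using assms unfolding SO_iff orth_iff by auto
  have v: "(Fl ** g ** (- Fl)) *v x = - (Fl *v (g *v (Fl *v x)))" for x by (simp flip: matrix_vector_mul_assoc)
  have "(Fl :: 'm sqmat) ** (- Fl) = mat 1" by (simp add: Fl_Fl)
  then have "det (Fl :: 'm sqmat) * det (- (Fl :: 'm sqmat)) = 1" unfolding det_mul[symmetric] by simp
  then have "det (Fl ** g ** (- Fl)) = 1" using assms unfolding det_mul by (simp add: SO_iff det_Fl)
  then show ?thesis unfolding SO_iff orth_iff v by (simp add: Fl_facts g)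
qed

lemma Fl_so: assumes "X \<in> so_star" shows "Fl ** X ** (- Fl) \<in> so_star"
proof -
  have g: "\<And>u v. dt (X *v u) v = - dt u (X *v v)" "\<And>x. X *v sg x = sg (X *v x)" using assms unfolding so_h by auto
  have v: "(Fl ** X ** (- Fl)) *v x = - (Fl *v (X *v (Fl *v x)))" for x by (simp flip: matrix_vector_mul_assoc)
  have f: "dt (Fl *v x) y = dt x (Fl *v y)" for x y :: "'a cv"
    using Fl_facts(2)[of x "Fl *v y"] unfolding Fl_facts(1) by simp
  show ?thesis unfolding so_h v by (simp add: Fl_facts(3) g f)
qed

text \<open>
  Conjugation by \<open>Fl\<close> preserves \<open>G\<close> but acts by \<open>-1\<close> on \<open>ee\<close>; as an element of \<open>P\<close> it preserves the hermitian form only up to sign.  Both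
  effects together reverse \<open>\<tau>\<close>.
\<close>

lemma move_flip: assumes nz: "\<beta> \<noteq> 0 \<or> \<gamma> \<noteq> 0" shows "eqv (nrm_ext \<beta> \<gamma> 0) (nrm_ext \<beta> (- \<gamma>) 0 :: 'n::finite mat2 \<Rightarrow> 'n mat2)"
proof -
  have n2: "nrm2 \<beta> (- \<gamma>) = nrm2 \<beta> \<gamma>" by (simp add: nrm2_def)
  have t2: "tau \<beta> (- \<gamma>) = - tau \<beta> \<gamma>" unfolding tau_def n2 by (simp only: mult_minus_right uminus_complex.sel minus_divide_left)
  have r2: "rho \<beta> (- \<gamma>) = rho \<beta> \<gamma>" by (simp add: rho_def n2)
  let ?P = "Fl :: 'n mat2"
  have i: "?P ** (- ?P) = mat 1" "(- ?P) ** ?P = mat 1" by (simp_all add: Fl_Fl)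
  have P: "?P \<in> P_grp"
  proof -
    have "adj ?P ** J ** ?P = mat (-1) ** J" unfolding adj_J_iff by (simp add: Fl_facts flip: Fl_facts(3))
    moreover have "mat (-1) ** J = - (J :: 'n mat2)" by (simp add: vec_eq_iff)
    ultimately have "?P \<in> L_grp" unfolding L_grp_iff by (simp add: det_Fl)
    then show ?thesis unfolding Fl_bm P_bm by simp
  qed
  have K: "?P ** k ** (- ?P) \<in> K_grp" if kK: "k \<in> K_grp" for k :: "'n mat2"
  proof -
    obtain l where l: "k = kg l" using kK by (rule K_cases) blast
    have "?P ** k ** (- ?P) = kg (Fl ** l ** (- Fl))" unfolding l Fl_bm by simp
    then show ?thesis using Fl_SO[OF K_SO[OF kK]] by (simp add: K_bm)
  qed
  have fi: "Fl *v (c *s x) = c *s (Fl *v x)" for c and x :: "'n cv" by simp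
  show ?thesis unfolding eqv_def
  proof (rule exI[of _ ?P], rule exI[of _ "- ?P"], rule exI[of _ ?P], intro conjI ballI)
    show "(- ?P) ** k ** ?P \<in> K_grp" if "k \<in> K_grp" for k using K[OF that] by simp
    show "?P ** k = ?P ** k ** (- ?P) ** ?P" for k by (simp only: matrix_mul_assoc[symmetric] i matrix_mul_rid)
    fix X :: "'n mat2" assume X: "X \<in> g_alg"
    show "nrm_ext \<beta> (- \<gamma>) 0 (?P ** X ** (- ?P)) ** ?P = ?P ** nrm_ext \<beta> \<gamma> 0 X"
    proof (rule gen_check[OF linear_nrm_ext linear_nrm_ext _ _ _ X])
      show "nrm_ext \<beta> (- \<gamma>) 0 (?P ** kb M ** (- ?P)) ** ?P = ?P ** nrm_ext \<beta> \<gamma> 0 (kb M)" for M :: "complex^('n+'n)^('n+'n)"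
      proof -
        have "?P ** kb M ** (- ?P) = kb (Fl ** M ** (- Fl))" unfolding Fl_bm by simp
        then have "nrm_ext \<beta> (- \<gamma>) 0 (?P ** kb M ** (- ?P)) = ?P ** kb M ** (- ?P)" by (simp only: nrm_ext_vals)
        then show ?thesis by (simp only: nrm_ext_vals matrix_mul_assoc[symmetric] i matrix_mul_rid)
      qed
      show "nrm_ext \<beta> (- \<gamma>) 0 (?P ** mc x ** (- ?P)) ** ?P = ?P ** nrm_ext \<beta> \<gamma> 0 (mc x)" for x :: "'n cv"
      proof -
        have vF: "y v* Fl = Fl *v y" for y :: "'n cv"
        proof -
          have "transpose Fl = (Fl :: 'n sqmat)" by (simp add: Fl_def transpose_def vec_eq_iff)
          then show ?thesis using transpose_matrix_vector[of Fl y] by simp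
        qed
        have 1: "?P ** mc x ** (- ?P) = mc (- \<i> *s (Fl *v x))"
          unfolding Fl_bm by (simp add: vF Fl_facts(3) vector_smult_lneg)
        have cF: "Fl *v (c *s y) = c *s (Fl *v y)" for c and y :: "'n cv" by simp
        define u where "u = qop \<beta> \<gamma> x"
        define f where "f = real CARD('n) * (tau \<beta> \<gamma> / (2 * real CARD('n) + 1))"
        define r where "r = rho \<beta> \<gamma> / nrm2 \<beta> \<gamma>"
        define v where "v = qop (Complex (- 0) (- f) / nrm2 \<beta> \<gamma>) r u"
        have u': "qop \<beta> (- \<gamma>) (- \<i> *s (Fl *v x)) = - \<i> *s (Fl *v u)"
          unfolding u_def qop_def matrix_vector_right_distrib cF Fl_facts(3) by (simp add: vec_eq_iff algebra_simps)
        have "Complex (- 0) f / nrm2 \<beta> \<gamma> = - (Complex (- 0) (- f) / nrm2 \<beta> \<gamma>)" by (simp add: complex_eq_iff)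
        then have v': "qop (Complex (- 0) f / nrm2 \<beta> \<gamma>) r (- \<i> *s (Fl *v u)) = \<i> *s (Fl *v v)"
          unfolding v_def qop_def matrix_vector_right_distrib cF Fl_facts(3) by (simp add: vec_eq_iff algebra_simps)
        have e: "nrm_ext \<beta> (- \<gamma>) 0 (mc (- \<i> *s (Fl *v x))) = bm 0 (sg (\<i> *s (Fl *v v))) 0 (- \<i> *s (Fl *v u)) 0 (\<i> *s (Fl *v v)) 0 (- sg (- \<i> *s (Fl *v u))) 0"
          unfolding nrm_ext_vals n2 t2 r2 Let_def u' r_def[symmetric] using v' by (simp add: f_def)
        have e': "nrm_ext \<beta> \<gamma> 0 (mc x) = bm 0 (sg v) 0 u 0 v 0 (- sg u) 0"
          unfolding nrm_ext_vals Let_def v_def r_def f_def u_def by simp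
        show ?thesis unfolding 1 e e' unfolding Fl_bm
          by (simp add: vF cF) (simp add: Fl_facts flip: Fl_facts(3))
      qed
      show "nrm_ext \<beta> (- \<gamma>) 0 (?P ** ee ** (- ?P)) ** ?P = ?P ** nrm_ext \<beta> \<gamma> 0 ee"
      proof -
        have 1: "?P ** ee ** (- ?P) = (-1) *\<^sub>R ee" unfolding Fl_bm by simp
        have m: "Fl ** mat c = mat c ** Fl" for c by (simp add: vec_eq_iff mult.commute)
        show ?thesis unfolding 1 linear_cmul[OF linear_nrm_ext] nrm_ext_vals n2 t2 r2 unfolding Fl_bm
          by (simp add: m) (auto simp: complex_eq_iff vec_eq_iff)
      qed
    qed
  qed (use i P K Fl_SO Fl_so in auto)
qed

section \<open>Derivatives along curves and second derivatives\<close>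

lemma hvd_lin:
  fixes f :: "real \<Rightarrow> 'a::euclidean_space"
  assumes "linear L" "(f has_vector_derivative f') (at x)"
  shows "((\<lambda>s. L (f s)) has_vector_derivative L f') (at x)"
  by (rule bounded_linear.has_vector_derivative[OF _ assms(2)]) (use assms(1) in \<open>simp add: linear_conv_bounded_linear\<close>)

lemma hvd_mm:
  fixes f g :: "real \<Rightarrow> complex^'m^'m"
  assumes "(f has_vector_derivative f') (at x)" "(g has_vector_derivative g') (at x)"
  shows "((\<lambda>s. f s ** g s) has_vector_derivative (f x ** g' + f' ** g x)) (at x)"
  by (rule bounded_bilinear.has_vector_derivative[OF bounded_bilinear_mm assms])

lemma hvd_Pair:
  assumes "(f has_vector_derivative f') (at x)" "(g has_vector_derivative g') (at x)"
  shows "((\<lambda>s. (f s, g s)) has_vector_derivative (f', g')) (at x)"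
  using has_derivative_Pair[OF assms[unfolded has_vector_derivative_def]] by (simp add: has_vector_derivative_def)

lemma hvd_chain:
  assumes c: "(c has_vector_derivative c') (at s)" and g: "g differentiable (at (c s))"
  shows "((\<lambda>t. g (c t)) has_vector_derivative frechet_derivative g (at (c s)) c') (at s)"
proof -
  have G: "(g has_derivative frechet_derivative g (at (c s))) (at (c s))" using g by (simp add: frechet_derivative_works)
  have "((\<lambda>t. g (c t)) has_derivative (\<lambda>t. frechet_derivative g (at (c s)) (t *\<^sub>R c'))) (at s)"
    by (rule has_derivative_compose[OF c[unfolded has_vector_derivative_def] G])
  then show ?thesis by (simp add: has_vector_derivative_def linear_cmul[OF has_derivative_linear[OF G]])
qed

lemma hvd_transform:
  assumes f: "(f has_vector_derivative f') (at x)" and e: "\<forall>\<^sub>F s in nhds x. f s = g s"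
  shows "(g has_vector_derivative f') (at x)"
  using f unfolding has_vector_derivative_def
  by (rule has_derivative_transform_eventually) (use e in \<open>auto simp: eventually_nhds_conv_at\<close>)

text \<open>
  Derivatives of relations that hold along a curve near the point in question.
\<close>

lemma hvd_unique_ev:
  assumes "(f has_vector_derivative f') (at x)" "(g has_vector_derivative g') (at x)" "\<forall>\<^sub>F s in nhds x. f s = g s"
  shows "f' = g'"
  using hvd_transform[OF assms(1,3)] assms(2) by (rule vector_derivative_unique_at)

lemma hvd_open:
  assumes c: "(c has_vector_derivative c') (at x)" and U: "open U" "c x \<in> U"
  shows "\<forall>\<^sub>F t in nhds x. c t \<in> U"
proof -
  have "(c \<longlongrightarrow> c x) (at x)" using has_vector_derivative_continuous[OF c] by (simp add: isCont_def)
  then have "\<forall>\<^sub>F t in at x. c t \<in> U" using U by (rule topological_tendstoD)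
  then show ?thesis using U by (simp add: eventually_nhds_conv_at)
qed

text \<open>
  The logarithmic derivative of a curve in \<open>SO\<^sup>*\<close>.
\<close>

lemma deriv_SO:
  fixes h :: "real \<Rightarrow> 'm::finite sqmat"
  assumes h: "(h has_vector_derivative h') (at 0)" and e: "\<forall>\<^sub>F s in nhds 0. h s \<in> SO_star"
  shows "transpose (h 0) ** h' \<in> so_star"
proof -
  let ?A = "h 0" let ?X = "transpose ?A ** h'"
  have A: "?A \<in> SO_star" using e by (rule eventually_nhds_x_imp_x)
  have t: "((\<lambda>s. transpose (h s)) has_vector_derivative transpose h') (at 0)" by (rule hvd_lin[OF linear_transpose h])
  have "transpose ?A ** h' + transpose h' ** ?A = 0"
  proof (rule hvd_unique_ev[OF hvd_mm[OF t h]])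
    show "((\<lambda>s. mat 1) has_vector_derivative 0) (at 0)" by (rule has_vector_derivative_const)
    show "\<forall>\<^sub>F s in nhds 0. transpose (h s) ** h s = mat 1" using e by eventually_elim (rule SO_inv(2))
  qed
  then have "transpose h' ** ?A = - ?X" by (metis add.commute eq_neg_iff_add_eq_0)
  then have tX: "transpose ?X = - ?X" by (simp add: matrix_transpose_mul)
  have c: "h' *v sg x = sg (h' *v x)" for x
  proof -
    let ?L = "\<lambda>M :: 'm sqmat. M *v sg x - sg (M *v x)"
    have L: "linear ?L" by (rule linearI) (simp_all add: matrix_vector_mult_add_rdistrib scaleR_diff_right)
    have "?L h' = 0"
    proof (rule hvd_unique_ev[OF hvd_lin[OF L h]])
      show "((\<lambda>s. 0) has_vector_derivative 0) (at 0)" by (rule has_vector_derivative_const)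
      show "\<forall>\<^sub>F s in nhds 0. ?L (h s) = 0" using e by eventually_elim (simp add: SO_iff)
    qed
    then show ?thesis by simp
  qed
  have s: "transpose ?A *v sg x = sg (transpose ?A *v x)" for x
    using SO_transpose[OF A] unfolding SO_iff by blast
  have "?X *v sg x = sg (?X *v x)" for x by (simp only: matrix_vector_mul_assoc[symmetric] c s)
  moreover have "dt (?X *v x) y = - dt x (?X *v y)" for x y
  proof -
    have "dt (?X *v x) y = dt x (- ?X *v y)" using tX unfolding transpose_dt by blast
    then show ?thesis by simp
  qed
  ultimately show ?thesis unfolding so_h by blast
qed

lemma line_deriv:
  fixes g :: "'a::real_normed_vector \<Rightarrow> 'b::real_inner"
  assumes "g differentiable (at (x + s *\<^sub>R u))"
  shows "((\<lambda>s. g (x + s *\<^sub>R u) \<bullet> e) has_real_derivative (frechet_derivative g (at (x + s *\<^sub>R u)) u \<bullet> e)) (at s)"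
proof -
  have l: "((\<lambda>s. x + s *\<^sub>R u) has_vector_derivative u) (at s)"
    unfolding has_vector_derivative_def by (auto intro!: derivative_eq_intros)
  have "((\<lambda>s. g (x + s *\<^sub>R u)) has_vector_derivative frechet_derivative g (at (x + s *\<^sub>R u)) u) (at s)"
    by (rule hvd_chain[OF l assms])
  then have "((\<lambda>s. g (x + s *\<^sub>R u) \<bullet> e) has_vector_derivative frechet_derivative g (at (x + s *\<^sub>R u)) u \<bullet> e) (at s)"
    by (rule bounded_linear.has_vector_derivative[OF bounded_linear_inner_left])
  then show ?thesis by (simp add: has_real_derivative_iff_has_vector_derivative)
qed

text \<open>
  The mean value theorem applied first in the direction of \<open>u\<close> and then in that of \<open>v\<close>.  The left hand side is symmetric in \<open>u\<close> and
  \<open>v\<close>, which is the source of the symmetry of second derivatives.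
\<close>

lemma second_difference:
  fixes f :: "'a::real_normed_vector \<Rightarrow> 'b::real_inner"
  assumes C: "\<And>y. y \<in> ball x r \<Longrightarrow> f differentiable (at y)"
    and C2: "\<And>y. y \<in> ball x r \<Longrightarrow> (\<lambda>y. frechet_derivative f (at y) u) differentiable (at y)"
    and h: "h > 0" "h * (norm u + norm v) < r"
  shows "\<exists>y\<in>ball x r. (f (x + h *\<^sub>R u + h *\<^sub>R v) - f (x + h *\<^sub>R u) - f (x + h *\<^sub>R v) + f x) \<bullet> e
     = h * h * (frechet_derivative (\<lambda>y. frechet_derivative f (at y) u) (at y) v \<bullet> e)"
proof -
  let ?D = "\<lambda>y. frechet_derivative f (at y) u"
  have b: "x + s *\<^sub>R u + t *\<^sub>R v \<in> ball x r" if "0 \<le> s" "s \<le> h" "0 \<le> t" "t \<le> h" for s t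
  proof -
    have "norm (s *\<^sub>R u + t *\<^sub>R v) \<le> s * norm u + t * norm v" using norm_triangle_ineq[of "s *\<^sub>R u" "t *\<^sub>R v"] that by simp
    also have "\<dots> \<le> h * norm u + h * norm v" using that by (intro add_mono mult_right_mono) auto
    finally have "norm (s *\<^sub>R u + t *\<^sub>R v) < r" using h by (simp add: distrib_left)
    moreover have "dist x (x + s *\<^sub>R u + t *\<^sub>R v) = norm (s *\<^sub>R u + t *\<^sub>R v)"
      by (subst dist_commute) (simp add: dist_norm add.assoc)
    ultimately show ?thesis by simp
  qed
  define \<phi> where "\<phi> s = f (x + h *\<^sub>R v + s *\<^sub>R u) \<bullet> e - f (x + s *\<^sub>R u) \<bullet> e" for s
  have "DERIV \<phi> s :> ?D (x + h *\<^sub>R v + s *\<^sub>R u) \<bullet> e - ?D (x + s *\<^sub>R u) \<bullet> e" if "0 \<le> s" "s \<le> h" for s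
    unfolding \<phi>_def
  proof (intro DERIV_diff line_deriv C)
    show "x + h *\<^sub>R v + s *\<^sub>R u \<in> ball x r" using b[of s h] that h by (simp add: ac_simps)
    show "x + s *\<^sub>R u \<in> ball x r" using b[of s 0] that h by simp
  qed
  then obtain a where a: "0 < a" "a < h" and A: "\<phi> h - \<phi> 0 = (h - 0) * (?D (x + h *\<^sub>R v + a *\<^sub>R u) \<bullet> e - ?D (x + a *\<^sub>R u) \<bullet> e)"
    using MVT2[OF h(1), of \<phi> "\<lambda>s. ?D (x + h *\<^sub>R v + s *\<^sub>R u) \<bullet> e - ?D (x + s *\<^sub>R u) \<bullet> e"] by auto
  define \<psi> where "\<psi> t = ?D (x + a *\<^sub>R u + t *\<^sub>R v) \<bullet> e" for t
  have "DERIV \<psi> t :> frechet_derivative ?D (at (x + a *\<^sub>R u + t *\<^sub>R v)) v \<bullet> e" if "0 \<le> t" "t \<le> h" for t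
    unfolding \<psi>_def by (intro line_deriv C2) (use b[of a t] that a in simp)
  then obtain c where c: "0 < c" "c < h" and B: "\<psi> h - \<psi> 0 = (h - 0) * (frechet_derivative ?D (at (x + a *\<^sub>R u + c *\<^sub>R v)) v \<bullet> e)"
    using MVT2[OF h(1), of \<psi> "\<lambda>t. frechet_derivative ?D (at (x + a *\<^sub>R u + t *\<^sub>R v)) v \<bullet> e"] by auto
  have "(f (x + h *\<^sub>R u + h *\<^sub>R v) - f (x + h *\<^sub>R u) - f (x + h *\<^sub>R v) + f x) \<bullet> e = \<phi> h - \<phi> 0"
    unfolding \<phi>_def by (simp add: inner_diff_left inner_add_left ac_simps)
  also have "\<dots> = h * (\<psi> h - \<psi> 0)" unfolding A \<psi>_def by (simp add: ac_simps)
  also have "\<dots> = h * h * (frechet_derivative ?D (at (x + a *\<^sub>R u + c *\<^sub>R v)) v \<bullet> e)" unfolding B by simp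
  finally show ?thesis using b[of a c] a c by (intro bexI) auto
qed

lemma second_derivative_symmetric:
  fixes f :: "'a::real_normed_vector \<Rightarrow> 'b::real_inner"
  assumes U: "open U" "x \<in> U" and f: "Ck_on (Suc (Suc 0)) U f"
  defines "D \<equiv> \<lambda>u v y. frechet_derivative (\<lambda>y. frechet_derivative f (at y) u) (at y) v"
  shows "D u v x = D v u x"
proof (rule ccontr)
  assume ne: "D u v x \<noteq> D v u x"
  define e where "e = D u v x - D v u x"
  have pos: "(e \<bullet> e) / 2 > 0" using ne by (simp add: e_def)
  have cont: "\<exists>d>0. \<forall>y. dist y x < d \<longrightarrow> dist (D u v y \<bullet> e) (D u v x \<bullet> e) < (e \<bullet> e) / 2" for u v
  proof -
    have "continuous_on U (D u v)" using f by (simp add: D_def)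
    then have "continuous (at x) (D u v)" using U by (simp add: continuous_on_eq_continuous_at)
    then have "continuous (at x) (\<lambda>y. D u v y \<bullet> e)" by (intro continuous_intros)
    then show ?thesis using pos unfolding continuous_at_eps_delta by blast
  qed
  obtain d1 where d1: "d1 > 0" "\<And>y. dist y x < d1 \<Longrightarrow> dist (D u v y \<bullet> e) (D u v x \<bullet> e) < (e \<bullet> e) / 2" using cont by blast
  obtain d2 where d2: "d2 > 0" "\<And>y. dist y x < d2 \<Longrightarrow> dist (D v u y \<bullet> e) (D v u x \<bullet> e) < (e \<bullet> e) / 2" using cont by blast
  obtain d3 where d3: "d3 > 0" "ball x d3 \<subseteq> U" using U by (meson open_contains_ball)
  define r where "r = min d1 (min d2 d3)"
  have r: "r > 0" "r \<le> d1" "r \<le> d2" "ball x r \<subseteq> U" using d1(1) d2(1) d3 by (auto simp: r_def)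
  define h where "h = r / (norm u + norm v + 1)"
  have n: "norm u + norm v + 1 > 0" by (simp add: add_nonneg_pos)
  have h: "h > 0" "h * (norm u + norm v) < r" using r(1) n by (simp_all add: h_def field_simps)
  have h': "h * (norm v + norm u) < r" using h(2) by (simp add: add.commute)
  have C: "f differentiable (at y)" "(\<lambda>y. frechet_derivative f (at y) w) differentiable (at y)" if "y \<in> ball x r" for y w
    using f r(4) that by auto
  obtain y where y: "y \<in> ball x r" and Y: "(f (x + h *\<^sub>R u + h *\<^sub>R v) - f (x + h *\<^sub>R u) - f (x + h *\<^sub>R v) + f x) \<bullet> e = h * h * (D u v y \<bullet> e)"
    using second_difference[OF C h, where e = e] unfolding D_def by blast
  obtain z where z: "z \<in> ball x r" and Z: "(f (x + h *\<^sub>R v + h *\<^sub>R u) - f (x + h *\<^sub>R v) - f (x + h *\<^sub>R u) + f x) \<bullet> e = h * h * (D v u z \<bullet> e)"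
    using second_difference[OF C h(1) h', where e = e] unfolding D_def by blast
  have "f (x + h *\<^sub>R v + h *\<^sub>R u) - f (x + h *\<^sub>R v) - f (x + h *\<^sub>R u) + f x = f (x + h *\<^sub>R u + h *\<^sub>R v) - f (x + h *\<^sub>R u) - f (x + h *\<^sub>R v) + f x"
    by (simp add: algebra_simps)
  then have "h * h * (D u v y \<bullet> e) = h * h * (D v u z \<bullet> e)" unfolding Y[symmetric] Z[symmetric] by (simp only:)
  then have "D u v y \<bullet> e = D v u z \<bullet> e" using h(1) by simp
  moreover have "dist (D u v y \<bullet> e) (D u v x \<bullet> e) < (e \<bullet> e) / 2" using d1(2)[of y] y r by (simp add: dist_commute)
  moreover have "dist (D v u z \<bullet> e) (D v u x \<bullet> e) < (e \<bullet> e) / 2" using d2(2)[of z] z r by (simp add: dist_commute)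
  moreover have "D u v x \<bullet> e - D v u x \<bullet> e = e \<bullet> e" by (simp add: e_def inner_diff_left)
  ultimately show False unfolding dist_real_def by linarith
qed

lemma frechet_expand:
  fixes g :: "'a::euclidean_space \<Rightarrow> 'b::real_normed_vector"
  assumes "g differentiable (at y)"
  shows "frechet_derivative g (at y) v = (\<Sum>b\<in>Basis. (v \<bullet> b) *\<^sub>R frechet_derivative g (at y) b)"
proof -
  have l: "linear (frechet_derivative g (at y))" using assms by (metis frechet_derivative_works has_derivative_linear)
  have "frechet_derivative g (at y) (\<Sum>b\<in>Basis. (v \<bullet> b) *\<^sub>R b) = (\<Sum>b\<in>Basis. (v \<bullet> b) *\<^sub>R frechet_derivative g (at y) b)"
    by (simp add: linear_sum[OF l] linear_cmul[OF l])
  then show ?thesis by (simp add: euclidean_representation)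
qed

text \<open>
  The chain rule for the derivative of \<open>f\<close> evaluated on a vector that varies along a curve: the second derivative, a symmetric form
  \<open>Q\<close>, and the derivative of the vector contribute one term each.
\<close>

lemma second_order:
  fixes f :: "'a::euclidean_space \<Rightarrow> 'b::euclidean_space"
  assumes U: "open U" "x \<in> U" and f: "Ck_on (Suc (Suc 0)) U f"
  obtains Q where "\<forall>u v. Q u v = Q v u"
    "\<forall>c V c' V'. (c has_vector_derivative c') (at 0) \<longrightarrow> c 0 = x \<longrightarrow> (V has_vector_derivative V') (at 0) \<longrightarrow>
      ((\<lambda>t. frechet_derivative f (at (c t)) (V t)) has_vector_derivative (Q c' (V 0) + frechet_derivative f (at x) V')) (at (0::real))"
proof -
  let ?D = "\<lambda>u v y. frechet_derivative (\<lambda>y. frechet_derivative f (at y) u) (at y) v"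
  define Q where "Q u v = (\<Sum>b\<in>Basis. (v \<bullet> b) *\<^sub>R ?D b u x)" for u v
  have fd: "f differentiable (at y)" "(\<lambda>y. frechet_derivative f (at y) b) differentiable (at y)" if "y \<in> U" for y b
    using f that by auto
  have q: "Q u v = (\<Sum>b\<in>Basis. \<Sum>c\<in>Basis. ((v \<bullet> b) * (u \<bullet> c)) *\<^sub>R ?D b c x)" for u v
  proof -
    have "(v \<bullet> b) *\<^sub>R ?D b u x = (\<Sum>c\<in>Basis. ((v \<bullet> b) * (u \<bullet> c)) *\<^sub>R ?D b c x)" for b
      unfolding frechet_expand[OF fd(2)[OF U(2)], of _ u] by (simp add: scaleR_sum_right)
    then show ?thesis by (simp only: Q_def)
  qed
  have t: "((v \<bullet> b) * (u \<bullet> c)) *\<^sub>R ?D b c x = ((u \<bullet> c) * (v \<bullet> b)) *\<^sub>R ?D c b x" for u v b c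
    using second_derivative_symmetric[OF U f, of b c] by (simp add: mult.commute)
  have sym: "Q u v = Q v u" for u v
  proof -
    have "Q u v = (\<Sum>c\<in>Basis. \<Sum>b\<in>Basis. ((v \<bullet> b) * (u \<bullet> c)) *\<^sub>R ?D b c x)" unfolding q by (rule sum.swap)
    also have "\<dots> = (\<Sum>c\<in>Basis. \<Sum>b\<in>Basis. ((u \<bullet> c) * (v \<bullet> b)) *\<^sub>R ?D c b x)" by (intro sum.cong refl t)
    finally show ?thesis unfolding q[of v u] .
  qed
  have "((\<lambda>t. frechet_derivative f (at (c t)) (V t)) has_vector_derivative (Q c' (V 0) + frechet_derivative f (at x) V')) (at 0)"
    if c: "(c has_vector_derivative c') (at 0)" "c 0 = x" and V: "(V has_vector_derivative V') (at 0)" for c V c' V'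
  proof -
    have 1: "((\<lambda>t. \<Sum>b\<in>Basis. (V t \<bullet> b) *\<^sub>R frechet_derivative f (at (c t)) b) has_vector_derivative
        (\<Sum>b\<in>Basis. (V 0 \<bullet> b) *\<^sub>R ?D b c' (c 0) + (V' \<bullet> b) *\<^sub>R frechet_derivative f (at (c 0)) b)) (at 0)"
    proof (rule has_vector_derivative_sum)
      fix b :: 'a assume "b \<in> Basis"
      have i: "((\<lambda>t. V t \<bullet> b) has_vector_derivative V' \<bullet> b) (at 0)"
        by (rule bounded_linear.has_vector_derivative[OF bounded_linear_inner_left V])
      have d: "((\<lambda>t. frechet_derivative f (at (c t)) b) has_vector_derivative ?D b c' (c 0)) (at 0)"
        by (rule hvd_chain[OF c(1)]) (use fd c(2) U(2) in simp)
      show "((\<lambda>t. (V t \<bullet> b) *\<^sub>R frechet_derivative f (at (c t)) b) has_vector_derivative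
          (V 0 \<bullet> b) *\<^sub>R ?D b c' (c 0) + (V' \<bullet> b) *\<^sub>R frechet_derivative f (at (c 0)) b) (at 0)"
        by (rule bounded_bilinear.has_vector_derivative[OF bounded_bilinear_scaleR i d])
    qed
    have 2: "(\<Sum>b\<in>Basis. (V 0 \<bullet> b) *\<^sub>R ?D b c' (c 0) + (V' \<bullet> b) *\<^sub>R frechet_derivative f (at (c 0)) b) = Q c' (V 0) + frechet_derivative f (at x) V'"
      unfolding c(2) Q_def frechet_expand[OF fd(1)[OF U(2)], of V'] by (rule sum.distrib)
    have "\<forall>\<^sub>F t in nhds 0. c t \<in> U" by (rule hvd_open[OF c(1) U(1)]) (simp add: c(2) U(2))
    then have "\<forall>\<^sub>F t in nhds 0. (\<Sum>b\<in>Basis. (V t \<bullet> b) *\<^sub>R frechet_derivative f (at (c t)) b) = frechet_derivative f (at (c t)) (V t)"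
      by eventually_elim (rule frechet_expand[OF fd(1), symmetric])
    then show ?thesis by (rule hvd_transform[OF 1[unfolded 2]])
  qed
  then show thesis using sym that by blast
qed

lemma one_P: "mat 1 \<in> (P_grp :: 'n::finite mat2 set)"
  using Nu_P[of 0, where 'n='n] by (simp add: Nu_def bm_1)

lemma linear_mm: "linear (\<lambda>Y. M ** (Y :: complex^'m^'m))" "linear (\<lambda>Y. (Y :: complex^'m^'m) ** M)"
  by (auto intro!: linearI simp: matrix_add_ldistrib mm_add_rdistrib)

lemma mm_cancel: "P ** Q = mat 1 \<Longrightarrow> P ** (Q ** Z) = (Z :: complex^'m^'m)"
  by (simp add: matrix_mul_assoc)

lemma mat_comm: "A ** mat c = mat c ** (A :: complex^'i^'i)" by (simp add: vec_eq_iff mult.commute)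

lemma P_det: "p \<in> P_grp \<Longrightarrow> det p \<noteq> 0" by (simp add: P_grp_def L_grp_def)

section \<open>Isomorphisms give equivalences\<close>

lemma Ck_const: "Ck_on k S (\<lambda>x. c)"
proof (induction k arbitrary: c)
  case (Suc k)
  have "frechet_derivative (\<lambda>x. c) (at x) = (\<lambda>v. 0)" for x by (rule frechet_derivative_at[symmetric]) simp
  then show ?case using Suc by simp
qed simp

lemma bounded_linear_smooth: assumes f: "bounded_linear f" shows "smooth_on S f"
  unfolding smooth_on_def
proof
  fix k
  have d: "f differentiable (at x)" for x using bounded_linear_imp_has_derivative[OF f] by (auto simp: differentiable_def)
  have fr: "frechet_derivative f (at x) = f" for x
    by (rule frechet_derivative_at[symmetric, OF bounded_linear_imp_has_derivative[OF f]])
  show "Ck_on k S f"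
    by (cases k) (use f d Ck_const in \<open>auto simp: fr intro: linear_continuous_on\<close>)
qed

lemma cls_iff:
  fixes g p :: "'n::finite mat2"
  assumes "g \<in> SO_star" "p \<in> P_grp"
  shows "y \<in> cls (g, p) \<longleftrightarrow> (\<exists>k\<in>K_grp. \<exists>z. mat z \<in> (L_grp :: 'n::finite mat2 set) \<and> y = (g ** k, mat z ** matrix_inv k ** p))"
  using assms by (cases y) (simp add: bundle_rel_def)

lemma cls_self: assumes "g \<in> SO_star" "p \<in> P_grp" shows "(g, p) \<in> cls (g, p :: 'n::finite mat2)"
proof -
  have K: "mat 1 \<in> (K_grp :: 'n mat2 set)" using SO_1 by (auto simp: K_grp_def)
  have L: "mat 1 \<in> (L_grp :: 'n mat2 set)" using one_P by (auto simp: P_grp_def)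
  have "matrix_inv (mat 1) = (mat 1 :: 'n mat2)" by (rule matrix_inv_unique) simp
  then show ?thesis unfolding cls_iff[OF assms] using K L by (intro bexI[of _ "mat 1"] exI[of _ 1]) auto
qed

text \<open>
  This is applied to the scalar by which two lifts of the same map differ.
\<close>

lemma finite_valued_locally_constant:
  fixes f :: "real \<Rightarrow> complex"
  assumes c: "isCont f 0" and S: "finite S" and e: "\<forall>\<^sub>F s in nhds 0. f s \<in> S"
  shows "\<forall>\<^sub>F s in nhds 0. f s = f 0"
proof -
  have "open (- (S - {f 0}))" using S by (intro open_Compl finite_imp_closed) auto
  then have "\<forall>\<^sub>F s in at 0. f s \<in> - (S - {f 0})" using c by (intro topological_tendstoD[of f "f 0"]) (auto simp: isCont_def)
  then have "\<forall>\<^sub>F s in nhds 0. f s \<in> - (S - {f 0})" by (simp add: eventually_nhds_conv_at)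
  then show ?thesis using e by eventually_elim auto
qed

lemma omega_eq: "omega \<beta> x w = matrix_inv (snd x) ** \<beta> (matrix_inv (fst x) ** fst w) ** snd x + matrix_inv (snd x) ** snd w"
  by (cases x; cases w) (simp add: omega_def)

lemma entry_linear: "linear (\<lambda>M :: complex^'j^'i. M $ r $ s)" by (rule linearI) simp_all

text \<open>
  The map \<open>F (g, h) = (A g B, p h)\<close> descends to the quotient.  Any local lift \<open>\<Psi>\<close> of the induced map differs from \<open>F\<close> by a function
  \<open>k\<close> with values in \<open>K\<close> and a scalar.  Along a curve the scalar is locally constant, and the derivative of \<open>k\<close> lies in \<open>\<kk>\<close>, where \<open>\<beta>\<close> is the
  identity; so its contributions to the two terms of the connection cancel.
\<close>

lemma eqv_equivalent:
  fixes \<alpha> \<beta> :: "'n::finite mat2 \<Rightarrow> 'n mat2"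
  assumes q: "eqv \<alpha> \<beta>" and eb: "extension \<beta>"
  shows "equivalent \<alpha> \<beta>"
proof -
  from q obtain A B p0 where AB: "A ** B = mat 1" "B ** A = mat 1" and p0: "p0 \<in> P_grp"
     and SO: "\<forall>g\<in>SO_star. A ** g ** B \<in> SO_star" and so: "\<forall>X\<in>so_star. A ** X ** B \<in> so_star"
     and K: "\<forall>k\<in>K_grp. A ** k ** B \<in> K_grp \<and> B ** k ** A \<in> K_grp \<and> p0 ** k = A ** k ** B ** p0"
     and ab: "\<forall>X\<in>g_alg. \<beta> (A ** X ** B) ** p0 = p0 ** \<alpha> X" unfolding eqv_def by metis
  define F :: "'n mat2 \<times> 'n mat2 \<Rightarrow> 'n mat2 \<times> 'n mat2" where "F = (\<lambda>(g, p). (A ** g ** B, p0 ** p))"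
  have Fgp: "F (g, p) = (A ** g ** B, p0 ** p)" for g p by (simp add: F_def)
  have conj: "(A ** X ** B) ** (A ** Y ** B) = A ** (X ** Y) ** B" for X Y
    by (simp only: matrix_mul_assoc[symmetric] mm_cancel[OF AB(2)])
  have c1: "A ** mat 1 ** B = mat 1" by (simp only: matrix_mul_rid AB)
  have kinv: "p0 ** matrix_inv k = matrix_inv (A ** k ** B) ** p0" if k: "k \<in> K_grp" for k
  proof -
    have i: "matrix_inv k = transpose k" by (rule SO_inv(1)[OF K_SO[OF k]])
    have "matrix_inv (A ** k ** B) = A ** transpose k ** B"
      by (rule matrix_inv_unique) (simp only: conj SO_inv(2)[OF K_SO[OF k]] c1)
    then show ?thesis unfolding i using K K_transpose[OF k] by simp
  qed
  have Fk: "F (g ** k, mat z ** matrix_inv k ** p) = ((A ** g ** B) ** (A ** k ** B), mat z ** matrix_inv (A ** k ** B) ** (p0 ** p))" if k: "k \<in> K_grp" for g k z p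
  proof -
    have "p0 ** (mat z ** matrix_inv k ** p) = (p0 ** mat z) ** matrix_inv k ** p" by (simp only: matrix_mul_assoc)
    also have "\<dots> = mat z ** (p0 ** matrix_inv k) ** p" unfolding mat_comm[of p0] by (simp only: matrix_mul_assoc)
    also have "\<dots> = mat z ** matrix_inv (A ** k ** B) ** (p0 ** p)" unfolding kinv[OF k] by (simp only: matrix_mul_assoc)
    finally show ?thesis unfolding Fgp conj by simp
  qed
  have KK: "\<exists>l\<in>K_grp. k = A ** l ** B" if "k \<in> K_grp" for k
  proof (rule bexI)
    have "A ** (B ** k ** A) ** B = (A ** B) ** k ** (A ** B)" by (simp only: matrix_mul_assoc)
    then show "k = A ** (B ** k ** A) ** B" by (simp add: AB)
    show "B ** k ** A \<in> K_grp" using K that by blast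
  qed
  have Fin: "A ** g ** B \<in> SO_star" "p0 ** p \<in> P_grp" if "g \<in> SO_star" "p \<in> P_grp" for g p
    using SO that P_mult[OF p0] by auto
  have Fcls: "F ` cls (g, p) = cls (F (g, p))" if gp: "g \<in> SO_star" "p \<in> P_grp" for g p
  proof (intro set_eqI iffI)
    fix y assume "y \<in> F ` cls (g, p)"
    then obtain k z where kz: "k \<in> K_grp" "mat z \<in> (L_grp :: 'n mat2 set)" "y = F (g ** k, mat z ** matrix_inv k ** p)"
      using cls_iff[OF gp] by auto
    show "y \<in> cls (F (g, p))" unfolding Fgp cls_iff[OF Fin[OF gp]] using kz K unfolding kz(3) Fk[OF kz(1)] by blast
  next
    fix y assume "y \<in> cls (F (g, p))"
    then obtain k z where kz: "k \<in> K_grp" "mat z \<in> (L_grp :: 'n mat2 set)" "y = (A ** g ** B ** k, mat z ** matrix_inv k ** (p0 ** p))"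
      unfolding Fgp cls_iff[OF Fin[OF gp]] by blast
    obtain l where l: "l \<in> K_grp" "k = A ** l ** B" using KK[OF kz(1)] by blast
    have "(g ** l, mat z ** matrix_inv l ** p) \<in> cls (g, p)" unfolding cls_iff[OF gp] using l kz(2) by blast
    moreover have "y = F (g ** l, mat z ** matrix_inv l ** p)" unfolding Fk[OF l(1)] kz(3) l(2) ..
    ultimately show "y \<in> F ` cls (g, p)" by blast
  qed
  define \<Phi> where "\<Phi> c = F ` c" for c
  have bl: "bounded_linear F"
    unfolding linear_conv_bounded_linear[symmetric] F_def
    by (rule linearI) (auto simp: matrix_add_ldistrib mm_add_rdistrib)
  have "bundle_morphism \<Phi>" unfolding bundle_morphism_def
  proof (intro conjI ballI)
    fix c :: "('n mat2 \<times> 'n mat2) set" assume "c \<in> GxP"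
    then obtain g p where gp: "g \<in> SO_star" "p \<in> P_grp" "c = cls (g, p)" unfolding GxP_def by (auto elim!: quotientE)
    then show "\<Phi> c \<in> GxP" using Fin[OF gp(1,2)] unfolding \<Phi>_def gp(3) Fcls[OF gp(1,2)] Fgp GxP_def by (auto intro!: quotientI)
  next
    fix c :: "('n mat2 \<times> 'n mat2) set" and q
    show "\<Phi> (ract c q) = ract (\<Phi> c) q"
      unfolding \<Phi>_def ract_def image_image F_def by (auto intro!: image_cong simp: matrix_mul_assoc)
  next
    fix x :: "'n mat2 \<times> 'n mat2"
    have "local_lift \<Phi> UNIV F" unfolding local_lift_def
      using bounded_linear_smooth[OF bl] Fin Fcls by (auto simp: \<Phi>_def Fgp)
    then show "\<exists>U \<Psi>. x \<in> U \<and> local_lift \<Phi> U \<Psi>" by blast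
  qed
  moreover have "pulls_back \<Phi> \<beta> \<alpha>" unfolding pulls_back_def
  proof (intro allI impI ballI)
    fix U and \<Psi> :: "'n mat2 \<times> 'n mat2 \<Rightarrow> 'n mat2 \<times> 'n mat2" and g p X A0 :: "'n mat2"
    assume ll: "local_lift \<Phi> U \<Psi>" and g: "g \<in> SO_star" and p: "p \<in> P_grp" and xU: "(g, p) \<in> U" and X: "X \<in> g_alg" and A0: "A0 \<in> p_alg"
    have U: "open U" and sm: "smooth_on U \<Psi>"
      and lf: "\<And>x. x \<in> U \<Longrightarrow> x \<in> SO_star \<times> P_grp \<Longrightarrow> \<Psi> x \<in> SO_star \<times> P_grp \<and> F ` cls x = cls (\<Psi> x)"
      using ll by (auto simp: local_lift_def \<Phi>_def)
    have "Ck_on (Suc 0) U \<Psi>" using sm by (simp only: smooth_on_def)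
    then have df: "\<Psi> differentiable (at (g, p))" using xU by simp
    define V1 where "V1 = fst (frechet_derivative \<Psi> (at (g, p)) (g ** X, p ** A0))"
    define V2 where "V2 = snd (frechet_derivative \<Psi> (at (g, p)) (g ** X, p ** A0))"
    obtain qc where qc: "qc 0 = mat 1" "\<And>s. qc s \<in> P_grp" "(qc has_vector_derivative A0) (at 0)" using cay_P[OF A0] by blast
    define c where "c s = (g ** cay X s, p ** qc s)" for s
    have c0: "c 0 = (g, p)" by (simp add: c_def qc)
    have cd: "(c has_vector_derivative (g ** X, p ** A0)) (at 0)"
      unfolding c_def by (intro hvd_Pair hvd_lin[OF linear_mm(1)] cay_deriv qc)
    have cU: "\<forall>\<^sub>F s in nhds 0. c s \<in> U" by (rule hvd_open[OF cd U]) (simp add: c0 xU)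
    define H1 where "H1 s = fst (\<Psi> (c s))" for s
    define H2 where "H2 s = snd (\<Psi> (c s))" for s
    have Hd: "((\<lambda>s. \<Psi> (c s)) has_vector_derivative (V1, V2)) (at 0)"
      using hvd_chain[OF cd, of \<Psi>] df unfolding c0 V1_def V2_def by simp
    have H1d: "(H1 has_vector_derivative V1) (at 0)" unfolding H1_def using bounded_linear.has_vector_derivative[OF bounded_linear_fst Hd] by simp
    have H2d: "(H2 has_vector_derivative V2) (at 0)" unfolding H2_def using bounded_linear.has_vector_derivative[OF bounded_linear_snd Hd] by simp
    define G0 where "G0 s = A ** (g ** cay X s) ** B" for s
    define P0 where "P0 s = p0 ** (p ** qc s)" for s
    define k where "k s = transpose (G0 s) ** H1 s" for s
    have G0: "G0 s \<in> SO_star" for s unfolding G0_def by (rule Fin(1)[OF SO_mult[OF g cay_SO[OF X]] p])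
    have P0: "P0 s \<in> P_grp" for s unfolding P0_def by (rule Fin(2)[OF g P_mult[OF p qc(2)]])
    have ev: "\<forall>\<^sub>F s in nhds 0. H1 s \<in> SO_star \<and> H2 s \<in> P_grp \<and> k s \<in> K_grp \<and> (\<exists>z. mat z \<in> (L_grp :: 'n mat2 set) \<and> k s ** H2 s = mat z ** P0 s)"
      using cU
    proof eventually_elim
      case (elim s)
      have in1: "g ** cay X s \<in> SO_star" "p ** qc s \<in> P_grp" using SO_mult[OF g cay_SO[OF X]] P_mult[OF p qc(2)] by auto
      then have *: "\<Psi> (c s) \<in> SO_star \<times> P_grp" "F ` cls (c s) = cls (\<Psi> (c s))" using lf[OF elim] by (auto simp: c_def)
      then have H: "H1 s \<in> SO_star" "H2 s \<in> P_grp" "\<Psi> (c s) = (H1 s, H2 s)" by (auto simp: H1_def H2_def mem_Times_iff)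
      have "(H1 s, H2 s) \<in> cls (G0 s, P0 s)"
        using cls_self[OF H(1,2)] *(2) Fcls[OF in1] unfolding H(3) by (simp add: c_def Fgp G0_def P0_def)
      then obtain l z where lz: "l \<in> K_grp" "mat z \<in> (L_grp :: 'n mat2 set)" "H1 s = G0 s ** l" "H2 s = mat z ** matrix_inv l ** P0 s"
        unfolding cls_iff[OF G0 P0] by blast
      have kl: "k s = l" unfolding k_def lz(3) by (rule mm_cancel[OF SO_inv(2)[OF G0]])
      have "k s ** H2 s = mat z ** (l ** matrix_inv l) ** P0 s"
        unfolding kl lz(4) by (simp only: matrix_mul_assoc mat_comm[of l])
      also have "\<dots> = mat z ** P0 s" unfolding SO_inv(1)[OF K_SO[OF lz(1)]] SO_inv(3)[OF K_SO[OF lz(1)]] by simp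
      finally show ?case using H kl lz by blast
    qed
    have G0d: "(G0 has_vector_derivative A ** (g ** X) ** B) (at 0)"
      unfolding G0_def by (intro hvd_lin[OF linear_mm(2)] hvd_lin[OF linear_mm(1)] cay_deriv)
    have P0d: "(P0 has_vector_derivative p0 ** (p ** A0)) (at 0)"
      unfolding P0_def by (intro hvd_lin[OF linear_mm(1)] qc)
    define \<kappa> where "\<kappa> = transpose (G0 0) ** V1 + transpose (A ** (g ** X) ** B) ** H1 0"
    have kd: "(k has_vector_derivative \<kappa>) (at 0)" unfolding k_def \<kappa>_def by (rule hvd_mm[OF hvd_lin[OF linear_transpose G0d] H1d])
    have Md: "((\<lambda>s. k s ** H2 s) has_vector_derivative (k 0 ** V2 + \<kappa> ** H2 0)) (at 0)" by (rule hvd_mm[OF kd H2d])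
    obtain i j where ij: "P0 0 $ i $ j \<noteq> 0"
    proof (rule ccontr)
      assume "\<not> thesis"
      then have z: "P0 0 = 0" using that by (auto simp: vec_eq_iff)
      have "mat 1 = (0 :: 'n mat2)" using inv_mult(2)[OF P_det[OF P0[of 0]]] unfolding z by simp
      then have "(mat 1 :: 'n mat2) $ Inl None $ Inl None = 0" by simp
      then show False by (simp add: mat_nth)
    qed
    \<comment> \<open>the scalar, extracted from an entry that does not vanish near \<open>0\<close>; this shows that it is continuous\<close>
    define zf where "zf s = (k s ** H2 s) $ i $ j / P0 s $ i $ j" for s
    have P0ij: "((\<lambda>s. P0 s $ i $ j) has_vector_derivative (p0 ** (p ** A0)) $ i $ j) (at 0)" by (rule hvd_lin[OF entry_linear P0d])
    have zc: "isCont zf 0" unfolding zf_def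
      using has_vector_derivative_continuous[OF hvd_lin[OF entry_linear Md]] has_vector_derivative_continuous[OF P0ij] ij
      by (intro isCont_divide) auto
    have "\<forall>\<^sub>F s in nhds 0. P0 s $ i $ j \<in> - {0}" by (rule hvd_open[OF P0ij]) (use ij in auto)
    then have zev: "\<forall>\<^sub>F s in nhds 0. mat (zf s) \<in> (L_grp :: 'n mat2 set) \<and> k s ** H2 s = mat (zf s) ** P0 s"
      using ev
    proof eventually_elim
      case (elim s)
      then obtain z where z: "mat z \<in> (L_grp :: 'n mat2 set)" "k s ** H2 s = mat z ** P0 s" by blast
      then have "zf s = z" using elim by (simp add: zf_def)
      then show ?case using z by simp
    qed
    have "\<forall>\<^sub>F s in nhds 0. zf s = zf 0"
    proof (rule finite_valued_locally_constant[OF zc])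
      show "finite {z :: complex. z ^ CARD('n option + 'n option) = 1}" by (rule finite_roots_unity) (simp add: Suc_leI)
      show "\<forall>\<^sub>F s in nhds 0. zf s \<in> {z :: complex. z ^ CARD('n option + 'n option) = 1}"
        using zev by eventually_elim (use mat_L in blast)
    qed
    then have "\<forall>\<^sub>F s in nhds 0. k s ** H2 s = mat (zf 0) ** P0 s" using zev by eventually_elim simp
    from hvd_unique_ev[OF Md hvd_lin[OF linear_mm(1) P0d] this]
    have eq1: "k 0 ** V2 + \<kappa> ** H2 0 = mat (zf 0) ** (p0 ** (p ** A0))" .
    have e0: "H1 0 \<in> SO_star" "H2 0 \<in> P_grp" "k 0 \<in> K_grp" "k 0 ** H2 0 = mat (zf 0) ** P0 0"
      using eventually_nhds_x_imp_x[OF ev] eventually_nhds_x_imp_x[OF zev] by auto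
    have kS: "k 0 \<in> SO_star" by (rule K_SO[OF e0(3)])
    note kk = SO_inv(2,3)[OF kS]
    note GG = SO_inv(2,3)[OF G0[of 0]]
    define W where "W = A ** X ** B"
    have W: "W \<in> so_star" using so X by (simp add: W_def)
    \<comment> \<open>the velocity of the first component of the lift, moved back to the fibre of \<open>F\<close> by \<open>k\<close>\<close>
    define Y where "Y = transpose (G0 0) ** V1 ** transpose (k 0)"
    have G0': "A ** (g ** X) ** B = G0 0 ** W" unfolding G0_def W_def by (simp only: cay_0 matrix_mul_rid matrix_mul_assoc[symmetric] mm_cancel[OF AB(2)])
    have H1k: "H1 0 = G0 0 ** k 0" unfolding k_def by (simp only: mm_cancel[OF GG(2)])
    have tW: "transpose W = - W" using W by (simp add: so_iff)
    have kY: "\<kappa> ** transpose (k 0) = Y - W"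
      unfolding \<kappa>_def G0' Y_def
      by (simp add: mm_add_rdistrib matrix_transpose_mul tW H1k) (simp only: mm_diff matrix_mul_assoc[symmetric] mm_cancel[OF GG(1)] kk matrix_mul_rid)
    have kso: "\<kappa> ** transpose (k 0) \<in> so_star"
    proof -
      have "transpose (k 0) ** \<kappa> \<in> so_star"
        by (rule deriv_SO[OF kd]) (use ev in \<open>eventually_elim\<close>, use K_SO in blast)
      then have "k 0 ** (transpose (k 0) ** \<kappa>) ** transpose (k 0) \<in> so_star" by (rule SO_conj_so[OF kS])
      then show ?thesis by (simp only: mm_cancel[OF kk(2)])
    qed
    have kk_alg: "\<kappa> ** transpose (k 0) \<in> k_alg"
    proof -
      have z: "\<kappa> $ r $ s = 0" if rs: "block r \<noteq> 1 \<or> block s \<noteq> 1" for r s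
      proof (rule hvd_unique_ev[OF hvd_lin[OF entry_linear kd]])
        show "((\<lambda>_. mat 1 $ r $ s) has_vector_derivative 0) (at 0)" by (rule has_vector_derivative_const)
        show "\<forall>\<^sub>F t in nhds 0. k t $ r $ s = mat 1 $ r $ s" using ev by eventually_elim (use rs in \<open>auto simp: K_grp_def\<close>)
      qed
      obtain a y c' x M z' d w f where km: "\<kappa> = bm a y c' x M z' d w f" by (rule bm_exists)
      have "a = 0" "c' = 0" "d = 0" "f = 0"
        using z[of "Inl None" "Inl None"] z[of "Inl None" "Inr None"] z[of "Inr None" "Inl None"] z[of "Inr None" "Inr None"] unfolding km by simp_all
      moreover have "y = 0" "w = 0" "x = 0" "z' = 0"
        using z[of "Inl None" "mid _"] z[of "Inr None" "mid _"] z[of "mid _" "Inl None"] z[of "mid _" "Inr None"] unfolding km by (simp_all add: vec_eq_iff)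
      ultimately have "\<kappa> = kb M" unfolding km by simp
      moreover obtain l where "k 0 = kg l" using e0(3) by (rule K_cases) blast
      ultimately have "\<kappa> ** transpose (k 0) = kb (M ** transpose l)" by simp
      then show ?thesis using kso by (simp add: k_bm g_bm)
    qed
    have Y: "Y \<in> so_star"
    proof -
      have "Y = W - (0 - \<kappa> ** transpose (k 0))" unfolding kY by simp
      then show ?thesis using so_diff[OF W so_diff[OF so_0 kso]] by simp
    qed
    have lb: "linear \<beta>" using eb by (simp add: extension_def)
    have bY: "\<beta> Y = \<beta> W + \<kappa> ** transpose (k 0)"
    proof -
      have "\<beta> (Y - W) = Y - W" using eb kk_alg unfolding kY[symmetric] by (simp add: extension_def)
      then show ?thesis unfolding kY linear_diff[OF lb] by (simp add: algebra_simps)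
    qed
    have bk: "\<beta> (transpose (H1 0) ** V1) = transpose (k 0) ** \<beta> Y ** k 0"
    proof -
      have i: "matrix_inv (transpose (k 0)) = k 0" using SO_inv(1)[OF SO_transpose[OF kS]] by simp
      have "transpose (H1 0) ** V1 = transpose (k 0) ** Y ** k 0"
        unfolding H1k Y_def matrix_transpose_mul by (simp only: matrix_mul_assoc[symmetric] kk matrix_mul_rid)
      moreover have "\<beta> (transpose (k 0) ** Y ** matrix_inv (transpose (k 0))) = transpose (k 0) ** \<beta> Y ** matrix_inv (transpose (k 0))"
        using eb Y K_transpose[OF e0(3)] unfolding extension_def by blast
      ultimately show ?thesis unfolding i by simp
    qed
    let ?I = "matrix_inv (H2 0)" and ?ip = "matrix_inv p"
    note HI = inv_mult(2)[OF P_det[OF e0(2)]]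
    note pI = inv_mult[OF P_det[OF p]]
    let ?l = "?I ** \<beta> (transpose (H1 0) ** V1) ** H2 0 + ?I ** V2" and ?r = "?ip ** \<alpha> X ** p + A0"
    have P00: "P0 0 = p0 ** p" unfolding P0_def qc(1) by simp
    \<comment> \<open>the two values of the connection are compared after multiplication by \<open>k H2\<close>, which removes the inverses\<close>
    have "k 0 ** H2 0 ** ?l = \<beta> Y ** (k 0 ** H2 0) + k 0 ** V2"
      unfolding bk by (simp only: matrix_add_ldistrib matrix_mul_assoc[symmetric] mm_cancel[OF HI] mm_cancel[OF kk(2)])
    also have "\<dots> = \<beta> W ** (k 0 ** H2 0) + (k 0 ** V2 + \<kappa> ** H2 0)"
      unfolding bY by (simp only: mm_add_rdistrib matrix_mul_assoc[symmetric] mm_cancel[OF kk(1)]) (simp add: ac_simps)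
    also have "\<dots> = \<beta> W ** (mat (zf 0) ** (p0 ** p)) + mat (zf 0) ** (p0 ** (p ** A0))" unfolding eq1 e0(4) P00 ..
    also have "\<beta> W ** (mat (zf 0) ** (p0 ** p)) = mat (zf 0) ** ((\<beta> W ** p0) ** p)"
    proof -
      have "\<beta> W ** (mat (zf 0) ** (p0 ** p)) = (\<beta> W ** mat (zf 0)) ** (p0 ** p)" by (simp only: matrix_mul_assoc)
      then show ?thesis unfolding mat_comm[of "\<beta> W"] by (simp only: matrix_mul_assoc)
    qed
    also have "\<beta> W ** p0 = p0 ** \<alpha> X" using ab X by (simp add: W_def)
    also have "mat (zf 0) ** (p0 ** \<alpha> X ** p) + mat (zf 0) ** (p0 ** (p ** A0)) = k 0 ** H2 0 ** ?r"
      unfolding e0(4) P00 by (simp only: matrix_add_ldistrib matrix_mul_assoc[symmetric] mm_cancel[OF pI(2)])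
    finally have "k 0 ** H2 0 ** ?l = k 0 ** H2 0 ** ?r" .
    then have "?I ** (transpose (k 0) ** (k 0 ** H2 0 ** ?l)) = ?I ** (transpose (k 0) ** (k 0 ** H2 0 ** ?r))" by simp
    then have lr: "?l = ?r" by (simp only: matrix_mul_assoc[symmetric] mm_cancel[OF kk(1)] mm_cancel[OF inv_mult(1)[OF P_det[OF e0(2)]]])
    have Psi: "\<Psi> (g, p) = (H1 0, H2 0)" by (simp add: H1_def H2_def c0)
    have "omega \<beta> (\<Psi> (g, p)) (frechet_derivative \<Psi> (at (g, p)) (g ** X, p ** A0)) = ?l"
      unfolding omega_eq V1_def[symmetric] V2_def[symmetric] Psi by (simp add: SO_inv(1)[OF e0(1)])
    also have "\<dots> = omega \<alpha> (g, p) (g ** X, p ** A0)"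
      unfolding lr omega_eq by (simp add: SO_inv(1)[OF g] mm_cancel[OF SO_inv(2)[OF g]] mm_cancel[OF pI(1)])
    finally show "omega \<beta> (\<Psi> (g, p)) (frechet_derivative \<Psi> (at (g, p)) (g ** X, p ** A0)) = omega \<alpha> (g, p) (g ** X, p ** A0)" .
  qed
  ultimately show ?thesis unfolding equivalent_def by blast
qed

section \<open>Equivalences transport the curvature\<close>

lemma zero_p_alg: "0 \<in> (p_alg :: 'n::finite mat2 set)"
proof -
  have "bm 0 0 0 0 0 0 0 0 0 \<in> (p_alg :: 'n mat2 set)" unfolding p_bm su_bm by simp
  then show ?thesis by (simp only: bm_0)
qed

text \<open>
  With a local lift \<open>\<Psi>\<close> near \<open>(1, 1)\<close>, the condition on the connections at \<open>(c, 1)\<close>, evaluated on \<open>(X c, 0)\<close>, is an equation for the first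
  derivative of \<open>\<Psi>\<close>.  At \<open>c = 1\<close> it relates \<open>\<beta> (L X)\<close> and \<open>\<alpha> X\<close>, where \<open>L X\<close> is the logarithmic derivative of the first component of \<open>\<Psi>\<close>.  Its derivative
  along a curve with tangent \<open>Y\<close>, antisymmetrized in \<open>X\<close> and \<open>Y\<close>, no longer contains second derivatives of \<open>\<Psi>\<close> and relates the curvatures.
\<close>

lemma transport:
  fixes \<alpha> \<beta> :: "'n::finite mat2 \<Rightarrow> 'n mat2"
  assumes e: "equivalent \<alpha> \<beta>" and la: "linear \<alpha>" and lb: "linear \<beta>"
  shows "\<exists>P L. P \<in> P_grp \<and> (\<forall>X\<in>g_alg. L X \<in> g_alg) \<and>
    (\<forall>X\<in>g_alg. \<forall>r s. block s < block r \<longrightarrow> (\<beta> (L X) ** P) $ r $ s = (P ** \<alpha> X) $ r $ s) \<and>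
    (\<forall>X\<in>g_alg. \<forall>Y\<in>g_alg. curv \<beta> (L X) (L Y) ** P = P ** curv \<alpha> X Y)"
proof -
  obtain \<Phi> where bm: "bundle_morphism \<Phi>" and pb: "pulls_back \<Phi> \<beta> \<alpha>" using e by (auto simp: equivalent_def)
  let ?o = "mat 1 :: 'n mat2"
  have o: "(?o, ?o) \<in> SO_star \<times> P_grp" using SO_1 one_P by auto
  obtain U \<Psi> where oU: "(?o, ?o) \<in> U" and ll: "local_lift \<Phi> U \<Psi>" using bm o unfolding bundle_morphism_def by blast
  have U: "open U" and sm: "smooth_on U \<Psi>" and lf: "\<And>x. x \<in> U \<Longrightarrow> x \<in> SO_star \<times> P_grp \<Longrightarrow> \<Psi> x \<in> SO_star \<times> P_grp"
    using ll by (auto simp: local_lift_def)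
  have ck: "Ck_on (Suc (Suc 0)) U \<Psi>" using sm by (simp only: smooth_on_def)
  then have df: "\<Psi> differentiable (at x)" if "x \<in> U" for x using that by simp
  obtain Q where Qs: "\<forall>u v. Q u v = Q v u"
    and Qd: "\<forall>c V c' V'. (c has_vector_derivative c') (at 0) \<longrightarrow> c 0 = (?o, ?o) \<longrightarrow> (V has_vector_derivative V') (at 0) \<longrightarrow>
      ((\<lambda>t. frechet_derivative \<Psi> (at (c t)) (V t)) has_vector_derivative (Q c' (V 0) + frechet_derivative \<Psi> (at (?o, ?o)) V')) (at (0::real))"
    by (rule second_order[OF U oU ck])
  let ?D = "frechet_derivative \<Psi> (at (?o, ?o))"
  define G1 where "G1 = fst (\<Psi> (?o, ?o))"
  define P where "P = snd (\<Psi> (?o, ?o))"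
  define a where "a X = fst (?D (X, 0))" for X
  define b where "b X = snd (?D (X, 0))" for X
  define L where "L X = transpose G1 ** a X" for X
  have G1: "G1 \<in> SO_star" and P: "P \<in> P_grp" using lf[OF oU o] by (auto simp: G1_def P_def mem_Times_iff)
  have Dl: "linear ?D" using df[OF oU] by (metis frechet_derivative_works has_derivative_linear)
  have Dab: "?D (X, 0) = (a X, b X)" for X by (simp add: a_def b_def)
  have ab: "a (X - Y) = a X - a Y" "b (X - Y) = b X - b Y" for X Y
    using linear_diff[OF Dl, of "(X, 0)" "(Y, 0)"] by (simp_all add: a_def b_def)
  define c where "c X s = (cay X s, ?o)" for X :: "'n mat2" and s
  have c0: "c X 0 = (?o, ?o)" for X by (simp add: c_def)
  have cd: "(c X has_vector_derivative (X, 0)) (at 0)" for X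
    unfolding c_def by (intro hvd_Pair cay_deriv has_vector_derivative_const)
  have cU: "\<forall>\<^sub>F s in nhds 0. c X s \<in> U" for X by (rule hvd_open[OF cd U]) (simp add: c0 oU)
  have cin: "c X s \<in> SO_star \<times> P_grp" if "X \<in> g_alg" for X s using cay_SO[OF that] one_P by (simp add: c_def)
  have Pd: "((\<lambda>s. \<Psi> (c X s)) has_vector_derivative (a X, b X)) (at 0)" for X
    using hvd_chain[OF cd, of \<Psi> X] df[OF oU] unfolding c0 Dab by simp
  have P1d: "((\<lambda>s. fst (\<Psi> (c X s))) has_vector_derivative a X) (at 0)" for X
    using bounded_linear.has_vector_derivative[OF bounded_linear_fst Pd[of X]] by simp
  have P2d: "((\<lambda>s. snd (\<Psi> (c X s))) has_vector_derivative b X) (at 0)" for X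
    using bounded_linear.has_vector_derivative[OF bounded_linear_snd Pd[of X]] by simp
  have ev: "\<forall>\<^sub>F s in nhds 0. fst (\<Psi> (c X s)) \<in> SO_star \<and> snd (\<Psi> (c X s)) \<in> P_grp" if X: "X \<in> g_alg" for X
    using cU[of X] by eventually_elim (use lf[OF _ cin[OF X]] in \<open>auto simp: mem_Times_iff\<close>)
  have LX: "L X \<in> so_star" if X: "X \<in> g_alg" for X
  proof -
    have "\<forall>\<^sub>F s in nhds 0. fst (\<Psi> (c X s)) \<in> SO_star" using ev[OF X] by eventually_elim blast
    from deriv_SO[OF P1d this] show ?thesis by (simp add: c0 L_def G1_def)
  qed
  have bX: "b X $ r $ s = 0" if X: "X \<in> g_alg" and rs: "block s < block r" for X r s
  proof (rule hvd_unique_ev[OF hvd_lin[OF entry_linear P2d]])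
    show "((\<lambda>_. 0) has_vector_derivative 0) (at 0)" by (rule has_vector_derivative_const)
    show "\<forall>\<^sub>F t in nhds 0. snd (\<Psi> (c X t)) $ r $ s = 0" using ev[OF X] by eventually_elim (use rs in \<open>auto simp: P_grp_def\<close>)
  qed
  have E1: "\<beta> (transpose (fst (\<Psi> (cc, ?o))) ** fst (frechet_derivative \<Psi> (at (cc, ?o)) (X ** cc, 0))) ** snd (\<Psi> (cc, ?o))
      + snd (frechet_derivative \<Psi> (at (cc, ?o)) (X ** cc, 0)) = snd (\<Psi> (cc, ?o)) ** \<alpha> (transpose cc ** X ** cc)"
    if cc: "cc \<in> SO_star" "(cc, ?o) \<in> U" and X: "X \<in> g_alg" for cc X
  proof -
    define W where "W = frechet_derivative \<Psi> (at (cc, ?o)) (X ** cc, 0)"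
    define X' where "X' = transpose cc ** X ** cc"
    have X': "X' \<in> so_star" using SO_conj_so[OF SO_transpose[OF cc(1)] X] by (simp add: X'_def)
    have cX: "cc ** X' = X ** cc" unfolding X'_def by (simp only: matrix_mul_assoc[symmetric] mm_cancel[OF SO_inv(3)[OF cc(1)]])
    have "omega \<beta> (\<Psi> (cc, ?o)) (frechet_derivative \<Psi> (at (cc, ?o)) (cc ** X', ?o ** 0)) = omega \<alpha> (cc, ?o) (cc ** X', ?o ** 0)"
      using pb ll cc X' one_P zero_p_alg unfolding pulls_back_def by blast
    moreover have i1: "matrix_inv ?o = ?o" by (rule matrix_inv_unique) simp
    moreover have z: "?o ** 0 = 0" by simp
    moreover have t: "\<Psi> (cc, ?o) \<in> SO_star \<times> P_grp" by (rule lf[OF cc(2)]) (use cc(1) one_P in simp)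
    then have in1: "fst (\<Psi> (cc, ?o)) \<in> SO_star" "snd (\<Psi> (cc, ?o)) \<in> P_grp" by (auto simp: mem_Times_iff)
    ultimately have eq: "matrix_inv (snd (\<Psi> (cc, ?o))) ** \<beta> (transpose (fst (\<Psi> (cc, ?o))) ** fst W) ** snd (\<Psi> (cc, ?o)) + matrix_inv (snd (\<Psi> (cc, ?o))) ** snd W = \<alpha> X'"
      unfolding omega_eq W_def cX[symmetric]
      by (simp add: SO_inv(1) cc(1) mm_cancel[OF SO_inv(2)[OF cc(1)]])
    note PI = mm_cancel[OF inv_mult(2)[OF P_det[OF in1(2)]]]
    show ?thesis unfolding W_def[symmetric] X'_def[symmetric] eq[symmetric]
      by (simp only: matrix_add_ldistrib matrix_mul_assoc[symmetric] PI)
  qed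
  have E0: "\<beta> (L X) ** P + b X = P ** \<alpha> X" if X: "X \<in> g_alg" for X
    using E1[of ?o X] SO_1 oU X by (simp add: Dab L_def G1_def P_def transpose_mat)
  have E2: "\<beta> (L X) ** b Y + \<beta> (transpose G1 ** (fst (Q (Y, 0) (X, 0)) + a (X ** Y)) - L Y ** L X) ** P + (snd (Q (Y, 0) (X, 0)) + b (X ** Y))
      = P ** \<alpha> (X ** Y - Y ** X) + b Y ** \<alpha> X" if X: "X \<in> g_alg" and Y: "Y \<in> g_alg" for X Y
  proof -
    define W where "W s = frechet_derivative \<Psi> (at (c Y s)) (X ** cay Y s, 0)" for s
    have Vd: "((\<lambda>s. (X ** cay Y s, 0 :: 'n mat2)) has_vector_derivative (X ** Y, 0)) (at 0)"
      by (intro hvd_Pair hvd_lin[OF linear_mm(1)] cay_deriv has_vector_derivative_const)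
    have Wd: "(W has_vector_derivative (Q (Y, 0) (X, 0) + (a (X ** Y), b (X ** Y)))) (at 0)"
      using Qd[rule_format, OF cd c0 Vd, of Y] unfolding W_def by (simp add: Dab)
    have W1: "((\<lambda>s. fst (W s)) has_vector_derivative fst (Q (Y, 0) (X, 0)) + a (X ** Y)) (at 0)"
      using bounded_linear.has_vector_derivative[OF bounded_linear_fst Wd] by simp
    have W2: "((\<lambda>s. snd (W s)) has_vector_derivative snd (Q (Y, 0) (X, 0)) + b (X ** Y)) (at 0)"
      using bounded_linear.has_vector_derivative[OF bounded_linear_snd Wd] by simp
    have W0: "fst (W 0) = a X" "fst (\<Psi> (c Y 0)) = G1" "snd (\<Psi> (c Y 0)) = P" by (simp_all add: W_def c0 Dab G1_def P_def)
    note l1 = hvd_mm[OF hvd_lin[OF linear_transpose P1d[of Y]] W1, unfolded W0]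
    note l2 = has_vector_derivative_add[OF hvd_mm[OF hvd_lin[OF lb l1] P2d[of Y], unfolded W0] W2]
    note r1 = hvd_mm[OF hvd_lin[OF linear_mm(2)[of X] hvd_lin[OF linear_transpose cay_deriv[of Y]]] cay_deriv[of Y], unfolded cay_0]
    note r2 = hvd_mm[OF P2d[of Y] hvd_lin[OF la r1], unfolded W0]
    have "\<forall>\<^sub>F s in nhds 0. \<beta> (transpose (fst (\<Psi> (c Y s))) ** fst (W s)) ** snd (\<Psi> (c Y s)) + snd (W s)
        = snd (\<Psi> (c Y s)) ** \<alpha> (transpose (cay Y s) ** X ** cay Y s)"
      using cU[of Y]
    proof eventually_elim
      case (elim s)
      show ?case using E1[OF cay_SO[OF Y] _ X, of s] elim by (simp add: c_def W_def)
    qed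
    from hvd_unique_ev[OF l2 r2 this]
    have *: "\<beta> (transpose G1 ** a X) ** b Y + \<beta> (transpose G1 ** (fst (Q (Y, 0) (X, 0)) + a (X ** Y)) + transpose (a Y) ** a X) ** P + (snd (Q (Y, 0) (X, 0)) + b (X ** Y))
      = P ** \<alpha> (transpose (mat 1) ** X ** Y + transpose Y ** X ** mat 1) + b Y ** \<alpha> (transpose (mat 1) ** X ** mat 1)"
      by (simp add: W0 c0)
    have tY: "transpose Y = - Y" "transpose (L Y) = - L Y" using Y LX[OF Y] by (auto simp: so_iff)
    have "transpose (a Y) ** a X = transpose (L Y) ** L X"
      unfolding L_def matrix_transpose_mul by (simp only: transpose_transpose matrix_mul_assoc[symmetric] mm_cancel[OF SO_inv(3)[OF G1]])
    then show ?thesis using * by (simp add: tY transpose_mat L_def[symmetric])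
  qed
  have low: "(\<beta> (L X) ** P) $ r $ s = (P ** \<alpha> X) $ r $ s" if "X \<in> g_alg" "block s < block r" for X r s
    unfolding E0[OF that(1), symmetric] by (simp add: bX[OF that])
  have "curv \<beta> (L X) (L Y) ** P = P ** curv \<alpha> X Y" if X: "X \<in> g_alg" and Y: "Y \<in> g_alg" for X Y
  proof -
    have br: "X ** Y - Y ** X \<in> g_alg" using so_br[OF X Y] by (simp add: br_def)
    have b: "b X = P ** \<alpha> X - \<beta> (L X) ** P" "b Y = P ** \<alpha> Y - \<beta> (L Y) ** P" using E0[OF X] E0[OF Y] by (simp_all add: algebra_simps)
    have Q: "Q (X, 0) (Y, 0) = Q (Y, 0) (X, 0)" using Qs by blast
    have aYX: "\<alpha> (Y ** X - X ** Y) = - \<alpha> (X ** Y - Y ** X)" by (simp add: linear_neg[OF la, symmetric])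
    define q1 where "q1 = \<beta> (transpose G1 ** fst (Q (Y, 0) (X, 0)))"
    define q2 where "q2 = snd (Q (Y, 0) (X, 0))"
    define t1 where "t1 = \<beta> (transpose G1 ** a (X ** Y))"
    define t2 where "t2 = \<beta> (transpose G1 ** a (Y ** X))"
    define m1 where "m1 = \<beta> (L X ** L Y)"
    define m2 where "m2 = \<beta> (L Y ** L X)"
    define A where "A = \<alpha> (X ** Y - Y ** X)"
    note lin = matrix_add_ldistrib mm_diff linear_add[OF lb] linear_diff[OF lb]
    have e1: "\<beta> (L X) ** b Y + (q1 + t1 - m2) ** P + (q2 + b (X ** Y)) - (P ** A + b Y ** \<alpha> X) = 0"
      using E2[OF X Y] unfolding lin q1_def t1_def m2_def q2_def A_def by simp
    have e2: "\<beta> (L Y) ** b X + (q1 + t2 - m1) ** P + (q2 + b (Y ** X)) - (P ** (- A) + b X ** \<alpha> Y) = 0"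
      using E2[OF Y X] unfolding lin q1_def t2_def m1_def q2_def Q A_def aYX by simp
    have e3: "(t1 - t2) ** P + (b (X ** Y) - b (Y ** X)) - P ** A = 0"
      using E0[OF br] unfolding L_def ab lin t1_def t2_def A_def by simp
    have bb: "\<beta> (br (L X) (L Y)) = m1 - m2" by (simp add: br_def linear_diff[OF lb] m1_def m2_def)
    \<comment> \<open>\<open>q1\<close> and \<open>q2\<close>, which stem from the second derivative, occur in both \<open>e1\<close> and \<open>e2\<close> and cancel\<close>
    have "curv \<beta> (L X) (L Y) ** P - P ** curv \<alpha> X Y =
        (0 - (\<beta> (L X) ** b Y + (q1 + t1 - m2) ** P + (q2 + b (X ** Y)) - (P ** A + b Y ** \<alpha> X)))
        + (\<beta> (L Y) ** b X + (q1 + t2 - m1) ** P + (q2 + b (Y ** X)) - (P ** (- A) + b X ** \<alpha> Y))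
        + ((t1 - t2) ** P + (b (X ** Y) - b (Y ** X)) - P ** A)"
      unfolding curv_def bb unfolding br_def A_def[symmetric] b
      by (simp add: matrix_add_ldistrib mm_add_rdistrib mm_diff matrix_mul_assoc algebra_simps)
    then show ?thesis unfolding e1 e2 e3 by simp
  qed
  then show ?thesis using P LX low by blast
qed

section \<open>The invariant\<close>

lemma nrm_ext_col:
  "\<exists>A Y C M' Z W F. nrm_ext \<beta> \<gamma> s (kb M + mc x + r *\<^sub>R ee) = (bm A Y C (qop \<beta> \<gamma> x) M' Z (complex_of_real (r * nrm2 \<beta> \<gamma>)) W F :: 'n::finite mat2)"
  unfolding linear_add[OF linear_nrm_ext] linear_cmul[OF linear_nrm_ext] nrm_ext_vals Let_def
  by (simp add: scaleR_complex)

text \<open>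
  Let \<open>p0\<close>, \<open>P1\<close>, \<open>pe\<close> be the diagonal blocks of \<open>P\<close>; they preserve the hermitian form up to sign.  Comparing first columns,
  \<open>L\<close> acts in degree \<open>-1\<close> as \<open>U = P1 / p0\<close>.  The curvature on two vectors of degree \<open>-1\<close>, evaluated on a vector that is isotropic for the
  symmetric form, gives \<open>\<bar>\<tau>'\<bar> = \<bar>p0\<bar>\<^sup>2 \<bar>\<tau>\<bar>\<close>.  If \<open>\<tau> \<noteq> 0\<close>, it also shows that \<open>P\<close> has no component of degree \<open>1\<close>, so that the curvature on
  \<open>ee\<close> and a vector of degree \<open>-1\<close> can be compared; this gives \<open>\<bar>\<tau>' \<rho>'\<bar> = \<bar>p0\<bar>\<^sup>4 \<bar>\<tau> \<rho>\<bar>\<close>.  The two relations and \<open>\<tau>\<^sup>2 + \<bar>\<rho>\<bar>\<^sup>2 = 1\<close>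
  force \<open>\<bar>p0\<bar> = 1\<close>.  If \<open>\<tau> = 0\<close>, the first relation suffices.
\<close>

lemma abs_tau_invariant:
  fixes \<beta> \<gamma> \<beta>' \<gamma>' :: complex and s s' :: real and P :: "'n::finite mat2"
  assumes nz: "\<beta> \<noteq> 0 \<or> \<gamma> \<noteq> 0" and nz': "\<beta>' \<noteq> 0 \<or> \<gamma>' \<noteq> 0"
    and D: "nrm2 \<beta> \<gamma> = 1" and D': "nrm2 \<beta>' \<gamma>' = 1"
    and P: "P \<in> P_grp" and L: "\<And>X. X \<in> g_alg \<Longrightarrow> L X \<in> g_alg"
    and low: "\<And>X r j. X \<in> g_alg \<Longrightarrow> block j < block r \<Longrightarrow> (nrm_ext \<beta>' \<gamma>' s' (L X) ** P) $ r $ j = (P ** nrm_ext \<beta> \<gamma> s X) $ r $ j"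
    and cv: "\<And>X Y. X \<in> g_alg \<Longrightarrow> Y \<in> g_alg \<Longrightarrow> curv (nrm_ext \<beta>' \<gamma>' s') (L X) (L Y) ** P = P ** curv (nrm_ext \<beta> \<gamma> s) X Y"
  shows "\<bar>tau \<beta> \<gamma>\<bar> = \<bar>tau \<beta>' \<gamma>'\<bar>"
proof -
  let ?n = "real CARD('n)"
  define \<nu> where "\<nu> = tau \<beta> \<gamma> / (2 * ?n + 1)"
  define \<nu>' where "\<nu>' = tau \<beta>' \<gamma>' / (2 * ?n + 1)"
  let ?a = "nrm_ext \<beta> \<gamma> s :: 'n mat2 \<Rightarrow> 'n mat2" and ?a' = "nrm_ext \<beta>' \<gamma>' s' :: 'n mat2 \<Rightarrow> 'n mat2"
  obtain p0 q r x P1 z d w pe where Pb0: "P = bm p0 q r x P1 z d w pe" by (rule bm_exists)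
  have "x = 0" "d = 0" "w = 0" and PL: "P \<in> L_grp" using P unfolding Pb0 P_bm by auto
  then have Pb: "P = bm p0 q r 0 P1 z 0 0 pe" using Pb0 by simp
  obtain e where e: "e = 1 \<or> e = -1" "adj P ** J ** P = mat e ** J"
  proof -
    have "mat (-1) ** J = - (J :: 'n mat2)" by (simp add: vec_eq_iff)
    then show ?thesis using PL that[of 1] that[of "-1"] unfolding L_grp_iff by auto
  qed
  have J1: "cnj p0 * pe = e" and J2: "adj P1 ** J ** P1 = mat e ** J" and J3: "q = 0 \<Longrightarrow> adj P1 *v (J *v z) = 0"
    using e(2) unfolding Pb adj_bm J_bm bm_mat bm_mult bm_eq_iff by (simp_all add: matrix_vector_mul_assoc)
  have e0: "e \<noteq> 0" "cmod e = 1" using e(1) by auto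
  have p0: "p0 \<noteq> 0" "pe \<noteq> 0" using J1 e0 by auto
  have hP: "dt (sg (P1 *v u)) (P1 *v v) = e * dt (sg u) v" for u v using J2 unfolding adj_J_iff by blast
  have dets: "det P1 \<noteq> 0" "det (adj P1) \<noteq> 0"
  proof -
    have "det (adj P1) * det (J :: 'n sqmat) * det P1 = e ^ CARD('n + 'n) * det (J :: 'n sqmat)"
      using arg_cong[OF J2, of det] by (simp only: det_mul det_mat)
    then show "det P1 \<noteq> 0" "det (adj P1) \<noteq> 0" using e0 det_J[where 'm='n] by auto
  qed
  have inj: "P1 *v v = 0 \<Longrightarrow> v = 0" "adj P1 *v v = 0 \<Longrightarrow> v = 0" for v
    using inv_mult(1)[OF dets(1)] inv_mult(1)[OF dets(2)] by (metis matrix_vector_mul_assoc matrix_vector_mul_lid matrix_vector_mult_0_right)+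
  have split: "\<exists>M1 x1 r1. M1 \<in> so_star \<and> L (kb M + mc x + r *\<^sub>R ee) = kb M1 + mc x1 + r1 *\<^sub>R ee \<and>
      p0 *s qop \<beta>' \<gamma>' x1 = P1 *v qop \<beta> \<gamma> x + complex_of_real r *s z \<and> complex_of_real r1 * p0 = pe * complex_of_real r"
    if M: "M \<in> so_star" for M x r
  proof -
    let ?X = "kb M + mc x + r *\<^sub>R ee :: 'n mat2"
    have X: "?X \<in> g_alg" using M by (simp add: g_bm scaleR_complex)
    obtain M1 x1 r1 where s1: "L ?X = kb M1 + mc x1 + r1 *\<^sub>R ee" "M1 \<in> so_star" using L[OF X] by (rule g_split)
    obtain A Y C M' Z W F where 1: "?a ?X = bm A Y C (qop \<beta> \<gamma> x) M' Z (complex_of_real (r * 1)) W F" using nrm_ext_col[of \<beta> \<gamma> s M x r] unfolding D by blast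
    obtain A' Y' C' M'' Z' W' F' where 2: "?a' (L ?X) = bm A' Y' C' (qop \<beta>' \<gamma>' x1) M'' Z' (complex_of_real (r1 * 1)) W' F'" using nrm_ext_col[of \<beta>' \<gamma>' s' M1 x1 r1] unfolding D' s1 by blast
    have "(?a' (L ?X) ** P) $ mid i $ Inl None = (P ** ?a ?X) $ mid i $ Inl None" for i by (rule low[OF X]) simp
    then have "p0 *s qop \<beta>' \<gamma>' x1 = P1 *v qop \<beta> \<gamma> x + complex_of_real r *s z"
      unfolding 1 2 Pb bm_mult bm_nth by (simp add: vec_eq_iff mult.commute)
    moreover have "(?a' (L ?X) ** P) $ Inr None $ Inl None = (P ** ?a ?X) $ Inr None $ Inl None" by (rule low[OF X]) simp
    then have "complex_of_real r1 * p0 = pe * complex_of_real r" unfolding 1 2 Pb bm_mult bm_nth by simp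
    ultimately show ?thesis using s1 by blast
  qed
  have split0: "\<exists>M1 x1. M1 \<in> so_star \<and> L (mc x) = kb M1 + mc x1 + 0 *\<^sub>R ee \<and> qop \<beta>' \<gamma>' x1 = (1 / p0) *s (P1 *v qop \<beta> \<gamma> x)" for x
  proof -
    obtain M1 x1 r1 where 1: "M1 \<in> so_star" "L (kb 0 + mc x + 0 *\<^sub>R ee) = kb M1 + mc x1 + r1 *\<^sub>R ee"
      "p0 *s qop \<beta>' \<gamma>' x1 = P1 *v qop \<beta> \<gamma> x + complex_of_real 0 *s z" "complex_of_real r1 * p0 = pe * complex_of_real 0" using split[OF so_0] by blast
    have "r1 = 0" using 1(4) p0 by simp
    moreover have "kb 0 + mc x + 0 *\<^sub>R ee = mc x" by simp
    moreover have "qop \<beta>' \<gamma>' x1 = (1 / p0) *s (p0 *s qop \<beta>' \<gamma>' x1)" using p0 by (simp add: vector_smult_assoc)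
    ultimately show ?thesis using 1 by auto
  qed
  have ex: "extension ?a" "extension ?a'" using nrm_ext_reg_normal[OF nz] nrm_ext_reg_normal[OF nz'] by (auto simp: reg_normal_ext_def)
  define U where "U u = (1 / p0) *s (P1 *v u)" for u
  have PU: "P1 *v u = p0 *s U u" for u using p0 by (simp add: U_def vector_smult_assoc)
  have Ui: "U (\<i> *s u) = \<i> *s U u" for u by (simp add: U_def vector_smult_assoc mult.commute)
  have Sc1: "Sc \<nu>' (U u) (U v) ** P1 = P1 ** Sc \<nu> u v \<and> q v* Sc \<nu> u v = 0" for u v
  proof -
    obtain x where u: "u = qop \<beta> \<gamma> x" using nz by (rule qop_surj)
    obtain y where v: "v = qop \<beta> \<gamma> y" using nz by (rule qop_surj)
    obtain M1 x1 where 1: "M1 \<in> so_star" "L (mc x) = kb M1 + mc x1 + 0 *\<^sub>R ee" "qop \<beta>' \<gamma>' x1 = U u" using split0[of x] by (auto simp: u U_def)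
    obtain M2 y1 where 2: "M2 \<in> so_star" "L (mc y) = kb M2 + mc y1 + 0 *\<^sub>R ee" "qop \<beta>' \<gamma>' y1 = U v" using split0[of y] by (auto simp: v U_def)
    have "curv ?a' (L (mc x)) (L (mc y)) = curv ?a' (mc x1) (mc y1)"
      unfolding 1(2) 2(2) by (subst curv_split[OF ex(2) 1(1) 2(1)]) simp
    then have "curv ?a' (mc x1) (mc y1) ** P = P ** curv ?a (mc x) (mc y)" using cv[OF mc_g mc_g, of x y] by simp
    then show ?thesis
      unfolding nrm_ext_curv(1)[OF nz] nrm_ext_curv(1)[OF nz'] D D' 1(3) 2(3) u[symmetric] v[symmetric] \<nu>_def[symmetric] \<nu>'_def[symmetric]
      unfolding Pb by simp
  qed
  have ScA: "Sc \<nu> u (\<i> *s u) *v u = (- 4 * \<nu> * dt (sg u) u) *s u" if "dt u u = 0" for u :: "'n cv"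
    unfolding Sc_apply using that by (simp add: vec_eq_iff algebra_simps)
  have nu: "\<nu>' * e = cnj p0 * p0 * \<nu>"
  proof -
    define u where "u = axis (Inl undefined) 1 + \<i> *s (axis (Inr undefined) 1 :: 'n cv)"
    have u: "dt u u = 0" "dt (sg u) u = 2 * \<i>" unfolding u_def using special_vector[of \<i> undefined] by auto
    have "u \<noteq> 0" using u(2) by auto
    then have U0: "U u \<noteq> 0" using inj(1)[of u] p0 PU[of u] by auto
    let ?h = "dt (sg (U u)) (U u)"
    have h: "cnj p0 * p0 * ?h = e * (2 * \<i>)"
    proof -
      have "dt (sg (P1 *v u)) (P1 *v u) = cnj p0 * p0 * ?h" unfolding PU by (simp add: mult.assoc mult.left_commute)
      then show ?thesis unfolding hP u(2) by simp
    qed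
    have "Sc \<nu>' (U u) (\<i> *s U u) *v (P1 *v u) = P1 *v (Sc \<nu> u (\<i> *s u) *v u)"
      using Sc1[of u "\<i> *s u"] by (simp add: matrix_vector_mul_assoc Ui)
    then have "p0 *s (Sc \<nu>' (U u) (\<i> *s U u) *v U u) = p0 *s ((- 8 * \<i> * \<nu>) *s U u)"
      unfolding ScA[OF u(1)] u(2) by (simp add: PU vector_smult_assoc mult.commute)
    then have "Sc \<nu>' (U u) (\<i> *s U u) *v U u = (- 8 * \<i> * \<nu>) *s U u" using p0 by (simp only: vector_mul_lcancel simp_thms)
    then have "qop (8 * \<i> * \<nu> - 4 * \<nu>' * ?h) (2 * (2 * ?n + 1) * \<nu>' * dt (U u) (U u)) (U u) = 0"
      unfolding Sc_apply qop_def by (simp add: vec_eq_iff algebra_simps)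
    then have "8 * \<i> * \<nu> - 4 * \<nu>' * ?h = 0" using U0 unfolding qop_eq_0 by blast
    then have "\<nu>' * ?h = 2 * \<i> * \<nu>" by (simp add: algebra_simps)
    then have "\<nu>' * (cnj p0 * p0 * ?h) = cnj p0 * p0 * (2 * \<i> * \<nu>)" by (metis mult.assoc mult.left_commute)
    then have "(2 * \<i>) * (\<nu>' * e) = (2 * \<i>) * (cnj p0 * p0 * \<nu>)" unfolding h by (simp only: mult.assoc mult.left_commute mult.commute)
    then show ?thesis by simp
  qed
  define m where "m = (cmod p0)\<^sup>2"
  have m: "m > 0" using p0 by (simp add: m_def)
  have nu_m: "\<bar>\<nu>'\<bar> = m * \<bar>\<nu>\<bar>"
  proof -
    have "cmod (\<nu>' * e) = cmod (cnj p0 * p0 * \<nu>)" by (simp only: nu)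
    then show ?thesis using e0 by (simp add: norm_mult m_def power2_eq_square)
  qed
  have n1: "2 * ?n + 1 > 0" by linarith
  have tn: "tau \<beta> \<gamma> = (2 * ?n + 1) * \<nu>" "tau \<beta>' \<gamma>' = (2 * ?n + 1) * \<nu>'" using n1 by (simp_all add: \<nu>_def \<nu>'_def)
  show ?thesis
  proof (cases "\<nu> = 0")
    case True
    then show ?thesis using nu_m unfolding tn by simp
  next
    case False
    have "q = 0"
    proof -
      have dq: "q $ Inl a + w * q $ Inr a = 0" if w: "w = \<i> \<or> w = - \<i>" for a w
      proof -
        define u where "u = axis (Inl a) 1 + w *s (axis (Inr a) 1 :: 'n cv)"
        have u: "dt u u = 0" "dt (sg u) u = 2 * w" unfolding u_def using special_vector[OF w, of a] by auto
        have "dt (q v* Sc \<nu> u (\<i> *s u)) u = 0" using Sc1[of u "\<i> *s u"] by simp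
        then have "dt q (Sc \<nu> u (\<i> *s u) *v u) = 0" by (simp only: dt_mv)
        then have "dt q u = 0" unfolding ScA[OF u(1)] u(2) using False w by auto
        then show ?thesis by (simp add: u_def)
      qed
      have "q $ Inl a = 0" "q $ Inr a = 0" for a using dq[of \<i> a] dq[of "- \<i>" a] by (auto simp: complex_eq_iff)
      then show ?thesis by (simp add: cv_eq_iff)
    qed
    then have "J *v z = 0" using J3 inj(2) by blast
    then have "J *v (J *v z) = 0" by simp
    then have z0: "z = 0" by (simp add: matrix_vector_mul_assoc J_J del: J_mv)
    obtain M1 x1 r1 where ee1: "M1 \<in> so_star" "L (kb 0 + mc 0 + 1 *\<^sub>R ee) = kb M1 + mc x1 + r1 *\<^sub>R ee"
      "p0 *s qop \<beta>' \<gamma>' x1 = P1 *v qop \<beta> \<gamma> 0 + complex_of_real 1 *s z" "complex_of_real r1 * p0 = pe * complex_of_real 1" using split[OF so_0] by blast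
    have "qop \<beta>' \<gamma>' x1 = 0" using ee1(3) p0 unfolding z0 by (simp add: vec_eq_iff)
    then have x1: "x1 = 0" using nz' unfolding qop_eq_0 by blast
    have r1: "complex_of_real r1 * p0 = pe" using ee1(4) by simp
    have Lee: "L ee = kb M1 + mc 0 + r1 *\<^sub>R ee" using ee1(2) unfolding x1 by simp
    define K where "K = 2 * (?n + 1) * \<i> * \<nu> * rho \<beta> \<gamma>"
    define K' where "K' = complex_of_real r1 * pe * (2 * (?n + 1) * \<i> * \<nu>' * rho \<beta>' \<gamma>') / cnj p0"
    \<comment> \<open>\<open>P1\<close> need not commute with \<open>sg\<close>, but the curvature forces it to do so up to a factor; applying this twice gives its absolute value\<close>
    have T: "K' *s sg (P1 *v u) = K *s (P1 *v sg u)" for u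
    proof -
      obtain x where u: "u = qop \<beta> \<gamma> x" using nz by (rule qop_surj)
      obtain M2 y1 where 2: "M2 \<in> so_star" "L (mc x) = kb M2 + mc y1 + 0 *\<^sub>R ee" "qop \<beta>' \<gamma>' y1 = U u" using split0[of x] by (auto simp: u U_def)
      have mc0: "(mc 0 :: 'n mat2) = 0" by simp
      have c0: "curv ?a' 0 C = 0" for C using curv_lin(3)[OF linear_nrm_ext, of \<beta>' \<gamma>' s' 0 0 C] by simp
      have "curv ?a' (L ee) (L (mc x)) = r1 *\<^sub>R curv ?a' ee (mc y1)"
        unfolding Lee 2(2) by (subst curv_split[OF ex(2) ee1(1) 2(1)]) (simp only: mc0 c0, simp)
      then have "r1 *\<^sub>R curv ?a' ee (mc y1) ** P = P ** curv ?a ee (mc x)" using cv[OF ee_g mc_g, of x] by simp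
      then have eqz: "r1 *\<^sub>R curv ?a' ee (mc y1) ** P = P ** curv ?a ee (mc x)" .
      define v where "v = qop 0 (2 * (?n + 1) * \<i> * \<nu> * rho \<beta> \<gamma>) u"
      define v' where "v' = qop 0 (2 * (?n + 1) * \<i> * \<nu>' * rho \<beta>' \<gamma>') (U u)"
      have c1: "curv ?a ee (mc x) = Zp v"
        unfolding nrm_ext_curv(2)[OF nz] D u[symmetric] \<nu>_def[symmetric] v_def by (simp add: mult.assoc mult.commute mult.left_commute)
      have c2: "curv ?a' ee (mc y1) = Zp v'"
        unfolding nrm_ext_curv(2)[OF nz'] D' 2(3) \<nu>'_def[symmetric] v'_def by (simp add: mult.assoc mult.commute mult.left_commute)
      have "complex_of_real r1 * pe * v' $ i = (P1 *v v) $ i" for i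
      proof -
        have "(r1 *\<^sub>R Zp v' ** P) $ mid i $ Inr None = (P ** Zp v) $ mid i $ Inr None" using eqz unfolding c1 c2 by (simp only:)
        then show ?thesis unfolding Pb by (simp add: scaleR_complex mult.assoc mult.commute mult.left_commute)
      qed
      then have "(complex_of_real r1 * pe) *s v' = P1 *v v" by (simp add: vec_eq_iff)
      then have "(complex_of_real r1 * pe * (2 * (?n + 1) * \<i> * \<nu>' * rho \<beta>' \<gamma>')) *s sg (U u) = K *s (P1 *v sg u)"
        unfolding v_def v'_def by (simp add: qop_def K_def vector_smult_assoc mult.assoc)
      moreover have "K' *s sg (P1 *v u) = (complex_of_real r1 * pe * (2 * (?n + 1) * \<i> * \<nu>' * rho \<beta>' \<gamma>')) *s sg (U u)"
        unfolding K'_def PU using p0 by (simp add: vector_smult_assoc)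
      ultimately show ?thesis by simp
    qed
    have KK: "cmod K' = cmod K"
    proof -
      define u where "u = (axis (Inl undefined) 1 :: 'n cv)"
      have "u \<noteq> 0" by (simp add: u_def axis_eq_0_iff)
      then obtain i where i: "(P1 *v u) $ i \<noteq> 0" using inj(1)[of u] by (auto simp: vec_eq_iff)
      have "cnj K *s (K' *s sg (P1 *v sg u)) = cnj K *s (K *s (P1 *v sg (sg u)))" by (simp only: T)
      also have "cnj K *s (K' *s sg (P1 *v sg u)) = K' *s sg (K *s (P1 *v sg u))" by (simp add: vector_smult_assoc mult.commute)
      also have "\<dots> = K' *s sg (K' *s sg (P1 *v u))" by (simp only: T)
      finally have "(K' * cnj K') *s (P1 *v u) = (K * cnj K) *s (P1 *v u)" by (simp add: vec_eq_iff mult.commute mult.left_commute)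
      then have "K' * cnj K' = K * cnj K" using i by (metis mult_cancel_right vector_smult_component)
      then have "complex_of_real ((cmod K')\<^sup>2) = complex_of_real ((cmod K)\<^sup>2)" unfolding complex_norm_square .
      then have "(cmod K')\<^sup>2 = (cmod K)\<^sup>2" by (simp only: of_real_eq_iff)
      then show ?thesis by (simp add: power2_eq_iff_nonneg)
    qed
    define R where "R = cmod (rho \<beta> \<gamma>)"
    define R' where "R' = cmod (rho \<beta>' \<gamma>')"
    have pe: "cmod p0 * cmod pe = 1" using arg_cong[OF J1, of cmod] e0 by (simp add: norm_mult)
    have r1': "\<bar>r1\<bar> * cmod p0 = cmod pe" using arg_cong[OF r1, of cmod] by (simp add: norm_mult)
    have n2: "?n + 1 > 0" by linarith
    have "\<bar>\<nu>'\<bar> * R' = m\<^sup>2 * (\<bar>\<nu>\<bar> * R)"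
    proof -
      have p: "cmod p0 > 0" using p0 by simp
      have "\<bar>r1\<bar> * cmod pe * (\<bar>\<nu>'\<bar> * R') = cmod p0 * (\<bar>\<nu>\<bar> * R)"
      proof -
        have ab: "\<bar>2 * (?n + 1) * y\<bar> = 2 * (?n + 1) * \<bar>y\<bar>" for y :: real using n2 by (simp add: abs_mult)
        have "K = complex_of_real (2 * (?n + 1) * \<nu>) * (\<i> * rho \<beta> \<gamma>)" unfolding K_def by simp
        then have cK: "cmod K = 2 * (?n + 1) * \<bar>\<nu>\<bar> * R" by (simp only: norm_mult norm_of_real norm_ii mult_1 ab R_def)
        have "K' * cnj p0 = complex_of_real r1 * pe * (complex_of_real (2 * (?n + 1) * \<nu>') * (\<i> * rho \<beta>' \<gamma>'))" unfolding K'_def using p0 by simp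
        then have "cmod (K' * cnj p0) = \<bar>r1\<bar> * cmod pe * (2 * (?n + 1) * \<bar>\<nu>'\<bar> * R')" by (simp only: norm_mult norm_of_real norm_ii mult_1 ab R'_def)
        then have "2 * (?n + 1) * (\<bar>r1\<bar> * cmod pe * (\<bar>\<nu>'\<bar> * R')) = cmod K * cmod p0" unfolding norm_mult KK complex_mod_cnj by (simp only: mult.assoc mult.left_commute mult.commute)
        also have "\<dots> = 2 * (?n + 1) * (cmod p0 * (\<bar>\<nu>\<bar> * R))" unfolding cK by (simp only: mult.assoc mult.left_commute mult.commute)
        finally show ?thesis using n2 by (simp only: mult_cancel_left) simp
      qed
      then have "(cmod p0 * (\<bar>r1\<bar> * cmod p0)) * (cmod p0 * cmod pe) * (\<bar>\<nu>'\<bar> * R') = cmod p0 * cmod p0 * cmod p0 * cmod p0 * (\<bar>\<nu>\<bar> * R)"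
      proof -
        have "(cmod p0 * (\<bar>r1\<bar> * cmod p0)) * (cmod p0 * cmod pe) * (\<bar>\<nu>'\<bar> * R') = cmod p0 * cmod p0 * cmod p0 * (\<bar>r1\<bar> * cmod pe * (\<bar>\<nu>'\<bar> * R'))"
          by (simp only: mult.assoc mult.left_commute mult.commute)
        also have "\<dots> = cmod p0 * cmod p0 * cmod p0 * (cmod p0 * (\<bar>\<nu>\<bar> * R))" by (simp only: \<open>\<bar>r1\<bar> * cmod pe * (\<bar>\<nu>'\<bar> * R') = cmod p0 * (\<bar>\<nu>\<bar> * R)\<close>)
        finally show ?thesis by (simp only: mult.assoc)
      qed
      then show ?thesis unfolding r1' pe m_def by (simp add: power2_eq_square mult.assoc)
    qed
    then have "m * \<bar>\<nu>\<bar> * R' = m * \<bar>\<nu>\<bar> * (m * R)" unfolding nu_m by (simp add: power2_eq_square mult.assoc mult.left_commute)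
    then have RR: "R' = m * R" using m False by simp
    have tt: "(tau \<beta>' \<gamma>')\<^sup>2 = m\<^sup>2 * (tau \<beta> \<gamma>)\<^sup>2"
    proof -
      have "\<bar>tau \<beta>' \<gamma>'\<bar> = m * \<bar>tau \<beta> \<gamma>\<bar>" unfolding tn abs_mult nu_m by (simp add: mult.left_commute)
      then have "\<bar>tau \<beta>' \<gamma>'\<bar>\<^sup>2 = (m * \<bar>tau \<beta> \<gamma>\<bar>)\<^sup>2" by simp
      then show ?thesis by (simp add: power_mult_distrib)
    qed
    have "1 = m\<^sup>2 * ((tau \<beta> \<gamma>)\<^sup>2 + R\<^sup>2)"
      using tau_rho[OF nz'] tt RR unfolding R'_def[symmetric] by (simp add: power_mult_distrib algebra_simps)
    then have "m\<^sup>2 = 1" using tau_rho[OF nz] by (simp add: R_def)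
    then have "(tau \<beta>' \<gamma>')\<^sup>2 = (tau \<beta> \<gamma>)\<^sup>2" using tt by simp
    then show ?thesis by (auto simp: power2_eq_iff abs_eq_iff)
  qed
qed

section \<open>Normalization of the quaternion\<close>

lemma eqv_cong:
  assumes "eqv \<alpha> \<beta>" "\<And>X. X \<in> g_alg \<Longrightarrow> \<alpha>' X = \<alpha> X" "\<And>X. X \<in> g_alg \<Longrightarrow> \<beta>' X = \<beta> X"
  shows "eqv \<alpha>' (\<beta>' :: 'n::finite mat2 \<Rightarrow> 'n mat2)"
proof -
  obtain A B p where *: "A ** B = mat 1" "B ** A = mat 1" "p \<in> P_grp"
     "\<forall>g\<in>SO_star. A ** g ** B \<in> SO_star" "\<forall>X\<in>so_star. A ** X ** B \<in> so_star"
     "\<forall>k\<in>K_grp. A ** k ** B \<in> K_grp \<and> B ** k ** A \<in> K_grp \<and> p ** k = A ** k ** B ** p"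
     "\<forall>X\<in>g_alg. \<beta> (A ** X ** B) ** p = p ** \<alpha> X" using assms(1) unfolding eqv_def by metis
  have "\<forall>X\<in>g_alg. \<beta>' (A ** X ** B) ** p = p ** \<alpha>' X" using *(5,7) assms(2,3) by simp
  then show ?thesis using *(1-6) unfolding eqv_def by blast
qed

text \<open>
  The sign of \<open>\<tau>\<close> is the sign of \<open>\<bar>\<beta> - \<i> \<gamma>\<bar> - \<bar>\<beta> + \<i> \<gamma>\<bar>\<close>, so a flip achieves \<open>\<tau> \<le> 0\<close>, that is \<open>t \<ge> 0\<close>.
\<close>

lemma flip_pq:
  assumes nz: "\<beta> \<noteq> 0 \<or> \<gamma> \<noteq> 0"
  obtains \<gamma>' where "\<gamma>' = \<gamma> \<or> \<gamma>' = - \<gamma>" "cmod (\<beta> - \<i> * \<gamma>') \<le> cmod (\<beta> + \<i> * \<gamma>')"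
    "eqv (nrm_ext \<beta> \<gamma> s) (nrm_ext \<beta> \<gamma>' 0 :: 'n::finite mat2 \<Rightarrow> 'n mat2)"
proof (cases "cmod (\<beta> - \<i> * \<gamma>) \<le> cmod (\<beta> + \<i> * \<gamma>)")
  case True
  show ?thesis by (rule that[of \<gamma>]) (use True move_s[OF nz] in auto)
next
  case False
  show ?thesis by (rule that[of "- \<gamma>"]) (use False eqv_trans[OF move_s[OF nz] move_flip[OF nz]] in auto)
qed

text \<open>
  Scaling by \<open>l\<close> and rotating by \<open>\<theta>\<close> multiplies \<open>\<beta> + \<i> \<gamma>\<close> and \<open>\<beta> - \<i> \<gamma>\<close> by \<open>l e\<^sup>i\<^sup>\<theta>\<close> and \<open>l e\<^sup>-\<^sup>i\<^sup>\<theta>\<close>.  Hence both phases can be prescribed, and the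
  common scale as well; \<open>t\<close> is read off from the ratio of the absolute values.
\<close>

lemma normalization:
  assumes nz: "\<beta> \<noteq> 0 \<or> \<gamma> \<noteq> 0"
  obtains t B G where "t \<in> {0..1}" "B \<noteq> 0 \<or> G \<noteq> 0"
    "B + \<i> * G = sqrt 2 * Complex (bnorm t $ 1) (bnorm t $ 4)" "B - \<i> * G = - \<i> * sqrt 2 * Complex (bnorm t $ 3) (bnorm t $ 2)"
    "eqv (nrm_ext \<beta> \<gamma> s) (nrm_ext B G 0 :: 'n::finite mat2 \<Rightarrow> 'n mat2)"
proof -
  obtain \<gamma>' where g': "\<gamma>' = \<gamma> \<or> \<gamma>' = - \<gamma>" and le: "cmod (\<beta> - \<i> * \<gamma>') \<le> cmod (\<beta> + \<i> * \<gamma>')"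
    and e1: "eqv (nrm_ext \<beta> \<gamma> s) (nrm_ext \<beta> \<gamma>' 0 :: 'n mat2 \<Rightarrow> 'n mat2)" using flip_pq[OF nz] by metis
  have nz': "\<beta> \<noteq> 0 \<or> \<gamma>' \<noteq> 0" using nz g' by auto
  define p where "p = \<beta> + \<i> * \<gamma>'"
  define q where "q = \<beta> - \<i> * \<gamma>'"
  define R where "R = sqrt ((cmod p)\<^sup>2 + (cmod q)\<^sup>2)"
  have R2: "R\<^sup>2 = (cmod p)\<^sup>2 + (cmod q)\<^sup>2" by (simp add: R_def)
  have "R\<^sup>2 > 0" unfolding R2 p_def q_def pq_norms(1) using nrm2_pos[OF nz'] by simp
  then have R: "R > 0" by (simp add: R_def)
  define t where "t = ((cmod p)\<^sup>2 - (cmod q)\<^sup>2) / R\<^sup>2"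
  have qp: "(cmod q)\<^sup>2 \<le> (cmod p)\<^sup>2" using le by (simp add: p_def q_def power_mono)
  have t: "t \<in> {0..1}"
  proof -
    have "(cmod p)\<^sup>2 - (cmod q)\<^sup>2 \<le> R\<^sup>2" unfolding R2 by simp
    then have "t \<le> 1" unfolding t_def using \<open>R\<^sup>2 > 0\<close> by (simp only: divide_le_eq_1_pos)
    moreover have "0 \<le> t" unfolding t_def using qp by simp
    ultimately show ?thesis by simp
  qed
  have tR: "t * R\<^sup>2 = (cmod p)\<^sup>2 - (cmod q)\<^sup>2" using R by (simp add: t_def)
  have b1: "sqrt ((1 + t) / 2) = cmod p / R"
  proof -
    have "(1 + t) / 2 * R\<^sup>2 = (R\<^sup>2 + t * R\<^sup>2) / 2" by (simp add: algebra_simps)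
    also have "\<dots> = (cmod p)\<^sup>2" unfolding tR unfolding R2 by simp
    finally have "(1 + t) / 2 = (cmod p / R)\<^sup>2" unfolding power_divide using R by (intro nonzero_eq_divide_eq[THEN iffD2]) auto
    then show ?thesis using R by simp
  qed
  have b3: "sqrt ((1 - t) / 2) = cmod q / R"
  proof -
    have "(1 - t) / 2 * R\<^sup>2 = (R\<^sup>2 - t * R\<^sup>2) / 2" by (simp add: algebra_simps)
    also have "\<dots> = (cmod q)\<^sup>2" unfolding tR unfolding R2 by simp
    finally have "(1 - t) / 2 = (cmod q / R)\<^sup>2" unfolding power_divide using R by (intro nonzero_eq_divide_eq[THEN iffD2]) auto
    then show ?thesis using R by simp
  qed
  \<comment> \<open>the phases by which \<open>p\<close> and \<open>q\<close> have to be turned: \<open>p\<close> becomes positive and \<open>q\<close> a positive multiple of \<open>-\<i>\<close>\<close>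
  define a where "a = - Arg p"
  define b where "b = - pi / 2 - Arg q"
  define \<phi> where "\<phi> = (a + b) / 2"
  define \<theta> where "\<theta> = (a - b) / 2"
  have ang: "Arg p + (\<phi> + \<theta>) = 0" "Arg q + (\<phi> - \<theta>) = - pi / 2" by (simp_all add: \<phi>_def \<theta>_def a_def b_def field_simps)
  define l where "l = complex_of_real (sqrt 2 / R) * cis \<phi>"
  have l: "l \<noteq> 0" using R by (simp add: l_def)
  have nz2: "l * \<beta> \<noteq> 0 \<or> l * \<gamma>' \<noteq> 0" using nz' l by simp
  define B where "B = (l * \<beta>) * complex_of_real (cos \<theta>) - (l * \<gamma>') * complex_of_real (sin \<theta>)"
  define G where "G = (l * \<beta>) * complex_of_real (sin \<theta>) + (l * \<gamma>') * complex_of_real (cos \<theta>)"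
  have polar: "z = complex_of_real (cmod z) * cis (Arg z)" for z using rcis_cmod_Arg[of z] by (simp add: rcis_def)
  have cs: "cis \<theta> = complex_of_real (cos \<theta>) + \<i> * complex_of_real (sin \<theta>)" "cis (- \<theta>) = complex_of_real (cos \<theta>) - \<i> * complex_of_real (sin \<theta>)"
    by (simp_all add: complex_eq_iff)
  have BG1: "B + \<i> * G = l * cis \<theta> * p" unfolding B_def G_def cs p_def by (simp add: algebra_simps)
  have BG2: "B - \<i> * G = l * cis (- \<theta>) * q" unfolding B_def G_def cs q_def by (simp add: algebra_simps)
  have P1: "l * cis \<theta> * p = complex_of_real (sqrt 2 * (cmod p / R))"
  proof -
    have "l * cis \<theta> * p = complex_of_real (sqrt 2 / R) * complex_of_real (cmod p) * (cis (Arg p) * (cis \<phi> * cis \<theta>))"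
      unfolding l_def by (subst polar[of p]) (simp only: mult.assoc mult.left_commute mult.commute)
    also have "cis (Arg p) * (cis \<phi> * cis \<theta>) = 1" unfolding cis_mult ang by simp
    finally show ?thesis by (simp flip: of_real_mult)
  qed
  have P2: "l * cis (- \<theta>) * q = - \<i> * complex_of_real (sqrt 2 * (cmod q / R))"
  proof -
    have "l * cis (- \<theta>) * q = complex_of_real (sqrt 2 / R) * complex_of_real (cmod q) * (cis (Arg q) * (cis \<phi> * cis (- \<theta>)))"
      unfolding l_def by (subst polar[of q]) (simp only: mult.assoc mult.left_commute mult.commute)
    also have "cis (Arg q) * (cis \<phi> * cis (- \<theta>)) = - \<i>" using ang(2) unfolding cis_mult by (simp add: complex_eq_iff)
    finally show ?thesis by (simp flip: of_real_mult)
  qed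
  have E: "eqv (nrm_ext \<beta> \<gamma> s) (nrm_ext B G 0 :: 'n mat2 \<Rightarrow> 'n mat2)"
    unfolding B_def G_def by (rule eqv_trans[OF e1 eqv_trans[OF move_scale[OF nz' l] move_rot[OF nz2]]])
  have 1: "B + \<i> * G = sqrt 2 * Complex (bnorm t $ 1) (bnorm t $ 4)"
    unfolding BG1 P1 by (simp add: bnorm_def b1 complex_eq_iff)
  have 2: "B - \<i> * G = - \<i> * sqrt 2 * Complex (bnorm t $ 3) (bnorm t $ 2)"
    unfolding BG2 P2 by (simp add: bnorm_def b3 complex_eq_iff)
  have "p \<noteq> 0"
  proof
    assume p: "p = 0"
    then have "q = 0" using le by (simp add: p_def[symmetric] q_def[symmetric])
    then show False using p R2 R by simp
  qed
  then have "B + \<i> * G \<noteq> 0" unfolding BG1 P1 using R by simp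
  then have "B \<noteq> 0 \<or> G \<noteq> 0" by auto
  then show ?thesis using that t 1 2 E by blast
qed

text \<open>
  A normalized quaternion has norm one, and its parameter is \<open>-\<tau>\<close>.
\<close>

lemma bnorm_params:
  assumes t: "t \<in> {0..1}" and p: "\<beta> + \<i> * \<gamma> = sqrt 2 * Complex (bnorm t $ 1) (bnorm t $ 4)"
    and q: "\<beta> - \<i> * \<gamma> = - \<i> * sqrt 2 * Complex (bnorm t $ 3) (bnorm t $ 2)"
  shows "\<beta> \<noteq> 0 \<or> \<gamma> \<noteq> 0" "nrm2 \<beta> \<gamma> = 1" "tau \<beta> \<gamma> = - t"
proof -
  have t': "0 \<le> 1 + t" "0 \<le> 1 - t" "0 < 1 + t" using t by auto
  have c: "Complex r 0 = complex_of_real r" for r by (simp add: complex_eq_iff)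
  have np: "(cmod (\<beta> + \<i> * \<gamma>))\<^sup>2 = 1 + t"
    unfolding p using t' by (simp add: bnorm_def norm_mult c power_mult_distrib)
  have nq: "(cmod (\<beta> - \<i> * \<gamma>))\<^sup>2 = 1 - t"
    unfolding q using t' by (simp add: bnorm_def norm_mult c power_mult_distrib)
  show nz: "\<beta> \<noteq> 0 \<or> \<gamma> \<noteq> 0" using np t'(3) by auto
  show D: "nrm2 \<beta> \<gamma> = 1" using pq_norms(1)[of \<beta> \<gamma>] unfolding np nq by simp
  show "tau \<beta> \<gamma> = - t" using pq_norms(2)[OF nz] unfolding np nq D by simp
qed

theorem theorem6p8:
  assumes "CARD('n::finite) \<ge> 2"
  shows
    "(\<forall>\<alpha> :: 'n mat2 \<Rightarrow> 'n mat2. reg_normal_ext \<alpha> \<longrightarrow>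
        (\<exists>t\<in>{0..1}. \<exists>\<beta>. reg_normal_ext \<beta> \<and> has_quat \<beta> (bnorm t) \<and> equivalent \<alpha> \<beta>)) \<and>
     (\<forall>t\<in>{0..1}. \<exists>\<alpha> :: 'n mat2 \<Rightarrow> 'n mat2. reg_normal_ext \<alpha> \<and> has_quat \<alpha> (bnorm t)) \<and>
     (\<forall>t\<in>{0..1}. \<forall>t'\<in>{0..1}. \<forall>\<alpha> \<beta> :: 'n mat2 \<Rightarrow> 'n mat2.
        reg_normal_ext \<alpha> \<and> has_quat \<alpha> (bnorm t) \<and> reg_normal_ext \<beta> \<and> has_quat \<beta> (bnorm t') \<longrightarrow>
        (equivalent \<alpha> \<beta> \<longleftrightarrow> t = t')) \<and>
     (\<forall>(\<alpha> :: 'n mat2 \<Rightarrow> 'n mat2) b.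
        reg_normal_ext \<alpha> \<and> has_quat \<alpha> b \<and> tpar b \<noteq> 0 \<longrightarrow> \<not> flat \<alpha>)"
proof (intro conjI allI ballI impI)
  fix \<alpha> :: "'n mat2 \<Rightarrow> 'n mat2"
  assume r: "reg_normal_ext \<alpha>"
  obtain \<beta> \<gamma> s where nz: "\<beta> \<noteq> 0 \<or> \<gamma> \<noteq> 0" and a: "\<And>X. X \<in> g_alg \<Longrightarrow> \<alpha> X = nrm_ext \<beta> \<gamma> s X"
    using r assms by (rule reg_normal_shape) blast
  obtain t B G where t: "t \<in> {0..1}" "B \<noteq> 0 \<or> G \<noteq> 0"
    "B + \<i> * G = sqrt 2 * Complex (bnorm t $ 1) (bnorm t $ 4)" "B - \<i> * G = - \<i> * sqrt 2 * Complex (bnorm t $ 3) (bnorm t $ 2)"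
    "eqv (nrm_ext \<beta> \<gamma> s) (nrm_ext B G 0 :: 'n mat2 \<Rightarrow> 'n mat2)" using nz by (rule normalization)
  let ?b = "nrm_ext B G 0 :: 'n mat2 \<Rightarrow> 'n mat2"
  have rb: "reg_normal_ext ?b" by (rule nrm_ext_reg_normal[OF t(2)])
  moreover have "has_quat ?b (bnorm t)" by (subst has_quat_iff[OF refl]) (use t(3,4) in simp)
  moreover have "eqv \<alpha> ?b" by (rule eqv_cong[OF t(5) a refl])
  then have "equivalent \<alpha> ?b" using rb by (intro eqv_equivalent) (auto simp: reg_normal_ext_def)
  ultimately show "\<exists>t\<in>{0..1}. \<exists>\<beta>. reg_normal_ext \<beta> \<and> has_quat \<beta> (bnorm t) \<and> equivalent \<alpha> \<beta>" using t(1) by blast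
next
  fix t :: real assume t: "t \<in> {0..1}"
  define p where "p = sqrt 2 * Complex (bnorm t $ 1) (bnorm t $ 4)"
  define q where "q = - \<i> * sqrt 2 * Complex (bnorm t $ 3) (bnorm t $ 2)"
  define B where "B = (p + q) / 2"
  define G where "G = (p - q) / (2 * \<i>)"
  have BG: "B + \<i> * G = p" "B - \<i> * G = q" by (simp_all add: B_def G_def field_simps)
  have nz: "B \<noteq> 0 \<or> G \<noteq> 0" by (rule bnorm_params(1)[OF t]) (simp_all only: BG p_def q_def)
  have "has_quat (nrm_ext B G 0 :: 'n mat2 \<Rightarrow> 'n mat2) (bnorm t)" by (subst has_quat_iff[OF refl]) (simp only: BG p_def q_def simp_thms)
  then show "\<exists>\<alpha> :: 'n mat2 \<Rightarrow> 'n mat2. reg_normal_ext \<alpha> \<and> has_quat \<alpha> (bnorm t)" using nrm_ext_reg_normal[OF nz] by blast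
next
  fix t t' :: real and \<alpha> \<alpha>' :: "'n mat2 \<Rightarrow> 'n mat2"
  assume t: "t \<in> {0..1}" "t' \<in> {0..1}"
    and H: "reg_normal_ext \<alpha> \<and> has_quat \<alpha> (bnorm t) \<and> reg_normal_ext \<alpha>' \<and> has_quat \<alpha>' (bnorm t')"
  have r: "reg_normal_ext \<alpha>" "reg_normal_ext \<alpha>'" using H by auto
  obtain \<beta> \<gamma> s where nz: "\<beta> \<noteq> 0 \<or> \<gamma> \<noteq> 0" and a: "\<And>X. X \<in> g_alg \<Longrightarrow> \<alpha> X = nrm_ext \<beta> \<gamma> s X"
    using r(1) assms by (rule reg_normal_shape) blast
  obtain \<beta>' \<gamma>' s' where nz': "\<beta>' \<noteq> 0 \<or> \<gamma>' \<noteq> 0" and a': "\<And>X. X \<in> g_alg \<Longrightarrow> \<alpha>' X = nrm_ext \<beta>' \<gamma>' s' X"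
    using r(2) assms by (rule reg_normal_shape) blast
  have q: "\<beta> + \<i> * \<gamma> = sqrt 2 * Complex (bnorm t $ 1) (bnorm t $ 4)" "\<beta> - \<i> * \<gamma> = - \<i> * sqrt 2 * Complex (bnorm t $ 3) (bnorm t $ 2)"
    using H has_quat_iff[OF a, of "bnorm t"] by auto
  have q': "\<beta>' + \<i> * \<gamma>' = sqrt 2 * Complex (bnorm t' $ 1) (bnorm t' $ 4)" "\<beta>' - \<i> * \<gamma>' = - \<i> * sqrt 2 * Complex (bnorm t' $ 3) (bnorm t' $ 2)"
    using H has_quat_iff[OF a', of "bnorm t'"] by auto
  note pr = bnorm_params[OF t(1) q] and pr' = bnorm_params[OF t(2) q']
  show "equivalent \<alpha> \<alpha>' \<longleftrightarrow> t = t'"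
  proof
    assume eq: "equivalent \<alpha> \<alpha>'"
    have lin: "linear \<alpha>" "linear \<alpha>'" using r by (auto simp: reg_normal_ext_def extension_def)
    obtain P L where P: "P \<in> P_grp" and L: "\<And>X. X \<in> g_alg \<Longrightarrow> L X \<in> g_alg"
      and low: "\<And>X r j. X \<in> g_alg \<Longrightarrow> block j < block r \<Longrightarrow> (\<alpha>' (L X) ** P) $ r $ j = (P ** \<alpha> X) $ r $ j"
      and cv: "\<And>X Y. X \<in> g_alg \<Longrightarrow> Y \<in> g_alg \<Longrightarrow> curv \<alpha>' (L X) (L Y) ** P = P ** curv \<alpha> X Y"
      using transport[OF eq lin] by blast
    have ca: "curv \<alpha> X Y = curv (nrm_ext \<beta> \<gamma> s) X Y" if "X \<in> g_alg" "Y \<in> g_alg" for X Y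
      unfolding curv_def by (simp add: a that so_br[OF that])
    have ca': "curv \<alpha>' X Y = curv (nrm_ext \<beta>' \<gamma>' s') X Y" if "X \<in> g_alg" "Y \<in> g_alg" for X Y
      unfolding curv_def by (simp add: a' that so_br[OF that])
    have "\<bar>tau \<beta> \<gamma>\<bar> = \<bar>tau \<beta>' \<gamma>'\<bar>"
    proof (rule abs_tau_invariant[OF nz nz' pr(2) pr'(2) P L])
      show "(nrm_ext \<beta>' \<gamma>' s' (L X) ** P) $ r $ j = (P ** nrm_ext \<beta> \<gamma> s X) $ r $ j" if "X \<in> g_alg" "block j < block r" for X r j
        using low[OF that] unfolding a[OF that(1)] a'[OF L[OF that(1)]] .
      show "curv (nrm_ext \<beta>' \<gamma>' s') (L X) (L Y) ** P = P ** curv (nrm_ext \<beta> \<gamma> s) X Y" if "X \<in> g_alg" "Y \<in> g_alg" for X Y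
        using cv[OF that] unfolding ca[OF that] ca'[OF L[OF that(1)] L[OF that(2)]] .
    qed
    then show "t = t'" unfolding pr(3) pr'(3) using t by simp
  next
    assume tt: "t = t'"
    have "2 * \<beta> = 2 * \<beta>'" using q q' tt by (metis (no_types) add_diff_cancel_left' add.commute diff_add_cancel mult_2 add_diff_eq)
    moreover have "2 * (\<i> * \<gamma>) = 2 * (\<i> * \<gamma>')"
    proof -
      have "2 * (\<i> * \<gamma>) = (\<beta> + \<i> * \<gamma>) - (\<beta> - \<i> * \<gamma>)" by simp
      also have "\<dots> = (\<beta>' + \<i> * \<gamma>') - (\<beta>' - \<i> * \<gamma>')" unfolding q q' tt ..
      finally show ?thesis by simp
    qed
    ultimately have bg: "\<beta>' = \<beta>" "\<gamma>' = \<gamma>" by auto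
    have "eqv \<alpha> \<alpha>'" by (rule eqv_cong[OF move_s[OF nz, of s s'] a a'[unfolded bg]])
    then show "equivalent \<alpha> \<alpha>'" using r(2) by (intro eqv_equivalent) (auto simp: reg_normal_ext_def)
  qed
next
  fix \<alpha> :: "'n mat2 \<Rightarrow> 'n mat2" and b :: quat
  assume H: "reg_normal_ext \<alpha> \<and> has_quat \<alpha> b \<and> tpar b \<noteq> 0"
  then obtain \<beta> \<gamma> s where nz: "\<beta> \<noteq> 0 \<or> \<gamma> \<noteq> 0" and a: "\<And>X. X \<in> g_alg \<Longrightarrow> \<alpha> X = nrm_ext \<beta> \<gamma> s X"
    using reg_normal_shape[OF _ assms] by metis
  have q: "\<beta> + \<i> * \<gamma> = sqrt 2 * Complex (b $ 1) (b $ 4)" "\<beta> - \<i> * \<gamma> = - \<i> * sqrt 2 * Complex (b $ 3) (b $ 2)"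
    using H has_quat_iff[OF a, of b] by auto
  have "2 * tpar b = - 2 * nrm2 \<beta> \<gamma> * tau \<beta> \<gamma>"
    unfolding pq_norms(2)[OF nz, symmetric] q by (simp add: norm_mult power_mult_distrib cmod_power2 tpar_def)
  then have "tau \<beta> \<gamma> \<noteq> 0" using H by auto
  then show "\<not> flat \<alpha>" using flat_tau[OF a nz] by blast
qed

end
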